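(* Let $F:[0,T]\times\mathbb{R}^d\times\mathscr{P}^2(\mathbb{R}^d)\rightrightarrows\mathbb{R}^d\times S_d^+$ be an upper semicontinuous multivalued mapping with nonempty convex values, and assume there exist nonnegative constants $C_b,C_A$ such that for every $(\beta,\Sigma)\in F(t,x,m)$ $$|\beta|\le C_b(1+|x|+\mathcal{M}_2(m)),\qquad \|\Sigma\|_F\le C_A(1+|x|^2+\mathcal{M}_2^2(m)).$$ Then, for every $\nu\in\mathscr{P}^2(\mathbb{R}^d)$, the set $\mathcal{S}_F(\nu)$ of solutions $(m_t)_{t\in[0,T]}$ of the Fokker-Planck-Kolmogorov inclusion determined by $F$ with $m_0=\nu$ is a nonempty subset of $C([0,T];\mathscr{P}^2(\mathbb{R}^d))$.
   Context: $T>0$ is fixed. $S_d^+$ is the set of symmetric nonnegative (positive semidefinite) real $d\times d$ matrices, $\|\cdot\|_F$ is the Frobenius norm. $\mathscr{P}^2(\mathbb{R}^d)$ is the space of Borel probability measures on $\mathbb{R}^d$ with finite second moment, endowed with the second Wasserstein metric $W_2$, and $\mathcal{M}_2(m)=\big(\int_{\mathbb{R}^d}|x|^2m(dx)\big)^{1/2}$. $C([0,T];\mathscr{P}^2(\mathbb{R}^d))$ is the space of $W_2$-continuous maps with the uniform metric $\sup_t W_2(\cdot,\cdot)$. Gradients $\nabla\varphi$ are taken in $x$ and are row vectors; $\nabla^\top\nabla\varphi$ is the Hessian in $x$. $C^{1,2}_c((0,T)\times\mathbb{R}^d)$ is the set of compactly supported real functions on $(0,T)\times\mathbb{R}^d$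 that are $C^1$ in time and $C^2$ in $x$. The Fokker-Planck-Kolmogorov inclusion determined by $F$ is $\partial_tm_t+(V_F(t,m_t))^*m_t\ni0$, where $V_F(t,m)$ is the set of generators $L\phi(x)=\nabla\phi(x)b(x)+\frac12\operatorname{tr}(\nabla^\top\nabla\phi(x)A(x))$ with $(b(x),A(x))\in F(t,x,m)$ for $m$-a.e. $x$. A flow of probabilities $(m_t)_{t\in[0,T]}$ (a family of measures in $\mathscr{P}^2(\mathbb{R}^d)$) is a solution of this inclusion if there exist Borel functions $b:[0,T]\times\mathbb{R}^d\to\mathbb{R}^d$ and $A:[0,T]\times\mathbb{R}^d\to S_d^+$ such that (i) $(b(t,x),A(t,x))\in F(t,x,m_t)$ for $m_t$-a.e. $x\in\mathbb{R}^d$ and a.e. $t\in[0,T]$; (ii) for every $\varphi\in C^{1,2}_c((0,T)\times\mathbb{R}^d)$, $$\int_0^T\int_{\mathbb{R}^d}\Big[\partial_t\varphi(t,x)+\nabla\varphi(t,x)b(t,x)+\tfrac12\operatorname{tr}\big(\nabla^\top\nabla\varphi(t,x)A(t,x)\big)\Big]m_t(dx)\,dt=0.$$ $\mathcal{S}_F(\nu)$ denotes the set of solutions with $m_0=\nu$.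
   Formalization: A flow of probabilities is required to be narrowly continuous in t (otherwise changing a solution at one time refutes the inclusion), and upper semicontinuity is taken in the closed-graph sense, so F has closed values (without them existence can fail). *)

theory Defs
  imports "HOL-Probability.Probability"
begin

section \<open>Probability measures with finite second moment\<close>

definition P2 :: "(real ^ 'n) measure set" where
  "P2 = {m. sets m = sets borel \<and> prob_space m \<and> integrable m (\<lambda>x. (norm x)\<^sup>2)}"

definition M2 :: "(real ^ 'n) measure \<Rightarrow> real" where
  "M2 m = sqrt (\<integral>x. (norm x)\<^sup>2 \<partial>m)"

definition couplings ::
  "(real ^ 'n) measure \<Rightarrow> (real ^ 'n) measure \<Rightarrow> ((real ^ 'n) \<times> (real ^ 'n)) measure set" where
  "couplings m m' =
     {\<pi>. sets \<pi> = sets borel \<and> prob_space \<pi> \<and> distr \<pi> borel fst = m \<and> distr \<pi> borel snd = m'}"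

text \<open>Only used for measures in \<^const>\<open>P2\<close>: there the set of couplings is nonempty and
  every cost is finite, so neither the real infimum nor the Bochner integral degenerates.\<close>

definition W2 :: "(real ^ 'n) measure \<Rightarrow> (real ^ 'n) measure \<Rightarrow> real" where
  "W2 m m' = sqrt (INF \<pi>\<in>couplings m m'. \<integral>z. (dist (fst z) (snd z))\<^sup>2 \<partial>\<pi>)"

text \<open>Curves are total functions on the reals; only their values on \<open>{0..T}\<close> matter.\<close>

definition C_P2 :: "real \<Rightarrow> (real \<Rightarrow> (real ^ 'n) measure) set" where
  "C_P2 T = {m. (\<forall>t\<in>{0..T}. m t \<in> P2) \<and>
                (\<forall>t\<in>{0..T}. ((\<lambda>s. W2 (m s) (m t)) \<longlongrightarrow> 0) (at t within {0..T}))}"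

text \<open>A family of measures is a flow if it is narrowly (weakly) continuous in time. Without any
  continuity the weak form of the equation below, which does not see changes of the family on a
  null set of times, would impose no relation between \<open>m 0\<close> and the other \<open>m t\<close>, and its time
  integrand need not be measurable.\<close>

definition flow_of_probabilities :: "real \<Rightarrow> (real \<Rightarrow> (real ^ 'n) measure) \<Rightarrow> bool" where
  "flow_of_probabilities T m \<longleftrightarrow>
     (\<forall>t\<in>{0..T}. m t \<in> P2) \<and>
     (\<forall>f :: real ^ 'n \<Rightarrow> real. continuous_on UNIV f \<longrightarrow> bounded (range f) \<longrightarrow>
        continuous_on {0..T} (\<lambda>t. \<integral>x. f x \<partial>m t))"

section \<open>Matrices and multivalued maps\<close>

definition psd_matrices :: "(real ^ 'n ^ 'n) set" where
  "psd_matrices = {A. transpose A = A \<and> (\<forall>v. 0 \<le> v \<bullet> (A *v v))}"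

text \<open>The library norm on matrices is the Frobenius norm.\<close>

lemma norm_matrix_eq_frobenius:
  fixes A :: "real ^ 'n ^ 'm"
  shows "norm A = sqrt (\<Sum>i\<in>UNIV. \<Sum>j\<in>UNIV. (A $ i $ j)\<^sup>2)"
  by (simp add: norm_vec_def L2_set_def sum_nonneg)

text \<open>Upper semicontinuity in the sense of Kuratowski:
  \<open>Limsup F (z') \<subseteq> F z\<close> as \<open>z' \<rightarrow> z\<close>, where the measure argument converges in
  \<^const>\<open>W2\<close>. For the locally bounded maps considered here this is the same as upper
  semicontinuity in terms of neighbourhoods for maps with closed values, see
  \<open>usc_multimap_iff_neighbourhoods\<close> below.\<close>

definition usc_multimap ::
  "real \<Rightarrow> (real \<Rightarrow> real ^ 'n \<Rightarrow> (real ^ 'n) measure \<Rightarrow> ((real ^ 'n) \<times> (real ^ 'n ^ 'n)) set) \<Rightarrow> bool"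
  where
  "usc_multimap T F \<longleftrightarrow>
     (\<forall>t x m y ts xs ms ys.
        t \<in> {0..T} \<longrightarrow> m \<in> P2 \<longrightarrow>
        (\<forall>k::nat. ts k \<in> {0..T} \<and> ms k \<in> P2 \<and> ys k \<in> F (ts k) (xs k) (ms k)) \<longrightarrow>
        ts \<longlonglongrightarrow> t \<longrightarrow> xs \<longlonglongrightarrow> x \<longrightarrow> (\<lambda>k. W2 (ms k) m) \<longlonglongrightarrow> 0 \<longrightarrow> ys \<longlonglongrightarrow> y \<longrightarrow>
        y \<in> F t x m)"

section \<open>Solutions of the Fokker-Planck-Kolmogorov inclusion\<close>

definition grad :: "(real ^ 'n \<Rightarrow> real) \<Rightarrow> real ^ 'n \<Rightarrow> real ^ 'n" where
  "grad f x = (\<chi> i. frechet_derivative f (at x) (axis i 1))"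

definition hessian :: "(real ^ 'n \<Rightarrow> real) \<Rightarrow> real ^ 'n \<Rightarrow> real ^ 'n ^ 'n" where
  "hessian f x = jacobian (grad f) (at x)"

definition generator ::
  "real ^ 'n \<Rightarrow> real ^ 'n ^ 'n \<Rightarrow> (real ^ 'n \<Rightarrow> real) \<Rightarrow> real ^ 'n \<Rightarrow> real" where
  "generator \<beta> \<Sigma> f x = grad f x \<bullet> \<beta> + 1 / 2 * trace (hessian f x ** \<Sigma>)"

text \<open>Functions on \<open>(0,T) \<times> R\<^sup>n\<close> with compact support, extended by zero.\<close>

definition C12c :: "real \<Rightarrow> (real \<Rightarrow> real ^ 'n \<Rightarrow> real) set" where
  "C12c T = {\<phi>.
     (\<exists>K. compact K \<and> K \<subseteq> {0<..<T} \<times> UNIV \<and> (\<forall>t x. (t, x) \<notin> K \<longrightarrow> \<phi> t x = 0)) \<and>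
     (\<forall>t x. (\<lambda>s. \<phi> s x) differentiable (at t)) \<and>
     (\<forall>t x. \<phi> t differentiable (at x)) \<and>
     (\<forall>t x. grad (\<phi> t) differentiable (at x)) \<and>
     continuous_on UNIV (\<lambda>(t, x). \<phi> t x) \<and>
     continuous_on UNIV (\<lambda>(t, x). deriv (\<lambda>s. \<phi> s x) t) \<and>
     continuous_on UNIV (\<lambda>(t, x). grad (\<phi> t) x) \<and>
     continuous_on UNIV (\<lambda>(t, x). hessian (\<phi> t) x)}"

text \<open>The integrability requirements say that the iterated integral exists; the Bochner
  integral of a non-integrable function would be 0.\<close>

definition FPK_solution ::
  "real \<Rightarrow> (real \<Rightarrow> real ^ 'n \<Rightarrow> (real ^ 'n) measure \<Rightarrow> ((real ^ 'n) \<times> (real ^ 'n ^ 'n)) set)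
     \<Rightarrow> (real \<Rightarrow> (real ^ 'n) measure) \<Rightarrow> bool" where
  "FPK_solution T F m \<longleftrightarrow>
     flow_of_probabilities T m \<and>
     (\<exists>(b :: real \<times> (real ^ 'n) \<Rightarrow> real ^ 'n) (A :: real \<times> (real ^ 'n) \<Rightarrow> real ^ 'n ^ 'n).
        b \<in> borel_measurable (restrict_space borel ({0..T} \<times> UNIV)) \<and>
        A \<in> borel_measurable (restrict_space borel ({0..T} \<times> UNIV)) \<and>
        A ` ({0..T} \<times> UNIV) \<subseteq> psd_matrices \<and>
        (AE t in lborel. t \<in> {0..T} \<longrightarrow>
           (AE x in m t. (b (t, x), A (t, x)) \<in> F t x (m t))) \<and>
        (\<forall>\<phi>\<in>C12c T.
           let G = (\<lambda>t x. deriv (\<lambda>s. \<phi> s x) t + generator (b (t, x)) (A (t, x)) (\<phi> t) x)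
           in (AE t in lborel. t \<in> {0..T} \<longrightarrow> integrable (m t) (G t)) \<and>
              set_integrable lborel {0..T} (\<lambda>t. \<integral>x. G t x \<partial>m t) \<and>
              (LINT t:{0..T}|lborel. (\<integral>x. G t x \<partial>m t)) = 0))"

definition FPK_solutions ::
  "real \<Rightarrow> (real \<Rightarrow> real ^ 'n \<Rightarrow> (real ^ 'n) measure \<Rightarrow> ((real ^ 'n) \<times> (real ^ 'n ^ 'n)) set)
     \<Rightarrow> (real ^ 'n) measure \<Rightarrow> (real \<Rightarrow> (real ^ 'n) measure) set" where
  "FPK_solutions T F \<nu> = {m. FPK_solution T F m \<and> m 0 = \<nu>}"

section \<open>Upper semicontinuity and neighbourhoods\<close>

lemma coupling_marginals:
  fixes f :: "real ^ 'n \<Rightarrow> real"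
  assumes "\<pi> \<in> couplings m m'" "f \<in> borel_measurable borel"
  shows "integrable m f \<longleftrightarrow> integrable \<pi> (\<lambda>z. f (fst z))"
    and "integrable m' f \<longleftrightarrow> integrable \<pi> (\<lambda>z. f (snd z))"
    and "(\<integral>x. f x \<partial>m) = (\<integral>z. f (fst z) \<partial>\<pi>)"
    and "(\<integral>x. f x \<partial>m') = (\<integral>z. f (snd z) \<partial>\<pi>)"
proof -
  have s: "sets \<pi> = sets borel" and m: "m = distr \<pi> borel fst" "m' = distr \<pi> borel snd"
    using assms(1) by (auto simp: couplings_def)
  have [measurable]: "fst \<in> measurable \<pi> borel" "snd \<in> measurable \<pi> borel"
    by (auto simp: measurable_cong_sets[OF s refl]
        intro!: borel_measurable_continuous_onI continuous_intros)
  note [measurable] = assms(2)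
  show "integrable m f \<longleftrightarrow> integrable \<pi> (\<lambda>z. f (fst z))"
    "integrable m' f \<longleftrightarrow> integrable \<pi> (\<lambda>z. f (snd z))"
    "(\<integral>x. f x \<partial>m) = (\<integral>z. f (fst z) \<partial>\<pi>)" "(\<integral>x. f x \<partial>m') = (\<integral>z. f (snd z) \<partial>\<pi>)"
    by (simp_all add: m integrable_distr_eq integral_distr)
qed

lemma W2_refl:
  assumes "m \<in> P2" shows "W2 m m = 0"
proof -
  have s: "sets m = sets borel" and p: "prob_space m" using assms by (auto simp: P2_def)
  have [measurable]: "(\<lambda>x. (x, x)) \<in> measurable m borel"
    by (auto simp: measurable_cong_sets[OF s refl]
        intro!: borel_measurable_continuous_onI continuous_intros)
  have [measurable]: "fst \<in> measurable borel (borel :: (real ^ 'a) measure)"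
    "snd \<in> measurable borel (borel :: (real ^ 'a) measure)"
    by (auto intro!: borel_measurable_continuous_onI continuous_intros)
  define \<pi> where "\<pi> = distr m (borel :: ((real ^ 'a) \<times> (real ^ 'a)) measure) (\<lambda>x. (x, x))"
  have id: "distr m borel (\<lambda>x. x) = m" by (rule distr_id2[OF s[symmetric]])
  have "\<pi> \<in> couplings m m"
    unfolding couplings_def \<pi>_def
    by (auto simp: distr_distr comp_def id intro!: prob_space.prob_space_distr[OF p])
  moreover have "(\<integral>z. (dist (fst z) (snd z))\<^sup>2 \<partial>\<pi>) = 0"
    unfolding \<pi>_def
    by (subst integral_distr) (auto intro!: borel_measurable_continuous_onI continuous_intros)
  ultimately have "(INF \<pi>\<in>couplings m m. \<integral>z. (dist (fst z) (snd z))\<^sup>2 \<partial>\<pi>) \<le> 0"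
    by (metis (mono_tags, lifting) cINF_lower bdd_belowI2 integral_nonneg_AE AE_I2 zero_le_power2)
  moreover have "(INF \<pi>\<in>couplings m m. \<integral>z. (dist (fst z) (snd z))\<^sup>2 \<partial>\<pi>) \<ge> 0"
    using \<open>\<pi> \<in> couplings m m\<close> by (intro cINF_greatest) auto
  ultimately show ?thesis by (simp add: W2_def)
qed

lemma couplings_nonempty:
  assumes "m \<in> P2" "m' \<in> P2" shows "couplings m m' \<noteq> {}"
proof -
  interpret a: prob_space m using assms by (auto simp: P2_def)
  interpret b: prob_space m' using assms by (auto simp: P2_def)
  interpret ab: pair_prob_space m m' ..
  have s: "sets m = sets borel" "sets m' = sets borel" using assms by (auto simp: P2_def)
  have sp: "sets (m \<Otimes>\<^sub>M m') = sets borel"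
    unfolding borel_prod[symmetric] by (rule sets_pair_measure_cong[OF s])
  have 1: "distr (m \<Otimes>\<^sub>M m') borel fst = m"
  proof -
    have "distr (m \<Otimes>\<^sub>M m') borel fst = distr (m \<Otimes>\<^sub>M m') m fst"
      by (rule distr_cong) (auto simp: s)
    also have "\<dots> = m"
    proof (rule measure_eqI)
      fix X assume X: "X \<in> sets (distr (m \<Otimes>\<^sub>M m') m fst)"
      then have "fst -` X \<inter> space (m \<Otimes>\<^sub>M m') = X \<times> space m'"
        using sets.sets_into_space by (fastforce simp: space_pair_measure)
      then show "emeasure (distr (m \<Otimes>\<^sub>M m') m fst) X = emeasure m X"
        using X by (simp add: emeasure_distr b.emeasure_pair_measure_Times b.emeasure_space_1)
    qed simp
    finally show ?thesis .
  qed
  have 2: "distr (m \<Otimes>\<^sub>M m') borel snd = m'"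
  proof -
    have "distr (m \<Otimes>\<^sub>M m') borel snd = distr (m \<Otimes>\<^sub>M m') m' snd"
      by (rule distr_cong) (auto simp: s)
    also have "\<dots> = m'"
    proof (rule measure_eqI)
      fix X assume X: "X \<in> sets (distr (m \<Otimes>\<^sub>M m') m' snd)"
      then have "snd -` X \<inter> space (m \<Otimes>\<^sub>M m') = space m \<times> X"
        using sets.sets_into_space by (fastforce simp: space_pair_measure)
      then show "emeasure (distr (m \<Otimes>\<^sub>M m') m' snd) X = emeasure m' X"
        using X by (simp add: emeasure_distr b.emeasure_pair_measure_Times a.emeasure_space_1)
    qed simp
    finally show ?thesis .
  qed
  show ?thesis using 1 2 sp ab.prob_space_axioms by (auto simp: couplings_def)
qed

lemma M2_le_W2:
  assumes "m \<in> P2" "m' \<in> P2" "W2 m m' < 1"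
  shows "(M2 m)\<^sup>2 \<le> 2 * (M2 m')\<^sup>2 + 2"
proof -
  let ?c = "\<lambda>\<pi>. \<integral>z. (dist (fst z) (snd z))\<^sup>2 \<partial>\<pi>"
  have "(INF \<pi>\<in>couplings m m'. ?c \<pi>) < 1"
    using assms(3) by (simp add: W2_def)
  then obtain \<pi> where \<pi>: "\<pi> \<in> couplings m m'" and c: "?c \<pi> < 1"
    using couplings_nonempty[OF assms(1,2)]
    by (subst (asm) cINF_less_iff) (auto intro!: bdd_belowI2[where m = 0])
  have meas: "(\<lambda>x::real^'a. (norm x)\<^sup>2) \<in> borel_measurable borel" by simp
  note i = coupling_marginals[OF \<pi> meas]
  have ix: "integrable \<pi> (\<lambda>z. (norm (fst z))\<^sup>2)" and iy: "integrable \<pi> (\<lambda>z. (norm (snd z))\<^sup>2)"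
    using assms i by (auto simp: P2_def)
  have sq: "(a + b)\<^sup>2 \<le> 2 * a\<^sup>2 + 2 * b\<^sup>2" for a b :: real
    using sum_squares_bound[of a b] by (simp add: power2_sum)
  have d: "(dist x y)\<^sup>2 \<le> 2 * (norm x)\<^sup>2 + 2 * (norm y)\<^sup>2"
    "(norm x)\<^sup>2 \<le> 2 * (norm y)\<^sup>2 + 2 * (dist x y)\<^sup>2" for x y :: "real ^ 'a"
    using order_trans[OF power_mono[OF norm_triangle_ineq4, of x y 2] sq]
      order_trans[OF power_mono[OF norm_triangle_ineq, of y "x - y" 2] sq]
    by (auto simp: dist_norm)
  have s: "sets \<pi> = sets borel" using \<pi> by (simp add: couplings_def)
  have id: "integrable \<pi> (\<lambda>z. (dist (fst z) (snd z))\<^sup>2)"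
  proof (rule Bochner_Integration.integrable_bound)
    show "integrable \<pi> (\<lambda>z. 2 * (norm (fst z))\<^sup>2 + 2 * (norm (snd z))\<^sup>2)" using ix iy by simp
    show "(\<lambda>z. (dist (fst z) (snd z))\<^sup>2) \<in> borel_measurable \<pi>"
      by (auto simp: measurable_cong_sets[OF s refl]
          intro!: borel_measurable_continuous_onI continuous_intros)
  qed (use d in auto)
  have "(\<integral>z. (norm (fst z))\<^sup>2 \<partial>\<pi>)
      \<le> (\<integral>z. 2 * (norm (snd z))\<^sup>2 + 2 * (dist (fst z) (snd z))\<^sup>2 \<partial>\<pi>)"
    using ix iy id d by (intro integral_mono) auto
  also have "\<dots> = 2 * (\<integral>z. (norm (snd z))\<^sup>2 \<partial>\<pi>) + 2 * ?c \<pi>" using iy id by simp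
  finally show ?thesis using c i by (simp add: M2_def)
qed

theorem usc_multimap_iff_neighbourhoods:
  fixes F :: "real \<Rightarrow> real ^ 'n \<Rightarrow> (real ^ 'n) measure \<Rightarrow> ((real ^ 'n) \<times> (real ^ 'n ^ 'n)) set"
  assumes "Cb \<ge> 0" "CA \<ge> 0"
    and growth: "\<And>t x m \<beta> \<Sigma>. t \<in> {0..T} \<Longrightarrow> m \<in> P2 \<Longrightarrow> (\<beta>, \<Sigma>) \<in> F t x m \<Longrightarrow>
       norm \<beta> \<le> Cb * (1 + norm x + M2 m) \<and> norm \<Sigma> \<le> CA * (1 + (norm x)\<^sup>2 + (M2 m)\<^sup>2)"
  shows "usc_multimap T F \<longleftrightarrow>
    (\<forall>t\<in>{0..T}. \<forall>x. \<forall>m\<in>P2. closed (F t x m) \<and>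
       (\<forall>V. open V \<longrightarrow> F t x m \<subseteq> V \<longrightarrow>
         (\<exists>\<delta>>0. \<forall>s\<in>{0..T}. \<forall>z. \<forall>m'\<in>P2.
            \<bar>s - t\<bar> < \<delta> \<longrightarrow> dist z x < \<delta> \<longrightarrow> W2 m' m < \<delta> \<longrightarrow> F s z m' \<subseteq> V)))"
    (is "?L \<longleftrightarrow> ?R")
proof
  assume L: ?L
  show ?R
  proof (intro ballI allI conjI impI)
    fix t x and m :: "(real ^ 'n) measure" assume t: "t \<in> {0..T}" and m: "m \<in> P2"
    show "closed (F t x m)"
      unfolding closed_sequential_limits
    proof (intro allI impI, elim conjE)
      fix ys y assume "\<forall>k. ys k \<in> F t x m" "ys \<longlonglongrightarrow> y"
      then show "y \<in> F t x m"
        using L[unfolded usc_multimap_def, rule_format, of t m "\<lambda>_. t" "\<lambda>_. m" ys "\<lambda>_. x" x y] t m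
        by (simp add: W2_refl)
    qed
    fix V assume V: "open V" "F t x m \<subseteq> V"
    show "\<exists>\<delta>>0. \<forall>s\<in>{0..T}. \<forall>z. \<forall>m'\<in>P2.
            \<bar>s - t\<bar> < \<delta> \<longrightarrow> dist z x < \<delta> \<longrightarrow> W2 m' m < \<delta> \<longrightarrow> F s z m' \<subseteq> V"
    proof (rule ccontr)
      assume n: "\<not> ?thesis"
      have "\<forall>k::nat. \<exists>s z m' y. s \<in> {0..T} \<and> m' \<in> P2 \<and> \<bar>s - t\<bar> < inverse (real (Suc k)) \<and>
          dist z x < inverse (real (Suc k)) \<and> W2 m' m < inverse (real (Suc k)) \<and>
          y \<in> F s z m' \<and> y \<notin> V"
      proof
        fix k :: nat
        have "inverse (real (Suc k)) > 0" by simp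
        with n show "\<exists>s z m' y. s \<in> {0..T} \<and> m' \<in> P2 \<and> \<bar>s - t\<bar> < inverse (real (Suc k)) \<and>
          dist z x < inverse (real (Suc k)) \<and> W2 m' m < inverse (real (Suc k)) \<and>
          y \<in> F s z m' \<and> y \<notin> V" by (meson subsetI)
      qed
      then obtain ts xs ms ys where *: "ts k \<in> {0..T}" "ms k \<in> P2"
          "\<bar>ts k - t\<bar> < inverse (real (Suc k))" "dist (xs k) x < inverse (real (Suc k))"
          "W2 (ms k) m < inverse (real (Suc k))" "ys k \<in> F (ts k) (xs k) (ms k)" "ys k \<notin> V"
        for k by metis
      have inv0: "(\<lambda>k. inverse (real (Suc k))) \<longlonglongrightarrow> 0" by (rule LIMSEQ_inverse_real_of_nat)
      have inv1: "inverse (real (Suc k)) \<le> 1" for k by (simp add: inverse_le_1_iff)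
      have W0: "0 \<le> W2 (ms k) m" for k
        unfolding W2_def using couplings_nonempty[OF *(2) m, of k]
        by (auto intro!: cINF_greatest)
      have tl: "ts \<longlonglongrightarrow> t"
        by (rule LIM_zero_cancel, rule Lim_null_comparison[OF _ inv0])
           (use *(3) in \<open>auto intro!: always_eventually less_imp_le\<close>)
      have xl: "xs \<longlonglongrightarrow> x"
        by (rule LIM_zero_cancel, rule Lim_null_comparison[OF _ inv0])
           (use *(4) in \<open>auto simp: dist_norm intro!: always_eventually less_imp_le\<close>)
      have Wl: "(\<lambda>k. W2 (ms k) m) \<longlonglongrightarrow> 0"
        by (rule Lim_null_comparison[OF _ inv0])
           (use *(5) W0 in \<open>auto intro!: always_eventually less_imp_le\<close>)
      define R where "R = norm x + 1"
      define Q where "Q = 2 * (M2 m)\<^sup>2 + 2"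
      have xb: "norm (xs k) \<le> R" for k
        using *(4)[of k] inv1[of k] norm_triangle_ineq2[of "xs k" x]
        by (simp add: R_def dist_norm)
      have Mb: "(M2 (ms k))\<^sup>2 \<le> Q" for k
        unfolding Q_def
        using M2_le_W2[OF *(2) m] *(5)[of k] inv1[of k] by fastforce
      have yb: "norm (ys k) \<le> Cb * (1 + R + sqrt Q) + CA * (1 + R\<^sup>2 + Q)" for k
      proof -
        obtain \<beta> \<Sigma> where y: "ys k = (\<beta>, \<Sigma>)" by fastforce
        have g: "norm \<beta> \<le> Cb * (1 + norm (xs k) + M2 (ms k))"
           "norm \<Sigma> \<le> CA * (1 + (norm (xs k))\<^sup>2 + (M2 (ms k))\<^sup>2)"
          using growth[OF *(1) *(2)] *(6)[of k] y by auto
        have "Cb * (1 + norm (xs k) + M2 (ms k)) \<le> Cb * (1 + R + sqrt Q)"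
          using xb[of k] real_le_rsqrt[OF Mb[of k]] assms(1) by (intro mult_left_mono) auto
        moreover have "CA * (1 + (norm (xs k))\<^sup>2 + (M2 (ms k))\<^sup>2) \<le> CA * (1 + R\<^sup>2 + Q)"
          using power_mono[OF xb[of k], of 2] Mb[of k] assms(2) by (intro mult_left_mono) auto
        moreover have "norm (ys k) \<le> norm \<beta> + norm \<Sigma>" using norm_Pair_le[of \<beta> \<Sigma>] y by simp
        ultimately show ?thesis using g by linarith
      qed
      have "bounded (range ys)" using yb by (auto simp: bounded_iff)
      then obtain y r where r: "strict_mono (r :: nat \<Rightarrow> nat)" "(ys \<circ> r) \<longlonglongrightarrow> y"
        using bounded_imp_convergent_subsequence by blast
      have "y \<in> F t x m"
        using L[unfolded usc_multimap_def, rule_format,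
            of t m "ts \<circ> r" "ms \<circ> r" "ys \<circ> r" "xs \<circ> r" x y] t m * r
          LIMSEQ_subseq_LIMSEQ[OF tl r(1)] LIMSEQ_subseq_LIMSEQ[OF xl r(1)]
          LIMSEQ_subseq_LIMSEQ[OF Wl r(1)]
        by (simp add: o_def)
      moreover have "y \<in> - V"
        using closed_sequentially[of "- V" "ys \<circ> r" y] V(1) r(2) *(7) by (simp add: closed_Compl)
      ultimately show False using V(2) by auto
    qed
  qed
next
  assume R: ?R
  show ?L
    unfolding usc_multimap_def
  proof (intro allI impI)
    fix t x y ts xs ys and m :: "(real ^ 'n) measure" and ms
    assume t: "t \<in> {0..T}" and m: "m \<in> P2"
      and s: "\<forall>k::nat. ts k \<in> {0..T} \<and> ms k \<in> P2 \<and> ys k \<in> F (ts k) (xs k) (ms k)"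
      and l: "ts \<longlonglongrightarrow> t" "xs \<longlonglongrightarrow> x" "(\<lambda>k. W2 (ms k) m) \<longlonglongrightarrow> 0" "ys \<longlonglongrightarrow> y"
    show "y \<in> F t x m"
    proof (rule ccontr)
      assume "y \<notin> F t x m"
      moreover have "closed (F t x m)" using R t m by blast
      ultimately obtain e where e: "e > 0" "\<forall>z\<in>F t x m. e \<le> dist y z"
        using separate_point_closed by blast
      define V where "V = - cball y (e / 2)"
      have "open V" "F t x m \<subseteq> V" using e by (force simp: V_def open_Compl)+
      then obtain \<delta> where d: "\<delta> > 0" and D: "\<And>s z m'. s \<in> {0..T} \<Longrightarrow> m' \<in> P2 \<Longrightarrow>
          \<bar>s - t\<bar> < \<delta> \<Longrightarrow> dist z x < \<delta> \<Longrightarrow> W2 m' m < \<delta> \<Longrightarrow> F s z m' \<subseteq> V"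
        using R t m by meson
      have "\<forall>\<^sub>F k in sequentially. dist (ts k) t < \<delta> \<and> dist (xs k) x < \<delta> \<and>
          W2 (ms k) m < \<delta> \<and> dist (ys k) y < e / 2"
        using tendstoD[OF l(1) d] tendstoD[OF l(2) d] order_tendstoD(2)[OF l(3) d]
          tendstoD[OF l(4), of "e / 2"] e(1) by (intro eventually_conj) auto
      then obtain k where k: "dist (ts k) t < \<delta>" "dist (xs k) x < \<delta>"
          "W2 (ms k) m < \<delta>" "dist (ys k) y < e / 2"
        unfolding eventually_sequentially by blast
      have "ys k \<in> V" using D[of "ts k" "ms k" "xs k"] s k by (auto simp: dist_real_def)
      then show False using k(4) by (simp add: V_def dist_commute)
    qed
  qed
qed

end

theory Submission
  imports Defs "HOL-Library.Diagonal_Subsequence"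
begin

text \<open>
  Continuity of solutions: testing the equation with cut-off versions of \<open>|x|\<^sup>2\<close> shows that
  on a time interval on which the second moment is bounded, it is Lipschitz with a constant
  proportional to that bound. The second moment is lower semicontinuous, so by Baire's theorem it is
  bounded on some interval, and the Lipschitz estimate rules out a point of unboundedness; weak
  convergence together with convergence of second moments is convergence in \<open>W\<^sub>2\<close>.

  Existence: select values of \<open>F\<close> at the times \<open>k T / N\<close>, at spatial grid points and at the current
  law, factor the diffusion matrix as \<open>\<Sum>j. w j (w j)\<^sup>T\<close> and move by \<open>h b \<plusminus> sqrt (h n) w j\<close> with
  random sign and index. Moment estimates uniform in \<open>N\<close> give limit laws \<open>m t\<close> in \<open>W\<^sub>2\<close> along a
  subsequence. The joint laws of time, position and selected value are tight; after a Skorohod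
  representation upper semicontinuity places the limiting value in \<open>F t x (m t)\<close>, and its
  conditional expectation given time and position stays there because the values of \<open>F\<close> are closed
  and convex. The generator is affine in the coefficients, so the conditional expectation satisfies
  the weak equation, which the scheme satisfies up to a vanishing consistency error.
\<close>

section \<open>Skorohod representation on Euclidean spaces\<close>

text \<open>The growth bound contains the second moment of the unknown law, and for a solution this
  moment is a priori only finite and lower semicontinuous in time. A Gronwall argument has no
  starting point, so boundedness has to be proved separately. On the existence side the initial law
  has no moment above the second. Uniform integrability of |x|^2 is obtained by conditioning on the
  starting point: there the fourth moment is finite, and the smaller of two resulting bounds is
  integrable. The selections need not be continuous, so their values cannot converge as functions;
  they are carried along as an extra random variable with tight laws. The noise of one step takes
  finitely many values, which makes expectations over a step finite averages. Convergence of laws is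
  tested with bounded Lipschitz functions, because the increments of the scheme are controlled for
  these. Representation by convergent variables is reduced to the real line by an injective Borel
  code.\<close>

text \<open>Digits 0 and 1 in base ten leave gaps between the values, so a convergent sequence of such
  numbers has eventually constant digits, which fails for binary expansions.\<close>

definition cantor :: "(nat \<Rightarrow> bool) \<Rightarrow> real" where
  "cantor a = (\<Sum>j. of_bool (a j) * (1/10) ^ Suc j)"

lemma cantor_summable: "summable (\<lambda>j. of_bool (a j) * (1/10 :: real) ^ Suc j)"
  by (rule summable_comparison_test[of _ "\<lambda>j. (1/10) ^ Suc j"])
     (auto simp: summable_Suc_iff intro!: exI[of _ 0] summable_geometric)

lemma cantor_bounds: "0 \<le> cantor a" "cantor a \<le> 1/9"
proof -
  show "0 \<le> cantor a" unfolding cantor_def by (intro suminf_nonneg cantor_summable) auto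
  have s: "(\<lambda>j. (1/10 :: real) ^ Suc j) sums (1/9)"
    using sums_mult[OF geometric_sums[of "1/10::real"], of "1/10"] by simp
  have "cantor a \<le> (\<Sum>j. (1/10 :: real) ^ Suc j)" unfolding cantor_def
    by (intro suminf_le cantor_summable sums_summable[OF s]) auto
  then show "cantor a \<le> 1/9" using sums_unique[OF s] by simp
qed

lemma cantor_Suc: "10 * cantor a = of_bool (a 0) + cantor (\<lambda>j. a (Suc j))"
proof -
  have "cantor a = of_bool (a 0) * (1/10) ^ Suc 0 + (\<Sum>j. of_bool (a (Suc j)) * (1/10) ^ Suc (Suc j))"
    unfolding cantor_def using suminf_split_head[OF cantor_summable[of a]] by simp
  also have "(\<Sum>j. of_bool (a (Suc j)) * (1/10::real) ^ Suc (Suc j)) = 1/10 * cantor (\<lambda>j. a (Suc j))"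
    unfolding cantor_def suminf_mult[OF cantor_summable, symmetric] by (simp add: mult_ac)
  finally show ?thesis by simp
qed

text \<open>Multiplication by \<open>10 ^ Suc J\<close> moves the digits up to index
  \<open>J\<close> in front of the decimal point, and digit \<open>J\<close> becomes the units digit
  of the integer part. What remains behind the point is the value of the shifted sequence.\<close>

lemma cantor_shift: "\<exists>N::int. 10 ^ Suc J * cantor a = of_int N + cantor (\<lambda>j. a (Suc J + j)) \<and> N mod 10 = of_bool (a J)"
proof (induction J)
  case 0
  show ?case by (rule exI[of _ "of_bool (a 0)"]) (simp add: cantor_Suc)
next
  case (Suc J)
  then obtain N where N: "10 ^ Suc J * cantor a = of_int N + cantor (\<lambda>j. a (Suc J + j))" by blast
  have "10 ^ Suc (Suc J) * cantor a = 10 * of_int N + 10 * cantor (\<lambda>j. a (Suc J + j))"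
    using N by simp
  also have "\<dots> = of_int (10 * N + of_bool (a (Suc J))) + cantor (\<lambda>j. a (Suc (Suc J) + j))"
    by (simp add: cantor_Suc)
  finally show ?case by (intro exI[of _ "10 * N + of_bool (a (Suc J))"]) (simp add: mod_simps)
qed

definition cantor_digit :: "nat \<Rightarrow> real \<Rightarrow> bool" where
  "cantor_digit J y \<longleftrightarrow> \<lfloor>10 ^ Suc J * y\<rfloor> mod 10 = 1"

text \<open>What stands behind the decimal point is at most 1/9. Scaled codes thus avoid the gap
  between 1/9 and the next integer, which makes reading a digit stable under small
  perturbations.\<close>

lemma cantor_floor: "\<lfloor>10 ^ Suc J * cantor a\<rfloor> \<le> 10 ^ Suc J * cantor a"
    "10 ^ Suc J * cantor a \<le> \<lfloor>10 ^ Suc J * cantor a\<rfloor> + 1/9"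
    and cantor_digit_cantor: "cantor_digit J (cantor a) = a J"
proof -
  obtain N :: int where N: "10 ^ Suc J * cantor a = of_int N + cantor (\<lambda>j. a (Suc J + j))" "N mod 10 = of_bool (a J)"
    using cantor_shift by blast
  have fl: "\<lfloor>10 ^ Suc J * cantor a\<rfloor> = N"
    unfolding N(1) using cantor_bounds[of "\<lambda>j. a (Suc J + j)"] by linarith
  then show "cantor_digit J (cantor a) = a J" unfolding cantor_digit_def using N(2) by auto
  show "\<lfloor>10 ^ Suc J * cantor a\<rfloor> \<le> 10 ^ Suc J * cantor a" by simp
  show "10 ^ Suc J * cantor a \<le> \<lfloor>10 ^ Suc J * cantor a\<rfloor> + 1/9"
    using fl N(1) cantor_bounds(2)[of "\<lambda>j. a (Suc J + j)"] by linarith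
qed

text \<open>Scaled codes with different integer parts are at least 8/9 apart, so closeness to within
  1/2 already forces equal integer parts and equal digits.\<close>

lemma cantor_convergent_digits:
  assumes "convergent (\<lambda>k. cantor (a k))"
  shows "\<exists>K. \<forall>k\<ge>K. \<forall>l\<ge>K. a k J = a l J"
proof -
  have "convergent (\<lambda>k. 10 ^ Suc J * cantor (a k))"
    using assms by (intro convergent_mult convergent_const)
  then have "Cauchy (\<lambda>k. 10 ^ Suc J * cantor (a k))" by (rule convergent_Cauchy)
  then obtain K where K: "\<And>k l. k \<ge> K \<Longrightarrow> l \<ge> K \<Longrightarrow> dist (10 ^ Suc J * cantor (a k)) (10 ^ Suc J * cantor (a l)) < 1/2"
    unfolding Cauchy_def by (meson half_gt_zero zero_less_one)
  have "a k J = a l J" if "k \<ge> K" "l \<ge> K" for k l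
  proof -
    have "\<lfloor>10 ^ Suc J * cantor (a k)\<rfloor> = \<lfloor>10 ^ Suc J * cantor (a l)\<rfloor>"
      using K[OF that] cantor_floor[of J "a k"] cantor_floor[of J "a l"]
      unfolding dist_real_def by linarith
    then have "cantor_digit J (cantor (a k)) = cantor_digit J (cantor (a l))"
      unfolding cantor_digit_def by simp
    then show ?thesis by (simp add: cantor_digit_cantor)
  qed
  then show ?thesis by blast
qed

section \<open>Binary expansions in the unit interval\<close>

definition binary_digit :: "nat \<Rightarrow> real \<Rightarrow> bool" where
  "binary_digit k t \<longleftrightarrow> odd \<lfloor>2 ^ Suc k * t\<rfloor>"

text \<open>The induction step is the identity floor(2^(n+1) t) = 2 floor(2^n t) + digit, obtained
  by halving and rounding down.\<close>

lemma binary_digit_sum: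
  assumes "0 \<le> t" "t < 1"
  shows "(\<Sum>k<n. of_bool (binary_digit k t) * (1/2) ^ Suc k) = \<lfloor>2 ^ n * t\<rfloor> / 2 ^ n"
proof (induction n)
  case 0
  have "\<lfloor>t\<rfloor> = 0" using assms by linarith
  then show ?case by simp
next
  case (Suc n)
  have "\<lfloor>2 ^ n * t\<rfloor> = \<lfloor>2 ^ Suc n * t\<rfloor> div 2"
  proof -
    have "\<lfloor>2 ^ Suc n * t / of_int 2\<rfloor> = \<lfloor>2 ^ Suc n * t\<rfloor> div 2"
      by (rule floor_divide_real_eq_div) simp
    then show ?thesis by simp
  qed
  then have "\<lfloor>2 ^ Suc n * t\<rfloor> = 2 * \<lfloor>2 ^ n * t\<rfloor> + of_bool (binary_digit n t)"
    unfolding binary_digit_def by (auto elim!: oddE evenE)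
  then have "real_of_int \<lfloor>2 ^ Suc n * t\<rfloor> / 2 ^ Suc n = \<lfloor>2 ^ n * t\<rfloor> / 2 ^ n + of_bool (binary_digit n t) * (1/2) ^ Suc n"
    by (auto simp: field_simps power_one_over)
  then show ?case using Suc by simp
qed

lemma binary_digit_sums:
  assumes "0 \<le> t" "t < 1"
  shows "(\<lambda>k. of_bool (binary_digit k t) * (1/2) ^ Suc k) sums t"
proof -
  have "(\<lambda>n. \<lfloor>2 ^ n * t\<rfloor> / 2 ^ n) \<longlonglongrightarrow> t"
  proof (rule LIM_zero_cancel, rule Lim_null_comparison)
    show "(\<lambda>n. (1/2::real) ^ n) \<longlonglongrightarrow> 0" by (rule LIMSEQ_realpow_zero) auto
    show "\<forall>\<^sub>F n in sequentially. norm (\<lfloor>2 ^ n * t\<rfloor> / 2 ^ n - t) \<le> (1/2) ^ n"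
    proof (intro always_eventually allI)
      fix n
      have "\<bar>\<lfloor>2 ^ n * t\<rfloor> - 2 ^ n * t\<bar> \<le> 1" by linarith
      moreover have "\<lfloor>2 ^ n * t\<rfloor> / 2 ^ n - t = (\<lfloor>2 ^ n * t\<rfloor> - 2 ^ n * t) / 2 ^ n" by (simp add: field_simps)
      ultimately show "norm (\<lfloor>2 ^ n * t\<rfloor> / 2 ^ n - t) \<le> (1/2) ^ n"
        by (simp add: divide_right_mono power_one_over)
    qed
  qed
  then show ?thesis unfolding sums_def binary_digit_sum[OF assms] .
qed

text \<open>Agreement of the first \<open>n\<close> digits means equal dyadic truncations, so the
  terms differ by less than 2^(-n). The converse fails at dyadic points, which is why the binary
  digits are encoded once more in base ten.\<close>

lemma binary_digit_convergent:
  assumes t: "\<And>m::nat. 0 \<le> t m \<and> t m < 1"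
    and c: "\<And>k. \<exists>K. \<forall>m\<ge>K. \<forall>l\<ge>K. binary_digit k (t m) = binary_digit k (t l)"
  shows "convergent t"
proof -
  obtain KK where KK: "\<And>k m l. m \<ge> KK k \<Longrightarrow> l \<ge> KK k \<Longrightarrow> binary_digit k (t m) = binary_digit k (t l)"
    using c by metis
  have "Cauchy t"
  proof (rule metric_CauchyI)
    fix e :: real assume e: "e > 0"
    obtain n where n: "(1/2) ^ n < e" using real_arch_pow_inv[OF e, of "1/2"] by auto
    show "\<exists>M. \<forall>m\<ge>M. \<forall>l\<ge>M. dist (t m) (t l) < e"
    proof (intro exI allI impI)
      \<comment> \<open>The index set \<open>{..n}\<close> instead of \<open>{..<n}\<close> keeps
        the maximum over a nonempty set when \<open>n = 0\<close>.\<close>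
      fix m l assume ml: "Max (KK ` {..n}) \<le> m" "Max (KK ` {..n}) \<le> l"
      have "(\<Sum>k<n. of_bool (binary_digit k (t m)) * (1/2::real) ^ Suc k) = (\<Sum>k<n. of_bool (binary_digit k (t l)) * (1/2) ^ Suc k)"
      proof (rule sum.cong)
        fix k assume "k \<in> {..<n}"
        then have "KK k \<le> Max (KK ` {..n})" by (intro Max_ge) auto
        then show "of_bool (binary_digit k (t m)) * (1/2::real) ^ Suc k = of_bool (binary_digit k (t l)) * (1/2) ^ Suc k"
          using KK[of k m l] ml by simp
      qed simp
      then have "\<lfloor>2 ^ n * t m\<rfloor> = \<lfloor>2 ^ n * t l\<rfloor>" using binary_digit_sum t by simp
      then have "\<bar>2 ^ n * t m - 2 ^ n * t l\<bar> < 1" by linarith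
      then have "2 ^ n * \<bar>t m - t l\<bar> < 1" by (simp add: abs_mult flip: right_diff_distrib)
      then have "\<bar>t m - t l\<bar> < (1/2) ^ n" by (simp add: field_simps power_one_over)
      then show "dist (t m) (t l) < e" using n by (simp add: dist_real_def)
    qed
  qed
  then show ?thesis by (rule Cauchy_convergent)
qed

section \<open>An increasing chart of the real line onto the open unit interval\<close>

definition squash :: "real \<Rightarrow> real" where "squash s = 1/2 + arctan s / pi"
definition unsquash :: "real \<Rightarrow> real" where "unsquash t = tan (pi * (t - 1/2))"

lemma squash_bounds: "0 < squash s" "squash s < 1"
  using arctan_bounded[of s] pi_gt_zero by (auto simp: squash_def field_simps)

lemma unsquash_squash: "unsquash (squash s) = s"
  by (simp add: squash_def unsquash_def tan_arctan)

lemma squash_gt_imp: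
  assumes "0 < t" "t < 1" shows "squash s \<le> t \<longleftrightarrow> s \<le> unsquash t"
proof -
  have b: "- (pi/2) < pi * (t - 1/2)" "pi * (t - 1/2) < pi/2"
    using assms by (auto simp: field_simps)
  have "s \<le> unsquash t \<longleftrightarrow> arctan s \<le> arctan (tan (pi * (t - 1/2)))"
    by (simp add: unsquash_def arctan_le_iff)
  also have "\<dots> \<longleftrightarrow> arctan s \<le> pi * (t - 1/2)" using b by (subst arctan_tan) auto
  also have "\<dots> \<longleftrightarrow> squash s \<le> t" by (simp add: squash_def field_simps)
  finally show ?thesis by simp
qed

lemma isCont_unsquash:
  assumes "0 < t" "t < 1" shows "isCont unsquash t"
proof -
  have "- (pi/2) < pi * (t - 1/2)" "pi * (t - 1/2) < pi/2"
    using assms by (auto simp: field_simps)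
  then have "cos (pi * (t - 1/2)) > 0" by (intro cos_gt_zero_pi) auto
  then show ?thesis unfolding unsquash_def by (intro isCont_tan' continuous_intros) auto
qed

lemma measurable_unsquash [measurable]: "unsquash \<in> borel_measurable borel"
  unfolding unsquash_def tan_def[abs_def] by measurable

lemma measurable_squash [measurable]: "squash \<in> borel_measurable borel"
  unfolding squash_def[abs_def] by measurable

lemma unsquash_lim:
  fixes s :: "nat \<Rightarrow> real"
  assumes "(\<lambda>k. squash (s k)) \<longlonglongrightarrow> t" "0 < t" "t < 1"
  shows "s \<longlonglongrightarrow> unsquash t"
  using isCont_tendsto_compose[OF isCont_unsquash[OF assms(2,3)] assms(1)]
  by (simp add: unsquash_squash)

text \<open>The limit lies in the closed unit interval. Outside the open one it is 0 or 1, and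
  comparison with the value of \<open>squash\<close> at a large negative or positive level pushes
  \<open>s k\<close> beyond that level.\<close>

lemma squash_lim_infinity:
  fixes s :: "nat \<Rightarrow> real"
  assumes "(\<lambda>k. squash (s k)) \<longlonglongrightarrow> t" "\<not> (0 < t \<and> t < 1)"
  shows "filterlim (\<lambda>k. \<bar>s k\<bar>) at_top sequentially"
  unfolding filterlim_at_top
proof
  fix R :: real
  define R' where "R' = max R 0"
  have lo: "squash (- R' - 1) > 0" and hi: "squash R' < 1" using squash_bounds by auto
  have t: "t \<ge> 0" "t \<le> 1"
    using LIMSEQ_le_const[OF assms(1), of 0] LIMSEQ_le_const2[OF assms(1), of 1] squash_bounds
    by (auto intro: less_imp_le)
  show "\<forall>\<^sub>F k in sequentially. R \<le> \<bar>s k\<bar>"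
  proof (cases "t = 0")
    case True
    then have "\<forall>\<^sub>F k in sequentially. squash (s k) < squash (- R' - 1)"
      using order_tendstoD(2)[OF assms(1)] lo by blast
    then show ?thesis
    proof eventually_elim
      case (elim k)
      then have "s k \<le> - R' - 1"
        using squash_gt_imp[of "squash (- R' - 1)" "s k"] squash_bounds by (simp add: unsquash_squash)
      then show ?case by (simp add: R'_def)
    qed
  next
    case False
    then have "t = 1" using t assms(2) by auto
    then have "\<forall>\<^sub>F k in sequentially. squash R' < squash (s k)"
      using order_tendstoD(1)[OF assms(1)] hi by blast
    then show ?thesis
    proof eventually_elim
      case (elim k)
      then have "\<not> s k \<le> R'"
        using squash_gt_imp[of "squash R'" "s k"] squash_bounds by (simp add: unsquash_squash)
      then show ?case by (simp add: R'_def)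
    qed
  qed
qed

text \<open>The binary digits of the squashed coordinates, interleaved into one Cantor-type expansion. The
  encoding is not continuous, but a limit of codes of a sequence that does not escape to infinity
  forces convergence of the sequence, so the representation theorem on the real line transfers.\<close>

definition code_dir :: "nat \<Rightarrow> 'a::euclidean_space" where
  "code_dir j = from_nat_into Basis (fst (prod_decode j))"

definition code_bits :: "'a::euclidean_space \<Rightarrow> nat \<Rightarrow> bool" where
  "code_bits x j = binary_digit (snd (prod_decode j)) (squash (x \<bullet> code_dir j))"

definition encode :: "'a::euclidean_space \<Rightarrow> real" where
  "encode x = cantor (code_bits x)"

definition bit_index :: "'a::euclidean_space \<Rightarrow> nat \<Rightarrow> nat" where
  "bit_index i k = prod_encode (to_nat_on Basis i, k)"

definition decode :: "real \<Rightarrow> 'a::euclidean_space" where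
  "decode y = (\<Sum>i\<in>Basis. unsquash (\<Sum>k. of_bool (cantor_digit (bit_index i k) y) * (1/2) ^ Suc k) *\<^sub>R i)"

lemma code_bits_bit_index:
  "i \<in> Basis \<Longrightarrow> code_bits x (bit_index i k) = binary_digit k (squash (x \<bullet> i))"
  by (simp add: code_bits_def bit_index_def code_dir_def countable_finite)

lemma decode_encode: "decode (encode x) = x"
proof -
  have "(\<Sum>k. of_bool (cantor_digit (bit_index i k) (encode x)) * (1/2) ^ Suc k) = squash (x \<bullet> i)"
    if "i \<in> Basis" for i
    using sums_unique[OF binary_digit_sums[of "squash (x \<bullet> i)"]] squash_bounds[of "x \<bullet> i"] that
    by (simp add: encode_def cantor_digit_cantor code_bits_bit_index)
  then show ?thesis by (simp add: decode_def unsquash_squash euclidean_representation)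
qed

lemma measurable_cantor_digit [measurable]: "Measurable.pred borel (cantor_digit j)"
  unfolding cantor_digit_def[abs_def] by measurable

lemma measurable_decode [measurable]: "decode \<in> borel_measurable borel"
  unfolding decode_def[abs_def] by measurable

lemma measurable_binary_digit [measurable]: "Measurable.pred borel (binary_digit j)"
  unfolding binary_digit_def[abs_def] by measurable

lemma measurable_encode [measurable]: "encode \<in> borel_measurable (borel :: 'a::euclidean_space measure)"
  unfolding encode_def[abs_def] code_bits_def cantor_def by measurable

lemma encode_convergent_coordinate:
  fixes x :: "nat \<Rightarrow> 'a::euclidean_space"
  assumes "convergent (\<lambda>k. encode (x k))" "i \<in> Basis"
  shows "convergent (\<lambda>k. squash (x k \<bullet> i))"
proof (rule binary_digit_convergent)
  show "0 \<le> squash (x m \<bullet> i) \<and> squash (x m \<bullet> i) < 1" for m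
    using squash_bounds less_imp_le by blast
  show "\<exists>K. \<forall>m\<ge>K. \<forall>l\<ge>K. binary_digit k (squash (x m \<bullet> i)) = binary_digit k (squash (x l \<bullet> i))" for k
    using cantor_convergent_digits[of "\<lambda>k. code_bits (x k)" "bit_index i k"] assms
    by (simp add: encode_def code_bits_bit_index)
qed

text \<open>Convergent codes give convergent squashed coordinates. A limit 0 or 1 in one coordinate
  would drive that coordinate, and with it the norm, to infinity; every other limit is pulled back
  through \<open>unsquash\<close>, which is continuous there.\<close>

lemma encode_convergent:
  fixes x :: "nat \<Rightarrow> 'a::euclidean_space"
  assumes "convergent (\<lambda>k. encode (x k))" "\<not> filterlim (\<lambda>k. norm (x k)) at_top sequentially"
  shows "convergent x"
proof -
  have "convergent (\<lambda>k. x k \<bullet> i)" if i: "i \<in> Basis" for i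
  proof -
    obtain t where t: "(\<lambda>k. squash (x k \<bullet> i)) \<longlonglongrightarrow> t"
      using encode_convergent_coordinate[OF assms(1) i] by (auto simp: convergent_def)
    have "0 < t \<and> t < 1"
    proof (rule ccontr)
      assume "\<not> ?thesis"
      from squash_lim_infinity[OF t this]
      have "filterlim (\<lambda>k. norm (x k)) at_top sequentially"
        by (rule filterlim_at_top_mono) (auto simp: Basis_le_norm i)
      with assms(2) show False by simp
    qed
    with unsquash_lim[OF t] show ?thesis by (auto simp: convergent_def)
  qed
  then obtain l where l: "\<And>i. i \<in> Basis \<Longrightarrow> (\<lambda>k. x k \<bullet> i) \<longlonglongrightarrow> l i"
    unfolding convergent_def by metis
  have "(\<lambda>k. \<Sum>i\<in>Basis. (x k \<bullet> i) *\<^sub>R i) \<longlonglongrightarrow> (\<Sum>i\<in>Basis. l i *\<^sub>R i)"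
    using l by (intro tendsto_sum tendsto_scaleR tendsto_const)
  then show ?thesis by (auto simp: convergent_def euclidean_representation)
qed

text \<open>Codes lie in a fixed bounded interval, so their laws are always tight and the
  one-dimensional theorem applies along a subsequence. Tightness of the original laws enters
  afterwards: it excludes that the represented variables escape to infinity, the only way in which
  convergent codes can fail to give convergent points. The laws are recovered because
  \<open>decode\<close> inverts \<open>encode\<close> everywhere.\<close>

theorem skorohod_subsequence:
  fixes \<mu> :: "nat \<Rightarrow> 'a::euclidean_space measure"
  assumes prob: "\<And>k. prob_space (\<mu> k)" and sets: "\<And>k. sets (\<mu> k) = sets borel"
    and tight: "\<And>e. e > 0 \<Longrightarrow> \<exists>R. \<forall>k. measure (\<mu> k) {x. R < norm x} \<le> e"
  obtains \<Omega> :: "real measure" and r and Z :: "nat \<Rightarrow> real \<Rightarrow> 'a" and Z'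
  where "strict_mono (r :: nat \<Rightarrow> nat)" "prob_space \<Omega>" "\<And>k. Z k \<in> borel_measurable \<Omega>"
    "Z' \<in> borel_measurable \<Omega>" "\<And>k. distr \<Omega> borel (Z k) = \<mu> (r k)"
    "AE \<omega> in \<Omega>. (\<lambda>k. Z k \<omega>) \<longlonglongrightarrow> Z' \<omega>"
proof -
  note [measurable_cong] = sets
  define \<nu> where "\<nu> k = distr (\<mu> k) borel encode" for k
  have real_distr: "real_distribution (\<nu> k)" for k
    unfolding \<nu>_def real_distribution_def real_distribution_axioms_def
    by (auto intro!: prob_space.prob_space_distr prob)
  have "Helly_Selection.tight \<nu>"
    unfolding tight_def
  proof (intro conjI allI impI real_distr)
    fix e :: real assume "e > 0"
    have "measure (\<nu> k) {-1<..1} > 1 - e" for k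
    proof -
      have "encode x \<in> {-1<..1}" for x :: 'a using cantor_bounds[of "code_bits x"] by (simp add: encode_def)
      then have "encode -` {-1<..1} = (UNIV :: 'a set)" by auto
      then show ?thesis
        using prob_space.prob_space[OF prob[of k]] \<open>e > 0\<close> sets_eq_imp_space_eq[OF sets[of k]]
        by (simp add: \<nu>_def measure_distr)
    qed
    then show "\<exists>a b. a < b \<and> (\<forall>n. 1 - e < measure (\<nu> n) {a<..b})"
      by (intro exI[of _ "-1"] exI[of _ 1]) auto
  qed
  from tight_imp_convergent_subsubsequence[OF this strict_mono_id]
  obtain r M where r: "strict_mono (r :: nat \<Rightarrow> nat)" and M: "real_distribution M"
    and wM: "weak_conv_m (\<nu> \<circ> id \<circ> r) M" by blast
  obtain \<Omega> Y Y' where \<Omega>: "prob_space (\<Omega> :: real measure)"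
    and Y [measurable]: "\<And>n. Y n \<in> measurable \<Omega> borel"
    and dY: "\<And>n. distr \<Omega> borel (Y n) = (\<nu> \<circ> id \<circ> r) n"
    and Y': "Y' \<in> measurable \<Omega> lborel" and limY: "\<And>x. x \<in> space \<Omega> \<Longrightarrow> (\<lambda>n. Y n x) \<longlonglongrightarrow> Y' x"
    using Skorohod[of "\<nu> \<circ> id \<circ> r" M] real_distr M wM by (simp add: o_def) metis
  interpret prob_space \<Omega> by fact
  define Z where "Z k \<omega> = (decode (Y k \<omega>) :: 'a)" for k \<omega>
  have Z [measurable]: "Z k \<in> borel_measurable \<Omega>" for k unfolding Z_def by measurable
  have dZ: "distr \<Omega> borel (Z k) = \<mu> (r k)" for k
  proof -
    have "distr \<Omega> borel (Z k) = distr (distr \<Omega> borel (Y k)) borel decode"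
      by (simp add: distr_distr comp_def Z_def[abs_def])
    also have "\<dots> = distr (\<mu> (r k)) borel (\<lambda>x. x)"
      unfolding dY by (simp add: \<nu>_def distr_distr comp_def decode_encode)
    also have "\<dots> = \<mu> (r k)" by (rule distr_id2) (simp add: sets)
    finally show ?thesis .
  qed
  \<comment> \<open>\<open>Y k\<close> has the law of a code, and almost every value under that law
    lies in the range of \<open>encode\<close>, where \<open>decode\<close> can be undone.\<close>
  have enc: "AE \<omega> in \<Omega>. Y k \<omega> = encode (Z k \<omega>)" for k
  proof -
    have "AE y in distr \<Omega> borel (Y k). y = encode (decode y :: 'a)"
      unfolding dY o_def \<nu>_def by (subst AE_distr_iff) (auto simp: decode_encode)
    then show ?thesis by (subst (asm) AE_distr_iff) (auto simp: Z_def)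
  qed
  \<comment> \<open>The event of escape is contained in the increasing union of the events
    \<open>C n\<close>. On \<open>C n\<close> the single variable \<open>Z n\<close> already has a
    large norm, so the tightness bound \<open>e\<close> holds for every \<open>C n\<close> and hence
    for the union.\<close>
  have fin: "AE \<omega> in \<Omega>. \<not> filterlim (\<lambda>k. norm (Z k \<omega>)) at_top sequentially"
  proof -
    define B where "B = {\<omega>\<in>space \<Omega>. \<forall>R::nat. \<exists>n. \<forall>k\<ge>n. real R < norm (Z k \<omega>)}"
    have [measurable]: "B \<in> sets \<Omega>" unfolding B_def by measurable
    have "prob B \<le> e" if e: "e > 0" for e
    proof -
      obtain R where R: "\<And>k. measure (\<mu> k) {x. R < norm x} \<le> e" using tight[OF e] by blast
      obtain R' :: nat where R': "R \<le> real R'" using real_arch_simple by blast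
      define C where "C n = {\<omega>\<in>space \<Omega>. \<forall>k\<ge>n. real R' < norm (Z k \<omega>)}" for n
      have Cm [measurable]: "C n \<in> sets \<Omega>" for n unfolding C_def by measurable
      have C: "prob (C n) \<le> e" for n
      proof -
        have "prob (C n) \<le> prob {\<omega>\<in>space \<Omega>. R < norm (Z n \<omega>)}"
          using R' by (intro finite_measure_mono) (auto simp: C_def)
        also have "\<dots> = measure (distr \<Omega> borel (Z n)) {x. R < norm x}"
          by (subst measure_distr) (auto intro!: arg_cong[where f=prob])
        also have "\<dots> \<le> e" using R by (simp add: dZ)
        finally show ?thesis .
      qed
      have "prob B \<le> prob (\<Union>n. C n)"
        by (intro finite_measure_mono) (auto simp: B_def C_def)
      also have "\<dots> \<le> e"
      proof (rule LIMSEQ_le_const2[OF finite_Lim_measure_incseq])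
        show "range C \<subseteq> events" by auto
        show "incseq C" by (auto simp: incseq_def C_def)
      qed (use C in auto)
      finally show ?thesis .
    qed
    then have "prob B \<le> 0" by (rule field_le_epsilon) simp
    then have null: "B \<in> null_sets \<Omega>" by (auto simp: null_sets_def emeasure_eq_measure measure_le_0_iff)
    show ?thesis
    proof (rule AE_I'[OF null])
      show "{\<omega> \<in> space \<Omega>. \<not> \<not> filterlim (\<lambda>k. norm (Z k \<omega>)) at_top sequentially} \<subseteq> B"
        unfolding B_def filterlim_at_top_dense eventually_sequentially by blast
    qed
  qed
  have lim: "AE \<omega> in \<Omega>. (\<lambda>k. Z k \<omega>) \<longlonglongrightarrow> lim (\<lambda>k. Z k \<omega>)"
  proof -
    have "AE \<omega> in \<Omega>. \<forall>k. Y k \<omega> = encode (Z k \<omega>)" using enc by (simp add: AE_all_countable)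
    then show ?thesis using fin AE_space
    proof eventually_elim
      case (elim \<omega>)
      then have "convergent (\<lambda>k. encode (Z k \<omega>))" using limY[of \<omega>] by (auto simp: convergent_def)
      then show ?case using encode_convergent elim by (simp add: convergent_LIMSEQ_iff)
    qed
  qed
  show ?thesis
    by (rule that[of r \<Omega> Z "\<lambda>\<omega>. lim (\<lambda>k. Z k \<omega>)"]) (use r \<Omega> dZ lim in auto)
qed

section \<open>Weak convergence and the Wasserstein metric\<close>

lemma (in prob_space) abs_integral_le_const:
  fixes f :: "'a \<Rightarrow> real"
  assumes "f \<in> borel_measurable M" "\<And>x. \<bar>f x\<bar> \<le> B"
  shows "integrable M f" "\<bar>\<integral>x. f x \<partial>M\<bar> \<le> B"
proof -
  show i: "integrable M f" using assms by (intro integrable_const_bound[of _ B]) auto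
  have "f x \<le> B" "- B \<le> f x" for x using assms(2)[of x] by auto
  then have "(\<integral>x. f x \<partial>M) \<le> B" "- B \<le> (\<integral>x. f x \<partial>M)"
    by (intro integral_le_const integral_ge_const i AE_I2; simp)+
  then show "\<bar>\<integral>x. f x \<partial>M\<bar> \<le> B" by simp
qed

lemma le_one_plus_square: "a \<le> 1 + a\<^sup>2" for a :: real
proof -
  have "2 * a \<le> a\<^sup>2 + 1" using sum_squares_bound[of a 1] by simp
  then show ?thesis using zero_le_power2[of a] by argo
qed

section \<open>Bounded Lipschitz convergence of probability measures\<close>

text \<open>Lipschitz test functions replace general bounded continuous ones because the increments
  of the scheme are estimated for them. By \<open>borel_prob_eqI_lipschitz\<close> they still
  determine a probability measure, and for tight sequences on Euclidean spaces the two notions of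
  convergence agree, see \<open>bl_conv_imp_weak\<close>.\<close>

definition bl_conv :: "(nat \<Rightarrow> 'a::metric_space measure) \<Rightarrow> 'a measure \<Rightarrow> bool" where
  "bl_conv \<mu> m \<longleftrightarrow> (\<forall>f L. L-lipschitz_on UNIV f \<longrightarrow> bounded (range f) \<longrightarrow>
     (\<lambda>k. \<integral>x. f x \<partial>\<mu> k) \<longlonglongrightarrow> (\<integral>x. (f x :: real) \<partial>m))"

lemma bl_convD:
  "bl_conv \<mu> m \<Longrightarrow> L-lipschitz_on UNIV f \<Longrightarrow> bounded (range f) \<Longrightarrow>
     (\<lambda>k. \<integral>x. f x \<partial>\<mu> k) \<longlonglongrightarrow> (\<integral>x. (f x :: real) \<partial>m)"
  by (auto simp: bl_conv_def)

lemma bl_conv_subseq: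
  "bl_conv \<mu> m \<Longrightarrow> strict_mono r \<Longrightarrow> bl_conv (\<lambda>k. \<mu> (r k)) m"
  unfolding bl_conv_def
  by (auto intro!: LIMSEQ_subseq_LIMSEQ[of _ _ r, unfolded o_def])

text \<open>The tents \<open>max 0 (1 - real k * infdist x C)\<close> eventually vanish off
  \<open>C\<close> because closedness makes the distance positive there. The empty set is excluded
  since \<open>infdist\<close> to it is 0 by convention.\<close>

lemma closed_indicator_approx:
  fixes C :: "'a::metric_space set"
  assumes C: "closed C" "C \<noteq> {}"
  obtains f :: "nat \<Rightarrow> 'a \<Rightarrow> real" where "\<And>k. (real k)-lipschitz_on UNIV (f k)" "\<And>k x. 0 \<le> f k x \<and> f k x \<le> 1"
    "\<And>x. (\<lambda>k. f k x) \<longlonglongrightarrow> indicator C x"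
proof -
  define f where "f k x = max 0 (1 - real k * infdist x C)" for k x
  have L: "(real k)-lipschitz_on UNIV (f k)" for k
  proof (rule lipschitz_onI)
    fix x y
    have "\<bar>f k x - f k y\<bar> \<le> \<bar>real k * infdist x C - real k * infdist y C\<bar>"
      by (auto simp: f_def)
    also have "\<dots> = real k * \<bar>infdist x C - infdist y C\<bar>"
      by (simp add: abs_mult flip: right_diff_distrib)
    also have "\<dots> \<le> real k * dist x y"
      by (intro mult_left_mono infdist_triangle_abs) auto
    finally show "dist (f k x) (f k y) \<le> real k * dist x y" by (simp add: dist_real_def)
  qed simp
  have lim: "(\<lambda>k. f k x) \<longlonglongrightarrow> indicator C x" for x
  proof (cases "x \<in> C")
    case True
    then show ?thesis by (simp add: f_def)
  next
    case nin: False
    then have pos: "infdist x C > 0" using in_closed_iff_infdist_zero[OF C, of x] infdist_nonneg[of x C] by linarith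
    then obtain K where K: "1 < real K * infdist x C" using reals_Archimedean3 by blast
    have "\<forall>\<^sub>F k in sequentially. f k x = 0"
      unfolding eventually_sequentially
    proof (intro exI allI impI)
      fix k assume "K \<le> k"
      then have "real K * infdist x C \<le> real k * infdist x C" using pos by (intro mult_right_mono) auto
      then show "f k x = 0" using K by (simp add: f_def)
    qed
    then show ?thesis using nin by (simp add: tendsto_eventually)
  qed
  show ?thesis by (rule that[of f, OF L _ lim]) (auto simp: f_def infdist_nonneg)
qed

text \<open>Closed sets form a generator stable under intersections, and the measure of a closed set
  is a limit of integrals of bounded Lipschitz functions.\<close>

lemma borel_prob_eqI_lipschitz:
  fixes \<mu> m :: "'a::metric_space measure"
  assumes p: "prob_space \<mu>" "prob_space m" and s: "sets \<mu> = sets borel" "sets m = sets borel"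
    and eq: "\<And>f :: 'a \<Rightarrow> real. \<And>L. L-lipschitz_on UNIV f \<Longrightarrow> bounded (range f) \<Longrightarrow> (\<integral>x. f x \<partial>\<mu>) = (\<integral>x. f x \<partial>m)"
  shows "\<mu> = m"
proof (rule measure_eqI_generator_eq[where E = "Collect closed" and \<Omega> = UNIV and A = "\<lambda>_. UNIV"])
  interpret \<mu>: prob_space \<mu> by fact
  interpret m: prob_space m by fact
  fix C :: "'a set" assume "C \<in> Collect closed"
  then have C: "closed C" by simp
  show "emeasure \<mu> C = emeasure m C"
  proof (cases "C = {}")
    case False
    obtain f :: "nat \<Rightarrow> 'a \<Rightarrow> real" where L: "\<And>k. (real k)-lipschitz_on UNIV (f k)"
      and f01: "\<And>k x. 0 \<le> f k x \<and> f k x \<le> 1" and lim: "\<And>x. (\<lambda>k. f k x) \<longlonglongrightarrow> indicator C x"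
      by (rule closed_indicator_approx[OF C False]) (rule that)
    have b: "\<bar>f k x\<bar> \<le> 1" for k x using f01[of k x] by simp
    have meas: "f k \<in> borel_measurable borel" for k
      using lipschitz_on_continuous_on[OF L] by (intro borel_measurable_continuous_onI)
    have to: "(\<lambda>k. \<integral>x. f k x \<partial>M) \<longlonglongrightarrow> measure M C" if "prob_space M" "sets M = sets borel" for M
    proof -
      interpret prob_space M by fact
      note [measurable_cong] = that(2)
      have "(\<lambda>k. \<integral>x. f k x \<partial>M) \<longlonglongrightarrow> (\<integral>x. indicator C x \<partial>M)"
        by (rule integral_dominated_convergence[where w = "\<lambda>_. 1"])
          (use C meas lim b that(2) in \<open>auto intro!: borel_measurable_indicator\<close>)
      then show ?thesis using C that(2) sets_eq_imp_space_eq[OF that(2)] by simp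
    qed
    have "bounded (range (f k))" for k using b by (auto simp: bounded_iff)
    then have "(\<lambda>k. \<integral>x. f k x \<partial>\<mu>) = (\<lambda>k. \<integral>x. f k x \<partial>m)" using eq L by blast
    then have "measure \<mu> C = measure m C" using to[OF p(1) s(1)] to[OF p(2) s(2)] LIMSEQ_unique by metis
    then show ?thesis by (simp add: \<mu>.emeasure_eq_measure m.emeasure_eq_measure)
  qed simp
next
  show "sets \<mu> = sigma_sets UNIV (Collect closed)" "sets m = sigma_sets UNIV (Collect closed)"
    unfolding s by (simp_all add: borel_eq_closed)
  show "emeasure \<mu> UNIV \<noteq> \<infinity>" for i :: nat
    using prob_space.emeasure_space_1[OF p(1)] sets_eq_imp_space_eq[OF s(1)] by simp
qed (auto simp: Int_stable_def)

text \<open>Representations by convergent variables exist only along subsequences; this principle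
  returns to the full sequence. If it failed, the infinitely many indices outside some neighbourhood
  of \<open>l\<close> would form a subsequence without a further subsequence converging to
  \<open>l\<close>.\<close>

lemma LIMSEQ_subseq_criterion:
  fixes X :: "nat \<Rightarrow> 'a::topological_space"
  assumes "\<And>s::nat\<Rightarrow>nat. strict_mono s \<Longrightarrow> \<exists>r::nat\<Rightarrow>nat. strict_mono r \<and> (\<lambda>k. X (s (r k))) \<longlonglongrightarrow> l"
  shows "X \<longlonglongrightarrow> l"
proof (rule topological_tendstoI, rule ccontr)
  fix S assume S: "open S" "l \<in> S" and n: "\<not> (\<forall>\<^sub>F x in sequentially. X x \<in> S)"
  define s where "s = enumerate {k. X k \<notin> S}"
  have inf: "infinite {k. X k \<notin> S}"
    using n unfolding eventually_sequentially infinite_nat_iff_unbounded_le by auto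
  have "strict_mono s" unfolding s_def using inf by (rule strict_mono_enumerate)
  then obtain r where "strict_mono (r::nat\<Rightarrow>nat)" "(\<lambda>k. X (s (r k))) \<longlonglongrightarrow> l" using assms by blast
  then have "\<forall>\<^sub>F k in sequentially. X (s (r k)) \<in> S" using S by (simp add: topological_tendstoD)
  moreover have "X (s j) \<notin> S" for j using enumerate_in_set[OF inf, of j] by (simp add: s_def)
  ultimately show False by simp
qed

lemma ae_tendsto_integral:
  fixes Z :: "nat \<Rightarrow> 'b \<Rightarrow> 'a::metric_space" and f :: "'a \<Rightarrow> real"
  assumes "prob_space \<Omega>" and [measurable]: "\<And>k. Z k \<in> borel_measurable \<Omega>" "Z' \<in> borel_measurable \<Omega>"
    and ae: "AE \<omega> in \<Omega>. (\<lambda>k. Z k \<omega>) \<longlonglongrightarrow> Z' \<omega>"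
    and f: "continuous_on UNIV f" "bounded (range f)"
  shows "(\<lambda>k. \<integral>x. f x \<partial>distr \<Omega> borel (Z k)) \<longlonglongrightarrow> (\<integral>x. f x \<partial>distr \<Omega> borel Z')"
proof -
  interpret prob_space \<Omega> by fact
  obtain B where B: "\<And>x. \<bar>f x\<bar> \<le> B" using f(2) by (auto simp: bounded_iff)
  have [measurable]: "f \<in> borel_measurable borel" using f(1) by (rule borel_measurable_continuous_onI)
  have "(\<lambda>k. \<integral>\<omega>. f (Z k \<omega>) \<partial>\<Omega>) \<longlonglongrightarrow> (\<integral>\<omega>. f (Z' \<omega>) \<partial>\<Omega>)"
  proof (rule integral_dominated_convergence[where w = "\<lambda>_. B"])
    show "AE \<omega> in \<Omega>. (\<lambda>k. f (Z k \<omega>)) \<longlonglongrightarrow> f (Z' \<omega>)"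
      using ae
    proof eventually_elim
      case (elim \<omega>)
      have "isCont f (Z' \<omega>)" using f(1) by (simp add: continuous_on_eq_continuous_at)
      then show ?case using elim by (rule isCont_tendsto_compose)
    qed
  qed (use B in auto)
  then show ?thesis by (simp add: integral_distr)
qed

text \<open>\<open>skorohod_subsequence\<close> leaves the law of the limit variable open; comparing
  integrals of bounded Lipschitz functions identifies it as \<open>m\<close>.\<close>

lemma skorohod_bl_conv:
  fixes \<mu> :: "nat \<Rightarrow> 'a::euclidean_space measure"
  assumes prob: "\<And>k. prob_space (\<mu> k)" and sets: "\<And>k. sets (\<mu> k) = sets borel"
    and m: "prob_space m" "sets m = sets borel"
    and tight: "\<And>e. e > 0 \<Longrightarrow> \<exists>R. \<forall>k. measure (\<mu> k) {x. R < norm x} \<le> e"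
    and conv: "bl_conv \<mu> m"
  obtains \<Omega> :: "real measure" and r and Z :: "nat \<Rightarrow> real \<Rightarrow> 'a" and Z'
  where "strict_mono (r :: nat \<Rightarrow> nat)" "prob_space \<Omega>" "\<And>k. Z k \<in> borel_measurable \<Omega>"
    "Z' \<in> borel_measurable \<Omega>" "\<And>k. distr \<Omega> borel (Z k) = \<mu> (r k)" "distr \<Omega> borel Z' = m"
    "AE \<omega> in \<Omega>. (\<lambda>k. Z k \<omega>) \<longlonglongrightarrow> Z' \<omega>"
proof -
  obtain \<Omega> :: "real measure" and r and Z :: "nat \<Rightarrow> real \<Rightarrow> 'a" and Z'
    where *: "strict_mono (r :: nat \<Rightarrow> nat)" "prob_space \<Omega>"
    and Z [measurable]: "\<And>k. Z k \<in> borel_measurable \<Omega>"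
    and Z' [measurable]: "Z' \<in> borel_measurable \<Omega>"
    and **: "\<And>k. distr \<Omega> borel (Z k) = \<mu> (r k)" "AE \<omega> in \<Omega>. (\<lambda>k. Z k \<omega>) \<longlonglongrightarrow> Z' \<omega>"
    by (rule skorohod_subsequence[OF prob sets tight], assumption, rule that)
  interpret prob_space \<Omega> by fact
  have "distr \<Omega> borel Z' = m"
  proof (rule borel_prob_eqI_lipschitz)
    fix f :: "'a \<Rightarrow> real" and L assume f: "L-lipschitz_on UNIV f" "bounded (range f)"
    have "(\<lambda>k. \<integral>x. f x \<partial>\<mu> (r k)) \<longlonglongrightarrow> (\<integral>x. f x \<partial>distr \<Omega> borel Z')"
      using ae_tendsto_integral[OF *(2) Z Z' **(2) lipschitz_on_continuous_on[OF f(1)] f(2)] unfolding **(1) .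
    then show "(\<integral>x. f x \<partial>distr \<Omega> borel Z') = (\<integral>x. f x \<partial>m)"
      using bl_convD[OF bl_conv_subseq[OF conv *(1)] f] LIMSEQ_unique by blast
  qed (use m in \<open>auto intro: prob_space_distr\<close>)
  then show ?thesis using that[of r \<Omega> Z Z'] * ** by simp
qed

lemma second_moment_tight:
  fixes \<mu> :: "'i \<Rightarrow> (real ^ 'n) measure"
  assumes \<mu>: "\<And>k. k \<in> I \<Longrightarrow> \<mu> k \<in> P2" and S: "\<And>k. k \<in> I \<Longrightarrow> (\<integral>x. (norm x)\<^sup>2 \<partial>\<mu> k) \<le> S" and e: "e > 0"
  shows "\<exists>R. \<forall>k\<in>I. measure (\<mu> k) {x. R < norm x} \<le> e"
proof (intro exI ballI)
  fix k assume k: "k \<in> I"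
  interpret prob_space "\<mu> k" using \<mu>[OF k] by (simp add: P2_def)
  have s [measurable_cong]: "sets (\<mu> k) = sets borel" using \<mu>[OF k] by (simp add: P2_def)
  \<comment> \<open>Markov's inequality with this radius gives exactly \<open>e\<close>; the summand
    1 keeps the radius positive when \<open>S = 0\<close>.\<close>
  define R where "R = sqrt ((\<bar>S\<bar> + 1) / e)"
  have R: "R\<^sup>2 = (\<bar>S\<bar> + 1) / e" "R > 0" using e by (auto simp: R_def)
  have "measure (\<mu> k) {x. R < norm x} \<le> measure (\<mu> k) {x\<in>space (\<mu> k). R\<^sup>2 \<le> (norm x)\<^sup>2}"
    using R(2) sets_eq_imp_space_eq[OF s] by (intro finite_measure_mono) (auto intro!: power_mono)
  also have "\<dots> \<le> (\<integral>x. (norm x)\<^sup>2 \<partial>\<mu> k) / R\<^sup>2"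
    using \<mu>[OF k] R(2) by (intro integral_Markov_inequality_measure[where A = "{}"]) (auto simp: P2_def)
  also have "\<dots> \<le> (\<bar>S\<bar> + 1) / R\<^sup>2" using S[OF k] by (intro divide_right_mono) auto
  also have "\<dots> = e" using R e by simp
  finally show "measure (\<mu> k) {x. sqrt ((\<bar>S\<bar> + 1) / e) < norm x} \<le> e" unfolding R_def .
qed

section \<open>Wasserstein convergence through almost surely convergent couplings\<close>

lemma W2_nonneg: "m \<in> P2 \<Longrightarrow> m' \<in> P2 \<Longrightarrow> 0 \<le> W2 m m'"
  unfolding W2_def using couplings_nonempty by (auto intro!: cINF_greatest)

lemma W2_le_coupling:
  fixes X Y :: "'b \<Rightarrow> real ^ 'n"
  assumes "prob_space \<Omega>" and [measurable]: "X \<in> borel_measurable \<Omega>" "Y \<in> borel_measurable \<Omega>"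
  shows "W2 (distr \<Omega> borel X) (distr \<Omega> borel Y) \<le> sqrt (\<integral>\<omega>. (norm (X \<omega> - Y \<omega>))\<^sup>2 \<partial>\<Omega>)"
proof -
  have [measurable]: "(\<lambda>\<omega>. (X \<omega>, Y \<omega>)) \<in> borel_measurable \<Omega>" by measurable
  have [measurable]: "fst \<in> measurable borel (borel :: (real ^ 'n) measure)"
    "snd \<in> measurable borel (borel :: (real ^ 'n) measure)"
    by (auto intro!: borel_measurable_continuous_onI continuous_intros)
  define \<pi> where "\<pi> = distr \<Omega> borel (\<lambda>\<omega>. (X \<omega>, Y \<omega>))"
  have \<pi>: "\<pi> \<in> couplings (distr \<Omega> borel X) (distr \<Omega> borel Y)"
    unfolding couplings_def \<pi>_def mem_Collect_eq
    by (subst (1 2) distr_distr) (auto simp: comp_def intro: prob_space.prob_space_distr[OF assms(1)])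
  have "(INF \<pi>\<in>couplings (distr \<Omega> borel X) (distr \<Omega> borel Y). \<integral>z. (dist (fst z) (snd z))\<^sup>2 \<partial>\<pi>)
      \<le> (\<integral>z. (dist (fst z) (snd z))\<^sup>2 \<partial>\<pi>)"
    by (intro cINF_lower \<pi>) (auto intro!: bdd_belowI2[where m = 0])
  also have "\<dots> = (\<integral>\<omega>. (norm (X \<omega> - Y \<omega>))\<^sup>2 \<partial>\<Omega>)"
    unfolding \<pi>_def dist_norm by (subst integral_distr) (auto intro!: borel_measurable_continuous_onI continuous_intros)
  finally show ?thesis unfolding W2_def by simp
qed

text \<open>An argument of Riesz-Scheffe type. \<open>G k\<close> is nonnegative by the
  parallelogram identity and tends to four times the squared norm of \<open>Z'\<close>, so Fatou's
  lemma bounds its integral from below. Convergence of the second moments then leaves no room for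
  the integrals of the squared differences.\<close>

lemma L2_convergence_of_norms:
  fixes Z :: "nat \<Rightarrow> 'b \<Rightarrow> 'a::euclidean_space"
  assumes [measurable]: "\<And>k. Z k \<in> borel_measurable \<Omega>" "Z' \<in> borel_measurable \<Omega>"
    and i: "\<And>k. integrable \<Omega> (\<lambda>\<omega>. (norm (Z k \<omega>))\<^sup>2)" "integrable \<Omega> (\<lambda>\<omega>. (norm (Z' \<omega>))\<^sup>2)"
    and ae: "AE \<omega> in \<Omega>. (\<lambda>k. Z k \<omega>) \<longlonglongrightarrow> Z' \<omega>"
    and M: "(\<lambda>k. \<integral>\<omega>. (norm (Z k \<omega>))\<^sup>2 \<partial>\<Omega>) \<longlonglongrightarrow> (\<integral>\<omega>. (norm (Z' \<omega>))\<^sup>2 \<partial>\<Omega>)"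
  shows "(\<lambda>k. \<integral>\<omega>. (norm (Z k \<omega> - Z' \<omega>))\<^sup>2 \<partial>\<Omega>) \<longlonglongrightarrow> 0"
proof -
  let ?M = "\<lambda>k. \<integral>\<omega>. (norm (Z k \<omega>))\<^sup>2 \<partial>\<Omega>" and ?M' = "\<integral>\<omega>. (norm (Z' \<omega>))\<^sup>2 \<partial>\<Omega>"
  let ?D = "\<lambda>k. \<integral>\<omega>. (norm (Z k \<omega> - Z' \<omega>))\<^sup>2 \<partial>\<Omega>"
  define G where "G k \<omega> = 2 * (norm (Z k \<omega>))\<^sup>2 + 2 * (norm (Z' \<omega>))\<^sup>2 - (norm (Z k \<omega> - Z' \<omega>))\<^sup>2" for k \<omega>
  have [measurable]: "G k \<in> borel_measurable \<Omega>" for k unfolding G_def by measurable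
  have G_eq: "G k \<omega> = (norm (Z k \<omega> + Z' \<omega>))\<^sup>2" for k \<omega>
    unfolding G_def by (simp add: power2_norm_eq_inner inner_simps inner_commute)
  have iD: "integrable \<Omega> (\<lambda>\<omega>. (norm (Z k \<omega> - Z' \<omega>))\<^sup>2)" for k
  proof (rule Bochner_Integration.integrable_bound)
    show "integrable \<Omega> (\<lambda>\<omega>. 2 * (norm (Z k \<omega>))\<^sup>2 + 2 * (norm (Z' \<omega>))\<^sup>2)" using i by simp
    have "0 \<le> G k \<omega>" for \<omega> unfolding G_eq by simp
    then show "AE \<omega> in \<Omega>. norm ((norm (Z k \<omega> - Z' \<omega>))\<^sup>2) \<le> norm (2 * (norm (Z k \<omega>))\<^sup>2 + 2 * (norm (Z' \<omega>))\<^sup>2)"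
      unfolding G_def by simp
  qed simp
  have iG: "integrable \<Omega> (G k)" for k unfolding G_def using i iD by simp
  have IG: "(\<integral>\<omega>. G k \<omega> \<partial>\<Omega>) = 2 * ?M k + 2 * ?M' - ?D k" for k unfolding G_def using i iD by simp
  have "ennreal (4 * ?M') = (\<integral>\<^sup>+\<omega>. ennreal (4 * (norm (Z' \<omega>))\<^sup>2) \<partial>\<Omega>)"
    using i by (subst nn_integral_eq_integral) auto
  also have "\<dots> = (\<integral>\<^sup>+\<omega>. liminf (\<lambda>k. ennreal (G k \<omega>)) \<partial>\<Omega>)"
  proof (rule nn_integral_cong_AE, use ae in eventually_elim)
    case (elim \<omega>)
    have "(\<lambda>k. ennreal (G k \<omega>)) \<longlonglongrightarrow> ennreal (2 * (norm (Z' \<omega>))\<^sup>2 + 2 * (norm (Z' \<omega>))\<^sup>2 - (norm (Z' \<omega> - Z' \<omega>))\<^sup>2)"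
      unfolding G_def by (intro tendsto_intros tendsto_ennrealI elim)
    then show ?case using lim_imp_Liminf by (simp add: lim_imp_Liminf)
  qed
  also have "\<dots> \<le> liminf (\<lambda>k. \<integral>\<^sup>+\<omega>. ennreal (G k \<omega>) \<partial>\<Omega>)"
    by (rule nn_integral_liminf) measurable
  also have "\<dots> = liminf (\<lambda>k. ennreal (2 * ?M k + 2 * ?M' - ?D k))"
    unfolding IG[symmetric] using iG by (subst nn_integral_eq_integral) (auto simp: G_eq)
  finally have lim: "ennreal (4 * ?M') \<le> liminf (\<lambda>k. ennreal (2 * ?M k + 2 * ?M' - ?D k))" .
  show ?thesis
  proof (rule order_tendstoI)
    fix a :: real assume "a < 0"
    then show "\<forall>\<^sub>F k in sequentially. a < ?D k"
      by (intro always_eventually allI, rule less_le_trans[of a 0]) auto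
  next
    fix e :: real assume e: "0 < e"
    have M0: "?M' \<ge> 0" by simp
    have "\<forall>\<^sub>F k in sequentially. 4 * ?M' - e/2 < 2 * ?M k + 2 * ?M' - ?D k"
    \<comment> \<open>\<open>ennreal\<close> maps negative numbers to 0, so the comparison in the
      extended reals yields the real inequality only for a nonnegative lower bound.\<close>
    proof (cases "4 * ?M' - e/2 < 0")
      case True
      have "0 \<le> 2 * ?M k + 2 * ?M' - ?D k" for k unfolding IG[symmetric] by (simp add: G_eq)
      then show ?thesis by (intro always_eventually allI less_le_trans[OF True])
    next
      case False
      then have "ennreal (4 * ?M' - e/2) < ennreal (4 * ?M')" using e M0 by (intro ennreal_lessI) auto
      then have "ennreal (4 * ?M' - e/2) < liminf (\<lambda>k. ennreal (2 * ?M k + 2 * ?M' - ?D k))"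
        using lim by (rule less_le_trans)
      from less_LiminfD[OF this] show ?thesis
      proof eventually_elim
        case (elim k)
        then show ?case using False by (simp add: ennreal_less_iff)
      qed
    qed
    moreover have "\<forall>\<^sub>F k in sequentially. ?M k < ?M' + e/4"
      using order_tendstoD(2)[OF M] e by simp
    ultimately show "\<forall>\<^sub>F k in sequentially. ?D k < e" by eventually_elim linarith
  qed
qed

text \<open>Along a subsequence the laws are realised by variables that converge almost surely.
  Convergence of the second moments improves this to convergence in L2, and the L2 distance of any
  two variables with these laws dominates \<open>W2\<close>.\<close>

theorem W2_tendsto_0:
  fixes \<mu> :: "nat \<Rightarrow> (real ^ 'n) measure"
  assumes \<mu>: "\<And>k. \<mu> k \<in> P2" and m: "m \<in> P2" and conv: "bl_conv \<mu> m"
    and M: "(\<lambda>k. \<integral>x. (norm x)\<^sup>2 \<partial>\<mu> k) \<longlonglongrightarrow> (\<integral>x. (norm x)\<^sup>2 \<partial>m)"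
  shows "(\<lambda>k. W2 (\<mu> k) m) \<longlonglongrightarrow> 0"
proof (rule LIMSEQ_subseq_criterion)
  fix s :: "nat \<Rightarrow> nat" assume s: "strict_mono s"
  obtain S where S: "\<And>k. (\<integral>x. (norm x)\<^sup>2 \<partial>\<mu> k) \<le> S"
    using convergent_imp_Bseq[OF convergentI[OF M]] by (auto simp: Bseq_def abs_le_iff)
  have ps: "prob_space (\<mu> k)" "sets (\<mu> k) = sets borel" "prob_space m" "sets m = sets borel" for k
    using \<mu>[of k] m by (auto simp: P2_def)
  have tight: "\<exists>R. \<forall>k. measure (\<mu> (s k)) {x. R < norm x} \<le> e" if "e > 0" for e
    using second_moment_tight[of UNIV "\<lambda>k. \<mu> (s k)" S e] \<mu> S that by auto
  obtain r and \<Omega> :: "real measure" and Z :: "nat \<Rightarrow> real \<Rightarrow> real ^ 'n" and Z'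
    where r: "strict_mono (r :: nat \<Rightarrow> nat)" and \<Omega>: "prob_space \<Omega>"
    and Z [measurable]: "\<And>k. Z k \<in> borel_measurable \<Omega>"
    and Z' [measurable]: "Z' \<in> borel_measurable \<Omega>"
    and d: "\<And>k. distr \<Omega> borel (Z k) = \<mu> (s (r k))" "distr \<Omega> borel Z' = m"
    and ae: "AE \<omega> in \<Omega>. (\<lambda>k. Z k \<omega>) \<longlonglongrightarrow> Z' \<omega>"
    by (rule skorohod_bl_conv[OF ps(1,2) ps(3,4) tight bl_conv_subseq[OF conv s]], assumption, rule that)
  have nm: "(\<lambda>x::real^'n. (norm x)\<^sup>2) \<in> borel_measurable borel" by simp
  have i: "integrable \<Omega> (\<lambda>\<omega>. (norm (Z k \<omega>))\<^sup>2)" "integrable \<Omega> (\<lambda>\<omega>. (norm (Z' \<omega>))\<^sup>2)" for k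
    using \<mu>[of "s (r k)"] m
    unfolding d(1)[of k, symmetric] d(2)[symmetric] P2_def by (simp_all add: integrable_distr_eq)
  have I: "(\<integral>x. (norm x)\<^sup>2 \<partial>\<mu> (s (r k))) = (\<integral>\<omega>. (norm (Z k \<omega>))\<^sup>2 \<partial>\<Omega>)" for k
    unfolding d(1)[of k, symmetric] by (simp add: integral_distr)
  have I': "(\<integral>x. (norm x)\<^sup>2 \<partial>m) = (\<integral>\<omega>. (norm (Z' \<omega>))\<^sup>2 \<partial>\<Omega>)"
    unfolding d(2)[symmetric] by (simp add: integral_distr)
  have "(\<lambda>k. \<integral>\<omega>. (norm (Z k \<omega> - Z' \<omega>))\<^sup>2 \<partial>\<Omega>) \<longlonglongrightarrow> 0"
  proof (rule L2_convergence_of_norms[OF Z Z' i ae])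
    show "(\<lambda>k. \<integral>\<omega>. (norm (Z k \<omega>))\<^sup>2 \<partial>\<Omega>) \<longlonglongrightarrow> (\<integral>\<omega>. (norm (Z' \<omega>))\<^sup>2 \<partial>\<Omega>)"
      using LIMSEQ_subseq_LIMSEQ[OF M strict_mono_o[OF s r]] by (simp add: o_def I I')
  qed
  from tendsto_real_sqrt[OF this]
  have z: "(\<lambda>k. sqrt (\<integral>\<omega>. (norm (Z k \<omega> - Z' \<omega>))\<^sup>2 \<partial>\<Omega>)) \<longlonglongrightarrow> 0" by simp
  have "(\<lambda>k. W2 (\<mu> (s (r k))) m) \<longlonglongrightarrow> 0"
  proof (rule tendsto_sandwich[OF _ _ tendsto_const z])
    show "\<forall>\<^sub>F k in sequentially. 0 \<le> W2 (\<mu> (s (r k))) m" using W2_nonneg[OF \<mu> m] by simp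
    show "\<forall>\<^sub>F k in sequentially. W2 (\<mu> (s (r k))) m \<le> sqrt (\<integral>\<omega>. (norm (Z k \<omega> - Z' \<omega>))\<^sup>2 \<partial>\<Omega>)"
      using W2_le_coupling[OF \<Omega> Z Z'] by (simp add: d)
  qed
  then show "\<exists>r. strict_mono r \<and> (\<lambda>k. W2 (\<mu> (s (r k))) m) \<longlonglongrightarrow> 0" using r by blast
qed

section \<open>Truncated second moments and uniform integrability\<close>

text \<open>The truncation is the square of min(|x|, sqrt \<rho>), a function with Lipschitz
  constant 1 and values at most sqrt \<rho>; the difference of squares factors.\<close>

lemma min_norm_square_lipschitz:
  assumes "0 \<le> \<rho>"
  shows "(2 * sqrt \<rho>)-lipschitz_on UNIV (\<lambda>x::'a::real_normed_vector. min ((norm x)\<^sup>2) \<rho>)"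
proof (rule lipschitz_onI)
  have eq: "min (a\<^sup>2) \<rho> = (min a (sqrt \<rho>))\<^sup>2" if "a \<ge> 0" for a :: real
  proof (cases "a \<le> sqrt \<rho>")
    case True
    then have "a\<^sup>2 \<le> \<rho>" using that assms by (metis power_mono real_sqrt_pow2)
    then show ?thesis using True by simp
  next
    case False
    then have "\<rho> \<le> a\<^sup>2" using that assms by (metis linear real_sqrt_le_iff real_sqrt_unique)
    then show ?thesis using False assms by (simp add: min_def)
  qed
  fix x y :: 'a
  let ?p = "min (norm x) (sqrt \<rho>)" and ?q = "min (norm y) (sqrt \<rho>)"
  have "\<bar>?p\<^sup>2 - ?q\<^sup>2\<bar> = \<bar>?p + ?q\<bar> * \<bar>?p - ?q\<bar>"
    by (simp add: power2_eq_square flip: abs_mult) (simp add: algebra_simps)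
  also have "\<dots> \<le> (2 * sqrt \<rho>) * dist x y"
  proof (rule mult_mono)
    have "\<bar>?p - ?q\<bar> \<le> \<bar>norm x - norm y\<bar>" by linarith
    then show "\<bar>?p - ?q\<bar> \<le> dist x y" using norm_triangle_ineq3[of x y] by (simp add: dist_norm)
    show "\<bar>?p + ?q\<bar> \<le> 2 * sqrt \<rho>" using assms by auto
  qed (use assms in auto)
  finally show "dist (min ((norm x)\<^sup>2) \<rho>) (min ((norm y)\<^sup>2) \<rho>) \<le> 2 * sqrt \<rho> * dist x y"
    by (simp add: eq dist_real_def)
qed (use assms in simp)

lemma integral_min_norm_square_tendsto:
  fixes m :: "(real ^ 'n) measure"
  assumes s: "sets m = sets borel" and i: "integrable m (\<lambda>x. (norm x)\<^sup>2)"
  shows "(\<lambda>n. \<integral>x. min ((norm x)\<^sup>2) (real n) \<partial>m) \<longlonglongrightarrow> (\<integral>x. (norm x)\<^sup>2 \<partial>m)"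
proof (rule integral_dominated_convergence[OF _ _ i])
  show "AE x in m. (\<lambda>n. min ((norm x)\<^sup>2) (real n)) \<longlonglongrightarrow> (norm x)\<^sup>2"
  proof (rule AE_I2)
    fix x :: "real ^ 'n"
    obtain N :: nat where N: "(norm x)\<^sup>2 \<le> real N" using real_arch_simple by blast
    show "(\<lambda>n. min ((norm x)\<^sup>2) (real n)) \<longlonglongrightarrow> (norm x)\<^sup>2"
      by (rule tendsto_eventually, unfold eventually_sequentially, rule exI[of _ N]) (use N in auto)
  qed
qed (use s in \<open>auto simp: measurable_cong_sets[OF s refl]\<close>)

text \<open>Monotone convergence. Bounds on truncated moments survive weak limits because the
  truncations are bounded Lipschitz functions, whereas |x|^2 itself is not an admissible test
  function.\<close>

lemma integrable_norm_square_if_bounded: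
  fixes m :: "(real ^ 'n) measure"
  assumes s: "sets m = sets borel" and p: "prob_space m"
    and S: "\<And>n::nat. (\<integral>x. min ((norm x)\<^sup>2) (real n) \<partial>m) \<le> S"
  shows "integrable m (\<lambda>x. (norm x)\<^sup>2)" "(\<integral>x. (norm x)\<^sup>2 \<partial>m) \<le> S"
proof -
  interpret prob_space m by fact
  note [measurable_cong] = s
  let ?f = "\<lambda>(n::nat) x::real^'n. min ((norm x)\<^sup>2) (real n)"
  have i: "integrable m (?f n)" for n
    by (rule integrable_const_bound[where B = "real n"]) auto
  have "incseq (\<lambda>n. \<integral>x. ?f n x \<partial>m)"
    unfolding incseq_def using i by (auto intro!: integral_mono)
  then obtain L where L: "(\<lambda>n. \<integral>x. ?f n x \<partial>m) \<longlonglongrightarrow> L"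
    using incseq_convergent[of "\<lambda>n. \<integral>x. ?f n x \<partial>m" S] S by blast
  have lim: "(\<lambda>n. ?f n x) \<longlonglongrightarrow> (norm x)\<^sup>2" for x
  proof -
    obtain N :: nat where N: "(norm x)\<^sup>2 \<le> real N" using real_arch_simple by blast
    show ?thesis
      by (rule tendsto_eventually, unfold eventually_sequentially, rule exI[of _ N]) (use N in auto)
  qed
  show "integrable m (\<lambda>x. (norm x)\<^sup>2)"
    by (rule integrable_monotone_convergence[OF i _ _ L]) (use lim in \<open>auto simp: mono_def\<close>)
  from integral_min_norm_square_tendsto[OF s this] show "(\<integral>x. (norm x)\<^sup>2 \<partial>m) \<le> S"
    by (rule LIMSEQ_le_const2) (use S in auto)
qed

text \<open>|x|^2 is split into its truncation \<open>t \<rho>\<close>, a bounded Lipschitz function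
  whose integrals converge, and a tail that is small uniformly in \<open>k\<close>. Once the tails
  of the limit are known to be small as well, the second moments converge, and with them the
  distances \<open>W2\<close>.\<close>

theorem uniformly_integrable_limit:
  fixes \<mu> :: "nat \<Rightarrow> (real ^ 'n) measure"
  assumes \<mu>: "\<And>k. \<mu> k \<in> P2" and m: "prob_space m" "sets m = sets borel" and conv: "bl_conv \<mu> m"
    and UI: "\<And>e. e > 0 \<Longrightarrow> \<exists>\<rho>. \<forall>k. (\<integral>x. max 0 ((norm x)\<^sup>2 - \<rho>) \<partial>\<mu> k) \<le> e"
  shows "m \<in> P2" "(\<lambda>k. \<integral>x. (norm x)\<^sup>2 \<partial>\<mu> k) \<longlonglongrightarrow> (\<integral>x. (norm x)\<^sup>2 \<partial>m)"
    "\<rho> \<ge> 0 \<Longrightarrow> (\<lambda>k. \<integral>x. max 0 ((norm x)\<^sup>2 - \<rho>) \<partial>\<mu> k) \<longlonglongrightarrow> (\<integral>x. max 0 ((norm x)\<^sup>2 - \<rho>) \<partial>m)"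
    "(\<lambda>k. W2 (\<mu> k) m) \<longlonglongrightarrow> 0"
proof -
  interpret m: prob_space m by fact
  have ps: "prob_space (\<mu> k)" "sets (\<mu> k) = sets borel" "integrable (\<mu> k) (\<lambda>x. (norm x)\<^sup>2)" for k
    using \<mu>[of k] by (auto simp: P2_def)
  note [measurable_cong] = m(2) ps(2)
  define t where "t = (\<lambda>\<rho> (x :: real ^ 'n). min ((norm x)\<^sup>2) \<rho>)"
  define tail where "tail = (\<lambda>\<rho> (x :: real ^ 'n). max 0 ((norm x)\<^sup>2 - \<rho>))"
  have [measurable]: "t \<rho> \<in> borel_measurable borel" "tail \<rho> \<in> borel_measurable borel" for \<rho>
    unfolding t_def tail_def by measurable
  have it: "integrable M (t \<rho>)" if "prob_space M" "sets M = sets borel" "\<rho> \<ge> 0" for M \<rho>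
  proof -
    interpret prob_space M by fact
    show ?thesis using that
      by (intro integrable_const_bound[where B = \<rho>]) (auto simp: t_def measurable_cong_sets[OF that(2) refl])
  qed
  have split: "(norm x)\<^sup>2 = t \<rho> x + tail \<rho> x" for \<rho> x by (auto simp: t_def tail_def)
  have itail: "integrable (\<mu> k) (tail \<rho>)" if "\<rho> \<ge> 0" for k \<rho>
    by (rule Bochner_Integration.integrable_bound[OF ps(3)]) (use that in \<open>auto simp: tail_def\<close>)
  have Itail: "(\<integral>x. (norm x)\<^sup>2 \<partial>\<mu> k) = (\<integral>x. t \<rho> x \<partial>\<mu> k) + (\<integral>x. tail \<rho> x \<partial>\<mu> k)" if "\<rho> \<ge> 0" for k \<rho>
    using it[OF ps(1,2) that] itail[OF that] by (simp add: split[of _ \<rho>])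
  have t: "(\<lambda>k. \<integral>x. t \<rho> x \<partial>\<mu> k) \<longlonglongrightarrow> (\<integral>x. t \<rho> x \<partial>m)" if "\<rho> \<ge> 0" for \<rho>
  proof (rule bl_convD[OF conv])
    show "(2 * sqrt \<rho>)-lipschitz_on UNIV (t \<rho>)"
      unfolding t_def by (rule min_norm_square_lipschitz[OF that])
    show "bounded (range (t \<rho>))" using that by (auto simp: bounded_iff t_def intro!: exI[of _ \<rho>])
  qed
  have UI': "\<exists>\<rho>\<ge>0. \<forall>k. (\<integral>x. tail \<rho> x \<partial>\<mu> k) \<le> e" if e: "e > 0" for e
  proof -
    obtain \<rho> where \<rho>: "\<And>k. (\<integral>x. max 0 ((norm x)\<^sup>2 - \<rho>) \<partial>\<mu> k) \<le> e" using UI[OF e] by blast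
    have "(\<integral>x. tail (max \<rho> 0) x \<partial>\<mu> k) \<le> e" for k
    proof -
      interpret prob_space "\<mu> k" by (rule ps)
      have "(\<integral>x. tail (max \<rho> 0) x \<partial>\<mu> k) \<le> (\<integral>x. max 0 ((norm x)\<^sup>2 - \<rho>) \<partial>\<mu> k)"
      proof (rule integral_mono)
        show "integrable (\<mu> k) (\<lambda>x. max 0 ((norm x)\<^sup>2 - \<rho>))" using ps(3) by simp
        show "integrable (\<mu> k) (tail (max \<rho> 0))" by (rule itail) simp
      qed (auto simp: tail_def)
      then show ?thesis using \<rho>[of k] by simp
    qed
    then show ?thesis by (intro exI[of _ "max \<rho> 0"]) auto
  qed
  have tail0: "0 \<le> (\<integral>x. tail \<rho> x \<partial>M)" for M \<rho>
    by (rule Bochner_Integration.integral_nonneg) (simp add: tail_def)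
  obtain \<rho>0 where \<rho>0: "\<rho>0 \<ge> 0" "\<And>k. (\<integral>x. tail \<rho>0 x \<partial>\<mu> k) \<le> 1" using UI'[of 1] by auto
  have t_le: "(\<integral>x. t \<rho> x \<partial>\<mu> k) \<le> \<rho>" if "\<rho> \<ge> 0" for k \<rho>
  proof -
    interpret prob_space "\<mu> k" by (rule ps)
    have "(\<integral>x. t \<rho> x \<partial>\<mu> k) \<le> (\<integral>x. \<rho> \<partial>\<mu> k)"
      using it[OF ps(1,2) that] by (intro integral_mono) (auto simp: t_def)
    then show ?thesis by (simp add: prob_space)
  qed
  have S: "(\<integral>x. (norm x)\<^sup>2 \<partial>\<mu> k) \<le> \<rho>0 + 1" for k
    using Itail[OF \<rho>0(1), of k] \<rho>0(2)[of k] t_le[OF \<rho>0(1), of k] by simp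
  have tS: "(\<integral>x. t \<rho> x \<partial>\<mu> k) \<le> \<rho>0 + 1" if "\<rho> \<ge> 0" for \<rho> k
    using S[of k] Itail[OF that, of k] tail0[of "\<mu> k" \<rho>] by linarith
  have "(\<integral>x. min ((norm x)\<^sup>2) (real n) \<partial>m) \<le> \<rho>0 + 1" for n
    using LIMSEQ_le_const2[OF t[of "real n"]] tS[of "real n"] by (auto simp: t_def)
  note int = integrable_norm_square_if_bounded[OF m(2,1) this]
  show m': "m \<in> P2" using int m by (simp add: P2_def)
  have itail': "integrable m (tail \<rho>)" if "\<rho> \<ge> 0" for \<rho>
    by (rule Bochner_Integration.integrable_bound[OF int(1)]) (use that in \<open>auto simp: tail_def\<close>)
  have Itail': "(\<integral>x. (norm x)\<^sup>2 \<partial>m) = (\<integral>x. t \<rho> x \<partial>m) + (\<integral>x. tail \<rho> x \<partial>m)" if "\<rho> \<ge> 0" for \<rho>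
    using it[OF m that] itail'[OF that] by (simp add: split[of _ \<rho>])
  \<comment> \<open>The tail is unbounded and hence no test function. It is approached by the
    differences \<open>t n - t \<rho>\<close> with growing \<open>n\<close>, for which the bound
    \<open>e\<close> passes to the limit in \<open>k\<close>.\<close>
  have tail_le: "(\<integral>x. tail \<rho> x \<partial>m) \<le> e" if "\<rho> \<ge> 0" and e: "\<And>k. (\<integral>x. tail \<rho> x \<partial>\<mu> k) \<le> e" for e \<rho>
  proof -
    have "(\<integral>x. t n x \<partial>m) - (\<integral>x. t \<rho> x \<partial>m) \<le> e" if n: "n \<ge> 0" for n
    proof (rule LIMSEQ_le_const2[OF tendsto_diff[OF t[OF n] t[OF \<open>\<rho> \<ge> 0\<close>]]])
      have "(\<integral>x. t n x \<partial>\<mu> k) - (\<integral>x. t \<rho> x \<partial>\<mu> k) \<le> e" for k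
        using Itail[OF n, of k] Itail[OF \<open>\<rho> \<ge> 0\<close>, of k] e[of k] tail0[of "\<mu> k" n]
        by linarith
      then show "\<exists>N. \<forall>k\<ge>N. (\<integral>x. t n x \<partial>\<mu> k) - (\<integral>x. t \<rho> x \<partial>\<mu> k) \<le> e" by blast
    qed
    then have *: "(\<integral>x. t (real n) x \<partial>m) \<le> e + (\<integral>x. t \<rho> x \<partial>m)" for n :: nat by (simp add: diff_le_eq)
    have "(\<integral>x. (norm x)\<^sup>2 \<partial>m) \<le> e + (\<integral>x. t \<rho> x \<partial>m)"
      by (rule LIMSEQ_le_const2[OF integral_min_norm_square_tendsto[OF m(2) int(1)]])
        (use * in \<open>auto simp: t_def\<close>)
    then show ?thesis using Itail'[OF \<open>\<rho> \<ge> 0\<close>] by simp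
  qed
  show mom: "(\<lambda>k. \<integral>x. (norm x)\<^sup>2 \<partial>\<mu> k) \<longlonglongrightarrow> (\<integral>x. (norm x)\<^sup>2 \<partial>m)"
  proof (rule LIMSEQ_I)
    fix e :: real assume e: "0 < e"
    then obtain \<rho> where \<rho>: "\<rho> \<ge> 0" "\<And>k. (\<integral>x. tail \<rho> x \<partial>\<mu> k) \<le> e/3" using UI'[of "e/3"] by auto
    obtain N where N: "\<And>k. k \<ge> N \<Longrightarrow> \<bar>(\<integral>x. t \<rho> x \<partial>\<mu> k) - (\<integral>x. t \<rho> x \<partial>m)\<bar> < e/3"
      using LIMSEQ_D[OF t[OF \<rho>(1)], of "e/3"] e by auto
    have "\<bar>(\<integral>x. (norm x)\<^sup>2 \<partial>\<mu> k) - (\<integral>x. (norm x)\<^sup>2 \<partial>m)\<bar> < e" if "k \<ge> N" for k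
      using N[OF that] Itail[OF \<rho>(1), of k] Itail'[OF \<rho>(1)] tail_le[OF \<rho>] \<rho>(2)[of k]
        tail0[of "\<mu> k" \<rho>] tail0[of m \<rho>]
      by linarith
    then show "\<exists>N. \<forall>k\<ge>N. norm ((\<integral>x. (norm x)\<^sup>2 \<partial>\<mu> k) - (\<integral>x. (norm x)\<^sup>2 \<partial>m)) < e" by auto
  qed
  show "(\<lambda>k. \<integral>x. max 0 ((norm x)\<^sup>2 - \<rho>) \<partial>\<mu> k) \<longlonglongrightarrow> (\<integral>x. max 0 ((norm x)\<^sup>2 - \<rho>) \<partial>m)" if "\<rho> \<ge> 0"
    using tendsto_diff[OF mom t[OF that]] Itail[OF that] Itail'[OF that] by (simp add: tail_def)
  show "(\<lambda>k. W2 (\<mu> k) m) \<longlonglongrightarrow> 0" by (rule W2_tendsto_0[OF \<mu> m' conv mom])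
qed

section \<open>Cut-off test functions\<close>

lemma grad_eqI:
  assumes "(f has_derivative (\<lambda>h. v \<bullet> h)) (at x)" shows "grad f x = v"
  using frechet_derivative_at[OF assms, symmetric] by (simp add: grad_def vec_eq_iff inner_axis)

lemma hessian_eqI:
  assumes "(grad f has_derivative (\<lambda>h. H *v h)) (at x)" shows "hessian f x = H"
  unfolding hessian_def jacobian_def frechet_derivative_at[OF assms, symmetric]
  by (simp add: matrix_of_matrix_vector_mul)

text \<open>An exponent of at least 2 smooths the corner at 0: the difference quotient there is at
  most \<open>(max 0 h) ^ Suc n\<close>.\<close>

lemma DERIV_pos_part_power:
  "((\<lambda>z::real. (max 0 z) ^ Suc (Suc n)) has_real_derivative (real (Suc (Suc n)) * (max 0 z) ^ Suc n)) (at z)"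
proof (cases "z = 0")
  case True
  have "(\<lambda>h::real. (max 0 h) ^ Suc (Suc n) / h) \<midarrow>0\<rightarrow> 0"
  proof (rule Lim_null_comparison)
    show "\<forall>\<^sub>F h in at 0. norm ((max 0 h) ^ Suc (Suc n) / h) \<le> (max 0 h) ^ Suc n"
      by (intro always_eventually allI) (auto simp: max_def)
    have "((\<lambda>h::real. (max 0 h) ^ Suc n) \<longlongrightarrow> (max 0 0) ^ Suc n) (at 0)"
      by (intro tendsto_intros)
    then show "((\<lambda>h::real. (max 0 h) ^ Suc n) \<longlongrightarrow> 0) (at 0)" by simp
  qed
  then show ?thesis using True by (simp add: DERIV_def)
next
  case False
  show ?thesis
  proof (cases "z > 0")
    case True
    have "((\<lambda>z. z ^ Suc (Suc n)) has_real_derivative (real (Suc (Suc n)) * (max 0 z) ^ Suc n)) (at z)"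
      using DERIV_pow[of "Suc (Suc n)" z] True by simp
    then show ?thesis
      by (rule has_field_derivative_transform_within_open[where S = "{0<..}"]) (use True in auto)
  next
    case False
    have "((\<lambda>z. 0) has_real_derivative (real (Suc (Suc n)) * (max 0 z) ^ Suc n)) (at z)"
      using False by (auto intro!: derivative_eq_intros simp: max_def)
    then show ?thesis
      by (rule has_field_derivative_transform_within_open[where S = "{..<0}"]) (use False \<open>z \<noteq> 0\<close> in auto)
  qed
qed

lemma DERIV_pos_part_power_chain:
  assumes "(f has_real_derivative f') (at x)"
  shows "((\<lambda>x. (max 0 (f x :: real))\<^sup>2) has_real_derivative 2 * max 0 (f x) * f') (at x)"
    "((\<lambda>x. (max 0 (f x :: real)) ^ 3) has_real_derivative 3 * (max 0 (f x))\<^sup>2 * f') (at x)"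
  using DERIV_chain2[OF DERIV_pos_part_power[of 0 "f x"] assms] DERIV_chain2[OF DERIV_pos_part_power[of 1 "f x"] assms]
  by (simp_all add: numeral_2_eq_2 numeral_3_eq_3)

text \<open>The cube is the smallest integer power of the positive part that is twice continuously
  differentiable at \<open>z = 1\<close>. Near 0 the function agrees with z to first order, so that
  \<open>psi\<close> approaches |x|^2 as the radius grows. \<open>chi1\<close> and
  \<open>chi2\<close> are its first two derivatives.\<close>

definition chi :: "real \<Rightarrow> real" where "chi z = z * (max 0 (1 - z)) ^ 3"
definition chi1 :: "real \<Rightarrow> real" where "chi1 z = (max 0 (1 - z)) ^ 3 - 3 * z * (max 0 (1 - z))\<^sup>2"
definition chi2 :: "real \<Rightarrow> real" where "chi2 z = 6 * z * max 0 (1 - z) - 6 * (max 0 (1 - z))\<^sup>2"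

lemma DERIV_chi: "(chi has_real_derivative chi1 z) (at z)" "(chi1 has_real_derivative chi2 z) (at z)"
proof -
  have d: "((\<lambda>z::real. 1 - z) has_real_derivative -1) (at z)" by (auto intro!: derivative_eq_intros)
  note p = DERIV_pos_part_power_chain[OF d]
  show "(chi has_real_derivative chi1 z) (at z)"
    unfolding chi_def[abs_def] chi1_def
    by (rule DERIV_cong[OF DERIV_mult[OF DERIV_ident p(2)]]) (simp add: algebra_simps)
  have t: "((\<lambda>z::real. 3 * z) has_real_derivative 3) (at z)" by (auto intro!: derivative_eq_intros)
  show "(chi1 has_real_derivative chi2 z) (at z)"
    unfolding chi1_def[abs_def] chi2_def
    by (rule DERIV_cong[OF DERIV_diff[OF p(2) DERIV_mult[OF t p(1)]]]) (simp add: algebra_simps)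
qed

text \<open>The factor z next to \<open>chi2\<close> is the one that the chain rule produces: the
  second term of the Hessian of \<open>psi\<close> carries x_i x_j / R^2, which is at most z = |x|^2
  / R^2 in absolute value. The radius therefore drops out of the derivative bounds in
  \<open>psi_bounds\<close>.\<close>

lemma chi_bounds:
  assumes "z \<ge> 0"
  shows "0 \<le> chi z" "chi z \<le> z" "\<bar>chi1 z\<bar> \<le> 4" "\<bar>chi2 z * z\<bar> \<le> 12" "z \<ge> 1 \<Longrightarrow> chi z = 0 \<and> chi1 z = 0 \<and> chi2 z = 0"
proof -
  let ?p = "max 0 (1 - z)"
  have p: "0 \<le> ?p" "?p \<le> 1" using assms by auto
  have p2: "0 \<le> ?p\<^sup>2" "?p\<^sup>2 \<le> 1" "0 \<le> ?p ^ 3" "?p ^ 3 \<le> 1" using p by (auto intro: power_le_one)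
  show z1: "chi z = 0 \<and> chi1 z = 0 \<and> chi2 z = 0" if "z \<ge> 1" using that by (simp add: chi_def chi1_def chi2_def)
  show "0 \<le> chi z" "chi z \<le> z" using assms p2 by (simp_all add: chi_def mult_left_le)
  show "\<bar>chi1 z\<bar> \<le> 4" "\<bar>chi2 z * z\<bar> \<le> 12"
  proof -
    have "\<bar>chi1 z\<bar> \<le> 4 \<and> \<bar>chi2 z * z\<bar> \<le> 12"
    proof (cases "z \<ge> 1")
      case True
      then show ?thesis using z1 by simp
    next
      case False
      have a: "0 \<le> z * ?p\<^sup>2" "z * ?p\<^sup>2 \<le> 1" using False assms p2 by (auto intro: mult_le_one)
      have b: "0 \<le> z * z * ?p" "z * z * ?p \<le> 1" using False assms p by (auto intro!: mult_le_one)
      have "chi2 z * z = 6 * (z * z * ?p) - 6 * (z * ?p\<^sup>2)" by (simp add: chi2_def algebra_simps)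
      moreover have "chi1 z = ?p ^ 3 - 3 * (z * ?p\<^sup>2)" by (simp add: chi1_def algebra_simps)
      ultimately show ?thesis using a b p2 by linarith
    qed
    then show "\<bar>chi1 z\<bar> \<le> 4" "\<bar>chi2 z * z\<bar> \<le> 12" by auto
  qed
qed

lemma continuous_chi: "continuous_on UNIV chi" "continuous_on UNIV chi1" "continuous_on UNIV chi2"
  unfolding chi_def[abs_def] chi1_def[abs_def] chi2_def[abs_def] by (auto intro!: continuous_intros)

text \<open>A version of \<open>|x|\<^sup>2\<close> cut off at radius \<open>R\<close> whose gradient and Hessian obey the
  bounds of \<open>|x|\<^sup>2\<close> up to constants independent of \<open>R\<close>.\<close>

definition psi :: "real \<Rightarrow> real ^ 'n \<Rightarrow> real" where "psi R x = R\<^sup>2 * chi ((norm x)\<^sup>2 / R\<^sup>2)"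
definition psi1 :: "real \<Rightarrow> real ^ 'n \<Rightarrow> real ^ 'n" where "psi1 R x = (2 * chi1 ((norm x)\<^sup>2 / R\<^sup>2)) *\<^sub>R x"
definition psi2 :: "real \<Rightarrow> real ^ 'n \<Rightarrow> real ^ 'n ^ 'n" where
  "psi2 R x = (\<chi> i j. 2 * chi1 ((norm x)\<^sup>2 / R\<^sup>2) * of_bool (i = j) + 4 * chi2 ((norm x)\<^sup>2 / R\<^sup>2) / R\<^sup>2 * x $ i * x $ j)"

lemma psi_derivs:
  assumes "R > 0"
  shows "((psi R :: real ^ 'n \<Rightarrow> real) has_derivative (\<lambda>h. psi1 R x \<bullet> h)) (at x)"
    and "((psi1 R :: real ^ 'n \<Rightarrow> real ^ 'n) has_derivative (\<lambda>h. psi2 R x *v h)) (at x)"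
proof -
  have n: "((\<lambda>x::real^'n. (norm x)\<^sup>2 / R\<^sup>2) has_derivative (\<lambda>h. 2 * (x \<bullet> h) / R\<^sup>2)) (at x)"
    unfolding power2_norm_eq_inner using assms
    by (auto intro!: derivative_eq_intros simp: inner_commute fun_eq_iff divide_simps eval_nat_numeral)
  note c = DERIV_chi[unfolded has_field_derivative_def]
  show "(psi R has_derivative (\<lambda>h. psi1 R x \<bullet> h)) (at x)"
    unfolding psi_def[abs_def] psi1_def using assms
    by (auto intro!: derivative_eq_intros has_derivative_compose[OF n c(1)])
  have *: "((psi1 R :: real ^ 'n \<Rightarrow> real ^ 'n) has_derivative
      (\<lambda>h. (2 * chi1 ((norm x)\<^sup>2 / R\<^sup>2)) *\<^sub>R h + (2 * (chi2 ((norm x)\<^sup>2 / R\<^sup>2) * (2 * (x \<bullet> h) / R\<^sup>2))) *\<^sub>R x)) (at x)"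
    unfolding psi1_def[abs_def]
    by (auto intro!: derivative_eq_intros has_derivative_compose[OF n c(2)])
  have "(2 * chi1 ((norm x)\<^sup>2 / R\<^sup>2)) *\<^sub>R h + (2 * (chi2 ((norm x)\<^sup>2 / R\<^sup>2) * (2 * (x \<bullet> h) / R\<^sup>2))) *\<^sub>R x = psi2 R x *v h"
    for h :: "real ^ 'n"
  proof (rule vec_eq_iff[THEN iffD2], rule allI)
    fix i
    have e: "(\<Sum>j\<in>UNIV. of_bool (i = j) * h $ j) = h $ i"
      by (simp add: of_bool_def if_distrib[of "\<lambda>c. c * _"] cong: if_cong)
    have "(psi2 R x *v h) $ i = (\<Sum>j\<in>UNIV. 2 * chi1 ((norm x)\<^sup>2 / R\<^sup>2) * (of_bool (i = j) * h $ j)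
       + 4 * chi2 ((norm x)\<^sup>2 / R\<^sup>2) / R\<^sup>2 * x $ i * (x $ j * h $ j))"
      by (simp add: matrix_vector_mult_def psi2_def algebra_simps)
    also have "\<dots> = 2 * chi1 ((norm x)\<^sup>2 / R\<^sup>2) * h $ i + 4 * chi2 ((norm x)\<^sup>2 / R\<^sup>2) / R\<^sup>2 * x $ i * (x \<bullet> h)"
      unfolding sum.distrib sum_distrib_left[symmetric] e inner_vec_def by simp
    finally show "((2 * chi1 ((norm x)\<^sup>2 / R\<^sup>2)) *\<^sub>R h + (2 * (chi2 ((norm x)\<^sup>2 / R\<^sup>2) * (2 * (x \<bullet> h) / R\<^sup>2))) *\<^sub>R x) $ i
       = (psi2 R x *v h) $ i" by (simp add: algebra_simps)
  qed
  then show "((psi1 R :: real ^ 'n \<Rightarrow> real ^ 'n) has_derivative (\<lambda>h. psi2 R x *v h)) (at x)"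
    using * by simp
qed

lemma psi_bounds:
  fixes x :: "real ^ 'n"
  assumes "R > 0"
  shows "0 \<le> psi R x" "psi R x \<le> (norm x)\<^sup>2" "norm (psi1 R x) \<le> 8 * norm x" "\<bar>psi2 R x $ i $ j\<bar> \<le> 56"
    "norm x \<ge> R \<Longrightarrow> psi R x = 0 \<and> psi1 R x = 0 \<and> psi2 R x = 0"
proof -
  let ?z = "(norm x)\<^sup>2 / R\<^sup>2"
  have z: "?z \<ge> 0" by simp
  note b = chi_bounds[OF z]
  show "0 \<le> psi R x" using b(1) by (simp add: psi_def)
  have "R\<^sup>2 * chi ?z \<le> R\<^sup>2 * ?z" using b(2) by (intro mult_left_mono) auto
  then show "psi R x \<le> (norm x)\<^sup>2" using assms by (simp add: psi_def)
  have "\<bar>2 * chi1 ?z\<bar> * norm x \<le> 8 * norm x" using b(3) by (intro mult_right_mono) auto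
  then show "norm (psi1 R x) \<le> 8 * norm x" by (simp add: psi1_def)
  have xx: "\<bar>x $ i * x $ j\<bar> \<le> (norm x)\<^sup>2" unfolding power2_eq_square abs_mult
    by (intro mult_mono component_le_norm_cart) auto
  have "\<bar>4 * chi2 ?z / R\<^sup>2 * x $ i * x $ j\<bar> = 4 * \<bar>chi2 ?z\<bar> / R\<^sup>2 * \<bar>x $ i * x $ j\<bar>"
    by (simp add: abs_mult)
  also have "\<dots> \<le> 4 * \<bar>chi2 ?z\<bar> / R\<^sup>2 * (norm x)\<^sup>2" by (intro mult_left_mono xx) auto
  also have "\<dots> = 4 * \<bar>chi2 ?z * ?z\<bar>" by (simp add: abs_mult)
  also have "\<dots> \<le> 48" using b(4) by simp
  finally have 1: "\<bar>4 * chi2 ?z / R\<^sup>2 * x $ i * x $ j\<bar> \<le> 48" .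
  have 2: "\<bar>2 * chi1 ?z * of_bool (i = j)\<bar> \<le> 8" using b(3) by (simp add: abs_mult)
  show "\<bar>psi2 R x $ i $ j\<bar> \<le> 56" unfolding psi2_def
    using 1 2 abs_triangle_ineq[of "2 * chi1 ?z * of_bool (i = j)" "4 * chi2 ?z / R\<^sup>2 * x $ i * x $ j"] by simp
  show "psi R x = 0 \<and> psi1 R x = 0 \<and> psi2 R x = 0" if "norm x \<ge> R"
  proof -
    have "R\<^sup>2 \<le> (norm x)\<^sup>2" using that assms by (intro power_mono) auto
    then have "?z \<ge> 1" using assms by simp
    from b(5)[OF this] show ?thesis by (simp add: psi_def psi1_def psi2_def vec_eq_iff)
  qed
qed

lemma continuous_psi:
  assumes "R > 0"
  shows "continuous_on UNIV (psi R :: real ^ 'n \<Rightarrow> real)" "continuous_on UNIV (psi1 R :: real ^ 'n \<Rightarrow> real ^ 'n)"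
    "continuous_on UNIV (psi2 R :: real ^ 'n \<Rightarrow> real ^ 'n ^ 'n)"
proof -
  have n: "continuous_on UNIV (\<lambda>x::real^'n. (norm x)\<^sup>2 / R\<^sup>2)" using assms by (auto intro!: continuous_intros)
  note c = continuous_on_compose2[OF continuous_chi(1) n] continuous_on_compose2[OF continuous_chi(2) n]
    continuous_on_compose2[OF continuous_chi(3) n]
  show "continuous_on UNIV (psi R :: real ^ 'n \<Rightarrow> real)" "continuous_on UNIV (psi1 R :: real ^ 'n \<Rightarrow> real ^ 'n)"
    "continuous_on UNIV (psi2 R :: real ^ 'n \<Rightarrow> real ^ 'n ^ 'n)"
    unfolding psi_def[abs_def] psi1_def[abs_def] psi2_def[abs_def] using assms
    by (auto intro!: continuous_intros c continuous_on_vec_lambda)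
qed

lemma psi_tendsto: "(\<lambda>k. psi (real (Suc k)) x) \<longlonglongrightarrow> (norm (x :: real ^ 'n))\<^sup>2"
proof -
  have i: "(\<lambda>k. inverse (real (Suc k))) \<longlonglongrightarrow> 0" by (rule LIMSEQ_inverse_real_of_nat)
  have "(\<lambda>k. (norm x)\<^sup>2 * (max 0 (1 - (norm x)\<^sup>2 * (inverse (real (Suc k)))\<^sup>2)) ^ 3) \<longlonglongrightarrow> (norm x)\<^sup>2 * (max 0 (1 - (norm x)\<^sup>2 * 0\<^sup>2)) ^ 3"
    by (intro tendsto_intros i)
  moreover have "psi (real (Suc k)) x = (norm x)\<^sup>2 * (max 0 (1 - (norm x)\<^sup>2 * (inverse (real (Suc k)))\<^sup>2)) ^ 3" for k
    by (simp add: psi_def chi_def power_inverse divide_inverse del: of_nat_Suc)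
  ultimately show ?thesis by simp
qed

lemma trace_mult_le:
  fixes H S :: "real ^ 'n ^ 'n"
  assumes "\<And>i j. \<bar>H $ i $ j\<bar> \<le> c"
  shows "\<bar>trace (H ** S)\<bar> \<le> c * real CARD('n) ^ 2 * norm S"
proof -
  have c: "0 \<le> c" using assms[of undefined undefined] by linarith
  have S: "\<bar>S $ j $ i\<bar> \<le> norm S" for i j
    using component_le_norm_cart[of "S $ j" i] order_trans Finite_Cartesian_Product.norm_nth_le[where x = S and i = j] by blast
  have "\<bar>trace (H ** S)\<bar> = \<bar>\<Sum>i\<in>UNIV. \<Sum>j\<in>UNIV. H $ i $ j * S $ j $ i\<bar>"
    by (simp add: trace_def matrix_matrix_mult_def)
  also have "\<dots> \<le> (\<Sum>i\<in>(UNIV::'n set). \<Sum>j\<in>(UNIV::'n set). c * norm S)"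
    by (intro order_trans[OF sum_abs] sum_mono) (auto simp: abs_mult intro!: mult_mono assms S c)
  finally show ?thesis by (simp add: power2_eq_square mult_ac)
qed

lemma generator_bound:
  assumes "\<And>i j. \<bar>hessian f x $ i $ j\<bar> \<le> c"
  shows "\<bar>generator \<beta> (\<Sigma> :: real ^ 'n ^ 'n) f x\<bar> \<le> norm (grad f x) * norm \<beta> + c * real CARD('n) ^ 2 * norm \<Sigma>"
proof -
  have "\<bar>generator \<beta> \<Sigma> f x\<bar> \<le> \<bar>grad f x \<bullet> \<beta>\<bar> + \<bar>trace (hessian f x ** \<Sigma>)\<bar>"
    unfolding generator_def by linarith
  then show ?thesis
    using Cauchy_Schwarz_ineq2[of "grad f x" \<beta>] trace_mult_le[OF assms, of \<Sigma>] by linarith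
qed

lemma generator_scale:
  assumes "(f has_derivative (\<lambda>h. f1 x \<bullet> h)) (at x)" "\<And>y. (f has_derivative (\<lambda>h. f1 y \<bullet> h)) (at y)"
    "(f1 has_derivative (\<lambda>h. f2 *v h)) (at x)"
  shows "grad (\<lambda>x. c * f x) x = c *\<^sub>R f1 x" "hessian (\<lambda>x. c * f x) x = c *\<^sub>R f2"
proof -
  have g: "grad (\<lambda>x. c * f x) y = c *\<^sub>R f1 y" for y
    by (rule grad_eqI) (use assms(2) in \<open>auto intro!: derivative_eq_intros\<close>)
  then show "grad (\<lambda>x. c * f x) x = c *\<^sub>R f1 x" by simp
  have "grad (\<lambda>x. c * f x) = (\<lambda>y. c *\<^sub>R f1 y)" using g by auto
  then show "hessian (\<lambda>x. c * f x) x = c *\<^sub>R f2"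
    by (intro hessian_eqI) (use assms(3) in \<open>auto intro!: derivative_eq_intros simp: scaleR_matrix_vector_assoc\<close>)
qed

section \<open>Continuously differentiable ramps in time\<close>

text \<open>On the unit interval this is the Hermite cubic 3z^2 - 2z^3. The terms in z - 1 reduce it
  to the constant 1 beyond that interval, so the derivative follows from the rule for powers of
  positive parts without a case distinction.\<close>

definition smooth_step :: "real \<Rightarrow> real" where
  "smooth_step z = 3 * (max 0 z)\<^sup>2 - 2 * (max 0 z) ^ 3 + 3 * (max 0 (z - 1))\<^sup>2 + 2 * (max 0 (z - 1)) ^ 3"
definition smooth_step1 :: "real \<Rightarrow> real" where
  "smooth_step1 z = 6 * max 0 z - 6 * (max 0 z)\<^sup>2 + 6 * max 0 (z - 1) + 6 * (max 0 (z - 1))\<^sup>2"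

lemma DERIV_smooth_step: "(smooth_step has_real_derivative smooth_step1 z) (at z)"
proof -
  have d: "((\<lambda>z::real. z) has_real_derivative 1) (at z)" "((\<lambda>z::real. z - 1) has_real_derivative 1) (at z)"
    by (auto intro!: derivative_eq_intros)
  note p = DERIV_pos_part_power_chain[OF d(1)] DERIV_pos_part_power_chain[OF d(2)]
  show ?thesis unfolding smooth_step_def[abs_def] smooth_step1_def
    by (rule DERIV_cong[OF DERIV_add[OF DERIV_add[OF DERIV_diff[OF DERIV_cmult[OF p(1)] DERIV_cmult[OF p(2)]] DERIV_cmult[OF p(3)]] DERIV_cmult[OF p(4)]]])
      simp
qed

lemma smooth_step_eqs: "z \<le> 0 \<Longrightarrow> smooth_step z = 0" "z \<ge> 1 \<Longrightarrow> smooth_step z = 1" "z \<le> 0 \<Longrightarrow> smooth_step1 z = 0" "z \<ge> 1 \<Longrightarrow> smooth_step1 z = 0"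
  by (auto simp: smooth_step_def smooth_step1_def power2_eq_square power3_eq_cube algebra_simps max_def)

lemma smooth_step1_nonneg: "smooth_step1 z \<ge> 0"
proof -
  consider "z \<le> 0" | "z \<ge> 1" | "0 < z" "z < 1" by linarith
  then show ?thesis
  proof cases
    case 3
    then have "smooth_step1 z = 6 * (z * (1 - z))" by (simp add: smooth_step1_def power2_eq_square algebra_simps)
    then show ?thesis using 3 by simp
  qed (auto simp: smooth_step_eqs)
qed

lemma smooth_step_bounds: "0 \<le> smooth_step z" "smooth_step z \<le> 1"
proof -
  have mono: "smooth_step x \<le> smooth_step y" if "x \<le> y" for x y
    using DERIV_nonneg_imp_nondecreasing[OF that, of smooth_step] DERIV_smooth_step smooth_step1_nonneg by blast
  show "0 \<le> smooth_step z" using mono[of "min z 0" z] by (simp add: smooth_step_eqs)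
  show "smooth_step z \<le> 1" using mono[of z "max z 1"] by (simp add: smooth_step_eqs)
qed

lemma continuous_smooth_step1: "continuous_on UNIV smooth_step1" "continuous_on UNIV smooth_step"
  unfolding smooth_step1_def[abs_def] smooth_step_def[abs_def] by (auto intro!: continuous_intros)

definition ramp :: "real \<Rightarrow> real \<Rightarrow> real \<Rightarrow> real" where "ramp s \<epsilon> r = smooth_step ((r - s) / \<epsilon>)"
definition ramp1 :: "real \<Rightarrow> real \<Rightarrow> real \<Rightarrow> real" where "ramp1 s \<epsilon> r = smooth_step1 ((r - s) / \<epsilon>) / \<epsilon>"

lemma DERIV_ramp: "\<epsilon> > 0 \<Longrightarrow> (ramp s \<epsilon> has_real_derivative ramp1 s \<epsilon> r) (at r)"
  unfolding ramp_def[abs_def] ramp1_def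
  by (rule DERIV_cong[OF DERIV_chain2[OF DERIV_smooth_step]]) (auto intro!: derivative_eq_intros)

lemma continuous_ramp:
  assumes "\<epsilon> > 0" shows "continuous_on UNIV (ramp s \<epsilon>)" "continuous_on UNIV (ramp1 s \<epsilon>)"
  unfolding ramp_def[abs_def] ramp1_def[abs_def] using assms
  by (auto intro!: continuous_intros continuous_on_compose2[OF continuous_smooth_step1(1)] continuous_on_compose2[OF continuous_smooth_step1(2)])

lemma ramp1_nonneg: "\<epsilon> > 0 \<Longrightarrow> ramp1 s \<epsilon> r \<ge> 0"
  by (simp add: ramp1_def smooth_step1_nonneg)

lemma ramp1_eq_0: "\<epsilon> > 0 \<Longrightarrow> r \<notin> {s..s+\<epsilon>} \<Longrightarrow> ramp1 s \<epsilon> r = 0"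
  by (auto simp: ramp1_def smooth_step_eqs field_simps)

text \<open>\<open>ramp1 s \<epsilon>\<close> is a probability density carried by the interval from
  s to s + \<epsilon>, on which \<open>ramp\<close> rises from 0 to 1. The integral is thus a
  weighted mean of values of \<open>f\<close> that lie within \<open>e\<close> of
  \<open>c\<close>.\<close>

lemma ramp_approx:
  fixes f :: "real \<Rightarrow> real"
  assumes \<epsilon>: "\<epsilon> > 0" and s: "0 \<le> s" "s + \<epsilon> \<le> T" and f: "continuous_on {0..T} f"
    and e: "\<And>r. r \<in> {s..s+\<epsilon>} \<Longrightarrow> \<bar>f r - c\<bar> \<le> e"
  shows "\<bar>(LINT r:{0..T}|lborel. ramp1 s \<epsilon> r * f r) - c\<bar> \<le> e"
proof -
  let ?b = "ramp1 s \<epsilon>"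
  have T: "0 \<le> T" using \<epsilon> s by linarith
  have cb: "continuous_on {0..T} ?b" using continuous_ramp(2)[OF \<epsilon>] continuous_on_subset by blast
  have I1: "(LINT r:{0..T}|lborel. ?b r) = 1"
  proof -
    have "(\<integral>x. ?b x * indicator {0..T} x \<partial>lborel) = ramp s \<epsilon> T - ramp s \<epsilon> 0"
      using continuous_ramp(2)[OF \<epsilon>] continuous_on_eq_continuous_at[of UNIV ?b]
      by (intro integral_FTC_Icc_real T DERIV_ramp \<epsilon>) auto
    moreover have "ramp s \<epsilon> T = 1" "ramp s \<epsilon> 0 = 0"
      using \<epsilon> s by (auto simp: ramp_def field_simps intro!: smooth_step_eqs)
    ultimately show ?thesis by (simp add: set_lebesgue_integral_def mult.commute)
  qed
  have i: "set_integrable lborel {0..T} ?b" "set_integrable lborel {0..T} (\<lambda>r. ?b r * f r)"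
    using cb f by (auto intro!: borel_integrable_atLeastAtMost' continuous_intros)
  have eq: "(LINT r:{0..T}|lborel. ?b r * f r) - c = (LINT r:{0..T}|lborel. ?b r * f r - ?b r * c)"
    using i I1 by (subst set_integral_diff) auto
  have i2: "set_integrable lborel {0..T} (\<lambda>r. ?b r * f r - ?b r * c)" using i by auto
  have "\<bar>LINT r:{0..T}|lborel. ?b r * f r - ?b r * c\<bar> \<le> (LINT r:{0..T}|lborel. \<bar>?b r * f r - ?b r * c\<bar>)"
    unfolding set_lebesgue_integral_def
    using integral_abs_bound[of lborel "\<lambda>r. indicat_real {0..T} r *\<^sub>R (?b r * f r - ?b r * c)"] by (simp add: abs_mult)
  also have "\<dots> \<le> (LINT r:{0..T}|lborel. ?b r * e)"
  proof (rule set_integral_mono)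
    show "set_integrable lborel {0..T} (\<lambda>r. \<bar>?b r * f r - ?b r * c\<bar>)" by (rule set_integrable_abs[OF i2])
    show "set_integrable lborel {0..T} (\<lambda>r. ?b r * e)" using i by auto
    show "\<bar>?b r * f r - ?b r * c\<bar> \<le> ?b r * e" for r
      using e[of r] ramp1_nonneg[OF \<epsilon>, of s r] ramp1_eq_0[OF \<epsilon>, of r s]
      by (cases "r \<in> {s..s+\<epsilon>}") (auto simp: abs_mult simp flip: right_diff_distrib intro!: mult_left_mono)
  qed
  also have "\<dots> = e" using I1 by simp
  finally show ?thesis unfolding eq .
qed

section \<open>Continuity of solutions\<close>

lemma M2_square: "(M2 m)\<^sup>2 = (\<integral>x. (norm x)\<^sup>2 \<partial>m)"
  by (simp add: M2_def)

lemma M2_nonneg: "0 \<le> M2 m"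
  by (simp add: M2_def)

text \<open>The factor 8 stands for the gradient bound of \<open>psi\<close>, and \<open>N\<close>
  for the bound of its Hessian entries times the square of the dimension. The drift contributes a (1
  + a + M), which is at most twice 1 + a^2 + M^2 by the inequality of arithmetic and geometric
  means; this turns 8 into 16.\<close>

lemma growth_bound:
  fixes a M Cb CA N :: real
  assumes "a \<ge> 0" "M \<ge> 0" "Cb \<ge> 0" "CA \<ge> 0" "N \<ge> 0" "nb \<le> Cb * (1 + a + M)" "ns \<le> CA * (1 + a\<^sup>2 + M\<^sup>2)"
  shows "8 * a * nb + N * ns \<le> (16 * Cb + N * CA) * (1 + a\<^sup>2 + M\<^sup>2)"
proof -
  have "2 * a \<le> 1 + a\<^sup>2" "2 * (a * M) \<le> a\<^sup>2 + M\<^sup>2"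
    using sum_squares_bound[of 1 a] sum_squares_bound[of a M] by (simp_all add: mult.assoc)
  moreover have gen: "a + p + r \<le> 2 * (1 + p + q)" if "2 * a \<le> 1 + p" "2 * r \<le> p + q" "0 \<le> p" "0 \<le> q" for p q r :: real
    using that by argo
  ultimately have "a + a\<^sup>2 + a * M \<le> 2 * (1 + a\<^sup>2 + M\<^sup>2)" by (intro gen) auto
  then have "a * (1 + a + M) \<le> 2 * (1 + a\<^sup>2 + M\<^sup>2)" by (simp add: algebra_simps power2_eq_square)
  then have "Cb * (a * (1 + a + M)) \<le> Cb * (2 * (1 + a\<^sup>2 + M\<^sup>2))" using assms by (intro mult_left_mono)
  moreover have "a * nb \<le> a * (Cb * (1 + a + M))" using assms by (intro mult_left_mono)
  moreover have "N * ns \<le> N * (CA * (1 + a\<^sup>2 + M\<^sup>2))" using assms by (intro mult_left_mono)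
  ultimately show ?thesis by (simp add: algebra_simps)
qed

lemma psi_eta_C12c:
  fixes \<eta> \<eta>1 :: "real \<Rightarrow> real"
  assumes R: "R > 0" and \<eta>: "\<And>r. (\<eta> has_real_derivative \<eta>1 r) (at r)" "continuous_on UNIV \<eta>1"
    and st: "0 < s" "t < T" and 0: "\<And>r. r \<notin> {s..t} \<Longrightarrow> \<eta> r = 0"
  defines "\<phi> \<equiv> \<lambda>r x. \<eta> r * psi R (x :: real ^ 'n)"
  shows "\<phi> \<in> C12c T" "deriv (\<lambda>r. \<phi> r x) r = \<eta>1 r * psi R x"
    "grad (\<phi> r) x = \<eta> r *\<^sub>R psi1 R x" "hessian (\<phi> r) x = \<eta> r *\<^sub>R psi2 R x"
proof -
  note p = psi_derivs[OF R]
  have g: "grad (\<phi> r) x = \<eta> r *\<^sub>R psi1 R x" for r x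
    unfolding \<phi>_def by (rule generator_scale(1)[OF p(1) p(1) p(2)])
  have h: "hessian (\<phi> r) x = \<eta> r *\<^sub>R psi2 R x" for r x
    unfolding \<phi>_def by (rule generator_scale(2)[OF p(1) p(1) p(2)])
  have d: "((\<lambda>r. \<phi> r x) has_real_derivative \<eta>1 r * psi R x) (at r)" for r x
    unfolding \<phi>_def by (rule DERIV_cmult_right[OF \<eta>(1)])
  have dd: "deriv (\<lambda>r. \<phi> r x) r = \<eta>1 r * psi R x" for r x by (rule DERIV_imp_deriv[OF d])
  have \<eta>c: "continuous_on UNIV \<eta>" using \<eta>(1) by (meson DERIV_isCont continuous_at_imp_continuous_on)
  have cf: "continuous_on UNIV (\<lambda>z::real \<times> (real ^ 'n). \<eta> (fst z))" "continuous_on UNIV (\<lambda>z::real \<times> (real ^ 'n). \<eta>1 (fst z))"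
    by (auto intro!: continuous_on_compose2[OF \<eta>c] continuous_on_compose2[OF \<eta>(2)] continuous_intros)
  have cs: "continuous_on UNIV (\<lambda>z::real \<times> (real ^ 'n). psi R (snd z))" "continuous_on UNIV (\<lambda>z::real \<times> (real ^ 'n). psi1 R (snd z))"
    "continuous_on UNIV (\<lambda>z::real \<times> (real ^ 'n). psi2 R (snd z))"
    by (auto intro!: continuous_on_compose2[OF continuous_psi(1)[OF R]] continuous_on_compose2[OF continuous_psi(2)[OF R]]
        continuous_on_compose2[OF continuous_psi(3)[OF R]] continuous_intros)
  show "\<phi> \<in> C12c T"
    unfolding C12c_def mem_Collect_eq
  proof (intro conjI allI)
    show "\<exists>K. compact K \<and> K \<subseteq> {0<..<T} \<times> UNIV \<and> (\<forall>r x. (r, x) \<notin> K \<longrightarrow> \<phi> r x = 0)"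
    proof (intro exI conjI allI impI)
      show "compact ({s..t} \<times> cball (0 :: real ^ 'n) R)" by (intro compact_Times) auto
      show "{s..t} \<times> cball (0 :: real ^ 'n) R \<subseteq> {0<..<T} \<times> UNIV" using st by auto
      show "\<phi> r x = 0" if "(r, x) \<notin> {s..t} \<times> cball 0 R" for r x
        using that 0[of r] psi_bounds(5)[OF R, of x] by (auto simp: \<phi>_def)
    qed
    show "(\<lambda>r. \<phi> r x) differentiable (at r)" for r x
      using d by (auto simp: differentiable_def has_field_derivative_def)
    show "\<phi> r differentiable (at x)" for r x
      unfolding \<phi>_def by (rule differentiableI) (rule derivative_intros p)+
    have "grad (\<phi> r) = (\<lambda>x. \<eta> r *\<^sub>R psi1 R x)" for r using g by auto
    then show "grad (\<phi> r) differentiable (at x)" for r x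
      by simp (rule differentiableI, (rule derivative_intros p)+)
    show "continuous_on UNIV (\<lambda>(t, x). \<phi> t x)"
      unfolding \<phi>_def split_beta by (intro continuous_intros cf cs)
    show "continuous_on UNIV (\<lambda>(t, x). deriv (\<lambda>s. \<phi> s x) t)"
      unfolding dd split_beta by (intro continuous_intros cf cs)
    show "continuous_on UNIV (\<lambda>(t, x). grad (\<phi> t) x)"
      unfolding g split_beta by (intro continuous_intros cf cs)
    show "continuous_on UNIV (\<lambda>(t, x). hessian (\<phi> t) x)"
      unfolding h split_beta by (intro continuous_intros cf cs)
  qed
  show "deriv (\<lambda>r. \<phi> r x) r = \<eta>1 r * psi R x" "grad (\<phi> r) x = \<eta> r *\<^sub>R psi1 R x" "hessian (\<phi> r) x = \<eta> r *\<^sub>R psi2 R x"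
    by (rule dd g h)+
qed

definition growth_const :: "real \<Rightarrow> real \<Rightarrow> 'n::finite itself \<Rightarrow> real" where
  "growth_const Cb CA _ = 16 * Cb + 56 * real CARD('n) ^ 2 * CA"

lemma growth_const_nonneg: "Cb \<ge> 0 \<Longrightarrow> CA \<ge> 0 \<Longrightarrow> 0 \<le> growth_const Cb CA TYPE('n::finite)"
  by (simp add: growth_const_def)

text \<open>The test function is \<open>psi R\<close> times a plateau in time that rises after
  \<open>s\<close> and falls before \<open>t\<close>. Its time derivative yields the two integrals
  of \<open>psi R\<close> up to a small error by continuity, and the growth condition on the
  interval alone bounds the generator part, with a constant free of \<open>R\<close>. The times 0
  and T are excluded because test functions vanish near them.\<close>

lemma weak_increment_interior:
  fixes m :: "real \<Rightarrow> (real ^ 'n) measure" and F T Cb CA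
  defines "K \<equiv> growth_const Cb CA TYPE('n)"
  assumes sol: "FPK_solution T F m" and C: "Cb \<ge> 0" "CA \<ge> 0"
    and growth: "\<And>t x m \<beta> \<Sigma>. t \<in> {0..T} \<Longrightarrow> m \<in> P2 \<Longrightarrow> (\<beta>, \<Sigma>) \<in> F t x m \<Longrightarrow>
           norm \<beta> \<le> Cb * (1 + norm x + M2 m) \<and> norm \<Sigma> \<le> CA * (1 + (norm x)\<^sup>2 + (M2 m)\<^sup>2)"
    and st: "0 < s" "s < t" "t < T" and R: "R > 0"
    and B: "\<And>r. r \<in> {s..t} \<Longrightarrow> 1 + (M2 (m r))\<^sup>2 \<le> B"
  shows "\<bar>(\<integral>x. psi R x \<partial>m t) - (\<integral>x. psi R x \<partial>m s)\<bar> \<le> 2 * K * B * (t - s)"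
proof -
  define f where "f r = (\<integral>x. psi R x \<partial>m r)" for r
  have K: "0 \<le> K" unfolding K_def by (rule growth_const_nonneg[OF C])
  have limit_flow: "flow_of_probabilities T m" using sol by (simp add: FPK_solution_def)
  have mP: "m r \<in> P2" if "r \<in> {0..T}" for r using limit_flow that by (simp add: flow_of_probabilities_def)
  have psi_b: "\<bar>psi R x\<bar> \<le> R\<^sup>2" for x :: "real ^ 'n"
  proof (cases "norm x \<ge> R")
    case False
    then have "(norm x)\<^sup>2 \<le> R\<^sup>2" by (intro power_mono) auto
    then show ?thesis using psi_bounds(1,2)[OF R, of x] by simp
  qed (use psi_bounds(5)[OF R, of x] in simp)
  have fc: "continuous_on {0..T} f"
    using limit_flow continuous_psi(1)[OF R] psi_b unfolding f_def flow_of_probabilities_def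
    by (auto simp: bounded_iff)
  obtain b :: "real \<times> (real ^ 'n) \<Rightarrow> real ^ 'n" and A :: "real \<times> (real ^ 'n) \<Rightarrow> real ^ 'n ^ 'n" where
    F: "AE t in lborel. t \<in> {0..T} \<longrightarrow> (AE x in m t. (b (t, x), A (t, x)) \<in> F t x (m t))"
    and W: "\<And>\<phi>. \<phi> \<in> C12c T \<Longrightarrow>
           (AE r in lborel. r \<in> {0..T} \<longrightarrow> integrable (m r) (\<lambda>x. deriv (\<lambda>s. \<phi> s x) r + generator (b (r, x)) (A (r, x)) (\<phi> r) x)) \<and>
              set_integrable lborel {0..T} (\<lambda>r. \<integral>x. deriv (\<lambda>s. \<phi> s x) r + generator (b (r, x)) (A (r, x)) (\<phi> r) x \<partial>m r) \<and>
              (LINT r:{0..T}|lborel. (\<integral>x. deriv (\<lambda>s. \<phi> s x) r + generator (b (r, x)) (A (r, x)) (\<phi> r) x \<partial>m r)) = 0"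
    using sol unfolding FPK_solution_def Let_def by blast
  have main: "\<bar>f t - f s\<bar> \<le> 2 * K * B * (t - s) + 2 * e" if e: "e > 0" for e
  proof -
    obtain \<delta>1 where \<delta>1: "\<delta>1 > 0" "\<And>r. r \<in> {0..T} \<Longrightarrow> dist r s < \<delta>1 \<Longrightarrow> dist (f r) (f s) < e"
      using fc[unfolded continuous_on_iff, rule_format, of s e] st e by auto
    obtain \<delta>2 where \<delta>2: "\<delta>2 > 0" "\<And>r. r \<in> {0..T} \<Longrightarrow> dist r t < \<delta>2 \<Longrightarrow> dist (f r) (f t) < e"
      using fc[unfolded continuous_on_iff, rule_format, of t e] st e by auto
    \<comment> \<open>At most half of the interval, so that the rising ramp is finished before the
      falling one begins and \<open>\<eta>\<close> stays between 0 and 1.\<close>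
    define \<epsilon> where "\<epsilon> = min (min \<delta>1 \<delta>2 / 2) ((t - s) / 2)"
    have \<epsilon>: "\<epsilon> > 0" "\<epsilon> < \<delta>1" "\<epsilon> < \<delta>2" "\<epsilon> \<le> (t - s) / 2"
      using \<delta>1(1) \<delta>2(1) st by (auto simp: \<epsilon>_def min_def)
    define \<eta> where "\<eta> r = ramp s \<epsilon> r - ramp (t - \<epsilon>) \<epsilon> r" for r
    define \<eta>1 where "\<eta>1 r = ramp1 s \<epsilon> r - ramp1 (t - \<epsilon>) \<epsilon> r" for r
    have d\<eta>: "(\<eta> has_real_derivative \<eta>1 r) (at r)" for r
      unfolding \<eta>_def[abs_def] \<eta>1_def by (intro DERIV_diff DERIV_ramp \<epsilon>)
    have c\<eta>1: "continuous_on UNIV \<eta>1" unfolding \<eta>1_def[abs_def] by (intro continuous_intros continuous_ramp \<epsilon>)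
    have \<eta>0: "\<eta> r = 0" if "r \<notin> {s..t}" for r
    proof (cases "r < s")
      case True
      then have "(r - s) / \<epsilon> \<le> 0" "(r - (t - \<epsilon>)) / \<epsilon> \<le> 0" using \<epsilon> st by (auto simp: field_simps)
      then show ?thesis by (simp add: \<eta>_def ramp_def smooth_step_eqs)
    next
      case False
      then have "r > t" using that by auto
      then have "1 \<le> (r - s) / \<epsilon>" "1 \<le> (r - (t - \<epsilon>)) / \<epsilon>" using \<epsilon> st by (auto simp: field_simps)
      then show ?thesis by (simp add: \<eta>_def ramp_def smooth_step_eqs)
    qed
    have \<eta>b: "0 \<le> \<eta> r" "\<eta> r \<le> 1" for r
    proof -
      have "0 \<le> \<eta> r \<and> \<eta> r \<le> 1"
      proof (cases "r \<le> t - \<epsilon>")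
        case True
        then have "(r - (t - \<epsilon>)) / \<epsilon> \<le> 0" using \<epsilon> by (auto simp: field_simps)
        then show ?thesis using smooth_step_bounds by (simp add: \<eta>_def ramp_def smooth_step_eqs)
      next
        case False
        then have "1 \<le> (r - s) / \<epsilon>" using \<epsilon> by (auto simp: field_simps)
        then show ?thesis using smooth_step_bounds by (simp add: \<eta>_def ramp_def smooth_step_eqs)
      qed
      then show "0 \<le> \<eta> r" "\<eta> r \<le> 1" by auto
    qed
    define \<phi> where "\<phi> = (\<lambda>r x. \<eta> r * psi R (x :: real ^ 'n))"
    note psi_eta = psi_eta_C12c[OF R d\<eta> c\<eta>1 st(1,3) \<eta>0]
    have \<phi>: "\<phi> \<in> C12c T" "deriv (\<lambda>r. \<phi> r x) r = \<eta>1 r * psi R x"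
      "grad (\<phi> r) x = \<eta> r *\<^sub>R psi1 R x" "hessian (\<phi> r) x = \<eta> r *\<^sub>R psi2 R x" for r x
      unfolding \<phi>_def using psi_eta by blast+
    define G where "G = (\<lambda>r x. \<eta>1 r * psi R x + generator (b (r, x)) (A (r, x)) (\<phi> r) x)"
    have W1: "AE r in lborel. r \<in> {0..T} \<longrightarrow> integrable (m r) (G r)"
      and W2: "set_integrable lborel {0..T} (\<lambda>r. \<integral>x. G r x \<partial>m r)"
      and W3: "(LINT r:{0..T}|lborel. (\<integral>x. G r x \<partial>m r)) = 0"
      using W[OF \<phi>(1)] unfolding \<phi>(2) G_def by auto
    have gen: "\<bar>generator \<beta> \<Sigma> (\<phi> r) x\<bar> \<le> \<eta> r * (K * (1 + (norm x)\<^sup>2 + (M2 (m r))\<^sup>2))"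
      if r: "r \<in> {0..T}" and "(\<beta>, \<Sigma>) \<in> F r x (m r)" for r x \<beta> \<Sigma>
    proof -
      have "\<bar>generator \<beta> \<Sigma> (\<phi> r) x\<bar> \<le> norm (grad (\<phi> r) x) * norm \<beta> + (\<eta> r * 56) * real CARD('n) ^ 2 * norm \<Sigma>"
      proof (rule generator_bound)
        show "\<bar>hessian (\<phi> r) x $ i $ j\<bar> \<le> \<eta> r * 56" for i j
          using psi_bounds(4)[OF R, of x i j] \<eta>b[of r] by (simp add: \<phi>(4) abs_mult mult_left_mono)
      qed
      also have "\<dots> \<le> (\<eta> r * (8 * norm x)) * norm \<beta> + (\<eta> r * 56) * real CARD('n) ^ 2 * norm \<Sigma>"
        using psi_bounds(3)[OF R, of x] \<eta>b[of r]
        by (intro add_right_mono mult_right_mono) (auto simp: \<phi>(3) intro!: mult_left_mono)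
      also have "\<dots> = \<eta> r * (8 * norm x * norm \<beta> + 56 * real CARD('n) ^ 2 * norm \<Sigma>)" by (simp add: algebra_simps)
      also have "\<dots> \<le> \<eta> r * (K * (1 + (norm x)\<^sup>2 + (M2 (m r))\<^sup>2))"
        unfolding K_def growth_const_def
        using growth[OF r mP[OF r] that(2)] C M2_nonneg[of "m r"] \<eta>b[of r]
        by (intro mult_left_mono growth_bound) auto
      finally show ?thesis .
    qed
    have est: "AE r in lborel. \<bar>indicat_real {0..T} r *\<^sub>R (\<eta>1 r * f r - (\<integral>x. G r x \<partial>m r))\<bar> \<le> 2 * K * B * indicat_real {s..t} r"
      using F W1
    proof eventually_elim
      case (elim r)
      show ?case
      proof (cases "r \<in> {0..T}")
        case True
        then interpret prob_space "m r" using mP[OF True] by (simp add: P2_def)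
        have sm: "sets (m r) = sets borel" and im: "integrable (m r) (\<lambda>x. (norm x)\<^sup>2)"
          using mP[OF True] by (auto simp: P2_def)
        note [measurable_cong] = sm
        have ip: "integrable (m r) (\<lambda>x. \<eta>1 r * psi R x)"
        proof (rule integrable_const_bound[where B = "\<bar>\<eta>1 r\<bar> * R\<^sup>2"])
          have [measurable]: "psi R \<in> borel_measurable (borel :: (real ^ 'n) measure)"
            by (rule borel_measurable_continuous_onI[OF continuous_psi(1)[OF R]])
          show "(\<lambda>x. \<eta>1 r * psi R x) \<in> borel_measurable (m r)" by measurable
        qed (use psi_b in \<open>auto simp: abs_mult intro!: mult_left_mono\<close>)
        have iG: "integrable (m r) (G r)" using elim True by simp
        then have ig: "integrable (m r) (\<lambda>x. generator (b (r, x)) (A (r, x)) (\<phi> r) x)"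
          using Bochner_Integration.integrable_diff[OF iG ip] by (simp add: G_def)
        have "(\<integral>x. G r x \<partial>m r) = \<eta>1 r * f r + (\<integral>x. generator (b (r, x)) (A (r, x)) (\<phi> r) x \<partial>m r)"
          unfolding G_def f_def using ip ig by simp
        then have "\<bar>\<eta>1 r * f r - (\<integral>x. G r x \<partial>m r)\<bar> = \<bar>\<integral>x. generator (b (r, x)) (A (r, x)) (\<phi> r) x \<partial>m r\<bar>" by simp
        also have "\<dots> \<le> (\<integral>x. \<bar>generator (b (r, x)) (A (r, x)) (\<phi> r) x\<bar> \<partial>m r)" by (rule integral_abs_bound)
        also have "\<dots> \<le> (\<integral>x. \<eta> r * (K * (1 + (norm x)\<^sup>2 + (M2 (m r))\<^sup>2)) \<partial>m r)"
        proof (rule integral_mono_AE)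
          show "AE x in m r. \<bar>generator (b (r, x)) (A (r, x)) (\<phi> r) x\<bar> \<le> \<eta> r * (K * (1 + (norm x)\<^sup>2 + (M2 (m r))\<^sup>2))"
            using elim(1) True gen[OF True] by (auto elim: eventually_mono)
        qed (use ig im in auto)
        \<comment> \<open>Integration turns |x|^2 into a second copy of the squared moment; this is
          the origin of the factor 2 in the claim.\<close>
        also have "\<dots> = \<eta> r * (K * (1 + 2 * (M2 (m r))\<^sup>2))"
          using im by (simp add: M2_square prob_space)
        also have "\<dots> \<le> 2 * K * B * indicat_real {s..t} r"
        proof (cases "r \<in> {s..t}")
          case True
          have "\<eta> r * (K * (1 + 2 * (M2 (m r))\<^sup>2)) \<le> 1 * (K * (2 * B))"
            using \<eta>b[of r] K B[OF True] by (intro mult_mono) auto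
          then show ?thesis using True by simp
        qed (use \<eta>0 in simp)
        finally show ?thesis using True by simp
      next
        case False
        have "B \<ge> 0" using B[of s] st zero_le_power2[of "M2 (m s)"] by (metis add_nonneg_nonneg atLeastAtMost_iff less_imp_le order_refl order_trans zero_le_one)
        then show ?thesis using False K by simp
      qed
    qed
    have i1: "set_integrable lborel {0..T} (\<lambda>r. ramp1 s \<epsilon> r * f r)" "set_integrable lborel {0..T} (\<lambda>r. ramp1 (t - \<epsilon>) \<epsilon> r * f r)"
      using fc continuous_on_subset[OF continuous_ramp(2)[OF \<epsilon>(1)]]
      by (auto intro!: borel_integrable_atLeastAtMost' continuous_intros)
    have i2: "set_integrable lborel {0..T} (\<lambda>r. \<eta>1 r * f r)"
      using set_integral_diff(1)[OF i1] by (simp add: \<eta>1_def left_diff_distrib)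
    have e2: "(LINT r:{0..T}|lborel. \<eta>1 r * f r) = (LINT r:{0..T}|lborel. ramp1 s \<epsilon> r * f r) - (LINT r:{0..T}|lborel. ramp1 (t - \<epsilon>) \<epsilon> r * f r)"
      using set_integral_diff(2)[OF i1] by (simp add: \<eta>1_def left_diff_distrib)
    have "(LINT r:{0..T}|lborel. \<eta>1 r * f r) = (LINT r:{0..T}|lborel. \<eta>1 r * f r - (\<integral>x. G r x \<partial>m r))"
      using set_integral_diff(2)[OF i2 W2] W3 by simp
    also have "\<bar>\<dots>\<bar> \<le> (\<integral>r. \<bar>indicat_real {0..T} r *\<^sub>R (\<eta>1 r * f r - (\<integral>x. G r x \<partial>m r))\<bar> \<partial>lborel)"
      unfolding set_lebesgue_integral_def by (rule integral_abs_bound)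
    also have "\<dots> \<le> (\<integral>r. 2 * K * B * indicat_real {s..t} r \<partial>lborel)"
    proof (rule integral_mono_AE[OF _ _ est])
      show "integrable lborel (\<lambda>r. \<bar>indicat_real {0..T} r *\<^sub>R (\<eta>1 r * f r - (\<integral>x. G r x \<partial>m r))\<bar>)"
        using set_integral_diff(1)[OF i2 W2] unfolding set_integrable_def by (rule integrable_abs)
    qed (use st in \<open>auto intro!: integrable_mult_right integrable_real_indicator\<close>)
    also have "\<dots> = 2 * K * B * (t - s)" using st by simp
    finally have I: "\<bar>LINT r:{0..T}|lborel. \<eta>1 r * f r\<bar> \<le> 2 * K * B * (t - s)" .
    have "\<bar>(LINT r:{0..T}|lborel. ramp1 s \<epsilon> r * f r) - f s\<bar> \<le> e"
    proof (rule ramp_approx[OF \<epsilon>(1) _ _ fc])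
      show "\<bar>f r - f s\<bar> \<le> e" if "r \<in> {s..s+\<epsilon>}" for r
        using \<delta>1(2)[of r] that \<epsilon> st by (auto simp: dist_real_def)
    qed (use \<epsilon> st in auto)
    moreover have "\<bar>(LINT r:{0..T}|lborel. ramp1 (t - \<epsilon>) \<epsilon> r * f r) - f t\<bar> \<le> e"
    proof (rule ramp_approx[OF \<epsilon>(1) _ _ fc])
      show "\<bar>f r - f t\<bar> \<le> e" if "r \<in> {t-\<epsilon>..t-\<epsilon>+\<epsilon>}" for r
        using \<delta>2(2)[of r] that \<epsilon> st by (auto simp: dist_real_def)
    qed (use \<epsilon> st in auto)
    ultimately show ?thesis using I e2 by linarith
  qed
  have "\<bar>f t - f s\<bar> \<le> 2 * K * B * (t - s)"
  proof (rule field_le_epsilon)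
    fix e :: real assume "e > 0"
    then show "\<bar>f t - f s\<bar> \<le> 2 * K * B * (t - s) + e" using main[of "e/2"] by simp
  qed
  then show ?thesis by (simp add: f_def)
qed

text \<open>Two limits are taken. The interior estimate is applied on intervals shrunk by
  \<open>d k\<close> at both ends, where narrow continuity brings in the endpoints; then the cut-off
  radius tends to infinity by dominated convergence, the bound being independent of it.\<close>

lemma second_moment_increment:
  fixes m :: "real \<Rightarrow> (real ^ 'n) measure" and F T Cb CA
  defines "K \<equiv> growth_const Cb CA TYPE('n)"
  assumes sol: "FPK_solution T F m" and C: "Cb \<ge> 0" "CA \<ge> 0"
    and growth: "\<And>t x m \<beta> \<Sigma>. t \<in> {0..T} \<Longrightarrow> m \<in> P2 \<Longrightarrow> (\<beta>, \<Sigma>) \<in> F t x m \<Longrightarrow>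
           norm \<beta> \<le> Cb * (1 + norm x + M2 m) \<and> norm \<Sigma> \<le> CA * (1 + (norm x)\<^sup>2 + (M2 m)\<^sup>2)"
    and st: "0 \<le> s" "s < t" "t \<le> T"
    and B: "\<And>r. r \<in> {s..t} \<Longrightarrow> 1 + (M2 (m r))\<^sup>2 \<le> B"
  shows "\<bar>(M2 (m t))\<^sup>2 - (M2 (m s))\<^sup>2\<bar> \<le> 2 * K * B * (t - s)"
proof -
  have K: "0 \<le> K" unfolding K_def by (rule growth_const_nonneg[OF C])
  have "1 + (M2 (m s))\<^sup>2 \<le> B" using B[of s] st by simp
  then have "B \<ge> 1" using zero_le_power2[of "M2 (m s)"] by linarith
  have limit_flow: "flow_of_probabilities T m" using sol by (simp add: FPK_solution_def)
  have mP: "m r \<in> P2" if "r \<in> {0..T}" for r using limit_flow that by (simp add: flow_of_probabilities_def)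
  have psi_b: "\<bar>\<integral>x. psi R x \<partial>m t - \<integral>x. psi R x \<partial>m s\<bar> \<le> 2 * K * B * (t - s)" if R: "R > 0" for R
  proof -
    have psi_b: "\<bar>psi R x\<bar> \<le> R\<^sup>2" for x :: "real ^ 'n"
    proof (cases "norm x \<ge> R")
      case False
      then have "(norm x)\<^sup>2 \<le> R\<^sup>2" by (intro power_mono) auto
      then show ?thesis using psi_bounds(1,2)[OF R, of x] by simp
    qed (use psi_bounds(5)[OF R, of x] in simp)
    have fc: "continuous_on {0..T} (\<lambda>r. \<integral>x. psi R x \<partial>m r)"
      using limit_flow continuous_psi(1)[OF R] psi_b unfolding flow_of_probabilities_def
      by (auto simp: bounded_iff)
    \<comment> \<open>Removing (t - s) / (k + 3) at each end leaves at least a third of the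
      interval, so the endpoints stay in order.\<close>
    define d where "d k = (t - s) * inverse (real (Suc (Suc (Suc k))))" for k
    have "(\<lambda>k. (t - s) * inverse (real (Suc (Suc (Suc k))))) \<longlonglongrightarrow> (t - s) * 0"
      using LIMSEQ_ignore_initial_segment[OF LIMSEQ_inverse_real_of_nat, of 2] by (intro tendsto_intros) simp
    then have d0: "d \<longlonglongrightarrow> 0" unfolding d_def[abs_def] by simp
    have d: "0 < d k" "3 * d k \<le> t - s" for k
    proof -
      show "0 < d k" using st by (simp add: d_def)
      have "inverse (real (Suc (Suc (Suc k)))) \<le> 1 / 3" by (simp add: field_simps)
      from mult_left_mono[OF this, of "t - s"] show "3 * d k \<le> t - s" using st by (simp add: d_def)
    qed
    have in_T: "s + d k \<in> {0..T}" "t - d k \<in> {0..T}" for k using d[of k] st by auto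
    have "(\<lambda>k. s + d k) \<longlonglongrightarrow> s" "(\<lambda>k. t - d k) \<longlonglongrightarrow> t" using tendsto_add[OF tendsto_const d0, of s] tendsto_diff[OF tendsto_const d0, of t] by auto
    then have "(\<lambda>k. \<integral>x. psi R x \<partial>m (s + d k)) \<longlonglongrightarrow> (\<integral>x. psi R x \<partial>m s)"
      "(\<lambda>k. \<integral>x. psi R x \<partial>m (t - d k)) \<longlonglongrightarrow> (\<integral>x. psi R x \<partial>m t)"
      using fc st in_T unfolding continuous_on_sequentially by (auto simp: o_def)
    from tendsto_rabs[OF tendsto_diff[OF this(2,1)]]
    show ?thesis
    proof (rule LIMSEQ_le_const2, intro exI allI impI)
      fix k
      have "\<bar>(\<integral>x. psi R x \<partial>m (t - d k)) - (\<integral>x. psi R x \<partial>m (s + d k))\<bar> \<le> 2 * K * B * ((t - d k) - (s + d k))"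
        unfolding K_def
        by (rule weak_increment_interior[OF sol C growth _ _ _ R B]) (use d[of k] st in \<open>auto\<close>)
      also have "\<dots> \<le> 2 * K * B * (t - s)"
        using d[of k] K \<open>B \<ge> 1\<close> by (intro mult_left_mono) auto
      finally show "\<bar>(\<integral>x. psi R x \<partial>m (t - d k)) - (\<integral>x. psi R x \<partial>m (s + d k))\<bar> \<le> 2 * K * B * (t - s)" .
    qed
  qed
  have lim: "(\<lambda>k. \<integral>x. psi (real (Suc k)) x \<partial>m r) \<longlonglongrightarrow> (M2 (m r))\<^sup>2" if r: "r \<in> {0..T}" for r
    unfolding M2_square
  proof (rule integral_dominated_convergence[where w = "\<lambda>x. (norm x)\<^sup>2"])
    have s: "sets (m r) = sets borel" using mP[OF r] by (auto simp: P2_def)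
    note [measurable_cong] = s
    show "(\<lambda>x. (norm x)\<^sup>2) \<in> borel_measurable (m r)" by measurable
    have [measurable]: "psi (real (Suc k)) \<in> borel_measurable (borel :: (real ^ 'n) measure)" for k
      by (rule borel_measurable_continuous_onI[OF continuous_psi(1)]) simp
    show "(\<lambda>x. psi (real (Suc k)) x) \<in> borel_measurable (m r)" for k by measurable
    show "integrable (m r) (\<lambda>x. (norm x)\<^sup>2)" using mP[OF r] by (simp add: P2_def)
    show "AE x in m r. norm (psi (real (Suc k)) x) \<le> (norm x)\<^sup>2" for k
    proof (rule AE_I2)
      fix x :: "real ^ 'n"
      have "0 < real (Suc k)" by simp
      from psi_bounds(1,2)[OF this, of x] show "norm (psi (real (Suc k)) x) \<le> (norm x)\<^sup>2"
        unfolding real_norm_def by linarith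
    qed
  qed (simp add: psi_tendsto del: of_nat_Suc)
  show ?thesis
    by (rule LIMSEQ_le_const2[OF tendsto_rabs[OF tendsto_diff[OF lim lim]]])
      (use st psi_b in \<open>auto simp del: of_nat_Suc\<close>)
qed

text \<open>Truncations of |x|^2 are bounded and continuous, so their integrals pass to the limit
  under narrow continuity; \<open>integrable_norm_square_if_bounded\<close> then removes the
  truncation.\<close>

lemma second_moment_lsc:
  fixes m :: "real \<Rightarrow> (real ^ 'n) measure"
  assumes limit_flow: "flow_of_probabilities T m" and r: "\<And>k. r k \<in> {0..T}" "l \<in> {0..T}" "r \<longlonglongrightarrow> l"
    and c: "\<And>k::nat. (M2 (m (r k)))\<^sup>2 \<le> c"
  shows "(M2 (m l))\<^sup>2 \<le> c"
  unfolding M2_square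
proof (rule integrable_norm_square_if_bounded(2))
  have mP: "m r \<in> P2" if "r \<in> {0..T}" for r using limit_flow that by (simp add: flow_of_probabilities_def)
  show "sets (m l) = sets borel" "prob_space (m l)" using mP[OF r(2)] by (auto simp: P2_def)
  fix n :: nat
  have b: "bounded (range (\<lambda>x::real^'n. min ((norm x)\<^sup>2) (real n)))" by (auto simp: bounded_iff intro!: exI[of _ "real n"])
  have "continuous_on UNIV (\<lambda>x::real^'n. min ((norm x)\<^sup>2) (real n))" by (intro continuous_intros)
  then have "continuous_on {0..T} (\<lambda>t. \<integral>x. min ((norm x)\<^sup>2) (real n) \<partial>m t)"
    using limit_flow b unfolding flow_of_probabilities_def by blast
  then have "(\<lambda>k. \<integral>x. min ((norm x)\<^sup>2) (real n) \<partial>m (r k)) \<longlonglongrightarrow> (\<integral>x. min ((norm x)\<^sup>2) (real n) \<partial>m l)"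
    using r unfolding continuous_on_sequentially by (auto simp: o_def)
  then show "(\<integral>x. min ((norm x)\<^sup>2) (real n) \<partial>m l) \<le> c"
  proof (rule LIMSEQ_le_const2, intro exI allI impI)
    fix k
    interpret prob_space "m (r k)" using mP[OF r(1)[of k]] by (simp add: P2_def)
    have "(\<integral>x. min ((norm x)\<^sup>2) (real n) \<partial>m (r k)) \<le> (\<integral>x. (norm x)\<^sup>2 \<partial>m (r k))"
    proof (rule integral_mono)
      show i: "integrable (m (r k)) (\<lambda>x. (norm x)\<^sup>2)" using mP[OF r(1)[of k]] by (simp add: P2_def)
      show "integrable (m (r k)) (\<lambda>x. min ((norm x)\<^sup>2) (real n))" using i by simp
    qed auto
    then show "(\<integral>x. min ((norm x)\<^sup>2) (real n) \<partial>m (r k)) \<le> c" using c[of k] by (simp add: M2_square)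
  qed
qed

section \<open>Boundedness of lower semicontinuous functions with self-controlled increments\<close>

definition locally_bounded_at :: "real set \<Rightarrow> (real \<Rightarrow> real) \<Rightarrow> real \<Rightarrow> bool" where
  "locally_bounded_at S u x \<longleftrightarrow> (\<exists>d>0. \<exists>B. \<forall>y\<in>S. dist y x < d \<longrightarrow> u y \<le> B)"

lemma locally_bounded_compact:
  assumes C: "compact C" "C \<subseteq> S" and l: "\<And>x. x \<in> C \<Longrightarrow> locally_bounded_at S u x"
  shows "\<exists>B. \<forall>x\<in>C. u x \<le> B"
proof (rule ccontr)
  assume "\<not> ?thesis"
  then have "\<forall>k::nat. \<exists>x\<in>C. real k < u x" by (meson not_le)
  then obtain x where x: "\<And>k. x k \<in> C" "\<And>k. real k < u (x k)" by metis
  obtain l r where lr: "l \<in> C" "strict_mono (r :: nat \<Rightarrow> nat)" "(x \<circ> r) \<longlonglongrightarrow> l"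
    using C(1) x(1) unfolding compact_def by metis
  obtain d B where d: "d > 0" "\<And>y. y \<in> S \<Longrightarrow> dist y l < d \<Longrightarrow> u y \<le> B"
    using l[OF lr(1)] unfolding locally_bounded_at_def by blast
  obtain N where N: "\<And>k. k \<ge> N \<Longrightarrow> dist (x (r k)) l < d" using lr(3) d(1) unfolding lim_sequentially o_def by blast
  obtain M :: nat where M: "B \<le> real M" using real_arch_simple by blast
  have "u (x (r (max N M))) \<le> B" using d(2) N x(1) C(2) by (metis max.cobounded1 subsetD)
  moreover have "B \<le> real (r (max N M))" using M seq_suble[OF lr(2), of "max N M"] by linarith
  ultimately show False using x(2)[of "r (max N M)"] by linarith
qed

text \<open>Let S be the supremum on the interval, finite by \<open>bdd\<close>. The increment
  estimate with B = S and L (q - p) \<le> 1/2 gives u \<le> u c + S/2 everywhere, hence S \<le> 2 u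
  c. The a priori bound has disappeared from the result.\<close>

lemma oscillation_bound:
  fixes u :: "real \<Rightarrow> real"
  assumes incr: "\<And>s t B. p \<le> s \<Longrightarrow> s < t \<Longrightarrow> t \<le> q \<Longrightarrow> (\<And>r. r \<in> {s..t} \<Longrightarrow> u r \<le> B) \<Longrightarrow> \<bar>u t - u s\<bar> \<le> L * B * (t - s)"
    and L: "L \<ge> 0" "L * (q - p) \<le> 1/2" and u: "\<And>r. r \<in> {p..q} \<Longrightarrow> 0 \<le> u r"
    and bdd: "\<And>r. r \<in> {p..q} \<Longrightarrow> u r \<le> B" and r: "r \<in> {p..q}" and c: "c \<in> {p..q}"
  shows "u r \<le> 2 * u c"
proof -
  define S where "S = (SUP x\<in>{p..q}. u x)"
  have bd: "bdd_above (u ` {p..q})" by (intro bdd_aboveI2[where M = B] bdd)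
  have S: "u x \<le> S" if "x \<in> {p..q}" for x unfolding S_def using that bd by (rule cSUP_upper)
  have S0: "0 \<le> S" using S[OF c] u[OF c] by linarith
  have "u x \<le> u c + S / 2" if x: "x \<in> {p..q}" for x
  proof -
    have *: "\<bar>u t - u s\<bar> \<le> S / 2" if "p \<le> s" "s < t" "t \<le> q" for s t
    proof -
      have "\<bar>u t - u s\<bar> \<le> L * S * (t - s)" by (rule incr) (use that S in auto)
      also have "\<dots> = S * (L * (t - s))" by simp
      also have "\<dots> \<le> S * (L * (q - p))" using that L S0 by (intro mult_left_mono) auto
      also have "\<dots> \<le> S * (1 / 2)" using L S0 by (intro mult_left_mono) auto
      finally show ?thesis by simp
    qed
    consider "x = c" | "x < c" | "c < x" by linarith
    then have "\<bar>u x - u c\<bar> \<le> S / 2"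
      using *[of x c] *[of c x] x c S0 by cases (auto simp: abs_minus_commute)
    then show ?thesis by linarith
  qed
  then have "S \<le> u c + S / 2" unfolding S_def using c by (intro cSUP_least) auto
  then show ?thesis using S[OF r] by linarith
qed

text \<open>Baire's theorem is applied to the closed set \<open>X\<close> of points near which
  \<open>u\<close> is unbounded: some sublevel set has interior relative to \<open>X\<close>, so u
  \<le> n on \<open>X\<close> near a point \<open>r0\<close>. For \<open>r\<close> close to
  \<open>r0\<close> let \<open>c\<close> be the point of \<open>X\<close> nearest to
  \<open>r\<close> on the segment between them. Between \<open>r\<close> and \<open>c\<close> the
  function is locally bounded, so \<open>oscillation_bound\<close> compares u r with u c \<le> n.
  Hence \<open>u\<close> is bounded near \<open>r0\<close>, contrary to the choice of
  \<open>r0\<close> in \<open>X\<close>.\<close>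

theorem bounded_by_category:
  fixes u :: "real \<Rightarrow> real"
  assumes incr: "\<And>s t B. a \<le> s \<Longrightarrow> s < t \<Longrightarrow> t \<le> b \<Longrightarrow> (\<And>r. r \<in> {s..t} \<Longrightarrow> u r \<le> B) \<Longrightarrow> \<bar>u t - u s\<bar> \<le> L * B * (t - s)"
    and L: "L \<ge> 0" and u: "\<And>r. r \<in> {a..b} \<Longrightarrow> 0 \<le> u r"
    and lsc: "\<And>x l c. (\<And>k::nat. x k \<in> {a..b}) \<Longrightarrow> l \<in> {a..b} \<Longrightarrow> x \<longlonglongrightarrow> l \<Longrightarrow> (\<And>k. u (x k) \<le> c) \<Longrightarrow> u l \<le> c"
  shows "\<exists>B. \<forall>r\<in>{a..b}. u r \<le> B"
proof (rule locally_bounded_compact[where S = "{a..b}"])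
  let ?lb = "locally_bounded_at {a..b} u"
  define X where "X = {x\<in>{a..b}. \<not> ?lb x}"
  have Xcl: "closed X"
    unfolding closed_sequential_limits
  proof (intro allI impI, elim conjE)
    fix x l assume x: "\<forall>n. x n \<in> X" and l: "x \<longlonglongrightarrow> l"
    have lab: "l \<in> {a..b}" using closed_sequentially[OF closed_atLeastAtMost _ l, of a b] x by (auto simp: X_def)
    show "l \<in> X"
    proof (rule ccontr)
      assume "l \<notin> X"
      then obtain d B where d: "d > 0" "\<And>y. y \<in> {a..b} \<Longrightarrow> dist y l < d \<Longrightarrow> u y \<le> B"
        using lab unfolding X_def locally_bounded_at_def by blast
      obtain k where k: "dist (x k) l < d / 2"
        using l d(1) unfolding lim_sequentially by (meson half_gt_zero order_refl)
      have "?lb (x k)"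
        unfolding locally_bounded_at_def
      proof (intro exI conjI ballI impI)
        show "0 < d / 2" using d by simp
        show "u y \<le> B" if "y \<in> {a..b}" "dist y (x k) < d / 2" for y
          using d(2)[OF that(1)] that(2) k dist_triangle[of y l "x k"] by linarith
      qed
      then show False using x by (auto simp: X_def)
    qed
  qed
  have "X = {}"
  proof (rule ccontr)
    assume ne: "X \<noteq> {}"
    define D where "D n = X - {x\<in>X. u x \<le> real n}" for n
    have cl: "closed {x\<in>X. u x \<le> real n}" for n
      unfolding closed_sequential_limits
    proof (intro allI impI, elim conjE)
      fix x l assume x: "\<forall>k. x k \<in> {x\<in>X. u x \<le> real n}" and l: "x \<longlonglongrightarrow> l"
      have lX: "l \<in> X" using closed_sequentially[OF Xcl _ l] x by auto
      moreover have "u l \<le> real n" by (rule lsc[of x]) (use x l lX in \<open>auto simp: X_def\<close>)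
      ultimately show "l \<in> {x\<in>X. u x \<le> real n}" by simp
    qed
    have "\<exists>n. \<not> X \<subseteq> closure (D n)"
    proof (rule ccontr)
      assume "\<not> ?thesis"
      then have dense: "\<And>n. X \<subseteq> closure (D n)" by blast
      have "X \<subseteq> closure (\<Inter>(range D))"
      proof (rule Baire[OF Xcl])
        fix T assume "T \<in> range D"
        then obtain n where T: "T = D n" by blast
        have "openin (top_of_set X) (X - {x\<in>X. u x \<le> real n})"
          using cl[of n] by (intro openin_diff openin_subtopology_self) (auto simp: closedin_closed)
        then show "openin (top_of_set X) T \<and> X \<subseteq> closure T" using dense T by (simp add: D_def)
      qed simp
      moreover have "\<Inter>(range D) = {}"
      proof -
        have "x \<notin> D (nat \<lceil>u x\<rceil>)" for x by (simp add: D_def real_nat_ceiling_ge)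
        then show ?thesis by blast
      qed
      ultimately show False using ne by simp
    qed
    then obtain n r0 where r0: "r0 \<in> X" "r0 \<notin> closure (D n)" by blast
    then obtain d where d: "d > 0" "\<And>y. y \<in> D n \<Longrightarrow> \<not> dist y r0 < d" unfolding closure_approachable by blast
    have un: "u y \<le> real n" if "y \<in> X" "dist y r0 < d" for y using d(2)[of y] that by (auto simp: D_def)
    define d' where "d' = min d (1 / (2 * (L + 1)))"
    have d': "d' > 0" "d' \<le> d" "L * d' \<le> 1/2"
    proof -
      have "L * d' \<le> (L + 1) * (1 / (2 * (L + 1)))" using L unfolding d'_def by (intro mult_mono) (use d in auto)
      also have "\<dots> = 1/2" using L by (simp add: field_simps)
      finally show "L * d' \<le> 1/2" .
    qed (use d L in \<open>auto simp: d'_def\<close>)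
    have "?lb r0"
      unfolding locally_bounded_at_def
    proof (intro exI conjI ballI impI)
      show "d' > 0" by (rule d')
      fix r assume r: "r \<in> {a..b}" "dist r r0 < d'"
      have r0ab: "r0 \<in> {a..b}" using r0 by (simp add: X_def)
      \<comment> \<open>The nearest point is sought only between \<open>r\<close> and
        \<open>r0\<close>, which keeps \<open>c\<close> at least as close to \<open>r0\<close> as
        \<open>r\<close> is.\<close>
      let ?I = "{min r r0..max r r0}"
      have XI: "closed (X \<inter> ?I)" "X \<inter> ?I \<noteq> {}" using Xcl r0 by (auto intro: closed_Int)
      obtain c where c': "c \<in> X \<inter> ?I" and cmin': "\<And>y. y \<in> X \<inter> ?I \<Longrightarrow> dist r c \<le> dist r y"
        by (rule distance_attains_inf[OF XI, of r]) (rule that)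
      then have c: "c \<in> X" "c \<in> ?I" and cmin: "\<And>y. y \<in> X \<Longrightarrow> y \<in> ?I \<Longrightarrow> dist r c \<le> dist r y" by blast+
      define p where "p = min r c"
      define q where "q = max r c"
      have pq: "p \<le> q" "r \<in> {p..q}" "c \<in> {p..q}" "{p..q} \<subseteq> {a..b}" "q - p < d'"
        using r r0ab c by (auto simp: p_def q_def dist_real_def)
      have Lpq: "L * (q - p) \<le> 1/2" using mult_left_mono[of "q - p" d' L] pq L d' by linarith
      have lb: "?lb x" if x: "x \<in> {p..q}" "x \<noteq> c" for x
      proof (rule ccontr)
        assume "\<not> ?lb x"
        then have "x \<in> X" using x pq by (auto simp: X_def)
        moreover have "x \<in> ?I" using x c by (auto simp: p_def q_def)
        ultimately have "dist r c \<le> dist r x" using cmin by blast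
        then show False using x by (auto simp: p_def q_def dist_real_def min_def max_def split: if_splits)
      qed
      have ur: "u x \<le> 2 * u r" if x: "x \<in> {p..q}" "x \<noteq> c" for x
      proof -
        let ?J = "{min r x..max r x}"
        have J: "?J \<subseteq> {p..q}" using x pq by auto
        have "r = c \<Longrightarrow> x = c" using x by (auto simp: p_def q_def)
        then have "c \<notin> ?J" using x by (auto simp: p_def q_def min_def max_def split: if_splits)
        then have "\<exists>B. \<forall>x\<in>?J. u x \<le> B"
          using J lb pq(4) by (intro locally_bounded_compact[where S = "{a..b}"]) blast+
        then obtain B where B: "\<And>y. y \<in> ?J \<Longrightarrow> u y \<le> B" by blast
        have LJ: "L * (max r x - min r x) \<le> 1/2"
        proof -
          have "max r x - min r x \<le> q - p" using J by (auto simp: min_def max_def split: if_splits)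
          then show ?thesis using mult_left_mono[of "max r x - min r x" "q - p" L] L Lpq by linarith
        qed
        show ?thesis
        proof (rule oscillation_bound[where u = u, OF _ L LJ _ B])
          show "\<bar>u t - u s\<bar> \<le> L * B * (t - s)" if "min r x \<le> s" "s < t" "t \<le> max r x" "\<And>r. r \<in> {s..t} \<Longrightarrow> u r \<le> B" for s t B
            by (rule incr) (use that J pq(4) in \<open>auto simp: subset_eq\<close>)
          show "0 \<le> u y" if "y \<in> ?J" for y using that J pq(4) u by blast
        qed auto
      qed
      have "u r \<le> 2 * u c"
      proof (rule oscillation_bound[where u = u, OF _ L Lpq])
        show "\<bar>u t - u s\<bar> \<le> L * B * (t - s)" if "p \<le> s" "s < t" "t \<le> q" "\<And>r. r \<in> {s..t} \<Longrightarrow> u r \<le> B" for s t B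
          by (rule incr) (use that pq in \<open>auto simp: subset_eq\<close>)
        show "u x \<le> max (u c) (2 * u r)" if "x \<in> {p..q}" for x using ur[OF that] by (cases "x = c") auto
      qed (use u pq in auto)
      moreover have "dist c r0 < d" using c r d' by (auto simp: dist_real_def)
      ultimately show "u r \<le> 2 * real n" using un[OF c(1)] by linarith
    qed
    then show False using r0 by (simp add: X_def)
  qed
  then show "?lb x" if "x \<in> {a..b}" for x using that by (auto simp: X_def)
qed auto

theorem FPK_solution_continuous:
  fixes m :: "real \<Rightarrow> (real ^ 'n) measure"
  assumes sol: "FPK_solution T F m" and C: "Cb \<ge> 0" "CA \<ge> 0"
    and growth: "\<And>t x m \<beta> \<Sigma>. t \<in> {0..T} \<Longrightarrow> m \<in> P2 \<Longrightarrow> (\<beta>, \<Sigma>) \<in> F t x m \<Longrightarrow>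
           norm \<beta> \<le> Cb * (1 + norm x + M2 m) \<and> norm \<Sigma> \<le> CA * (1 + (norm x)\<^sup>2 + (M2 m)\<^sup>2)"
  shows "m \<in> C_P2 T"
proof -
  let ?K = "growth_const Cb CA TYPE('n)"
  \<comment> \<open>With the summand 1 a bound of \<open>u\<close> on an interval is the constant
    \<open>B\<close> of \<open>second_moment_increment\<close>, so the increments of
    \<open>u\<close> are controlled by \<open>u\<close> itself, as
    \<open>bounded_by_category\<close> requires.\<close>
  define u where "u r = 1 + (M2 (m r))\<^sup>2" for r
  have limit_flow: "flow_of_probabilities T m" using sol by (simp add: FPK_solution_def)
  have mP: "m r \<in> P2" if "r \<in> {0..T}" for r using limit_flow that by (simp add: flow_of_probabilities_def)
  have incr: "\<bar>u t - u s\<bar> \<le> 2 * ?K * B * (t - s)"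
    if "0 \<le> s" "s < t" "t \<le> T" "\<And>r. r \<in> {s..t} \<Longrightarrow> u r \<le> B" for s t B
    using second_moment_increment[OF sol C growth that(1-3), where B = B] that(4) by (simp add: u_def)
  have "\<exists>B. \<forall>r\<in>{0..T}. u r \<le> B"
  proof (rule bounded_by_category[OF incr])
    show "u l \<le> c" if "\<And>k::nat. x k \<in> {0..T}" "l \<in> {0..T}" "x \<longlonglongrightarrow> l" "\<And>k. u (x k) \<le> c" for x l c
      using second_moment_lsc[OF limit_flow that(1-3), of "c - 1"] that(4) by (simp add: u_def algebra_simps)
  qed (use growth_const_nonneg[OF C] in \<open>auto simp: u_def\<close>)
  then obtain B where B: "\<And>r. r \<in> {0..T} \<Longrightarrow> u r \<le> B" by blast
  have lip: "\<bar>u t - u s\<bar> \<le> 2 * ?K * B * \<bar>t - s\<bar>" if "s \<in> {0..T}" "t \<in> {0..T}" for s t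
  proof -
    consider "s = t" | "s < t" | "t < s" by linarith
    then show ?thesis using incr[of s t B] incr[of t s B] B that by cases (auto simp: abs_minus_commute)
  qed
  show ?thesis
    unfolding C_P2_def mem_Collect_eq
  proof (intro conjI ballI mP)
    fix t assume t: "t \<in> {0..T}"
    show "((\<lambda>s. W2 (m s) (m t)) \<longlongrightarrow> 0) (at t within {0..T})"
      unfolding tendsto_at_iff_sequentially o_def
    proof (intro allI impI)
      fix x assume "\<forall>i. x i \<in> {0..T} - {t}" and l: "x \<longlonglongrightarrow> t"
      then have x: "\<And>i. x i \<in> {0..T}" by auto
      show "(\<lambda>i. W2 (m (x i)) (m t)) \<longlonglongrightarrow> 0"
      proof (rule W2_tendsto_0)
        show "m (x k) \<in> P2" "m t \<in> P2" for k using mP x t by auto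
        show "bl_conv (\<lambda>k. m (x k)) (m t)"
          unfolding bl_conv_def
        proof (intro allI impI)
          fix f :: "real ^ 'n \<Rightarrow> real" and L assume "L-lipschitz_on UNIV f" "bounded (range f)"
          then have "continuous_on {0..T} (\<lambda>t. \<integral>x. f x \<partial>m t)"
            using limit_flow lipschitz_on_continuous_on unfolding flow_of_probabilities_def by blast
          then show "(\<lambda>k. \<integral>x. f x \<partial>m (x k)) \<longlonglongrightarrow> (\<integral>x. f x \<partial>m t)"
            using x t l unfolding continuous_on_sequentially by (auto simp: o_def)
        qed
        have "(\<lambda>k. u (x k)) \<longlonglongrightarrow> u t"
        proof (rule LIM_zero_cancel, rule Lim_null_comparison)
          show "\<forall>\<^sub>F k in sequentially. norm (u (x k) - u t) \<le> 2 * ?K * B * \<bar>x k - t\<bar>"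
            using lip[OF t x] by simp
          have "(\<lambda>k. 2 * ?K * B * \<bar>x k - t\<bar>) \<longlonglongrightarrow> 2 * ?K * B * \<bar>t - t\<bar>" by (intro tendsto_intros l)
          then show "(\<lambda>k. 2 * ?K * B * \<bar>x k - t\<bar>) \<longlonglongrightarrow> 0" by simp
        qed
        from tendsto_diff[OF this tendsto_const[of 1]]
        show "(\<lambda>k. \<integral>z. (norm z)\<^sup>2 \<partial>m (x k)) \<longlonglongrightarrow> (\<integral>z. (norm z)\<^sup>2 \<partial>m t)"
          by (simp add: u_def M2_square)
      qed
    qed
  qed
qed

section \<open>Sums of rank-one matrices\<close>

lemma psd_symmetric:
  assumes "A \<in> psd_matrices" shows "x \<bullet> (A *v y) = y \<bullet> (A *v x)" "A $ a $ b = A $ b $ a"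
proof -
  have t: "transpose A = A" using assms by (simp add: psd_matrices_def)
  have "x \<bullet> (A *v y) = (transpose A *v x) \<bullet> y" by (simp add: dot_lmul_matrix)
  then show "x \<bullet> (A *v y) = y \<bullet> (A *v x)" by (simp add: t inner_commute)
  have "transpose A $ a $ b = A $ b $ a" by (simp add: transpose_def)
  then show "A $ a $ b = A $ b $ a" by (simp add: t)
qed

lemma quadratic_form_add:
  assumes "A \<in> psd_matrices"
  shows "(v + c *\<^sub>R e) \<bullet> (A *v (v + c *\<^sub>R e)) = v \<bullet> (A *v v) + 2 * c * (v \<bullet> (A *v e)) + c\<^sup>2 * (e \<bullet> (A *v e))"
proof -
  have 1: "A *v (v + c *\<^sub>R e) = A *v v + c *\<^sub>R (A *v e)"
    by (simp add: matrix_vector_right_distrib matrix_vector_mult_scaleR)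
  have 2: "e \<bullet> (A *v v) = v \<bullet> (A *v e)" by (rule psd_symmetric(1)[OF assms])
  show ?thesis unfolding 1 inner_add_left inner_add_right inner_scaleR_left inner_scaleR_right 2
    by (simp add: algebra_simps power2_eq_square)
qed

lemma inner_axis_matrix: "(axis a 1 :: real ^ 'n) \<bullet> (A *v axis b 1) = A $ a $ b"
  by (simp add: inner_axis' matrix_vector_mult_basis column_def)

lemma psd_zero_diagonal:
  assumes A: "A \<in> psd_matrices" and z: "A $ i $ i = 0" shows "A $ a $ i = 0"
proof (rule ccontr)
  assume n: "A $ a $ i \<noteq> 0"
  \<comment> \<open>The quadratic form at \<open>axis a 1 + c *\<^sub>R axis i 1\<close> is affine
    in c because the diagonal entry vanishes; this value of c makes it -1.\<close>
  let ?c = "- (A $ a $ a + 1) / (2 * A $ a $ i)"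
  have "0 \<le> (axis a 1 + ?c *\<^sub>R axis i 1) \<bullet> (A *v (axis a 1 + ?c *\<^sub>R axis i 1))"
    using A by (simp add: psd_matrices_def)
  also have "\<dots> = A $ a $ a + 2 * ?c * A $ a $ i"
    unfolding quadratic_form_add[OF A] inner_axis_matrix z by simp
  also have "\<dots> = -1" using n by (simp add: field_simps)
  finally show False by simp
qed

definition outer_sum :: "('n \<Rightarrow> real ^ 'n) \<Rightarrow> real ^ 'n ^ 'n" where
  "outer_sum w = (\<chi> a b. \<Sum>j\<in>UNIV. w j $ a * w j $ b)"

text \<open>Cholesky elimination of one index at a time.\<close>

lemma psd_factor_aux:
  fixes S :: "'n::finite set" and A :: "real ^ 'n ^ 'n"
  assumes "finite S" "A \<in> psd_matrices" "\<And>a b. a \<notin> S \<Longrightarrow> A $ a $ b = 0"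
  shows "\<exists>w :: 'n \<Rightarrow> real ^ 'n. \<forall>a b. A $ a $ b = (\<Sum>j\<in>S. w j $ a * w j $ b)"
  using assms
proof (induction S arbitrary: A rule: finite_induct)
  case empty
  then show ?case by auto
next
  case (insert i S)
  note A = insert.prems(1)
  show ?case
  proof (cases "A $ i $ i = 0")
    case True
    have "A $ a $ b = 0" if "a \<notin> S" for a b
      using insert.prems(2)[of a b] that psd_zero_diagonal[OF A True, of b] psd_symmetric(2)[OF A, of b i]
      by (cases "a = i") auto
    from insert.IH[OF A this] obtain w :: "'n \<Rightarrow> real ^ 'n" where w: "\<And>a b. A $ a $ b = (\<Sum>j\<in>S. w j $ a * w j $ b)" by blast
    show ?thesis
      by (rule exI[of _ "w(i := 0)"], intro allI) (use insert.hyps w in \<open>auto intro!: sum.cong\<close>)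
  next
    case False
    let ?d = "A $ i $ i"
    have "0 \<le> ?d" using A inner_axis_matrix[of i A i] by (simp add: psd_matrices_def) metis
    then have d: "0 < ?d" using False by simp
    \<comment> \<open>The Schur complement of the pivot. Its quadratic form at \<open>v\<close> is
      the minimum of that of \<open>A\<close> along the line
      \<open>v + c *\<^sub>R axis i 1\<close>, which is why it stays positive semidefinite.\<close>
    define A' where "A' = (\<chi> a b. A $ a $ b - A $ a $ i * A $ b $ i / ?d)"
    have quad: "v \<bullet> (A' *v v) = v \<bullet> (A *v v) - (v \<bullet> (A *v axis i 1))\<^sup>2 / ?d" for v
    proof -
      have vi: "v \<bullet> (A *v axis i 1) = (\<Sum>a\<in>UNIV. v $ a * A $ a $ i)"
        by (simp add: matrix_vector_mult_basis column_def inner_vec_def)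
      have "v \<bullet> (A' *v v) = (\<Sum>a\<in>UNIV. \<Sum>b\<in>UNIV. v $ a * (A $ a $ b * v $ b)) - (\<Sum>a\<in>UNIV. \<Sum>b\<in>UNIV. v $ a * A $ a $ i * (v $ b * A $ b $ i)) / ?d"
        by (simp add: inner_vec_def matrix_vector_mult_def A'_def sum_distrib_left algebra_simps sum_subtractf sum_divide_distrib)
      also have "(\<Sum>a\<in>UNIV. \<Sum>b\<in>UNIV. v $ a * A $ a $ i * (v $ b * A $ b $ i)) = (\<Sum>a\<in>UNIV. v $ a * A $ a $ i)\<^sup>2"
        unfolding power2_eq_square by (rule sum_product[symmetric])
      finally show ?thesis unfolding vi by (simp add: inner_vec_def matrix_vector_mult_def sum_distrib_left)
    qed
    have A': "A' \<in> psd_matrices"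
      unfolding psd_matrices_def mem_Collect_eq
    proof (intro conjI allI)
      show "transpose A' = A'"
        by (simp add: transpose_def A'_def vec_eq_iff psd_symmetric(2)[OF A] mult.commute)
      fix v
      let ?c = "- (v \<bullet> (A *v axis i 1)) / ?d"
      have "0 \<le> (v + ?c *\<^sub>R axis i 1) \<bullet> (A *v (v + ?c *\<^sub>R axis i 1))" using A by (simp add: psd_matrices_def)
      also have "\<dots> = v \<bullet> (A' *v v)"
        unfolding quadratic_form_add[OF A] quad inner_axis_matrix using d by (simp add: field_simps power2_eq_square)
      finally show "0 \<le> v \<bullet> (A' *v v)" .
    qed
    have "A' $ a $ b = 0" if "a \<notin> S" for a b
      using insert.prems(2)[of a] that d psd_symmetric(2)[OF A, of b i] by (cases "a = i") (auto simp: A'_def)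
    from insert.IH[OF A' this] obtain w :: "'n \<Rightarrow> real ^ 'n" where w: "\<And>a b. A' $ a $ b = (\<Sum>j\<in>S. w j $ a * w j $ b)" by blast
    define w' where "w' = w(i := (\<chi> a. A $ a $ i / sqrt ?d))"
    have "A $ a $ b = (\<Sum>j\<in>insert i S. w' j $ a * w' j $ b)" for a b
    proof -
      have "(\<Sum>j\<in>insert i S. w' j $ a * w' j $ b) = A $ a $ i / sqrt ?d * (A $ b $ i / sqrt ?d) + (\<Sum>j\<in>S. w' j $ a * w' j $ b)"
        using insert.hyps by (simp add: w'_def)
      also have "(\<Sum>j\<in>S. w' j $ a * w' j $ b) = A' $ a $ b"
        unfolding w using insert.hyps by (intro sum.cong) (auto simp: w'_def)
      finally show ?thesis using d by (simp add: A'_def)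
    qed
    then show ?thesis by blast
  qed
qed

lemma psd_factor:
  fixes A :: "real ^ 'n ^ 'n"
  assumes "A \<in> psd_matrices"
  obtains w :: "'n \<Rightarrow> real ^ 'n" where "A = outer_sum w"
  using psd_factor_aux[OF _ assms, of UNIV] by (auto simp: outer_sum_def vec_eq_iff)

text \<open>The squared norm of \<open>w j\<close> is one summand of the trace of
  \<open>outer_sum w\<close>, and each diagonal entry is at most the Frobenius norm.\<close>

lemma norm_outer_sum_factor:
  fixes w :: "'n::finite \<Rightarrow> real ^ 'n"
  shows "(norm (w j))\<^sup>2 \<le> real CARD('n) * norm (outer_sum w)"
proof -
  have "(norm (w j))\<^sup>2 = (\<Sum>a\<in>UNIV. (w j $ a)\<^sup>2)" by (simp add: norm_vec_def L2_set_def sum_nonneg)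
  also have "\<dots> \<le> (\<Sum>a\<in>UNIV. outer_sum w $ a $ a)"
  proof (rule sum_mono)
    fix a :: 'n
    have "(w j $ a)\<^sup>2 \<le> (\<Sum>j\<in>UNIV. (w j $ a)\<^sup>2)" by (rule member_le_sum) auto
    then show "(w j $ a)\<^sup>2 \<le> outer_sum w $ a $ a" by (simp add: outer_sum_def power2_eq_square)
  qed
  also have "\<dots> \<le> (\<Sum>a\<in>(UNIV::'n set). norm (outer_sum w))"
  proof (rule sum_mono)
    fix a :: 'n
    show "outer_sum w $ a $ a \<le> norm (outer_sum w)"
      using component_le_norm_cart[of "outer_sum w $ a" a] Finite_Cartesian_Product.norm_nth_le[where x = "outer_sum w" and i = a]
      by linarith
  qed
  finally show ?thesis by simp
qed

lemma trace_outer_sum: "trace (H ** outer_sum w) = (\<Sum>j\<in>UNIV. w j \<bullet> (H *v w j))"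
proof -
  have "trace (H ** outer_sum w) = (\<Sum>a\<in>UNIV. \<Sum>b\<in>UNIV. \<Sum>j\<in>UNIV. w j $ a * (H $ a $ b * w j $ b))"
    by (simp add: trace_def matrix_matrix_mult_def outer_sum_def sum_distrib_left mult_ac)
  also have "\<dots> = (\<Sum>a\<in>UNIV. \<Sum>j\<in>UNIV. \<Sum>b\<in>UNIV. w j $ a * (H $ a $ b * w j $ b))"
    by (intro sum.cong refl sum.swap)
  also have "\<dots> = (\<Sum>j\<in>UNIV. \<Sum>a\<in>UNIV. \<Sum>b\<in>UNIV. w j $ a * (H $ a $ b * w j $ b))"
    by (rule sum.swap)
  finally show ?thesis by (simp add: inner_vec_def matrix_vector_mult_def sum_distrib_left)
qed

section \<open>Consistency of one Euler step\<close>

definition avg :: "('n::finite \<times> bool \<Rightarrow> real) \<Rightarrow> real" where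
  "avg f = (\<Sum>js\<in>UNIV. f js) / real (2 * CARD('n))"

lemma avg_eq: "avg f = (\<Sum>j\<in>UNIV. f (j, True) + f (j, False)) / real (2 * CARD('n))"
  for f :: "'n::finite \<times> bool \<Rightarrow> real"
proof -
  have "(\<Sum>js\<in>(UNIV :: ('n \<times> bool) set). f js) = (\<Sum>j\<in>UNIV. \<Sum>s\<in>UNIV. f (j, s))"
    unfolding UNIV_Times_UNIV[symmetric] by (simp only: sum.cartesian_product)  simp
  then show ?thesis by (simp add: avg_def UNIV_bool add.commute)
qed

lemma avg_const [simp]: "avg (\<lambda>_. c) = c"
  by (simp add: avg_def card_cartesian_product flip: UNIV_Times_UNIV)

lemma avg_linear: "avg (\<lambda>js. f js + g js) = avg f + avg g" "avg (\<lambda>js. f js - g js) = avg f - avg g"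
    "avg (\<lambda>js. c * f js) = c * avg f"
  by (simp_all add: avg_def sum.distrib add_divide_distrib sum_subtractf diff_divide_distrib sum_distrib_left)

lemma avg_mono: "(\<And>js. f js \<le> g js) \<Longrightarrow> avg f \<le> avg g"
  by (auto simp: avg_def intro!: divide_right_mono sum_mono)

lemma avg_abs: "\<bar>avg f\<bar> \<le> avg (\<lambda>js. \<bar>f js\<bar>)"
  by (auto simp: avg_def intro!: divide_right_mono sum_abs)

text \<open>With \<open>js\<close> uniform on \<open>'n \<times> bool\<close> this has mean \<open>h b\<close>, and the factor \<open>CARD('n)\<close>
  compensates for using only one column \<open>w j\<close> per step.\<close>

definition euler_step :: "real \<Rightarrow> real ^ 'n \<Rightarrow> ('n \<Rightarrow> real ^ 'n) \<Rightarrow> 'n \<times> bool \<Rightarrow> real ^ 'n" where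
  "euler_step h b w js = h *\<^sub>R b + ((if snd js then 1 else -1) * sqrt (h * real CARD('n))) *\<^sub>R w (fst js)"

lemma avg_linear_form: "avg (\<lambda>js. v \<bullet> euler_step h b w js) = h * (v \<bullet> b)"
  by (simp add: avg_eq euler_step_def inner_simps)

text \<open>The two signs cancel the terms mixing \<open>b\<close> with \<open>w\<close>. Each
  direction is used with probability 1 / CARD('n) and enters its square with weight h CARD('n),
  which leaves h times the full sum.\<close>

lemma avg_quadratic_form:
  fixes w :: "'n::finite \<Rightarrow> real ^ 'n"
  assumes "h \<ge> 0"
  shows "avg (\<lambda>js. euler_step h b w js \<bullet> (H *v euler_step h b w js)) = h\<^sup>2 * (b \<bullet> (H *v b)) + h * (\<Sum>j\<in>UNIV. w j \<bullet> (H *v w j))"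
proof -
  let ?r = "sqrt (h * real CARD('n))"
  have r: "?r * ?r = h * real CARD('n)" using assms by simp
  have *: "euler_step h b w (j, True) \<bullet> (H *v euler_step h b w (j, True)) + euler_step h b w (j, False) \<bullet> (H *v euler_step h b w (j, False))
     = 2 * (h\<^sup>2 * (b \<bullet> (H *v b))) + 2 * (h * real CARD('n) * (w j \<bullet> (H *v w j)))" for j
  proof -
    have "euler_step h b w (j, True) \<bullet> (H *v euler_step h b w (j, True)) + euler_step h b w (j, False) \<bullet> (H *v euler_step h b w (j, False))
     = 2 * (h\<^sup>2 * (b \<bullet> (H *v b))) + 2 * (?r * ?r * (w j \<bullet> (H *v w j)))"
      by (simp add: euler_step_def matrix_vector_right_distrib matrix_vector_mult_diff_distrib matrix_vector_mult_scaleR inner_simps power2_eq_square algebra_simps)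
    then show ?thesis unfolding r .
  qed
  show ?thesis unfolding avg_eq * by (simp add: sum.distrib add_divide_distrib sum_distrib_left[symmetric])
qed

lemma quadratic_form_bound:
  fixes H :: "real ^ 'n ^ 'n"
  shows "\<bar>z \<bullet> (H *v z)\<bar> \<le> real CARD('n) ^ 2 * norm H * (norm z)\<^sup>2"
proof -
  have H: "\<bar>H $ a $ b\<bar> \<le> norm H" for a b
    using component_le_norm_cart[of "H $ a" b] Finite_Cartesian_Product.norm_nth_le[where x = H and i = a] by linarith
  have "z \<bullet> (H *v z) = (\<Sum>a\<in>UNIV. \<Sum>b\<in>UNIV. z $ a * (H $ a $ b * z $ b))"
    by (simp add: inner_vec_def matrix_vector_mult_def sum_distrib_left)
  also have "\<bar>\<dots>\<bar> \<le> (\<Sum>a\<in>(UNIV::'n set). \<Sum>b\<in>(UNIV::'n set). norm H * (norm z)\<^sup>2)"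
  proof (intro order_trans[OF sum_abs] sum_mono)
    fix a b :: 'n
    have "\<bar>z $ a * (H $ a $ b * z $ b)\<bar> = \<bar>H $ a $ b\<bar> * (\<bar>z $ a\<bar> * \<bar>z $ b\<bar>)" by (simp add: abs_mult)
    also have "\<dots> \<le> norm H * (norm z * norm z)" by (intro mult_mono H component_le_norm_cart) auto
    finally show "\<bar>z $ a * (H $ a $ b * z $ b)\<bar> \<le> norm H * (norm z)\<^sup>2" by (simp add: power2_eq_square)
  qed
  finally show ?thesis by (simp add: power2_eq_square)
qed

section \<open>Taylor expansion and compactly supported test functions\<close>

lemma has_derivative_grad:
  fixes f :: "real ^ 'n \<Rightarrow> real"
  assumes "f differentiable (at x)"
  shows "(f has_derivative (\<lambda>h. grad f x \<bullet> h)) (at x)"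
proof -
  have d: "(f has_derivative frechet_derivative f (at x)) (at x)" using assms by (simp add: frechet_derivative_works)
  then have l: "linear (frechet_derivative f (at x))" by (rule has_derivative_linear)
  have "frechet_derivative f (at x) h = grad f x \<bullet> h" for h
  proof -
    have "frechet_derivative f (at x) h = frechet_derivative f (at x) (\<Sum>i\<in>UNIV. h $ i *\<^sub>R axis i 1)"
      by (simp add: basis_expansion scalar_mult_eq_scaleR[symmetric])
    also have "\<dots> = (\<Sum>i\<in>UNIV. h $ i * frechet_derivative f (at x) (axis i 1))"
      by (simp add: linear_sum[OF l] linear_scale[OF l])
    finally show ?thesis by (simp add: grad_def inner_vec_def mult.commute)
  qed
  then have "frechet_derivative f (at x) = (\<lambda>h. grad f x \<bullet> h)" by blast
  with d show ?thesis by simp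
qed

text \<open>Maclaurin's formula for the restriction of \<open>f\<close> to the segment from x to x +
  z; \<open>D m\<close> is its m-th derivative for m \<le> 2.\<close>

lemma second_order_expansion:
  fixes f :: "real ^ 'n \<Rightarrow> real"
  assumes f: "\<And>x. f differentiable (at x)" "\<And>x. grad f differentiable (at x)"
  obtains c where "0 < c" "c < 1" "f (x + z) = f x + grad f x \<bullet> z + 1 / 2 * (z \<bullet> (hessian f (x + c *\<^sub>R z) *v z))"
proof -
  define D where "D m s = (if m = 0 then f (x + s *\<^sub>R z) else if m = 1 then grad f (x + s *\<^sub>R z) \<bullet> z
     else z \<bullet> (hessian f (x + s *\<^sub>R z) *v z))" for m :: nat and s
  have l: "((\<lambda>s. x + s *\<^sub>R z) has_derivative (\<lambda>r. r *\<^sub>R z)) (at s)" for s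
    by (auto intro!: derivative_eq_intros)
  have 0: "(D 0 has_real_derivative D (Suc 0) s) (at s)" for s
    using has_derivative_compose[OF l has_derivative_grad[OF f(1)], of s]
    unfolding has_field_derivative_def D_def by (simp add: mult_commute_abs)
  have 1: "(D (Suc 0) has_real_derivative D (Suc (Suc 0)) s) (at s)" for s
  proof -
    have "(grad f has_derivative (\<lambda>h. hessian f y *v h)) (at y)" for y
      using f(2)[of y] unfolding hessian_def by (simp add: jacobian_works)
    from has_derivative_compose[OF l this, of s]
    have "((\<lambda>s. grad f (x + s *\<^sub>R z) \<bullet> z) has_derivative (\<lambda>r. (hessian f (x + s *\<^sub>R z) *v (r *\<^sub>R z)) \<bullet> z)) (at s)"
      by (rule has_derivative_inner_left)
    then show ?thesis
      unfolding has_field_derivative_def D_def by (simp add: matrix_vector_mult_scaleR inner_commute mult_commute_abs)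
  qed
  have "\<exists>t. 0 < t \<and> t < 1 \<and> D 0 1 = (\<Sum>m<2. D m 0 / fact m * 1 ^ m) + D 2 t / fact 2 * 1 ^ 2"
  proof (rule Maclaurin)
    show "\<forall>m t. m < 2 \<and> 0 \<le> t \<and> t \<le> 1 \<longrightarrow> (D m has_real_derivative D (Suc m) t) (at t)"
      using 0 1 by (auto simp: less_2_cases_iff)
  qed auto
  then obtain c where "0 < c" "c < 1" "D 0 1 = (\<Sum>m<2. D m 0 / fact m * 1 ^ m) + D 2 c / fact 2 * 1 ^ 2" by blast
  then show ?thesis using that[of c] by (simp add: D_def eval_nat_numeral)
qed

text \<open>Uniform continuity on the ball of radius R + 1 suffices: two points at distance below 1
  either both lie in this ball or both lie beyond R, where \<open>f\<close> vanishes.\<close>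

lemma uniformly_continuous_compact_support:
  fixes f :: "'a::euclidean_space \<Rightarrow> 'b::real_normed_vector"
  assumes f: "continuous_on UNIV f" and 0: "\<And>x. norm x > R \<Longrightarrow> f x = 0"
  shows "uniformly_continuous_on UNIV f" "\<exists>C. \<forall>x. norm (f x) \<le> C"
proof -
  have u: "uniformly_continuous_on (cball 0 (R + 1)) f"
    using f continuous_on_subset by (intro compact_uniformly_continuous) auto
  show "uniformly_continuous_on UNIV f"
    unfolding uniformly_continuous_on_def
  proof (intro allI impI)
    fix e :: real assume e: "e > 0"
    then obtain d where d: "d > 0" "\<And>x y. x \<in> cball 0 (R + 1) \<Longrightarrow> y \<in> cball 0 (R + 1) \<Longrightarrow> dist y x < d \<Longrightarrow> dist (f y) (f x) < e"
      using u unfolding uniformly_continuous_on_def by meson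
    show "\<exists>d>0. \<forall>x\<in>UNIV. \<forall>x'\<in>UNIV. dist x' x < d \<longrightarrow> dist (f x') (f x) < e"
    proof (intro exI conjI ballI impI)
      show "min d 1 > 0" using d by simp
      fix x y :: 'a assume xy: "dist y x < min d 1"
      have "norm y \<le> norm x + dist y x" "norm x \<le> norm y + dist y x"
        using norm_triangle_ineq2[of y x] norm_triangle_ineq2[of x y] by (auto simp: dist_norm norm_minus_commute)
      then have "(norm x \<le> R + 1 \<and> norm y \<le> R + 1) \<or> (norm x > R \<and> norm y > R)" using xy by linarith
      then show "dist (f y) (f x) < e"
      proof
        assume "norm x \<le> R + 1 \<and> norm y \<le> R + 1"
        then show ?thesis using d(2)[of x y] xy by simp
      qed (use 0 e in simp)
    qed
  qed
  have "compact (f ` cball 0 R)" using f continuous_on_subset by (intro compact_continuous_image) auto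
  then have "bounded (f ` cball 0 R)" by (rule compact_imp_bounded)
  then obtain C where C: "\<forall>x\<in>cball 0 R. norm (f x) \<le> C" by (auto simp: bounded_iff)
  show "\<exists>C. \<forall>x. norm (f x) \<le> C"
  proof (intro exI allI)
    fix x show "norm (f x) \<le> max C 0"
      using C[rule_format, of x] 0[of x] by (cases "norm x \<le> R") auto
  qed
qed

lemma C12c_vanish:
  fixes \<phi> :: "real \<Rightarrow> real ^ 'n \<Rightarrow> real"
  assumes K: "compact K" "\<And>t x. (t, x) \<notin> K \<Longrightarrow> \<phi> t x = 0" and tx: "(t, x) \<notin> K"
  shows "deriv (\<lambda>s. \<phi> s x) t = 0" "grad (\<phi> t) x = 0" "hessian (\<phi> t) x = 0"
proof -
  have op: "open (- K)" using K(1) by (simp add: compact_imp_closed open_Compl)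
  have o1: "open {s. (s, x) \<in> - K}" for x
    using open_vimage[OF op, of "\<lambda>s. (s, x)"] by (simp add: vimage_def continuous_on_Pair)
  have o2: "open {y. (t, y) \<in> - K}"
    using open_vimage[OF op, of "\<lambda>y. (t, y)"] by (simp add: vimage_def continuous_on_Pair)
  show "deriv (\<lambda>s. \<phi> s x) t = 0"
  proof (rule DERIV_imp_deriv)
    show "((\<lambda>s. \<phi> s x) has_real_derivative 0) (at t)"
      by (rule has_field_derivative_transform_within_open[OF DERIV_const[of 0] o1]) (use tx K(2) in auto)
  qed
  have g: "grad (\<phi> t) y = 0" if "(t, y) \<notin> K" for y
  proof (rule grad_eqI)
    have "(\<phi> t has_derivative (\<lambda>h. 0)) (at y)"
      by (rule has_derivative_transform_within_open[OF has_derivative_const[of 0] o2]) (use that K(2) in auto)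
    then show "(\<phi> t has_derivative (\<lambda>h. 0 \<bullet> h)) (at y)" by simp
  qed
  then show "grad (\<phi> t) x = 0" using tx by simp
  show "hessian (\<phi> t) x = 0"
  proof (rule hessian_eqI)
    have "(grad (\<phi> t) has_derivative (\<lambda>h. 0)) (at x)"
      by (rule has_derivative_transform_within_open[OF has_derivative_const[of 0] o2]) (use tx g in auto)
    then show "(grad (\<phi> t) has_derivative (\<lambda>h. 0 *v h)) (at x)" by simp
  qed
qed

lemma C12c_support:
  fixes \<phi> :: "real \<Rightarrow> real ^ 'n \<Rightarrow> real"
  assumes "\<phi> \<in> C12c T"
  obtains R where "R > 0" "\<And>t x. norm (t, x) > R \<Longrightarrow> \<phi> t x = 0 \<and> deriv (\<lambda>s. \<phi> s x) t = 0 \<and> grad (\<phi> t) x = 0 \<and> hessian (\<phi> t) x = 0"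
    "\<And>t x. t \<notin> {0<..<T} \<Longrightarrow> \<phi> t x = 0"
proof -
  obtain K where K: "compact K" "K \<subseteq> {0<..<T} \<times> UNIV" "\<And>t x. (t, x) \<notin> K \<Longrightarrow> \<phi> t x = 0"
    using assms unfolding C12c_def by blast
  obtain R where R: "R > 0" "\<And>z. z \<in> K \<Longrightarrow> norm z \<le> R"
    using compact_imp_bounded[OF K(1)] unfolding bounded_pos by blast
  show ?thesis
  proof (rule that[OF R(1)])
    show "\<phi> t x = 0 \<and> deriv (\<lambda>s. \<phi> s x) t = 0 \<and> grad (\<phi> t) x = 0 \<and> hessian (\<phi> t) x = 0" if "norm (t, x) > R" for t x
      using C12c_vanish[where K = K and \<phi> = \<phi> and t = t and x = x, OF K(1) K(3)] R(2)[of "(t, x)"] K(3)[of t x] that by fastforce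
    show "\<phi> t x = 0" if "t \<notin> {0<..<T}" for t x using K(3)[of t x] K(2) that by blast
  qed
qed

lemma norm_euler_step_le:
  fixes b :: "real ^ 'n"
  assumes h: "0 < h" "h \<le> 1" and b: "norm b \<le> B" and w: "\<And>j. norm (w j) \<le> B"
  shows "norm (euler_step h b w js) \<le> sqrt h * ((1 + sqrt (real CARD('n))) * B)"
proof -
  have B0: "0 \<le> B" using b norm_ge_zero order_trans by blast
  have hs: "h \<le> sqrt h" using h by (simp add: real_le_rsqrt power2_eq_square mult_left_le)
  have "norm (euler_step h b w js) \<le> h * norm b + sqrt (h * real CARD('n)) * norm (w (fst js))"
    unfolding euler_step_def by (rule order_trans[OF norm_triangle_ineq]) (use h in \<open>simp add: abs_mult\<close>)
  also have "\<dots> \<le> sqrt h * B + sqrt (h * real CARD('n)) * B"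
    using hs b w B0 h by (intro add_mono mult_mono) auto
  also have "\<dots> = sqrt h * ((1 + sqrt (real CARD('n))) * B)" by (simp add: real_sqrt_mult algebra_simps)
  finally show ?thesis .
qed

text \<open>The increment is split into a time increment at fixed x, treated by the mean value
  theorem, and a space increment at time s + h, treated by Taylor expansion. Averaging over
  \<open>js\<close> removes the first-order noise and turns the second-order noise into the trace
  term. The four errors on the right come from the moduli of continuity of the time derivative, the
  gradient and the Hessian, and from the part of the quadratic form that is quadratic in the drift.
  The assumption on \<open>\<delta>\<close> keeps every intermediate point within \<delta> of (t,
  x).\<close>

lemma consistency_interior:
  fixes \<phi> :: "real \<Rightarrow> real ^ 'n \<Rightarrow> real"
  assumes \<phi>: "\<phi> \<in> C12c T" and h: "0 < h" "h \<le> 1" and st: "s \<le> t" "t \<le> s + h"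
    and e1: "e1 > 0"
    and ut: "\<And>p q. dist p q < \<delta> \<Longrightarrow> \<bar>deriv (\<lambda>s. \<phi> s (snd p)) (fst p) - deriv (\<lambda>s. \<phi> s (snd q)) (fst q)\<bar> \<le> e1"
    and ug: "\<And>p q. dist p q < \<delta> \<Longrightarrow> norm (grad (\<phi> (fst p)) (snd p) - grad (\<phi> (fst q)) (snd q)) \<le> e1"
    and uh: "\<And>p q. dist p q < \<delta> \<Longrightarrow> norm (hessian (\<phi> (fst p)) (snd p) - hessian (\<phi> (fst q)) (snd q)) \<le> e1"
    and CH: "\<And>t x. norm (hessian (\<phi> t) x) \<le> CH"
    and b: "norm b \<le> B" and w: "\<And>j. norm (w j) \<le> B" and Z: "Z = (1 + sqrt (real CARD('n))) * B"
    and \<delta>: "sqrt h * Z + h < \<delta>"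
  defines "d \<equiv> real CARD('n) ^ 2"
  shows "\<bar>avg (\<lambda>js. \<phi> (s + h) (x + euler_step h b w js)) - \<phi> s x - h * (deriv (\<lambda>r. \<phi> r x) t + generator b (outer_sum w) (\<phi> t) x)\<bar>
    \<le> h * (e1 + e1 * B + d * e1 * Z\<^sup>2 + h * d * CH * B\<^sup>2)"
proof -
  have B0: "0 \<le> B" using b norm_ge_zero order_trans by blast
  have Z0: "0 \<le> Z" using B0 Z by simp
  have CH0: "0 \<le> CH" using CH[of 0 0] norm_ge_zero order_trans by blast
  have d0: "0 \<le> d" by (simp add: d_def)
  have stpZ: "norm (euler_step h b w js) \<le> sqrt h * Z" for js unfolding Z by (rule norm_euler_step_le[OF h b w])
  have diff: "\<phi> r differentiable (at y)" "grad (\<phi> r) differentiable (at y)" "(\<lambda>s. \<phi> s y) differentiable (at r)" for r y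
    using \<phi> by (auto simp: C12c_def)
  define H where "H = hessian (\<phi> t) x"
  define g where "g = grad (\<phi> (s + h)) x"
  have one: "\<bar>\<phi> (s + h) (x + euler_step h b w js) - \<phi> (s + h) x - g \<bullet> euler_step h b w js - 1 / 2 * (euler_step h b w js \<bullet> (H *v euler_step h b w js))\<bar>
      \<le> d * e1 * (h * Z\<^sup>2)" for js
  proof -
    let ?z = "euler_step h b w js"
    obtain c where c: "0 < c" "c < 1" "\<phi> (s + h) (x + ?z) = \<phi> (s + h) x + g \<bullet> ?z + 1 / 2 * (?z \<bullet> (hessian (\<phi> (s + h)) (x + c *\<^sub>R ?z) *v ?z))"
      using second_order_expansion[of "\<phi> (s + h)" x ?z] diff unfolding g_def by blast
    let ?H = "hessian (\<phi> (s + h)) (x + c *\<^sub>R ?z)"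
    have "dist (s + h, x + c *\<^sub>R ?z) (t, x) \<le> dist (s + h) t + dist (x + c *\<^sub>R ?z) x"
      unfolding dist_Pair_Pair by (rule sqrt_sum_squares_le_sum) auto
    also have "\<dots> \<le> h + 1 * norm ?z"
    proof (rule add_mono)
      show "dist (s + h) t \<le> h" using st by (simp add: dist_real_def)
      have "dist (x + c *\<^sub>R ?z) x = c * norm ?z" using c by (simp add: dist_norm)
      then show "dist (x + c *\<^sub>R ?z) x \<le> 1 * norm ?z" using mult_right_mono[of c 1 "norm ?z"] c by simp
    qed
    also have "\<dots> < \<delta>" using stpZ[of js] \<delta> by linarith
    finally have "norm (?H - H) \<le> e1" using uh[of "(s + h, x + c *\<^sub>R ?z)" "(t, x)"] by (simp add: H_def)
    have half: "\<bar>a + k + 1 / 2 * P - a - k - 1 / 2 * Q\<bar> = 1 / 2 * \<bar>P - Q\<bar>" for a k P Q :: real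
      by (simp add: abs_if)
    have "\<bar>\<phi> (s + h) (x + ?z) - \<phi> (s + h) x - g \<bullet> ?z - 1 / 2 * (?z \<bullet> (H *v ?z))\<bar> = 1 / 2 * \<bar>?z \<bullet> ((?H - H) *v ?z)\<bar>"
      unfolding c(3) matrix_vector_mult_diff_rdistrib inner_diff_right by (rule half)
    also have "\<dots> \<le> 1 / 2 * (d * norm (?H - H) * (norm ?z)\<^sup>2)"
      unfolding d_def by (intro mult_left_mono quadratic_form_bound) auto
    also have "\<dots> \<le> 1 * (d * e1 * (sqrt h * Z)\<^sup>2)"
      using \<open>norm (?H - H) \<le> e1\<close> stpZ[of js] d0 e1 by (intro mult_mono power_mono) auto
    also have "\<dots> = d * e1 * (h * Z\<^sup>2)" using h by (simp add: power_mult_distrib)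
    finally show ?thesis .
  qed
  define G where "G js = g \<bullet> euler_step h b w js + 1 / 2 * (euler_step h b w js \<bullet> (H *v euler_step h b w js))" for js
  have a1: "\<bar>avg (\<lambda>js. \<phi> (s + h) (x + euler_step h b w js) - \<phi> (s + h) x - G js)\<bar> \<le> d * e1 * (h * Z\<^sup>2)"
  proof -
    have "\<bar>avg (\<lambda>js. \<phi> (s + h) (x + euler_step h b w js) - \<phi> (s + h) x - G js)\<bar> \<le> avg (\<lambda>js::'n \<times> bool. d * e1 * (h * Z\<^sup>2))"
      by (rule order_trans[OF avg_abs], rule avg_mono) (use one in \<open>simp add: G_def algebra_simps\<close>)
    then show ?thesis by simp
  qed
  have a2: "avg (\<lambda>js. \<phi> (s + h) (x + euler_step h b w js) - \<phi> (s + h) x - G js) = avg (\<lambda>js. \<phi> (s + h) (x + euler_step h b w js)) - \<phi> (s + h) x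
      - h * (g \<bullet> b) - 1 / 2 * (h\<^sup>2 * (b \<bullet> (H *v b)) + h * (\<Sum>j\<in>UNIV. w j \<bullet> (H *v w j)))"
    unfolding G_def avg_linear avg_const avg_linear_form avg_quadratic_form[OF less_imp_le[OF h(1)]] by simp
  have a3: "\<bar>\<phi> (s + h) x - \<phi> s x - h * deriv (\<lambda>r. \<phi> r x) t\<bar> \<le> h * e1"
  proof -
    have D: "((\<lambda>r. \<phi> r x) has_real_derivative deriv (\<lambda>r. \<phi> r x) r) (at r)" for r
      using diff(3)[of x r] by (simp add: DERIV_deriv_iff_real_differentiable)
    obtain z where z: "s < z" "z < s + h" "\<phi> (s + h) x - \<phi> s x = (s + h - s) * deriv (\<lambda>r. \<phi> r x) z"
      using MVT2[of s "s + h" "\<lambda>r. \<phi> r x" "deriv (\<lambda>r. \<phi> r x)"] h D by auto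
    have "dist (z, x) (t, x) < \<delta>" using z st \<delta> Z0 h unfolding dist_Pair_Pair
      by (simp add: dist_real_def) (smt (verit) mult_nonneg_nonneg real_sqrt_ge_zero)
    from ut[OF this] have "\<bar>deriv (\<lambda>r. \<phi> r x) z - deriv (\<lambda>r. \<phi> r x) t\<bar> \<le> e1" by simp
    then have "h * \<bar>deriv (\<lambda>r. \<phi> r x) z - deriv (\<lambda>r. \<phi> r x) t\<bar> \<le> h * e1" using h by (intro mult_left_mono) auto
    then show ?thesis unfolding z(3) using h by (simp add: abs_mult flip: right_diff_distrib)
  qed
  have a4: "\<bar>h * (g \<bullet> b) - h * (grad (\<phi> t) x \<bullet> b)\<bar> \<le> h * (e1 * B)"
  proof -
    have "dist (s + h, x) (t, x) < \<delta>" using st \<delta> Z0 h unfolding dist_Pair_Pair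
      by (simp add: dist_real_def) (smt (verit) mult_nonneg_nonneg real_sqrt_ge_zero)
    from ug[OF this] have n: "norm (g - grad (\<phi> t) x) \<le> e1" by (simp add: g_def)
    have "\<bar>(g - grad (\<phi> t) x) \<bullet> b\<bar> \<le> norm (g - grad (\<phi> t) x) * norm b" by (rule Cauchy_Schwarz_ineq2)
    also have "\<dots> \<le> e1 * B" using n b e1 by (intro mult_mono) auto
    finally have "h * \<bar>(g - grad (\<phi> t) x) \<bullet> b\<bar> \<le> h * (e1 * B)" using h by (intro mult_left_mono) auto
    then show ?thesis using h by (simp add: abs_mult inner_diff_left flip: right_diff_distrib)
  qed
  have a5: "\<bar>1 / 2 * (h\<^sup>2 * (b \<bullet> (H *v b)))\<bar> \<le> h * (h * d * CH * B\<^sup>2)"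
  proof -
    have "\<bar>b \<bullet> (H *v b)\<bar> \<le> d * norm H * (norm b)\<^sup>2" unfolding d_def by (rule quadratic_form_bound)
    also have "\<dots> \<le> d * CH * B\<^sup>2" using CH b d0 CH0 unfolding H_def by (intro mult_mono power_mono) auto
    finally have "1 / 2 * h\<^sup>2 * \<bar>b \<bullet> (H *v b)\<bar> \<le> 1 * h\<^sup>2 * (d * CH * B\<^sup>2)" by (intro mult_mono) auto
    then show ?thesis by (simp add: abs_mult power2_eq_square algebra_simps)
  qed
  have gen: "h * (deriv (\<lambda>r. \<phi> r x) t + generator b (outer_sum w) (\<phi> t) x)
     = h * deriv (\<lambda>r. \<phi> r x) t + h * (grad (\<phi> t) x \<bullet> b) + 1 / 2 * (h * (\<Sum>j\<in>UNIV. w j \<bullet> (H *v w j)))"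
    by (simp add: generator_def trace_outer_sum H_def algebra_simps)
  have rhs: "h * (e1 + e1 * B + d * e1 * Z\<^sup>2 + h * d * CH * B\<^sup>2) = h * e1 + h * (e1 * B) + d * e1 * (h * Z\<^sup>2) + h * (h * d * CH * B\<^sup>2)"
    by (simp add: algebra_simps)
  have split: "1 / 2 * (h\<^sup>2 * (b \<bullet> (H *v b)) + h * (\<Sum>j\<in>UNIV. w j \<bullet> (H *v w j)))
    = 1 / 2 * (h\<^sup>2 * (b \<bullet> (H *v b))) + 1 / 2 * (h * (\<Sum>j\<in>UNIV. w j \<bullet> (H *v w j)))" by simp
  show ?thesis unfolding gen rhs using a1[unfolded a2 split] a3 a4 a5 by linarith
qed

lemma C12c_continuous:
  assumes "\<phi> \<in> C12c T"
  shows "continuous_on UNIV (\<lambda>p. \<phi> (fst p) (snd p))" "continuous_on UNIV (\<lambda>p. deriv (\<lambda>s. \<phi> s (snd p)) (fst p))"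
    "continuous_on UNIV (\<lambda>p. grad (\<phi> (fst p)) (snd p))" "continuous_on UNIV (\<lambda>p. hessian (\<phi> (fst p)) (snd p))"
  using assms unfolding C12c_def split_beta by auto

text \<open>The coefficients grow with x, so uniformity in x needs two regimes. For |x| \<le> 2 R +
  1 they are bounded and \<open>consistency_interior\<close> applies. Beyond, a step has length at
  most (1 + |x|) / 2, so neither its start nor its end comes within distance R of the origin, and
  every term is 0. The threshold 2 R + 1 is the one above which |x| - (1 + |x|) / 2 exceeds
  R.\<close>

lemma consistency:
  fixes \<phi> :: "real \<Rightarrow> real ^ 'n \<Rightarrow> real"
  assumes \<phi>: "\<phi> \<in> C12c T" and c: "c \<ge> 0" and \<epsilon>: "\<epsilon> > 0"
  shows "\<exists>h0>0. \<forall>h s t x b w. 0 < h \<longrightarrow> h < h0 \<longrightarrow> s \<le> t \<longrightarrow> t \<le> s + h \<longrightarrow>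
     (norm b)\<^sup>2 \<le> c * (1 + (norm x)\<^sup>2) \<longrightarrow> (\<forall>j. (norm (w j))\<^sup>2 \<le> c * (1 + (norm x)\<^sup>2)) \<longrightarrow>
     \<bar>avg (\<lambda>js. \<phi> (s + h) (x + euler_step h b w js)) - \<phi> s x - h * (deriv (\<lambda>r. \<phi> r x) t + generator b (outer_sum w) (\<phi> t) x)\<bar> \<le> h * \<epsilon>"
proof -
  obtain R where R: "R > 0" "\<And>t x. norm (t, x) > R \<Longrightarrow> \<phi> t x = 0 \<and> deriv (\<lambda>s. \<phi> s x) t = 0 \<and> grad (\<phi> t) x = 0 \<and> hessian (\<phi> t) x = 0"
    using C12c_support[OF \<phi>] by metis
  note cont = C12c_continuous[OF \<phi>]
  have R': "norm p > R \<Longrightarrow> deriv (\<lambda>s. \<phi> s (snd p)) (fst p) = 0 \<and> grad (\<phi> (fst p)) (snd p) = 0 \<and> hessian (\<phi> (fst p)) (snd p) = 0" for p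
    using R(2)[of "fst p" "snd p"] by simp
  define d where "d = real CARD('n) ^ 2"
  define B where "B = sqrt (c * (1 + (2 * R + 1)\<^sup>2))"
  define Z where "Z = (1 + sqrt (real CARD('n))) * B"
  have B0: "0 \<le> B" "B\<^sup>2 = c * (1 + (2 * R + 1)\<^sup>2)" using c by (auto simp: B_def)
  have Z0: "0 \<le> Z" using B0 by (simp add: Z_def)
  have d0: "0 \<le> d" by (simp add: d_def)
  \<comment> \<open>Half of \<open>\<epsilon>\<close> is reserved for the three errors governed by
    moduli of continuity, the other half for the term \<open>h * d * CH * B\<^sup>2\<close>, which
    is made small through \<open>h\<close>.\<close>
  define e1 where "e1 = \<epsilon> / (2 * (1 + B + d * Z\<^sup>2))"
  have pos: "0 < 1 + B + d * Z\<^sup>2" using B0 d0 by (intro add_pos_nonneg) auto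
  have e1: "e1 > 0" using \<epsilon> pos by (simp add: e1_def)
  have e1': "e1 + e1 * B + d * e1 * Z\<^sup>2 = \<epsilon> / 2"
  proof -
    have "e1 + e1 * B + d * e1 * Z\<^sup>2 = e1 * (1 + B + d * Z\<^sup>2)" by (simp add: algebra_simps)
    also have "\<dots> = \<epsilon> / 2" using pos by (simp add: e1_def field_simps)
    finally show ?thesis .
  qed
  obtain \<delta>1 where \<delta>1: "\<delta>1 > 0" "\<And>p q. dist p q < \<delta>1 \<Longrightarrow> dist (deriv (\<lambda>s. \<phi> s (snd p)) (fst p)) (deriv (\<lambda>s. \<phi> s (snd q)) (fst q)) < e1"
    using uniformly_continuous_compact_support(1)[OF cont(2), of R] R' e1 unfolding uniformly_continuous_on_def by (metis UNIV_I)
  obtain \<delta>2 where \<delta>2: "\<delta>2 > 0" "\<And>p q. dist p q < \<delta>2 \<Longrightarrow> dist (grad (\<phi> (fst p)) (snd p)) (grad (\<phi> (fst q)) (snd q)) < e1"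
    using uniformly_continuous_compact_support(1)[OF cont(3), of R] R' e1 unfolding uniformly_continuous_on_def by (metis UNIV_I)
  obtain \<delta>3 where \<delta>3: "\<delta>3 > 0" "\<And>p q. dist p q < \<delta>3 \<Longrightarrow> dist (hessian (\<phi> (fst p)) (snd p)) (hessian (\<phi> (fst q)) (snd q)) < e1"
    using uniformly_continuous_compact_support(1)[OF cont(4), of R] R' e1 unfolding uniformly_continuous_on_def by (metis UNIV_I)
  obtain CH where "\<forall>p. norm (hessian (\<phi> (fst p)) (snd p)) \<le> CH"
    using uniformly_continuous_compact_support(2)[OF cont(4), of R] R' by blast
  then have CH: "\<And>t x. norm (hessian (\<phi> t) x) \<le> CH" by (metis fst_conv snd_conv)
  have CH0: "0 \<le> CH" using CH[of 0 0] norm_ge_zero order_trans by blast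
  define \<delta> where "\<delta> = min \<delta>1 (min \<delta>2 \<delta>3)"
  have \<delta>: "\<delta> > 0" using \<delta>1 \<delta>2 \<delta>3 by (simp add: \<delta>_def)
  define Y where "Y = (1 + sqrt (real CARD('n))) * sqrt c"
  have Y0: "0 \<le> Y" using c by (simp add: Y_def)
  have lim: "((\<lambda>h. sqrt h * Z + h) \<longlongrightarrow> sqrt 0 * Z + 0) (at_right 0)" "((\<lambda>h. sqrt h * Y) \<longlongrightarrow> sqrt 0 * Y) (at_right 0)"
    "((\<lambda>h. h * d * CH * B\<^sup>2) \<longlongrightarrow> 0 * d * CH * B\<^sup>2) (at_right 0)" "((\<lambda>h::real. h) \<longlongrightarrow> 0) (at_right 0)"
    by (intro tendsto_intros)+
  have "\<forall>\<^sub>F h in at_right 0. sqrt h * Z + h < \<delta> \<and> sqrt h * Y < 1/2 \<and> h * d * CH * B\<^sup>2 < \<epsilon> / 2 \<and> h < 1"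
    using order_tendstoD(2)[OF lim(1), of \<delta>] order_tendstoD(2)[OF lim(2), of "1/2"] order_tendstoD(2)[OF lim(3), of "\<epsilon> / 2"]
      order_tendstoD(2)[OF lim(4), of 1] \<delta> \<epsilon> by (auto intro!: eventually_conj)
  then obtain h0 where h0: "h0 > 0" and H: "\<And>h. 0 < h \<Longrightarrow> h < h0 \<Longrightarrow> sqrt h * Z + h < \<delta> \<and> sqrt h * Y < 1/2 \<and> h * d * CH * B\<^sup>2 < \<epsilon> / 2 \<and> h < 1"
    unfolding eventually_at_right_field by auto
  show ?thesis
  proof (intro exI conjI allI impI)
    show "h0 > 0" by (rule h0)
    fix h s t :: real and x b :: "real ^ 'n" and w :: "'n \<Rightarrow> real ^ 'n"
    assume h: "0 < h" "h < h0" and st: "s \<le> t" "t \<le> s + h"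
      and b: "(norm b)\<^sup>2 \<le> c * (1 + (norm x)\<^sup>2)" and w: "\<forall>j. (norm (w j))\<^sup>2 \<le> c * (1 + (norm x)\<^sup>2)"
    note Hh = H[OF h]
    let ?E = "\<bar>avg (\<lambda>js. \<phi> (s + h) (x + euler_step h b w js)) - \<phi> s x - h * (deriv (\<lambda>r. \<phi> r x) t + generator b (outer_sum w) (\<phi> t) x)\<bar>"
    show "?E \<le> h * \<epsilon>"
    proof (cases "norm x \<le> 2 * R + 1")
      case True
      have "(norm x)\<^sup>2 \<le> (2 * R + 1)\<^sup>2" using True by (intro power_mono) auto
      then have "c * (1 + (norm x)\<^sup>2) \<le> B\<^sup>2" unfolding B0 using c by (intro mult_left_mono) auto
      then have bB: "norm b \<le> B" "\<And>j. norm (w j) \<le> B"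
        using b w B0 by (auto intro!: power2_le_imp_le[of _ B] intro: order_trans)
      have "?E \<le> h * (e1 + e1 * B + d * e1 * Z\<^sup>2 + h * d * CH * B\<^sup>2)"
        unfolding d_def
      proof (rule consistency_interior[OF \<phi> h(1) _ st e1 _ _ _ CH bB Z_def])
        show "sqrt h * Z + h < \<delta>" "h \<le> 1" using Hh by auto
        show "\<bar>deriv (\<lambda>s. \<phi> s (snd p)) (fst p) - deriv (\<lambda>s. \<phi> s (snd q)) (fst q)\<bar> \<le> e1" if "dist p q < \<delta>" for p q
          using \<delta>1(2)[of p q] that by (simp add: \<delta>_def dist_real_def)
        show "norm (grad (\<phi> (fst p)) (snd p) - grad (\<phi> (fst q)) (snd q)) \<le> e1" if "dist p q < \<delta>" for p q
          using \<delta>2(2)[of p q] that by (simp add: \<delta>_def dist_norm)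
        show "norm (hessian (\<phi> (fst p)) (snd p) - hessian (\<phi> (fst q)) (snd q)) \<le> e1" if "dist p q < \<delta>" for p q
          using \<delta>3(2)[of p q] that by (simp add: \<delta>_def dist_norm)
      qed
      also have "\<dots> \<le> h * \<epsilon>" unfolding e1' using Hh h by (intro mult_left_mono) auto
      finally show ?thesis .
    next
      case False
      have le: "c * (1 + (norm x)\<^sup>2) \<le> (sqrt c * (1 + norm x))\<^sup>2"
        using c by (simp add: power_mult_distrib power2_sum mult_left_mono)
      have sc: "0 \<le> sqrt c * (1 + norm x)" using c by simp
      have bB: "norm b \<le> sqrt c * (1 + norm x)" "norm (w j) \<le> sqrt c * (1 + norm x)" for j
        using power2_le_imp_le[OF order_trans[OF b le] sc] power2_le_imp_le[OF order_trans[OF w[rule_format] le] sc] by auto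
      have far: "norm (r, x + euler_step h b w js) > R" for r js
      proof -
        have "norm (euler_step h b w js) \<le> sqrt h * ((1 + sqrt (real CARD('n))) * (sqrt c * (1 + norm x)))"
          using Hh h by (intro norm_euler_step_le bB) auto
        also have "\<dots> = sqrt h * Y * (1 + norm x)" by (simp add: Y_def)
        also have "\<dots> \<le> 1 / 2 * (1 + norm x)" using Hh by (intro mult_right_mono) auto
        finally have 1: "norm (euler_step h b w js) \<le> 1 / 2 * (1 + norm x)" .
        have "norm x \<le> norm (x + euler_step h b w js) + norm (euler_step h b w js)"
          using norm_triangle_ineq4[of "x + euler_step h b w js" "euler_step h b w js"] by simp
        moreover have "norm (x + euler_step h b w js) \<le> norm (r, x + euler_step h b w js)" by (simp add: norm_Pair)
        ultimately show ?thesis using 1 False by argo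
      qed
      have x: "norm (r, x) > R" for r
      proof -
        have "norm x \<le> norm (r, x)" by (simp add: norm_Pair)
        then show ?thesis using False R(1) by argo
      qed
      have "?E = 0" using R(2)[OF far] R(2)[OF x] by (simp add: generator_def trace_def)
      then show ?thesis using h \<epsilon> by simp
    qed
  qed
qed

section \<open>Moments of one Euler step\<close>

lemma avg_norm_square:
  fixes w :: "'n::finite \<Rightarrow> real ^ 'n"
  assumes "h \<ge> 0"
  shows "avg (\<lambda>js. (norm (y + euler_step h b w js))\<^sup>2) = (norm (y + h *\<^sub>R b))\<^sup>2 + h * (\<Sum>j\<in>UNIV. (norm (w j))\<^sup>2)"
proof -
  let ?r = "sqrt (h * real CARD('n))"
  have r: "?r * ?r = h * real CARD('n)" using assms by simp
  have *: "(norm (y + euler_step h b w (j, True)))\<^sup>2 + (norm (y + euler_step h b w (j, False)))\<^sup>2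
     = 2 * (norm (y + h *\<^sub>R b))\<^sup>2 + 2 * (h * real CARD('n) * (norm (w j))\<^sup>2)" for j
  proof -
    have "(norm (y + euler_step h b w (j, True)))\<^sup>2 + (norm (y + euler_step h b w (j, False)))\<^sup>2
       = 2 * (norm (y + h *\<^sub>R b))\<^sup>2 + 2 * (?r * ?r * (norm (w j))\<^sup>2)"
      unfolding power2_norm_eq_inner euler_step_def by (simp add: inner_simps algebra_simps inner_commute)
    then show ?thesis unfolding r .
  qed
  show ?thesis unfolding avg_eq * by (simp add: sum.distrib add_divide_distrib sum_distrib_left[symmetric])
qed

lemma norm_add_scale_square:
  fixes y b :: "'a::real_inner"
  assumes "h \<ge> 0"
  shows "(norm (y + h *\<^sub>R b))\<^sup>2 \<le> (1 + h) * (norm y)\<^sup>2 + h * (1 + h) * (norm b)\<^sup>2"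
proof -
  have "2 * (norm y * norm b) \<le> (norm y)\<^sup>2 + (norm b)\<^sup>2" using sum_squares_bound[of "norm y" "norm b"] by (simp add: mult.assoc)
  then have "2 * (y \<bullet> b) \<le> (norm y)\<^sup>2 + (norm b)\<^sup>2" using norm_cauchy_schwarz[of y b] by linarith
  then have "h * (2 * (y \<bullet> b)) \<le> h * ((norm y)\<^sup>2 + (norm b)\<^sup>2)" using assms by (intro mult_left_mono)
  moreover have "(norm (y + h *\<^sub>R b))\<^sup>2 = (norm y)\<^sup>2 + h * (2 * (y \<bullet> b)) + h\<^sup>2 * (norm b)\<^sup>2"
    unfolding power2_norm_eq_inner by (simp add: inner_simps inner_commute algebra_simps power2_eq_square)
  ultimately show ?thesis by (simp add: algebra_simps power2_eq_square)
qed

text \<open>The parameter \<open>Q\<close> leaves room for two uses: with the second moment of the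
  law contained in it, as long as that moment is being estimated, and with Q = 1 + |x|^2 once the
  moment is bounded.\<close>

lemma avg_moment2:
  fixes w :: "'n::finite \<Rightarrow> real ^ 'n"
  assumes h: "0 \<le> h" "h \<le> T" and c: "c \<ge> 0" and Q: "(norm y)\<^sup>2 \<le> Q"
    and b: "(norm b)\<^sup>2 \<le> c * Q" and w: "\<And>j. (norm (w j))\<^sup>2 \<le> c * Q"
  shows "avg (\<lambda>js. (norm (y + euler_step h b w js))\<^sup>2) \<le> (norm y)\<^sup>2 + h * (1 + (1 + T + real CARD('n)) * c) * Q"
proof -
  have Q0: "0 \<le> Q" using Q zero_le_power2 order_trans by blast
  have "(\<Sum>j\<in>UNIV. (norm (w j))\<^sup>2) \<le> (\<Sum>j\<in>(UNIV::'n set). c * Q)" by (intro sum_mono w)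
  then have 1: "h * (\<Sum>j\<in>UNIV. (norm (w j))\<^sup>2) \<le> h * (real CARD('n) * (c * Q))" using h by (intro mult_left_mono) auto
  have "h * (1 + h) * (norm b)\<^sup>2 \<le> h * (1 + T) * (c * Q)" using h b by (intro mult_mono) auto
  moreover have "h * (norm y)\<^sup>2 \<le> h * Q" using h Q by (intro mult_left_mono)
  ultimately show ?thesis unfolding avg_norm_square[OF h(1)] using norm_add_scale_square[OF h(1), of y b] 1
    by (simp add: algebra_simps)
qed

text \<open>Here \<open>y\<close> is the position relative to an arbitrary centre and is not bounded
  by \<open>Q\<close>, so its square keeps the separate factor 1 + h.\<close>

lemma avg_moment_shifted:
  fixes w :: "'n::finite \<Rightarrow> real ^ 'n"
  assumes h: "0 \<le> h" "h \<le> T" and c: "c \<ge> 0" and b: "(norm b)\<^sup>2 \<le> c * Q" and w: "\<And>j. (norm (w j))\<^sup>2 \<le> c * Q"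
  shows "avg (\<lambda>js. (norm (y + euler_step h b w js))\<^sup>2) \<le> (1 + h) * (norm y)\<^sup>2 + h * ((1 + T + real CARD('n)) * c) * Q"
proof -
  have "(\<Sum>j\<in>UNIV. (norm (w j))\<^sup>2) \<le> (\<Sum>j\<in>(UNIV::'n set). c * Q)" by (intro sum_mono w)
  then have 1: "h * (\<Sum>j\<in>UNIV. (norm (w j))\<^sup>2) \<le> h * (real CARD('n) * (c * Q))" using h by (intro mult_left_mono) auto
  have "h * (1 + h) * (norm b)\<^sup>2 \<le> h * (1 + T) * (c * Q)" using h b by (intro mult_mono) auto
  then show ?thesis unfolding avg_norm_square[OF h(1)] using norm_add_scale_square[OF h(1), of y b] 1
    by (simp add: algebra_simps)
qed

text \<open>Adding the contributions of the two signs cancels the odd powers of the noise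
  \<open>v\<close>, and the Cauchy-Schwarz inequality bounds the square of the mixed term
  \<open>i\<close> by A V. As V is of order h, the growth factor is 1 plus a multiple of h; higher
  powers of h are absorbed through h \<le> T.\<close>

lemma avg_moment4:
  fixes w :: "'n::finite \<Rightarrow> real ^ 'n"
  assumes h: "0 \<le> h" "h \<le> T" and c: "c \<ge> 0"
    and b: "(norm b)\<^sup>2 \<le> c * (1 + (norm x)\<^sup>2)" and w: "\<And>j. (norm (w j))\<^sup>2 \<le> c * (1 + (norm x)\<^sup>2)"
  defines "D \<equiv> real CARD('n)" and "C0 \<equiv> 1 + (1 + T) * c"
  shows "avg (\<lambda>js. (1 + (norm (x + euler_step h b w js))\<^sup>2)\<^sup>2)
    \<le> (1 + h * (2 * C0 + T * C0\<^sup>2 + 6 * (1 + T * C0) * (D * c) + T * (D * c)\<^sup>2)) * (1 + (norm x)\<^sup>2)\<^sup>2"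
proof -
  let ?q = "1 + (norm x)\<^sup>2" and ?a = "x + h *\<^sub>R b"
  let ?A = "1 + (norm ?a)\<^sup>2"
  have T: "0 \<le> T" using h by linarith
  have q: "1 \<le> ?q" by simp
  have D: "0 \<le> D" by (simp add: D_def)
  have C0: "0 \<le> C0" using T c by (simp add: C0_def)
  have A: "?A \<le> (1 + h * C0) * ?q"
  proof -
    have "h * (1 + h) * (norm b)\<^sup>2 \<le> h * (1 + T) * (c * ?q)" using h b by (intro mult_mono) auto
    then have "?A \<le> 1 + (1 + h) * (norm x)\<^sup>2 + h * (1 + T) * (c * ?q)" using norm_add_scale_square[OF h(1), of x b] by linarith
    also have "\<dots> \<le> ?q + h * ?q + h * ((1 + T) * c) * ?q" using h by (simp add: algebra_simps)
    also have "\<dots> = (1 + h * C0) * ?q" by (simp add: C0_def algebra_simps)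
    finally show ?thesis .
  qed
  have A0: "0 \<le> ?A" by simp
  define M where "M = (1 + h * C0)\<^sup>2 + 6 * (1 + h * C0) * (h * (D * c)) + (h * (D * c))\<^sup>2"
  have pair: "(1 + (norm (x + euler_step h b w (j, True)))\<^sup>2)\<^sup>2 + (1 + (norm (x + euler_step h b w (j, False)))\<^sup>2)\<^sup>2 \<le> 2 * (M * ?q\<^sup>2)" for j
  proof -
    define v where "v = sqrt (h * real CARD('n)) *\<^sub>R w j"
    have e: "x + euler_step h b w (j, True) = ?a + v" "x + euler_step h b w (j, False) = ?a - v" by (simp_all add: euler_step_def v_def)
    define V where "V = (norm v)\<^sup>2"
    have V: "0 \<le> V" "V \<le> h * (D * c) * ?q"
    proof -
      have "V = (h * D) * (norm (w j))\<^sup>2" using h by (simp add: V_def v_def power_mult_distrib D_def)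
      also have "\<dots> \<le> (h * D) * (c * ?q)" using w h D by (intro mult_left_mono) auto
      finally show "V \<le> h * (D * c) * ?q" by (simp add: mult_ac)
    qed (simp add: V_def)
    define i where "i = ?a \<bullet> v"
    have n: "1 + (norm (?a + v))\<^sup>2 = ?A + V + 2 * i" "1 + (norm (?a - v))\<^sup>2 = ?A + V - 2 * i"
      unfolding V_def i_def power2_norm_eq_inner by (simp_all add: inner_simps inner_commute algebra_simps)
    have i2: "i\<^sup>2 \<le> ?A * V"
    proof -
      have "i\<^sup>2 \<le> (norm ?a)\<^sup>2 * V" unfolding i_def V_def power2_norm_eq_inner by (rule Cauchy_Schwarz_ineq)
      also have "\<dots> \<le> ?A * V" using V by (intro mult_right_mono) auto
      finally show ?thesis .
    qed
    have "(?A + V + 2 * i)\<^sup>2 + (?A + V - 2 * i)\<^sup>2 = 2 * (?A\<^sup>2 + 2 * (?A * V) + V\<^sup>2 + 4 * i\<^sup>2)"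
      by (simp add: power2_eq_square algebra_simps)
    also have "\<dots> \<le> 2 * (?A\<^sup>2 + 6 * (?A * V) + V\<^sup>2)" using i2 by (simp add: mult.commute)
    also have "\<dots> \<le> 2 * (((1 + h * C0) * ?q)\<^sup>2 + 6 * (((1 + h * C0) * ?q) * (h * (D * c) * ?q)) + (h * (D * c) * ?q)\<^sup>2)"
      using A A0 V h C0 D c by (intro mult_left_mono add_mono mult_mono power_mono) auto
    also have "\<dots> = 2 * (M * ?q\<^sup>2)" by (simp add: M_def power2_eq_square algebra_simps)
    finally show ?thesis unfolding e n .
  qed
  have "avg (\<lambda>js. (1 + (norm (x + euler_step h b w js))\<^sup>2)\<^sup>2) \<le> (\<Sum>j\<in>(UNIV::'n set). 2 * (M * ?q\<^sup>2)) / real (2 * CARD('n))"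
    unfolding avg_eq by (intro divide_right_mono sum_mono pair) auto
  also have "\<dots> = M * ?q\<^sup>2" by simp
  also have "\<dots> \<le> (1 + h * (2 * C0 + T * C0\<^sup>2 + 6 * (1 + T * C0) * (D * c) + T * (D * c)\<^sup>2)) * ?q\<^sup>2"
  proof (rule mult_right_mono)
    have "h * (h * C0\<^sup>2) \<le> h * (T * C0\<^sup>2)" "h * (h * (D * c)\<^sup>2) \<le> h * (T * (D * c)\<^sup>2)"
      using h by (auto intro!: mult_left_mono mult_right_mono)
    moreover have "6 * (1 + h * C0) * (h * (D * c)) \<le> 6 * (1 + T * C0) * (h * (D * c))"
      using h C0 D c by (intro mult_right_mono mult_left_mono add_left_mono) auto
    moreover have "M = 1 + 2 * (h * C0) + h * (h * C0\<^sup>2) + 6 * (1 + h * C0) * (h * (D * c)) + h * (h * (D * c)\<^sup>2)"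
      by (simp add: M_def power2_eq_square algebra_simps)
    moreover have "1 + h * (2 * C0 + T * C0\<^sup>2 + 6 * (1 + T * C0) * (D * c) + T * (D * c)\<^sup>2)
      = 1 + 2 * (h * C0) + h * (T * C0\<^sup>2) + 6 * (1 + T * C0) * (h * (D * c)) + h * (T * (D * c)\<^sup>2)"
      by (simp add: algebra_simps)
    ultimately show "M \<le> 1 + h * (2 * C0 + T * C0\<^sup>2 + 6 * (1 + T * C0) * (D * c) + T * (D * c)\<^sup>2)" by linarith
  qed simp
  finally show ?thesis .
qed

section \<open>Random walks with linear growth\<close>

text \<open>Evaluating a selection at grid points makes it countably valued in space, hence Borel without any
  measurable selection theorem.\<close>

definition grid_point :: "real \<Rightarrow> real ^ 'n \<Rightarrow> real ^ 'n" where
  "grid_point h x = (\<chi> i. h * of_int \<lfloor>x $ i / h\<rfloor>)"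

lemma grid_point_dist:
  fixes x :: "real ^ 'n"
  assumes "h > 0" shows "norm (grid_point h x - x) \<le> real CARD('n) * h"
proof -
  have "\<bar>(grid_point h x - x) $ i\<bar> \<le> h" for i
  proof -
    have "\<bar>of_int \<lfloor>x $ i / h\<rfloor> - x $ i / h\<bar> \<le> 1" by linarith
    then have "h * \<bar>of_int \<lfloor>x $ i / h\<rfloor> - x $ i / h\<bar> \<le> h * 1" using assms by (intro mult_left_mono) auto
    moreover have "(grid_point h x - x) $ i = h * (of_int \<lfloor>x $ i / h\<rfloor> - x $ i / h)"
      using assms by (simp add: grid_point_def algebra_simps)
    ultimately show ?thesis using assms by (simp add: abs_mult)
  qed
  then have "(\<Sum>i\<in>UNIV. \<bar>(grid_point h x - x) $ i\<bar>) \<le> (\<Sum>i\<in>(UNIV::'n set). h)" by (intro sum_mono)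
  then show ?thesis using norm_le_l1_cart[of "grid_point h x - x"] by simp
qed

lemma measurable_grid_point_compose:
  fixes g :: "real ^ 'n \<Rightarrow> 'b::topological_space"
  shows "(\<lambda>x. g (grid_point h x)) \<in> borel_measurable borel"
proof -
  define G where "G x = (\<chi> i. \<lfloor>x $ i / h\<rfloor>)" for x :: "real ^ 'n"
  have "G \<in> measurable borel (count_space UNIV)"
    unfolding measurable_count_space_eq_countable[OF countableI_type]
  proof (intro conjI ballI)
    fix a :: "int ^ 'n"
    have "G -` {a} \<inter> space borel = {x\<in>space borel. \<forall>i. \<lfloor>x $ i / h\<rfloor> = a $ i}"
      by (auto simp: G_def vec_eq_iff)
    also have "\<dots> \<in> sets borel" by measurable
    finally show "G -` {a} \<inter> space borel \<in> sets borel" .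
  qed simp
  moreover have "(\<lambda>z. g (\<chi> i. h * of_int (z $ i))) \<in> measurable (count_space UNIV) borel" by simp
  ultimately have "(\<lambda>x. g (\<chi> i. h * of_int (G x $ i))) \<in> borel_measurable borel" by (rule measurable_compose)
  then show ?thesis by (simp add: grid_point_def G_def)
qed

definition random_step :: "('n::finite \<times> bool \<Rightarrow> real ^ 'n \<Rightarrow> real ^ 'n) \<Rightarrow> (real ^ 'n) measure \<Rightarrow> (real ^ 'n) measure" where
  "random_step S m = distr (m \<Otimes>\<^sub>M measure_pmf (pmf_of_set UNIV)) borel (\<lambda>p. S (snd p) (fst p))"

lemma avg_integral: "(\<integral>js. f js \<partial>measure_pmf (pmf_of_set UNIV)) = avg f"
  for f :: "'n::finite \<times> bool \<Rightarrow> real"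
  by (subst integral_pmf_of_set) (auto simp: avg_def card_cartesian_product simp flip: UNIV_Times_UNIV)

lemma random_step:
  fixes S :: "'n::finite \<times> bool \<Rightarrow> real ^ 'n \<Rightarrow> real ^ 'n"
  assumes m: "prob_space m" "sets m = sets borel" and S: "\<And>js. S js \<in> borel_measurable borel"
  shows "prob_space (random_step S m)" "sets (random_step S m) = sets borel"
    and "f \<in> borel_measurable borel \<Longrightarrow> (\<And>js. integrable m (\<lambda>x. f (S js x) :: real)) \<Longrightarrow> integrable (random_step S m) f"
    and "f \<in> borel_measurable borel \<Longrightarrow> (\<And>js. integrable m (\<lambda>x. f (S js x) :: real)) \<Longrightarrow>
      (\<integral>x. f x \<partial>random_step S m) = (\<integral>x. avg (\<lambda>js. f (S js x)) \<partial>m)"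
proof -
  let ?U = "measure_pmf (pmf_of_set UNIV) :: ('n \<times> bool) measure"
  interpret M: prob_space m by fact
  interpret U: prob_space ?U by (rule measure_pmf.prob_space_axioms)
  interpret P: pair_prob_space m ?U ..
  note [measurable_cong] = m(2)
  have T [measurable]: "(\<lambda>p. S (snd p) (fst p)) \<in> measurable (m \<Otimes>\<^sub>M ?U) borel"
  proof (rule measurable_compose_countable'[where I = UNIV and f = "\<lambda>js p. S js (fst p)" and g = snd])
    show "(\<lambda>p. S i (fst p)) \<in> borel_measurable (m \<Otimes>\<^sub>M ?U)" for i
      using S[of i] by measurable
    show "snd \<in> m \<Otimes>\<^sub>M ?U \<rightarrow>\<^sub>M count_space UNIV" by measurable
  qed (auto intro: countable_finite)
  show "prob_space (random_step S m)" unfolding random_step_def by (rule P.prob_space_distr[OF T])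
  show "sets (random_step S m) = sets borel" by (simp add: random_step_def)
  assume f [measurable]: "f \<in> borel_measurable borel" and i: "\<And>js. integrable m (\<lambda>x. f (S js x))"
  have I: "integrable (m \<Otimes>\<^sub>M ?U) (\<lambda>p. f (S (snd p) (fst p)))"
  proof (rule P.Fubini_integrable)
    show "(\<lambda>p. f (S (snd p) (fst p))) \<in> borel_measurable (m \<Otimes>\<^sub>M ?U)" by measurable
    have "integrable m (\<lambda>x. avg (\<lambda>js. norm (f (S js x))))"
      unfolding avg_def using i by auto
    then show "integrable m (\<lambda>x. \<integral>js. norm (f (S (snd (x, js)) (fst (x, js)))) \<partial>?U)"
      by (simp only: avg_integral fst_conv snd_conv)
    show "AE x in m. integrable ?U (\<lambda>js. f (S (snd (x, js)) (fst (x, js))))"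
      by (intro AE_I2 integrable_measure_pmf_finite) simp
  qed
  then show "integrable (random_step S m) f" unfolding random_step_def by (simp add: integrable_distr_eq)
  have "(\<integral>x. f x \<partial>random_step S m) = (\<integral>p. f (S (snd p) (fst p)) \<partial>(m \<Otimes>\<^sub>M ?U))"
    unfolding random_step_def by (simp add: integral_distr)
  also have "\<dots> = (\<integral>x. (\<integral>js. f (S js x) \<partial>?U) \<partial>m)" using P.integral_fst'[OF I] by simp
  finally show "(\<integral>x. f x \<partial>random_step S m) = (\<integral>x. avg (\<lambda>js. f (S js x)) \<partial>m)" by (simp only: avg_integral)
qed

section \<open>Markov chains under one-step moment bounds\<close>

text \<open>Collects what the estimates uniform in the mesh use. The maps \<open>S k\<close> may
  depend on the law \<open>m k\<close>, but the bounds involve positions only, so they can be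
  iterated separately for each starting point. \<open>increment\<close> allows an arbitrary centre
  \<open>z\<close>, since the induction over steps measures the distance to a fixed point.\<close>

locale walk =
  fixes S :: "nat \<Rightarrow> 'n::finite \<times> bool \<Rightarrow> real ^ 'n \<Rightarrow> real ^ 'n" and m :: "nat \<Rightarrow> (real ^ 'n) measure"
    and N :: nat and h C :: real
  assumes S_measurable [measurable]: "\<And>k js. S k js \<in> borel_measurable borel"
    and h: "h > 0" and C: "C \<ge> 0" and m0: "m 0 \<in> P2"
    and step: "\<And>k. k < N \<Longrightarrow> m (Suc k) = random_step (S k) (m k)"
    and growth2: "\<And>k x. k < N \<Longrightarrow> avg (\<lambda>js. 1 + (norm (S k js x))\<^sup>2) \<le> (1 + C * h) * (1 + (norm x)\<^sup>2)"
    and growth4: "\<And>k x. k < N \<Longrightarrow> avg (\<lambda>js. (1 + (norm (S k js x))\<^sup>2)\<^sup>2) \<le> (1 + C * h) * (1 + (norm x)\<^sup>2)\<^sup>2"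
    and increment: "\<And>k x z. k < N \<Longrightarrow> avg (\<lambda>js. (norm (S k js x - z))\<^sup>2) \<le> (1 + h) * (norm (x - z))\<^sup>2 + h * C * (1 + (norm x)\<^sup>2)"
begin

definition P :: "nat \<Rightarrow> (real ^ 'n \<Rightarrow> real) \<Rightarrow> real ^ 'n \<Rightarrow> real" where
  "P k f x = avg (\<lambda>js. f (S k js x))"

text \<open>The expectation of \<open>f\<close> after \<open>l\<close> steps started at time \<open>j\<close>, as a function of the starting point.\<close>

primrec U :: "nat \<Rightarrow> nat \<Rightarrow> (real ^ 'n \<Rightarrow> real) \<Rightarrow> real ^ 'n \<Rightarrow> real" where
  "U j 0 = (\<lambda>f. f)"
| "U j (Suc l) = (\<lambda>f. U j l (P (j + l) f))"

definition q :: "real ^ 'n \<Rightarrow> real" where "q x = 1 + (norm x)\<^sup>2"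

lemma q_ge1: "1 \<le> q x" by (simp add: q_def)

lemma P_mono: "(\<And>x. f x \<le> g x) \<Longrightarrow> P k f x \<le> P k g x"
  unfolding P_def by (rule avg_mono)

lemma U_mono: "(\<And>x. f x \<le> g x) \<Longrightarrow> U j l f x \<le> U j l g x"
proof (induction l arbitrary: f g)
  case (Suc l)
  show ?case unfolding U.simps by (rule Suc.IH, rule P_mono, rule Suc.prems)
qed simp

lemma U_cmult: "U j l (\<lambda>x. c * f x) x = c * U j l f x"
proof (induction l arbitrary: f)
  case (Suc l)
  have "P (j + l) (\<lambda>x. c * f x) = (\<lambda>x. c * P (j + l) f x)" by (simp add: P_def avg_linear fun_eq_iff)
  then show ?case using Suc by simp
qed simp

lemma U_add: "U j l (\<lambda>x. f x + g x) x = U j l f x + U j l g x"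
proof (induction l arbitrary: f g)
  case (Suc l)
  have "P (j + l) (\<lambda>x. f x + g x) = (\<lambda>x. P (j + l) f x + P (j + l) g x)" by (simp add: P_def avg_linear fun_eq_iff)
  then show ?case using Suc by simp
qed simp

lemma U_const: "U j l (\<lambda>x. c) x = c"
proof (induction l)
  case (Suc l)
  have "P (j + l) (\<lambda>x. c) = (\<lambda>x. c)" by (simp add: P_def fun_eq_iff)
  then show ?case using Suc by simp
qed simp

lemma measurable_P [measurable]:
  assumes [measurable]: "f \<in> borel_measurable borel" shows "P k f \<in> borel_measurable borel"
  unfolding P_def[abs_def] avg_def by measurable

lemma measurable_U [measurable]: "f \<in> borel_measurable borel \<Longrightarrow> U j l f \<in> borel_measurable borel"
  by (induction l arbitrary: f) (auto intro: measurable_P)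

lemma measurable_q [measurable]: "q \<in> borel_measurable borel"
  unfolding q_def[abs_def] by measurable

lemma U_growth:
  assumes v: "\<And>k x. k < N \<Longrightarrow> P k v x \<le> (1 + C * h) * v x" and v0: "\<And>x. 0 \<le> v x" and "j + l \<le> N"
  shows "U j l v x \<le> (1 + C * h) ^ l * v x"
  using assms(3)
proof (induction l)
  case (Suc l)
  have "U j (Suc l) v x \<le> U j l (\<lambda>x. (1 + C * h) * v x) x"
    using Suc.prems by (auto intro!: U_mono v)
  also have "\<dots> = (1 + C * h) * U j l v x" by (rule U_cmult)
  also have "\<dots> \<le> (1 + C * h) * ((1 + C * h) ^ l * v x)"
    using Suc C h by (intro mult_left_mono) auto
  finally show ?case by simp
qed simp

definition E where "E = exp (C * (real N * h))"
definition E2 where "E2 = exp (real N * h)"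

lemma power_le_exp:
  assumes "a \<ge> 0" "l \<le> N" shows "(1 + a * h) ^ l \<le> exp (a * (real N * h))"
proof -
  have "(1 + a * h) ^ l \<le> exp (a * h) ^ l" using assms h by (intro power_mono exp_ge_add_one_self) auto
  also have "\<dots> = exp (real l * (a * h))" by (simp add: exp_of_nat_mult)
  also have "\<dots> \<le> exp (real N * (a * h))" using assms h by (simp add: mult_right_mono)
  finally show ?thesis by (simp add: mult_ac)
qed

lemma E_pos: "1 \<le> E" "1 \<le> E2" unfolding E_def E2_def using C h by auto

lemma P_q: "k < N \<Longrightarrow> P k q x \<le> (1 + C * h) * q x"
  unfolding P_def q_def by (rule growth2)

lemma U_q: "j + l \<le> N \<Longrightarrow> U j l q x \<le> E * q x"
proof -
  assume jl: "j + l \<le> N"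
  have "U j l q x \<le> (1 + C * h) ^ l * q x" using P_q jl by (intro U_growth) (auto simp: q_def)
  also have "\<dots> \<le> E * q x" using power_le_exp[OF C, of l] jl q_ge1[of x] unfolding E_def by (intro mult_right_mono) auto
  finally show ?thesis .
qed

lemma U_q4: "j + l \<le> N \<Longrightarrow> U j l (\<lambda>x. (q x)\<^sup>2) x \<le> E * (q x)\<^sup>2"
proof -
  assume jl: "j + l \<le> N"
  have "U j l (\<lambda>x. (q x)\<^sup>2) x \<le> (1 + C * h) ^ l * (q x)\<^sup>2"
    using growth4 jl by (intro U_growth) (auto simp: q_def P_def)
  also have "\<dots> \<le> E * (q x)\<^sup>2" using power_le_exp[OF C, of l] jl unfolding E_def by (intro mult_right_mono) auto
  finally show ?thesis .
qed

text \<open>Every further step multiplies the squared distance to \<open>z\<close> by 1 + h and adds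
  h C times the expectation of \<open>q\<close>, which \<open>U_q\<close> bounds. The power of 1 + h
  on the second term gives the induction a closed form.\<close>

lemma U_increment: "j + l \<le> N \<Longrightarrow> U j l (\<lambda>y. (norm (y - z))\<^sup>2) x \<le> (1 + h) ^ l * (norm (x - z))\<^sup>2 + real l * h * C * E * (1 + h) ^ l * q x"
proof (induction l)
  case (Suc l)
  have "U j (Suc l) (\<lambda>y. (norm (y - z))\<^sup>2) x \<le> U j l (\<lambda>y. (1 + h) * (norm (y - z))\<^sup>2 + (h * C) * q y) x"
    using Suc.prems increment by (auto intro!: U_mono simp: P_def q_def)
  also have "\<dots> = (1 + h) * U j l (\<lambda>y. (norm (y - z))\<^sup>2) x + (h * C) * U j l q x"
    by (simp add: U_add U_cmult)
  also have "\<dots> \<le> (1 + h) * ((1 + h) ^ l * (norm (x - z))\<^sup>2 + real l * h * C * E * (1 + h) ^ l * q x) + (h * C) * (E * q x)"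
    using Suc h C U_q[of j l x] by (intro add_mono mult_left_mono) auto
  also have "(h * C) * (E * q x) \<le> (h * C) * (E * q x) * (1 + h) ^ Suc l"
    using mult_left_mono[OF one_le_power[of "1 + h" "Suc l"], of "(h * C) * (E * q x)"] h C E_pos q_ge1[of x] by simp
  finally show ?case by (simp add: algebra_simps)
qed simp

lemma integrable_growth:
  assumes "m k \<in> P2" "f \<in> borel_measurable borel" "\<And>x. \<bar>f x\<bar> \<le> c * q x"
  shows "integrable (m k) f"
proof -
  interpret prob_space "m k" using assms(1) by (simp add: P2_def)
  have s: "sets (m k) = sets borel" using assms(1) by (simp add: P2_def)
  have "integrable (m k) (\<lambda>x. c * q x)" using assms(1) by (simp add: P2_def q_def)
  then show ?thesis
    by (rule Bochner_Integration.integrable_bound)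
      (use assms(2,3) s in \<open>auto simp: measurable_cong_sets[OF s refl] intro!: order_trans[OF assms(3)] abs_ge_self\<close>)
qed

lemma q_le_P: "q (S k js x) \<le> real (2 * CARD('n)) * P k q x"
proof -
  have "q (S k js x) \<le> (\<Sum>js\<in>UNIV. q (S k js x))"
    using q_ge1 by (intro member_le_sum) (auto intro: order_trans[of 0 1])
  then show ?thesis by (simp add: P_def avg_def)
qed

lemma step_integral:
  assumes k: "k < N" and mk: "m k \<in> P2" and f [measurable]: "f \<in> borel_measurable borel" and b: "\<And>x. \<bar>f x\<bar> \<le> c * q x"
  shows "integrable (m (Suc k)) f" "(\<integral>x. f x \<partial>m (Suc k)) = (\<integral>x. P k f x \<partial>m k)"
    "\<And>x. \<bar>P k f x\<bar> \<le> (c * (1 + C * h)) * q x"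
proof -
  have c: "0 \<le> c" using b[of 0] by (simp add: q_def)
  have i: "integrable (m k) (\<lambda>x. f (S k js x))" for js
  proof (rule integrable_growth[OF mk])
    fix x
    have "\<bar>f (S k js x)\<bar> \<le> c * q (S k js x)" by (rule b)
    also have "\<dots> \<le> c * (real (2 * CARD('n)) * ((1 + C * h) * q x))"
      using q_le_P[of k js x] P_q[OF k, of x] c by (intro mult_left_mono order_trans[OF q_le_P]) auto
    finally show "\<bar>f (S k js x)\<bar> \<le> c * (real (2 * CARD('n)) * (1 + C * h)) * q x" by (simp add: mult_ac)
  qed measurable
  have p: "prob_space (m k)" "sets (m k) = sets borel" using mk by (auto simp: P2_def)
  show "integrable (m (Suc k)) f" "(\<integral>x. f x \<partial>m (Suc k)) = (\<integral>x. P k f x \<partial>m k)"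
    unfolding step[OF k] P_def using random_step(3,4)[OF p S_measurable f i] by auto
  fix x
  have "\<bar>P k f x\<bar> \<le> P k (\<lambda>x. \<bar>f x\<bar>) x" unfolding P_def by (rule avg_abs)
  also have "\<dots> \<le> P k (\<lambda>x. c * q x) x" by (intro P_mono b)
  also have "\<dots> = c * P k q x" by (simp add: P_def avg_linear)
  also have "\<dots> \<le> c * ((1 + C * h) * q x)" using P_q[OF k] c by (intro mult_left_mono)
  finally show "\<bar>P k f x\<bar> \<le> (c * (1 + C * h)) * q x" by simp
qed

lemma m_P2: "k \<le> N \<Longrightarrow> m k \<in> P2"
proof (induction k)
  case 0
  show ?case by (rule m0)
next
  case (Suc k)
  then have k: "k < N" and mk: "m k \<in> P2" by auto
  have p: "prob_space (m k)" "sets (m k) = sets borel" using mk by (auto simp: P2_def)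
  have "integrable (m (Suc k)) (\<lambda>x. (norm x)\<^sup>2)"
    by (rule step_integral(1)[OF k mk, where c = 1]) (auto simp: q_def)
  then show ?case using random_step(1,2)[OF p S_measurable] by (simp add: P2_def step[OF k])
qed

text \<open>Moves a test function from the law after \<open>l\<close> more steps back to the law at
  time \<open>j\<close>. Inequalities can then be proved for a deterministic starting point and
  integrated afterwards. The constant \<open>c\<close> varies in the induction because one
  application of \<open>P\<close> enlarges it.\<close>

lemma integral_U:
  assumes "j + l \<le> N" "f \<in> borel_measurable borel" "\<And>x. \<bar>f x\<bar> \<le> c * q x"
  shows "(\<integral>x. f x \<partial>m (j + l)) = (\<integral>x. U j l f x \<partial>m j)"
  using assms
proof (induction l arbitrary: f c)
  case (Suc l)
  have k: "j + l < N" using Suc.prems by simp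
  note st = step_integral[OF k m_P2[OF less_imp_le[OF k]] Suc.prems(2,3)]
  have "(\<integral>x. f x \<partial>m (Suc (j + l))) = (\<integral>x. P (j + l) f x \<partial>m (j + l))" by (rule st(2))
  also have "\<dots> = (\<integral>x. U j l (P (j + l) f) x \<partial>m j)"
    by (rule Suc.IH[OF less_imp_le[OF k] measurable_P[OF Suc.prems(2)] st(3)])
  finally show ?case by simp
qed simp

lemma U_bound: "\<lbrakk>j + l \<le> N; \<And>x. \<bar>f x\<bar> \<le> c * q x\<rbrakk> \<Longrightarrow> \<bar>U j l f x\<bar> \<le> (c * E) * q x"
proof -
  assume jl: "j + l \<le> N" and b: "\<And>x. \<bar>f x\<bar> \<le> c * q x"
  have c: "0 \<le> c" using b[of 0] by (simp add: q_def)
  have "U j l f x \<le> U j l (\<lambda>x. c * q x) x" "U j l (\<lambda>x. (-1) * f x) x \<le> U j l (\<lambda>x. c * q x) x"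
    using b by (auto intro!: U_mono simp: abs_le_iff)
  then have "\<bar>U j l f x\<bar> \<le> c * U j l q x" unfolding U_cmult by (simp add: abs_le_iff)
  also have "\<dots> \<le> c * (E * q x)" using U_q[OF jl] c by (intro mult_left_mono)
  finally show ?thesis by simp
qed

lemma moment_bound: "k \<le> N \<Longrightarrow> (\<integral>x. q x \<partial>m k) \<le> E * (\<integral>x. q x \<partial>m 0)"
proof -
  assume k: "k \<le> N"
  have qb: "\<And>x. \<bar>q x\<bar> \<le> 1 * q x" using q_ge1 by (simp add: q_def)
  have "(\<integral>x. q x \<partial>m k) = (\<integral>x. U 0 k q x \<partial>m 0)" using integral_U[of 0 k q 1] k qb by simp
  also have "\<dots> \<le> (\<integral>x. E * q x \<partial>m 0)"
  proof (rule integral_mono)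
    show "integrable (m 0) (U 0 k q)" using U_bound[of 0 k q 1] k qb by (intro integrable_growth[OF m0, where c = "1 * E"]) auto
    show "integrable (m 0) (\<lambda>x. E * q x)" using qb by (intro integrable_mult_right integrable_growth[OF m0, where c = 1]) auto
  qed (use U_q k in auto)
  finally show ?thesis by simp
qed

text \<open>The initial law has a second moment only. For a fixed starting point the expected tail
  is at most E q by the second moment, and at most E q^2 / \<rho> by the fourth, as the tail lies
  below q^2 / \<rho>. The minimum of the two is integrable, and its integral vanishes as \<rho>
  grows.\<close>

lemma tail_bound:
  assumes \<rho>: "\<rho> > 0" and k: "k \<le> N"
  shows "(\<integral>x. max 0 ((norm x)\<^sup>2 - \<rho>) \<partial>m k) \<le> (\<integral>x. min (E * q x) (E * (q x)\<^sup>2 / \<rho>) \<partial>m 0)"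
proof -
  let ?t = "\<lambda>x::real^'n. max 0 ((norm x)\<^sup>2 - \<rho>)"
  have tb: "\<bar>?t x\<bar> \<le> 1 * q x" for x using \<rho> by (auto simp: q_def)
  have t4: "?t x \<le> (1 / \<rho>) * (q x)\<^sup>2" for x
  proof (cases "(norm x)\<^sup>2 \<le> \<rho>")
    case False
    have "\<rho> * (norm x)\<^sup>2 \<le> q x * q x" using False \<rho> by (intro mult_mono) (auto simp: q_def)
    then have "(norm x)\<^sup>2 \<le> (1 / \<rho>) * (q x)\<^sup>2" using \<rho> by (simp add: field_simps power2_eq_square)
    then show ?thesis using \<rho> by auto
  qed (use \<rho> in auto)
  have "(\<integral>x. ?t x \<partial>m k) = (\<integral>x. U 0 k ?t x \<partial>m 0)" using integral_U[of 0 k ?t 1] k tb by simp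
  also have "\<dots> \<le> (\<integral>x. min (E * q x) (E * (q x)\<^sup>2 / \<rho>) \<partial>m 0)"
  proof (rule integral_mono)
    show "integrable (m 0) (U 0 k ?t)" using U_bound[of 0 k ?t 1] k tb by (intro integrable_growth[OF m0, where c = "1 * E"]) auto
    show "integrable (m 0) (\<lambda>x. min (E * q x) (E * (q x)\<^sup>2 / \<rho>))"
    proof (rule integrable_growth[OF m0, where c = E])
      fix x :: "real ^ 'n"
      have "0 \<le> E * q x" "0 \<le> E * (q x)\<^sup>2 / \<rho>" using E_pos q_ge1[of x] \<rho> by auto
      then show "\<bar>min (E * q x) (E * (q x)\<^sup>2 / \<rho>)\<bar> \<le> E * q x" by auto
    qed measurable
    show "U 0 k ?t x \<le> min (E * q x) (E * (q x)\<^sup>2 / \<rho>)" for x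
    proof -
      have "U 0 k ?t x \<le> U 0 k q x" using tb by (intro U_mono) (auto simp: abs_le_iff)
      moreover have "U 0 k ?t x \<le> U 0 k (\<lambda>x. (1 / \<rho>) * (q x)\<^sup>2) x" using t4 by (intro U_mono)
      moreover have "(1 / \<rho>) * U 0 k (\<lambda>x. (q x)\<^sup>2) x \<le> (1 / \<rho>) * (E * (q x)\<^sup>2)"
        using U_q4[of 0 k x] k \<rho> by (intro mult_left_mono) auto
      ultimately show ?thesis using U_q[of 0 k x] k unfolding U_cmult by auto
    qed
  qed
  finally show ?thesis .
qed

text \<open>A Lipschitz bound is made quadratic, L n \<le> (L / \<delta>) n^2 + L \<delta>, because
  second moments of increments are available. These are of order l h, so \<delta> = sqrt(l h)
  balances the two terms.\<close>

lemma lipschitz_increment: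
  assumes f: "L-lipschitz_on UNIV f" "bounded (range f)" and jl: "j + l \<le> N"
  shows "\<bar>(\<integral>x. f x \<partial>m (j + l)) - (\<integral>x. f x \<partial>m j)\<bar> \<le> L * sqrt (real l * h) * (C * E * E2 * E * (\<integral>x. q x \<partial>m 0) + 1)"
proof (cases "l = 0")
  case False
  define \<delta> where "\<delta> = sqrt (real l * h)"
  have \<delta>: "\<delta> > 0" "\<delta> * \<delta> = real l * h" using False h by (auto simp: \<delta>_def)
  have L: "0 \<le> L" using lipschitz_on_nonneg[OF f(1)] .
  obtain B where B: "\<And>x. \<bar>f x\<bar> \<le> B" using f(2) by (auto simp: bounded_iff)
  have fm [measurable]: "f \<in> borel_measurable borel"
    using lipschitz_on_continuous_on[OF f(1)] by (rule borel_measurable_continuous_onI)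
  have mj: "m j \<in> P2" using jl by (intro m_P2) simp
  interpret prob_space "m j" using mj by (simp add: P2_def)
  have B0: "0 \<le> B" using B[of 0] by simp
  have fb: "\<bar>f x\<bar> \<le> B * q x" for x
    using mult_left_mono[OF q_ge1[of x] B0] B[of x] by simp
  have iq: "integrable (m j) q" by (rule integrable_growth[OF mj, where c = 1]) (auto simp: q_def)
  have ptw: "\<bar>U j l f x - f x\<bar> \<le> L * \<delta> * (C * E * E2 * q x + 1)" for x
  proof -
    have lip: "\<bar>f y - f x\<bar> \<le> (L / \<delta>) * (norm (y - x))\<^sup>2 + L * \<delta>" for y
    proof -
      let ?n = "norm (y - x)"
      have "2 * (?n * \<delta>) \<le> ?n\<^sup>2 + \<delta> * \<delta>" using sum_squares_bound[of ?n \<delta>] by (simp add: power2_eq_square mult.assoc)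
      then have "?n * \<delta> \<le> ?n\<^sup>2 + \<delta> * \<delta>" using \<delta> by (smt (verit) mult_nonneg_nonneg norm_ge_zero)
      then have "?n \<le> (?n\<^sup>2 + \<delta> * \<delta>) / \<delta>" using \<delta> by (simp add: field_simps)
      then have "L * ?n \<le> L * ((?n\<^sup>2 + \<delta> * \<delta>) / \<delta>)" using L by (intro mult_left_mono)
      also have "\<dots> = (L / \<delta>) * ?n\<^sup>2 + L * \<delta>" using \<delta>(1) by (simp add: field_simps)
      finally show ?thesis using lipschitz_onD[OF f(1), of y x] by (simp add: dist_real_def dist_norm)
    qed
    have up: "U j l (\<lambda>y. (L / \<delta>) * (norm (y - x))\<^sup>2 + L * \<delta>) x \<le> L * \<delta> * (C * E * E2 * q x + 1)"
    proof -
      have "U j l (\<lambda>y. (norm (y - x))\<^sup>2) x \<le> real l * h * C * E * (1 + h) ^ l * q x"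
        using U_increment[OF jl, of x x] by simp
      also have "\<dots> \<le> real l * h * C * E * E2 * q x"
        using power_le_exp[of 1 l] jl h C E_pos q_ge1[of x] unfolding E2_def by (intro mult_right_mono mult_left_mono) auto
      finally have "(L / \<delta>) * U j l (\<lambda>y. (norm (y - x))\<^sup>2) x \<le> (L / \<delta>) * (\<delta> * \<delta> * C * E * E2 * q x)"
        using L \<delta> by (intro mult_left_mono) auto
      also have "\<dots> = L * \<delta> * (C * E * E2 * q x)" using \<delta>(1) by simp
      finally show ?thesis unfolding U_add U_cmult U_const by (simp add: algebra_simps)
    qed
    have "U j l f x + (- f x) \<le> L * \<delta> * (C * E * E2 * q x + 1)"
    proof -
      have "U j l f x + (- f x) = U j l (\<lambda>y. f y + (- f x)) x" by (simp only: U_add U_const)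
      also have "\<dots> \<le> U j l (\<lambda>y. (L / \<delta>) * (norm (y - x))\<^sup>2 + L * \<delta>) x"
        using lip by (intro U_mono) (auto simp: abs_le_iff)
      finally show ?thesis using up by linarith
    qed
    moreover have "(-1) * U j l f x + f x \<le> L * \<delta> * (C * E * E2 * q x + 1)"
    proof -
      have "(-1) * U j l f x + f x = U j l (\<lambda>y. (-1) * f y + f x) x" by (simp only: U_add U_const U_cmult)
      also have "\<dots> \<le> U j l (\<lambda>y. (L / \<delta>) * (norm (y - x))\<^sup>2 + L * \<delta>) x"
        using lip by (intro U_mono) (auto simp: abs_le_iff)
      finally show ?thesis using up by linarith
    qed
    ultimately show ?thesis by (simp add: abs_le_iff)
  qed
  have iU: "integrable (m j) (U j l f)" using U_bound[OF jl fb] by (intro integrable_growth[OF mj, where c = "B * E"]) auto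
  have iF: "integrable (m j) f" by (rule integrable_growth[OF mj fm fb])
  have "(\<integral>x. f x \<partial>m (j + l)) - (\<integral>x. f x \<partial>m j) = (\<integral>x. U j l f x - f x \<partial>m j)"
    unfolding integral_U[OF jl fm fb] using iU iF by simp
  also have "\<bar>\<dots>\<bar> \<le> (\<integral>x. \<bar>U j l f x - f x\<bar> \<partial>m j)" by (rule integral_abs_bound)
  also have "\<dots> \<le> (\<integral>x. L * \<delta> * (C * E * E2 * q x + 1) \<partial>m j)"
    using iU iF iq ptw by (intro integral_mono) auto
  also have "\<dots> = L * \<delta> * (C * E * E2 * (\<integral>x. q x \<partial>m j) + 1)" using iq by (simp add: prob_space)
  also have "\<dots> \<le> L * \<delta> * (C * E * E2 * (E * (\<integral>x. q x \<partial>m 0)) + 1)"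
    using moment_bound[of j] jl L \<delta> C E_pos by (intro mult_left_mono add_right_mono) auto
  finally show ?thesis unfolding \<delta>_def by (simp add: mult_ac)
qed (use lipschitz_on_nonneg[OF f(1)] in simp)

end

section \<open>The Euler scheme of the inclusion\<close>

text \<open>The growth condition contains the second moment of the law itself. This moment is
  therefore bounded before \<open>walk\<close>, whose bounds involve the position alone, becomes
  applicable. Averaging |x|^2 reproduces the moment, whence the factor 2.\<close>

lemma one_step_moment:
  fixes S :: "'n::finite \<times> bool \<Rightarrow> real ^ 'n \<Rightarrow> real ^ 'n"
  assumes m: "m \<in> P2" and S: "\<And>js. S js \<in> borel_measurable borel" and a: "a \<ge> 0"
    and g: "\<And>x. avg (\<lambda>js. (norm (S js x))\<^sup>2) \<le> (norm x)\<^sup>2 + a * (1 + (norm x)\<^sup>2 + (M2 m)\<^sup>2)"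
  shows "random_step S m \<in> P2" "1 + (M2 (random_step S m))\<^sup>2 \<le> (1 + 2 * a) * (1 + (M2 m)\<^sup>2)"
proof -
  have p: "prob_space m" "sets m = sets borel" and i: "integrable m (\<lambda>x. (norm x)\<^sup>2)" using m by (auto simp: P2_def)
  interpret prob_space m by fact
  note [measurable] = S
  note [measurable_cong] = p(2)
  \<comment> \<open>Only the average over \<open>js\<close> is bounded by assumption; a single
    summand is at most 2 CARD('n) times the average, all summands being nonnegative.\<close>
  have iS: "integrable m (\<lambda>x. (norm (S js x))\<^sup>2)" for js
  proof (rule Bochner_Integration.integrable_bound)
    show "integrable m (\<lambda>x. real (2 * CARD('n)) * ((norm x)\<^sup>2 + a * (1 + (norm x)\<^sup>2 + (M2 m)\<^sup>2)))" using i by simp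
    show "AE x in m. norm ((norm (S js x))\<^sup>2) \<le> norm (real (2 * CARD('n)) * ((norm x)\<^sup>2 + a * (1 + (norm x)\<^sup>2 + (M2 m)\<^sup>2)))"
    proof (rule AE_I2)
      fix x
      have "(norm (S js x))\<^sup>2 \<le> (\<Sum>js\<in>UNIV. (norm (S js x))\<^sup>2)" by (rule member_le_sum) auto
      also have "\<dots> = real (2 * CARD('n)) * avg (\<lambda>js. (norm (S js x))\<^sup>2)" by (simp add: avg_def)
      also have "\<dots> \<le> real (2 * CARD('n)) * ((norm x)\<^sup>2 + a * (1 + (norm x)\<^sup>2 + (M2 m)\<^sup>2))" by (intro mult_left_mono g) auto
      finally show "norm ((norm (S js x))\<^sup>2) \<le> norm (real (2 * CARD('n)) * ((norm x)\<^sup>2 + a * (1 + (norm x)\<^sup>2 + (M2 m)\<^sup>2)))"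
        by (simp only: real_norm_def) (auto intro: order_trans[OF _ abs_ge_self])
    qed
  qed measurable
  note K12 = random_step(1,2)[OF p S] and K34 = random_step(3,4)[OF p S, where f = "\<lambda>x. (norm x)\<^sup>2"]
  have iK: "integrable (random_step S m) (\<lambda>x. (norm x)\<^sup>2)" by (rule K34(1)) (use iS in auto)
  show KP: "random_step S m \<in> P2" using K12 iK by (simp add: P2_def)
  have "(M2 (random_step S m))\<^sup>2 = (\<integral>x. avg (\<lambda>js. (norm (S js x))\<^sup>2) \<partial>m)" unfolding M2_square by (rule K34(2)) (use iS in auto)
  also have "\<dots> \<le> (\<integral>x. (norm x)\<^sup>2 + a * (1 + (norm x)\<^sup>2 + (M2 m)\<^sup>2) \<partial>m)"
  proof (rule integral_mono)
    show "integrable m (\<lambda>x. avg (\<lambda>js. (norm (S js x))\<^sup>2))" unfolding avg_def using iS by auto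
  qed (use i g in auto)
  also have "\<dots> = (M2 m)\<^sup>2 + a * (1 + 2 * (M2 m)\<^sup>2)" using i by (simp add: M2_square prob_space algebra_simps)
  finally show "1 + (M2 (random_step S m))\<^sup>2 \<le> (1 + 2 * a) * (1 + (M2 m)\<^sup>2)" using a by (simp add: algebra_simps)
qed

locale fpk_data =
  fixes T Cb CA :: real
    and F :: "real \<Rightarrow> real ^ 'n \<Rightarrow> (real ^ 'n) measure \<Rightarrow> ((real ^ 'n) \<times> (real ^ 'n ^ 'n)) set"
    and \<nu> :: "(real ^ 'n) measure"
  assumes T: "T > 0"
    and psd: "\<And>t x m. t \<in> {0..T} \<Longrightarrow> m \<in> P2 \<Longrightarrow> F t x m \<subseteq> UNIV \<times> psd_matrices"
    and usc: "usc_multimap T F"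
    and nonempty_convex: "\<And>t x m. t \<in> {0..T} \<Longrightarrow> m \<in> P2 \<Longrightarrow> F t x m \<noteq> {} \<and> convex (F t x m)"
    and Cb: "Cb \<ge> 0" and CA: "CA \<ge> 0"
    and growth: "\<And>t x m \<beta> \<Sigma>. t \<in> {0..T} \<Longrightarrow> m \<in> P2 \<Longrightarrow> (\<beta>, \<Sigma>) \<in> F t x m \<Longrightarrow>
           norm \<beta> \<le> Cb * (1 + norm x + M2 m) \<and> norm \<Sigma> \<le> CA * (1 + (norm x)\<^sup>2 + (M2 m)\<^sup>2)"
    and \<nu>: "\<nu> \<in> P2"
begin

text \<open>This definition and \<open>disp_sel\<close> refer to the same choice from
  \<open>F\<close>, so the drift and the factored diffusion together form one element of
  \<open>F\<close>.\<close>

definition drift_sel :: "real \<Rightarrow> real ^ 'n \<Rightarrow> (real ^ 'n) measure \<Rightarrow> real ^ 'n" where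
  "drift_sel t x m = fst (SOME y. y \<in> F t x m)"
definition disp_sel :: "real \<Rightarrow> real ^ 'n \<Rightarrow> (real ^ 'n) measure \<Rightarrow> 'n \<Rightarrow> real ^ 'n" where
  "disp_sel t x m = (SOME w. snd (SOME y. y \<in> F t x m) = outer_sum w)"

lemma sel_in: "t \<in> {0..T} \<Longrightarrow> m \<in> P2 \<Longrightarrow> (drift_sel t x m, outer_sum (disp_sel t x m)) \<in> F t x m"
proof -
  assume t: "t \<in> {0..T}" and m: "m \<in> P2"
  let ?y = "SOME y. y \<in> F t x m"
  have y: "?y \<in> F t x m" using nonempty_convex[OF t m] by (simp add: some_in_eq)
  then have "snd ?y \<in> psd_matrices" using psd[OF t m, of x] by (auto simp: mem_Times_iff)
  then obtain w where "snd ?y = outer_sum w" by (rule psd_factor)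
  then have "\<exists>w. snd ?y = outer_sum w" by blast
  from someI_ex[OF this] have "snd ?y = outer_sum (disp_sel t x m)" unfolding disp_sel_def .
  then have "?y = (drift_sel t x m, outer_sum (disp_sel t x m))" unfolding drift_sel_def by (simp add: prod_eq_iff)
  with y show ?thesis by simp
qed

definition D :: real where "D = real CARD('n)"

lemma D1: "1 \<le> D" unfolding D_def using zero_less_card_finite[where 'a='n] by linarith

text \<open>The 3 comes from squaring a sum of three terms, and 2 D CA from the diffusion, where D
  is the loss in \<open>norm_outer_sum_factor\<close>. The last factor pays for evaluation at a grid
  point, which lies within D T of the position.\<close>

definition cg :: real where "cg = (3 * Cb\<^sup>2 + 2 * D * CA) * (1 + D * T)\<^sup>2"

lemma cg0: "0 \<le> cg" unfolding cg_def using Cb CA D1 by simp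

lemma sel_bounds:
  assumes t: "t \<in> {0..T}" and m: "m \<in> P2" and h: "0 < h" "h \<le> T"
  shows "(norm (drift_sel t (grid_point h x) m))\<^sup>2 \<le> cg * (1 + (norm x)\<^sup>2 + (M2 m)\<^sup>2)"
    "(norm (disp_sel t (grid_point h x) m j))\<^sup>2 \<le> cg * (1 + (norm x)\<^sup>2 + (M2 m)\<^sup>2)"
    "norm (outer_sum (disp_sel t (grid_point h x) m)) \<le> cg * (1 + (norm x)\<^sup>2 + (M2 m)\<^sup>2)"
proof -
  let ?y = "grid_point h x" and ?Q = "1 + (norm x)\<^sup>2 + (M2 m)\<^sup>2" and ?G = "(1 + D * T)\<^sup>2"
  have Q0: "0 \<le> ?Q" by simp
  have DT: "0 \<le> D * T" using D1 T by simp
  have G1: "1 \<le> ?G" using DT by (simp add: one_le_power)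
  have ny: "norm ?y \<le> norm x + D * T"
  proof -
    have "norm (?y - x) \<le> D * h" unfolding D_def by (rule grid_point_dist[OF h(1)])
    also have "\<dots> \<le> D * T" using h D1 by (intro mult_left_mono) auto
    finally show ?thesis using norm_triangle_sub[of ?y x] by linarith
  qed
  note g = growth[OF t m sel_in[OF t m, of ?y]]
  have 3: "(a + b + c)\<^sup>2 \<le> 3 * (a\<^sup>2 + b\<^sup>2 + c\<^sup>2)" for a b c :: real
    using zero_le_power2[of "a - b"] zero_le_power2[of "b - c"] zero_le_power2[of "a - c"]
    by (simp add: power2_eq_square algebra_simps)
  have "norm (drift_sel t ?y m) \<le> Cb * ((1 + D * T) + norm x + M2 m)"
    using g ny Cb by (auto elim!: order_trans intro!: mult_left_mono)
  then have "(norm (drift_sel t ?y m))\<^sup>2 \<le> (Cb * ((1 + D * T) + norm x + M2 m))\<^sup>2" by (intro power_mono) auto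
  also have "\<dots> \<le> Cb\<^sup>2 * (3 * (?G + (norm x)\<^sup>2 + (M2 m)\<^sup>2))"
    unfolding power_mult_distrib by (intro mult_left_mono 3) auto
  also have "\<dots> \<le> Cb\<^sup>2 * (3 * (?G * ?Q))"
  proof -
    have "(norm x)\<^sup>2 + (M2 m)\<^sup>2 \<le> ?G * ((norm x)\<^sup>2 + (M2 m)\<^sup>2)" using mult_right_mono[OF G1, of "(norm x)\<^sup>2 + (M2 m)\<^sup>2"] by simp
    then have "?G + (norm x)\<^sup>2 + (M2 m)\<^sup>2 \<le> ?G * ?Q" by (simp add: algebra_simps)
    then show ?thesis by (intro mult_left_mono) auto
  qed
  also have "\<dots> \<le> cg * ?Q" unfolding cg_def using CA D1 by (simp add: algebra_simps)
  finally show "(norm (drift_sel t ?y m))\<^sup>2 \<le> cg * ?Q" .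
  have "D * norm (outer_sum (disp_sel t ?y m)) \<le> D * (CA * (1 + (norm ?y)\<^sup>2 + (M2 m)\<^sup>2))" using g D1 by (intro mult_left_mono) auto
  also have "\<dots> \<le> D * (CA * (2 * (?G * ?Q)))"
  proof -
    have "(norm ?y)\<^sup>2 \<le> (norm x + D * T)\<^sup>2" using ny by (intro power_mono) auto
    also have "\<dots> \<le> 2 * (norm x)\<^sup>2 + 2 * (D * T)\<^sup>2"
      using sum_squares_bound[of "norm x" "D * T"] by (simp add: power2_sum)
    finally have "1 + (norm ?y)\<^sup>2 + (M2 m)\<^sup>2 \<le> 2 * (1 + (D * T)\<^sup>2 + ((norm x)\<^sup>2 + (M2 m)\<^sup>2))"
      using zero_le_power2[of "M2 m"] by argo
    also have "1 + (D * T)\<^sup>2 \<le> ?G" using DT by (simp add: power2_sum)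
    also have "?G + ((norm x)\<^sup>2 + (M2 m)\<^sup>2) \<le> ?G * ?Q"
      using mult_right_mono[OF G1, of "(norm x)\<^sup>2 + (M2 m)\<^sup>2"] by (simp add: algebra_simps)
    finally show ?thesis using CA D1 by (intro mult_left_mono) auto
  qed
  also have "\<dots> \<le> cg * ?Q" unfolding cg_def by (simp add: algebra_simps)
  finally have le: "D * norm (outer_sum (disp_sel t ?y m)) \<le> cg * ?Q" .
  have "(norm (disp_sel t ?y m j))\<^sup>2 \<le> D * norm (outer_sum (disp_sel t ?y m))" unfolding D_def by (rule norm_outer_sum_factor)
  then show "(norm (disp_sel t ?y m j))\<^sup>2 \<le> cg * ?Q" using le by linarith
  have "1 * norm (outer_sum (disp_sel t ?y m)) \<le> D * norm (outer_sum (disp_sel t ?y m))" using D1 by (intro mult_right_mono) auto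
  then show "norm (outer_sum (disp_sel t ?y m)) \<le> cg * ?Q" using le by linarith
qed

definition step_map :: "nat \<Rightarrow> nat \<Rightarrow> (real ^ 'n) measure \<Rightarrow> 'n \<times> bool \<Rightarrow> real ^ 'n \<Rightarrow> real ^ 'n" where
  "step_map N k m js x = x + euler_step (T / N) (drift_sel (k * (T / N)) (grid_point (T / N) x) m) (disp_sel (k * (T / N)) (grid_point (T / N) x) m) js"

primrec scheme :: "nat \<Rightarrow> nat \<Rightarrow> (real ^ 'n) measure" where
  "scheme N 0 = \<nu>"
| "scheme N (Suc k) = random_step (step_map N k (scheme N k)) (scheme N k)"

lemma measurable_step_map [measurable]: "step_map N k m js \<in> borel_measurable borel"
proof -
  have "(\<lambda>x. euler_step (T / N) (drift_sel (k * (T / N)) (grid_point (T / N) x) m) (disp_sel (k * (T / N)) (grid_point (T / N) x) m) js) \<in> borel_measurable borel"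
    by (rule measurable_grid_point_compose[of "\<lambda>y. euler_step (T / N) (drift_sel (k * (T / N)) y m) (disp_sel (k * (T / N)) y m) js"])
  then show ?thesis unfolding step_map_def[abs_def] by measurable
qed

lemma time_in: "N \<ge> 1 \<Longrightarrow> k \<le> N \<Longrightarrow> real k * (T / real N) \<in> {0..T}"
  using T by (auto simp: field_simps)

lemma h_bounds: "N \<ge> 1 \<Longrightarrow> 0 < T / real N \<and> T / real N \<le> T"
  using T by (auto simp: field_simps)

text \<open>\<open>C1\<close> is the constant of \<open>avg_moment2\<close> for c =
  \<open>cg\<close>. \<open>K0\<close> is the discrete Gronwall bound that follows from it, the 2 in
  the exponent being that of \<open>one_step_moment\<close>.\<close>

definition C1 :: real where "C1 = 1 + (1 + T + D) * cg"
definition K0 :: real where "K0 = exp (2 * C1 * T) * (1 + (M2 \<nu>)\<^sup>2)"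

lemma C1_0: "0 \<le> C1" unfolding C1_def using T D1 cg0 by simp

lemma scheme_moment:
  assumes N: "N \<ge> 1" and k: "k \<le> N"
  shows "scheme N k \<in> P2 \<and> 1 + (M2 (scheme N k))\<^sup>2 \<le> (1 + 2 * C1 * (T / N)) ^ k * (1 + (M2 \<nu>)\<^sup>2)"
  using k
proof (induction k)
  case 0
  show ?case using \<nu> by simp
next
  case (Suc k)
  then have IH: "scheme N k \<in> P2" "1 + (M2 (scheme N k))\<^sup>2 \<le> (1 + 2 * C1 * (T / N)) ^ k * (1 + (M2 \<nu>)\<^sup>2)" by auto
  have k: "k \<le> N" using Suc by simp
  note h = h_bounds[OF N]
  have a: "0 \<le> T / N * C1" using h C1_0 by simp
  have g: "avg (\<lambda>js. (norm (step_map N k (scheme N k) js x))\<^sup>2) \<le> (norm x)\<^sup>2 + T / N * C1 * (1 + (norm x)\<^sup>2 + (M2 (scheme N k))\<^sup>2)" for x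
    unfolding step_map_def C1_def D_def
    by (rule avg_moment2[OF _ _ cg0]) (use h sel_bounds(1,2)[OF time_in[OF N k] IH(1)] in auto)
  note o = one_step_moment[OF IH(1) measurable_step_map a g]
  have "1 + (M2 (scheme N (Suc k)))\<^sup>2 \<le> (1 + 2 * (T / N * C1)) * (1 + (M2 (scheme N k))\<^sup>2)" using o(2) by simp
  also have "\<dots> \<le> (1 + 2 * (T / N * C1)) * ((1 + 2 * C1 * (T / N)) ^ k * (1 + (M2 \<nu>)\<^sup>2))"
    using IH(2) a by (intro mult_left_mono) auto
  finally show ?case using o(1) by (simp add: mult_ac)
qed

lemma scheme_P2: "N \<ge> 1 \<Longrightarrow> k \<le> N \<Longrightarrow> scheme N k \<in> P2"
  using scheme_moment by blast

lemma scheme_K0: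
  assumes "N \<ge> 1" "k \<le> N" shows "1 + (M2 (scheme N k))\<^sup>2 \<le> K0"
proof -
  let ?h = "T / N"
  have "(1 + 2 * C1 * ?h) ^ k \<le> exp (2 * C1 * ?h) ^ k"
    using h_bounds[OF assms(1)] C1_0 by (intro power_mono exp_ge_add_one_self) auto
  also have "\<dots> = exp (real k * (2 * C1 * ?h))" by (rule exp_of_nat_mult[symmetric])
  also have "\<dots> \<le> exp (real N * (2 * C1 * ?h))"
    unfolding exp_le_cancel_iff using assms h_bounds[OF assms(1)] C1_0 by (intro mult_right_mono) auto
  also have "real N * (2 * C1 * ?h) = 2 * C1 * T" using assms by simp
  finally have "(1 + 2 * C1 * ?h) ^ k * (1 + (M2 \<nu>)\<^sup>2) \<le> K0" unfolding K0_def by (intro mult_right_mono) auto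
  then show ?thesis using scheme_moment[OF assms] by linarith
qed

text \<open>Once \<open>K0\<close> bounds the second moments of all laws of the scheme, they are
  absorbed into this constant, and the coefficients are bounded by the position alone.\<close>

definition cs :: real where "cs = cg * K0"

lemma K0_1: "1 \<le> K0"
  using scheme_K0[of 1 0] zero_le_power2[of "M2 (scheme 1 0)"] by linarith

lemma cs0: "0 \<le> cs" using cg0 K0_1 by (simp add: cs_def)

lemma step_bounds:
  assumes N: "N \<ge> 1" and k: "k \<le> N"
  shows "(norm (drift_sel (k * (T / N)) (grid_point (T / N) x) (scheme N k)))\<^sup>2 \<le> cs * (1 + (norm x)\<^sup>2)"
    "(norm (disp_sel (k * (T / N)) (grid_point (T / N) x) (scheme N k) j))\<^sup>2 \<le> cs * (1 + (norm x)\<^sup>2)"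
    "norm (outer_sum (disp_sel (k * (T / N)) (grid_point (T / N) x) (scheme N k))) \<le> cs * (1 + (norm x)\<^sup>2)"
proof -
  let ?M = "(M2 (scheme N k))\<^sup>2"
  have "1 + (norm x)\<^sup>2 + ?M \<le> (1 + ?M) * (1 + (norm x)\<^sup>2)" by (simp add: algebra_simps)
  also have "\<dots> \<le> K0 * (1 + (norm x)\<^sup>2)" using scheme_K0[OF N k] by (intro mult_right_mono) auto
  finally have "cg * (1 + (norm x)\<^sup>2 + ?M) \<le> cg * (K0 * (1 + (norm x)\<^sup>2))" using cg0 by (intro mult_left_mono)
  then have le: "cg * (1 + (norm x)\<^sup>2 + ?M) \<le> cs * (1 + (norm x)\<^sup>2)" by (simp add: cs_def mult_ac)
  note s = sel_bounds[OF time_in[OF N k] scheme_P2[OF N k], of "T / N" x]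
  show "(norm (drift_sel (k * (T / N)) (grid_point (T / N) x) (scheme N k)))\<^sup>2 \<le> cs * (1 + (norm x)\<^sup>2)"
    "(norm (disp_sel (k * (T / N)) (grid_point (T / N) x) (scheme N k) j))\<^sup>2 \<le> cs * (1 + (norm x)\<^sup>2)"
    "norm (outer_sum (disp_sel (k * (T / N)) (grid_point (T / N) x) (scheme N k))) \<le> cs * (1 + (norm x)\<^sup>2)"
    using s h_bounds[OF N] le by (auto intro: order_trans)
qed

text \<open>The sum of the constants of \<open>avg_moment2\<close> and \<open>avg_moment4\<close>
  for c = \<open>cs\<close>; \<open>walk\<close> asks for a single constant in its three
  estimates.\<close>

definition CC :: real where
  "CC = (1 + (1 + T + D) * cs) + (2 * (1 + (1 + T) * cs) + T * (1 + (1 + T) * cs)\<^sup>2 + 6 * (1 + T * (1 + (1 + T) * cs)) * (D * cs) + T * (D * cs)\<^sup>2)"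

lemma CC_ge:
  "0 \<le> CC" "1 + (1 + T + D) * cs \<le> CC" "(1 + T + D) * cs \<le> CC"
  "2 * (1 + (1 + T) * cs) + T * (1 + (1 + T) * cs)\<^sup>2 + 6 * (1 + T * (1 + (1 + T) * cs)) * (D * cs) + T * (D * cs)\<^sup>2 \<le> CC"
proof -
  have a: "0 \<le> (1 + T + D) * cs" using T D1 cs0 by simp
  have b: "0 \<le> 2 * (1 + (1 + T) * cs) + T * (1 + (1 + T) * cs)\<^sup>2 + 6 * (1 + T * (1 + (1 + T) * cs)) * (D * cs) + T * (D * cs)\<^sup>2"
    using T D1 cs0 by (intro add_nonneg_nonneg mult_nonneg_nonneg) auto
  show "0 \<le> CC" "1 + (1 + T + D) * cs \<le> CC" "(1 + T + D) * cs \<le> CC"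
    "2 * (1 + (1 + T) * cs) + T * (1 + (1 + T) * cs)\<^sup>2 + 6 * (1 + T * (1 + (1 + T) * cs)) * (D * cs) + T * (D * cs)\<^sup>2 \<le> CC"
    using a b unfolding CC_def by linarith+
qed

lemma walk_scheme:
  assumes N: "N \<ge> 1"
  shows "walk (\<lambda>k. step_map N k (scheme N k)) (scheme N) N (T / N) CC"
proof
  note h = h_bounds[OF N]
  show "0 < T / real N" "0 \<le> CC" "scheme N 0 \<in> P2" using h CC_ge \<nu> by auto
  show "step_map N k (scheme N k) js \<in> borel_measurable borel" for k js by (rule measurable_step_map)
  show "scheme N (Suc k) = random_step (step_map N k (scheme N k)) (scheme N k)" for k by simp
  fix k :: nat and x z :: "real ^ 'n" assume "k < N"
  then have k: "k \<le> N" by simp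
  let ?q = "1 + (norm x)\<^sup>2"
  note s = step_bounds[OF N k, of x]
  have "avg (\<lambda>js. (norm (step_map N k (scheme N k) js x))\<^sup>2) \<le> (norm x)\<^sup>2 + T / N * (1 + (1 + T + D) * cs) * ?q"
    unfolding step_map_def D_def by (rule avg_moment2[OF _ _ cs0]) (use h s in auto)
  also have "\<dots> \<le> (norm x)\<^sup>2 + T / N * CC * ?q"
    using h CC_ge by (intro add_left_mono mult_right_mono mult_left_mono) auto
  finally show "avg (\<lambda>js. 1 + (norm (step_map N k (scheme N k) js x))\<^sup>2) \<le> (1 + CC * (T / N)) * ?q"
    unfolding avg_linear avg_const by (simp add: algebra_simps)
  have "avg (\<lambda>js. (1 + (norm (step_map N k (scheme N k) js x))\<^sup>2)\<^sup>2) \<le> (1 + T / N * (2 * (1 + (1 + T) * cs) + T * (1 + (1 + T) * cs)\<^sup>2 + 6 * (1 + T * (1 + (1 + T) * cs)) * (D * cs) + T * (D * cs)\<^sup>2)) * ?q\<^sup>2"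
    unfolding step_map_def D_def by (rule avg_moment4[OF _ _ cs0]) (use h s in auto)
  also have "\<dots> \<le> (1 + T / N * CC) * ?q\<^sup>2"
    using h CC_ge(4) by (intro mult_right_mono add_left_mono mult_left_mono) auto
  finally show "avg (\<lambda>js. (1 + (norm (step_map N k (scheme N k) js x))\<^sup>2)\<^sup>2) \<le> (1 + CC * (T / N)) * ?q\<^sup>2" by (simp only: mult.commute)
  have "avg (\<lambda>js. (norm (x - z + euler_step (T / N) (drift_sel (k * (T / N)) (grid_point (T / N) x) (scheme N k)) (disp_sel (k * (T / N)) (grid_point (T / N) x) (scheme N k)) js))\<^sup>2)
     \<le> (1 + T / N) * (norm (x - z))\<^sup>2 + T / N * ((1 + T + D) * cs) * ?q"
    unfolding D_def by (rule avg_moment_shifted[OF _ _ cs0]) (use h s in auto)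
  also have "\<dots> \<le> (1 + T / N) * (norm (x - z))\<^sup>2 + T / N * CC * ?q"
    using h CC_ge by (intro add_left_mono mult_right_mono mult_left_mono) auto
  finally show "avg (\<lambda>js. (norm (step_map N k (scheme N k) js x - z))\<^sup>2) \<le> (1 + T / N) * (norm (x - z))\<^sup>2 + T / N * CC * ?q"
    unfolding step_map_def by (simp add: algebra_simps)
qed

section \<open>Piecewise constant interpolation in time\<close>

definition curve :: "nat \<Rightarrow> real \<Rightarrow> (real ^ 'n) measure" where "curve N t = scheme N (nat \<lfloor>t * N / T\<rfloor>)"

lemma index_bounds:
  fixes N :: nat
  assumes N: "N \<ge> 1" and t: "t \<in> {0..T}"
  defines "i \<equiv> nat \<lfloor>t * N / T\<rfloor>"
  shows "i \<le> N" "real i * (T / N) \<le> t" "t \<le> real i * (T / N) + T / N"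
proof -
  have a: "0 \<le> t * N / T" using t T by simp
  have "t * N / T \<le> N" using t T by (simp add: field_simps mult_right_mono)
  then show "i \<le> N" unfolding i_def by linarith
  have i: "real i \<le> t * N / T" "t * N / T \<le> real i + 1" using a unfolding i_def by linarith+
  have p: "0 < T / N" using h_bounds[OF N] by simp
  have e: "t * N / T * (T / N) = t" using T N by simp
  show "real i * (T / N) \<le> t" using mult_right_mono[OF i(1), of "T / N"] p e by simp
  have "t * N / T * (T / N) \<le> (real i + 1) * (T / N)" using p by (intro mult_right_mono i) auto
  then show "t \<le> real i * (T / N) + T / N" unfolding e distrib_right by simp
qed

lemma curve_P2: "N \<ge> 1 \<Longrightarrow> t \<in> {0..T} \<Longrightarrow> curve N t \<in> P2"
  unfolding curve_def using scheme_P2 index_bounds by blast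

lemma curve_0: "curve N 0 = \<nu>" by (simp add: curve_def)

lemma curve_moment: "N \<ge> 1 \<Longrightarrow> t \<in> {0..T} \<Longrightarrow> (\<integral>x. (norm x)\<^sup>2 \<partial>curve N t) \<le> K0"
  unfolding curve_def using scheme_K0[of N "nat \<lfloor>t * N / T\<rfloor>"] index_bounds(1)[of N t] by (simp add: M2_square)

text \<open>\<open>tail_bound\<close> reduces all \<open>N\<close> and \<open>t\<close> to one
  integral over the initial law. Its integrand tends to 0 pointwise as \<rho> grows and is dominated
  by a multiple of 1 + |x|^2.\<close>

lemma curve_uniformly_integrable:
  assumes e: "e > 0"
  shows "\<exists>\<rho>>0. \<forall>N\<ge>1. \<forall>t\<in>{0..T}. (\<integral>x. max 0 ((norm x)\<^sup>2 - \<rho>) \<partial>curve N t) \<le> e"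
proof -
  interpret prob_space \<nu> using \<nu> by (simp add: P2_def)
  have s [measurable_cong]: "sets \<nu> = sets borel" and i: "integrable \<nu> (\<lambda>x. (norm x)\<^sup>2)" using \<nu> by (auto simp: P2_def)
  define E where "E = exp (CC * T)"
  have E: "0 < E" by (simp add: E_def)
  let ?g = "\<lambda>\<rho> x::real^'n. min (E * (1 + (norm x)\<^sup>2)) (E * (1 + (norm x)\<^sup>2)\<^sup>2 / \<rho>)"
  have "(\<lambda>n. \<integral>x. ?g (real (Suc n)) x \<partial>\<nu>) \<longlonglongrightarrow> (\<integral>x. 0 \<partial>\<nu>)"
  proof (rule integral_dominated_convergence[where w = "\<lambda>x. E * (1 + (norm x)\<^sup>2)"])
    show "integrable \<nu> (\<lambda>x. E * (1 + (norm x)\<^sup>2))" using i by simp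
    show "AE x in \<nu>. (\<lambda>n. ?g (real (Suc n)) x) \<longlonglongrightarrow> 0"
    proof (rule AE_I2)
      fix x :: "real ^ 'n"
      have "(\<lambda>n. E * (1 + (norm x)\<^sup>2)\<^sup>2 * inverse (real (Suc n))) \<longlonglongrightarrow> E * (1 + (norm x)\<^sup>2)\<^sup>2 * 0"
        by (intro tendsto_intros LIMSEQ_inverse_real_of_nat)
      then have "(\<lambda>n. E * (1 + (norm x)\<^sup>2)\<^sup>2 / real (Suc n)) \<longlonglongrightarrow> 0" by (simp add: divide_inverse)
      from tendsto_min[OF tendsto_const this, of "E * (1 + (norm x)\<^sup>2)"]
      show "(\<lambda>n. ?g (real (Suc n)) x) \<longlonglongrightarrow> 0" using E by (simp add: min_absorb2)
    qed
    show "AE x in \<nu>. norm (?g (real (Suc n)) x) \<le> E * (1 + (norm x)\<^sup>2)" for n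
    proof (rule AE_I2)
      fix x :: "real ^ 'n"
      have "0 \<le> E * (1 + (norm x)\<^sup>2)" "0 \<le> E * (1 + (norm x)\<^sup>2)\<^sup>2 / real (Suc n)" using E by auto
      then show "norm (?g (real (Suc n)) x) \<le> E * (1 + (norm x)\<^sup>2)" by (auto simp: min_def)
    qed
  qed measurable
  then have "\<forall>\<^sub>F n in sequentially. (\<integral>x. ?g (real (Suc n)) x \<partial>\<nu>) < e" using e by (intro order_tendstoD(2)) auto
  then obtain n where n: "(\<integral>x. ?g (real (Suc n)) x \<partial>\<nu>) < e" by (auto simp: eventually_sequentially)
  show ?thesis
  proof (intro exI conjI allI ballI impI)
    show "0 < real (Suc n)" by simp
    fix N :: nat and t assume N: "1 \<le> N" and t: "t \<in> {0..T}"
    interpret W: walk "\<lambda>k. step_map N k (scheme N k)" "scheme N" N "T / N" CC by (rule walk_scheme[OF N])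
    have WE: "W.E = E" unfolding W.E_def E_def using N by simp
    have "(\<integral>x. max 0 ((norm x)\<^sup>2 - real (Suc n)) \<partial>curve N t) \<le> (\<integral>x. ?g (real (Suc n)) x \<partial>\<nu>)"
      using W.tail_bound[of "real (Suc n)" "nat \<lfloor>t * N / T\<rfloor>"] index_bounds(1)[OF N t]
      unfolding curve_def WE W.q_def by simp
    then show "(\<integral>x. max 0 ((norm x)\<^sup>2 - real (Suc n)) \<partial>curve N t) \<le> e" using n by linarith
  qed
qed

definition K1 :: real where
  "K1 = CC * exp (CC * T) * exp T * exp (CC * T) * (\<integral>x. 1 + (norm x)\<^sup>2 \<partial>\<nu>) + 1"

text \<open>Times that are close can still be separated by a grid point; the summand T / N accounts
  for rounding both down to the grid. \<open>K1\<close> collects the constants of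
  \<open>lipschitz_increment\<close>, with N h = T in the exponentials.\<close>

lemma curve_increment:
  assumes f: "L-lipschitz_on UNIV f" "bounded (range f)" and N: "N \<ge> 1" and st: "s \<in> {0..T}" "t \<in> {0..T}"
  shows "\<bar>(\<integral>x. f x \<partial>curve N t) - (\<integral>x. f x \<partial>curve N s)\<bar> \<le> L * sqrt (\<bar>t - s\<bar> + T / N) * K1"
proof -
  interpret W: walk "\<lambda>k. step_map N k (scheme N k)" "scheme N" N "T / N" CC by (rule walk_scheme[OF N])
  have WE: "W.E = exp (CC * T)" "W.E2 = exp T" unfolding W.E_def W.E2_def using N by simp_all
  have K1: "0 \<le> K1" unfolding K1_def using CC_ge by (intro add_nonneg_nonneg mult_nonneg_nonneg) auto
  have L: "0 \<le> L" using lipschitz_on_nonneg[OF f(1)] .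
  have main: "\<bar>(\<integral>x. f x \<partial>curve N t) - (\<integral>x. f x \<partial>curve N s)\<bar> \<le> L * sqrt (t - s + T / N) * K1"
    if st: "s \<in> {0..T}" "t \<in> {0..T}" "s \<le> t" for s t
  proof -
    define j where "j = nat \<lfloor>s * N / T\<rfloor>"
    define k where "k = nat \<lfloor>t * N / T\<rfloor>"
    have jk: "j \<le> k" unfolding j_def k_def using st T by (intro nat_mono floor_mono divide_right_mono mult_right_mono) auto
    have kN: "j + (k - j) \<le> N" using index_bounds(1)[OF N st(2)] jk by (simp add: k_def)
    have "\<bar>(\<integral>x. f x \<partial>scheme N (j + (k - j))) - (\<integral>x. f x \<partial>scheme N j)\<bar> \<le> L * sqrt (real (k - j) * (T / N)) * K1"
      using W.lipschitz_increment[OF f kN] unfolding WE K1_def W.q_def by simp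
    also have "\<dots> \<le> L * sqrt (t - s + T / N) * K1"
    proof -
      have "real (k - j) * (T / N) = real k * (T / N) - real j * (T / N)" using jk by (simp add: of_nat_diff left_diff_distrib diff_divide_distrib)
      also have "\<dots> \<le> t - s + T / N" using index_bounds[OF N st(1)] index_bounds[OF N st(2)] unfolding j_def k_def by linarith
      finally show ?thesis using L K1 by (intro mult_right_mono mult_left_mono real_sqrt_le_mono)
    qed
    finally show ?thesis using jk by (simp add: curve_def j_def k_def)
  qed
  show ?thesis
  proof (cases "s \<le> t")
    case True
    then show ?thesis using main[OF st True] by simp
  next
    case False
    then show ?thesis using main[OF st(2,1)] by (simp add: abs_minus_commute)
  qed
qed

end

section \<open>Convergence of the scheme\<close>

text \<open>The representation theorem supplies a limit law along one subsequence. As all integrals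
  of bounded Lipschitz functions are assumed to converge, their limits must be those found along the
  subsequence.\<close>

lemma bl_conv_exists:
  fixes \<mu> :: "nat \<Rightarrow> 'a::euclidean_space measure"
  assumes prob: "\<And>k. prob_space (\<mu> k)" and sets: "\<And>k. sets (\<mu> k) = sets borel"
    and tight: "\<And>e. e > 0 \<Longrightarrow> \<exists>R. \<forall>k. measure (\<mu> k) {x. R < norm x} \<le> e"
    and conv: "\<And>f L. L-lipschitz_on UNIV f \<Longrightarrow> bounded (range f) \<Longrightarrow> convergent (\<lambda>k. \<integral>x. (f x :: real) \<partial>\<mu> k)"
  shows "\<exists>m. prob_space m \<and> sets m = sets borel \<and> bl_conv \<mu> m"
proof -
  obtain \<Omega> :: "real measure" and r and Z :: "nat \<Rightarrow> real \<Rightarrow> 'a" and Z'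
    where r: "strict_mono (r :: nat \<Rightarrow> nat)" and \<Omega>: "prob_space \<Omega>"
    and Z [measurable]: "\<And>k. Z k \<in> borel_measurable \<Omega>"
    and Z' [measurable]: "Z' \<in> borel_measurable \<Omega>"
    and d: "\<And>k. distr \<Omega> borel (Z k) = \<mu> (r k)" and ae: "AE \<omega> in \<Omega>. (\<lambda>k. Z k \<omega>) \<longlonglongrightarrow> Z' \<omega>"
    by (rule skorohod_subsequence[OF prob sets tight], assumption, rule that)
  have "bl_conv \<mu> (distr \<Omega> borel Z')"
    unfolding bl_conv_def
  proof (intro allI impI)
    fix f :: "'a \<Rightarrow> real" and L assume f: "L-lipschitz_on UNIV f" "bounded (range f)"
    obtain l where l: "(\<lambda>k. \<integral>x. f x \<partial>\<mu> k) \<longlonglongrightarrow> l" using conv[OF f] by (auto simp: convergent_def)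
    have "(\<lambda>k. \<integral>x. f x \<partial>\<mu> (r k)) \<longlonglongrightarrow> l" using LIMSEQ_subseq_LIMSEQ[OF l r] by (simp add: o_def)
    moreover have "(\<lambda>k. \<integral>x. f x \<partial>\<mu> (r k)) \<longlonglongrightarrow> (\<integral>x. f x \<partial>distr \<Omega> borel Z')"
      using ae_tendsto_integral[OF \<Omega> Z Z' ae lipschitz_on_continuous_on[OF f(1)] f(2)] by (simp add: d)
    ultimately show "(\<lambda>k. \<integral>x. f x \<partial>\<mu> k) \<longlonglongrightarrow> (\<integral>x. f x \<partial>distr \<Omega> borel Z')"
      using l LIMSEQ_unique by blast
  qed
  then show ?thesis using prob_space.prob_space_distr[OF \<Omega> Z'] by auto
qed

text \<open>From every subsequence a further one is represented by almost surely convergent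
  variables, to which any bounded continuous function may be applied.\<close>

lemma bl_conv_imp_weak:
  fixes \<mu> :: "nat \<Rightarrow> 'a::euclidean_space measure" and f :: "'a \<Rightarrow> real"
  assumes prob: "\<And>k. prob_space (\<mu> k)" and sets: "\<And>k. sets (\<mu> k) = sets borel"
    and m: "prob_space m" "sets m = sets borel"
    and tight: "\<And>e. e > 0 \<Longrightarrow> \<exists>R. \<forall>k. measure (\<mu> k) {x. R < norm x} \<le> e"
    and conv: "bl_conv \<mu> m" and f: "continuous_on UNIV f" "bounded (range f)"
  shows "(\<lambda>k. \<integral>x. f x \<partial>\<mu> k) \<longlonglongrightarrow> (\<integral>x. f x \<partial>m)"
proof (rule LIMSEQ_subseq_criterion)
  fix s :: "nat \<Rightarrow> nat" assume s: "strict_mono s"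
  have tight': "\<exists>R. \<forall>k. measure (\<mu> (s k)) {x. R < norm x} \<le> e" if "e > 0" for e using tight[OF that] by blast
  obtain \<Omega> :: "real measure" and r and Z :: "nat \<Rightarrow> real \<Rightarrow> 'a" and Z'
    where r: "strict_mono (r :: nat \<Rightarrow> nat)" and \<Omega>: "prob_space \<Omega>"
    and Z: "\<And>k. Z k \<in> borel_measurable \<Omega>" and Z': "Z' \<in> borel_measurable \<Omega>"
    and d: "\<And>k. distr \<Omega> borel (Z k) = \<mu> (s (r k))" "distr \<Omega> borel Z' = m"
    and ae: "AE \<omega> in \<Omega>. (\<lambda>k. Z k \<omega>) \<longlonglongrightarrow> Z' \<omega>"
    by (rule skorohod_bl_conv[OF prob sets m tight' bl_conv_subseq[OF conv s]], assumption, rule that)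
  show "\<exists>r. strict_mono r \<and> (\<lambda>k. \<integral>x. f x \<partial>\<mu> (s (r k))) \<longlonglongrightarrow> (\<integral>x. f x \<partial>m)"
    using ae_tendsto_integral[OF \<Omega> Z Z' ae f] r by (auto simp: d)
qed

lemma bl_conv_offset: "bl_conv (\<lambda>k. \<mu> (k + c)) m \<Longrightarrow> bl_conv \<mu> m"
  unfolding bl_conv_def by (blast intro: LIMSEQ_offset)

lemma bl_conv_unique:
  fixes \<mu> :: "nat \<Rightarrow> 'a::metric_space measure"
  assumes "bl_conv \<mu> m" "bl_conv \<mu> m'" "prob_space m" "sets m = sets borel" "prob_space m'" "sets m' = sets borel"
  shows "m = m'"
  using assms by (intro borel_prob_eqI_lipschitz) (auto intro: LIMSEQ_unique bl_convD)

context fpk_data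
begin

lemma curve_prob: "N \<ge> 1 \<Longrightarrow> t \<in> {0..T} \<Longrightarrow> prob_space (curve N t)" "N \<ge> 1 \<Longrightarrow> t \<in> {0..T} \<Longrightarrow> sets (curve N t) = sets borel"
  using curve_P2[of N t] by (auto simp: P2_def)

lemma curve_tight:
  assumes "\<And>k::nat. mesh k \<ge> (1::nat)" "\<And>k. t k \<in> {0..T}" "e > 0"
  shows "\<exists>R. \<forall>k. measure (curve (mesh k) (t k)) {x. R < norm x} \<le> e"
  using second_moment_tight[of UNIV "\<lambda>k. curve (mesh k) (t k)" K0 e] curve_P2 curve_moment assms by auto

lemma K1_nonneg: "0 \<le> K1"
  unfolding K1_def using CC_ge by (intro add_nonneg_nonneg mult_nonneg_nonneg) auto

lemma subsequence_countable_times: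
  fixes dd :: "nat \<Rightarrow> real"
  assumes D: "\<And>n::nat. dd n \<in> {0..T}"
  shows "\<exists>r::nat\<Rightarrow>nat. strict_mono r \<and> (\<forall>n. \<exists>\<mu>. prob_space \<mu> \<and> sets \<mu> = sets borel \<and> bl_conv (\<lambda>k. curve (Suc (r k)) (dd n)) \<mu>)"
proof -
  define Q where "Q n s \<longleftrightarrow> (\<exists>\<mu>. prob_space \<mu> \<and> sets \<mu> = sets borel \<and> bl_conv (\<lambda>k. curve (Suc (s k)) (dd n)) \<mu>)" for n and s :: "nat \<Rightarrow> nat"
  interpret subseqs Q
  proof
    fix n and s :: "nat \<Rightarrow> nat" assume s: "strict_mono s"
    let ?\<mu> = "\<lambda>k. curve (Suc (s k)) (dd n)"
    have p: "prob_space (?\<mu> k)" "sets (?\<mu> k) = sets borel" for k using curve_prob D by auto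
    have tight: "\<exists>R. \<forall>k. measure (?\<mu> k) {x. R < norm x} \<le> e" if "e > 0" for e using that D by (intro curve_tight) auto
    obtain \<Omega> :: "real measure" and r and Z :: "nat \<Rightarrow> real \<Rightarrow> real ^ 'n" and Z'
      where r: "strict_mono (r :: nat \<Rightarrow> nat)" and \<Omega>: "prob_space \<Omega>"
      and Z: "\<And>k. Z k \<in> borel_measurable \<Omega>" and Z': "Z' \<in> borel_measurable \<Omega>"
      and d: "\<And>k. distr \<Omega> borel (Z k) = ?\<mu> (r k)" and ae: "AE \<omega> in \<Omega>. (\<lambda>k. Z k \<omega>) \<longlonglongrightarrow> Z' \<omega>"
      by (rule skorohod_subsequence[where \<mu> = ?\<mu>, OF p tight], assumption, rule that)
    have "bl_conv (\<lambda>k. ?\<mu> (r k)) (distr \<Omega> borel Z')"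
      unfolding bl_conv_def d[symmetric]
      using ae_tendsto_integral[OF \<Omega> Z Z' ae] lipschitz_on_continuous_on by blast
    then have "Q n (s \<circ> r)" unfolding Q_def using prob_space.prob_space_distr[OF \<Omega> Z'] by (auto intro!: exI[of _ "distr \<Omega> borel Z'"])
    then show "\<exists>r'. strict_mono r' \<and> Q n (s \<circ> r')" using r by blast
  qed
  have stable: "Q n (s \<circ> r)" if r: "strict_mono r" and q: "Q n s" for n s and r :: "nat \<Rightarrow> nat"
  proof -
    obtain \<mu> where "prob_space \<mu>" "sets \<mu> = sets borel" "bl_conv (\<lambda>k. curve (Suc (s k)) (dd n)) \<mu>" using q unfolding Q_def by blast
    then show ?thesis unfolding Q_def using bl_conv_subseq[OF _ r, of "\<lambda>k. curve (Suc (s k)) (dd n)"] by (auto intro!: exI[of _ \<mu>])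
  qed
  have "Q n diagseq" for n
  proof -
    \<comment> \<open>The diagonal sequence is guaranteed to refine the extraction for
      \<open>n\<close> only after its initial terms are dropped; these do not affect the limit, see
      \<open>bl_conv_offset\<close>.\<close>
    have "Q n (diagseq \<circ> (+) (Suc n))" by (rule diagseq_holds) (rule stable)
    then obtain \<mu> where \<mu>: "prob_space \<mu>" "sets \<mu> = sets borel" "bl_conv (\<lambda>k. curve (Suc ((diagseq \<circ> (+) (Suc n)) k)) (dd n)) \<mu>"
      unfolding Q_def by blast
    from \<mu>(3) have "bl_conv (\<lambda>k. curve (Suc (diagseq (k + Suc n))) (dd n)) \<mu>" by (simp add: add.commute)
    from bl_conv_offset[OF this] show ?thesis unfolding Q_def using \<mu> by blast
  qed
  then show ?thesis using subseq_diagseq unfolding Q_def by blast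
qed

lemma curve_increment_small:
  fixes f :: "real ^ 'n \<Rightarrow> real"
  assumes f: "L-lipschitz_on UNIV f" "bounded (range f)" and e: "e > 0"
  shows "\<exists>\<eta>>0. \<forall>N s t. N \<ge> 1 \<longrightarrow> T / real N < \<eta> \<longrightarrow> s \<in> {0..T} \<longrightarrow> t \<in> {0..T} \<longrightarrow> \<bar>t - s\<bar> < \<eta> \<longrightarrow>
    \<bar>(\<integral>x. f x \<partial>curve N t) - (\<integral>x. f x \<partial>curve N s)\<bar> < e"
proof -
  have L: "0 \<le> L" using lipschitz_on_nonneg[OF f(1)] .
  \<comment> \<open>The summand 1 avoids a division by zero. It suffices to bring the square root
    below \<open>a\<close>, and the time difference and the mesh are granted half of
    \<open>a\<^sup>2\<close> each.\<close>
  define a where "a = e / (L * K1 + 1)"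
  have p: "0 < L * K1 + 1" using L K1_nonneg by (intro add_nonneg_pos mult_nonneg_nonneg) auto
  have a: "0 < a" using e p by (simp add: a_def)
  show ?thesis
  proof (intro exI[of _ "a\<^sup>2 / 2"] conjI allI impI)
    show "0 < a\<^sup>2 / 2" using a by simp
    fix N :: nat and s t assume *: "N \<ge> 1" "T / real N < a\<^sup>2 / 2" "s \<in> {0..T}" "t \<in> {0..T}" "\<bar>t - s\<bar> < a\<^sup>2 / 2"
    have "\<bar>t - s\<bar> + T / N \<le> a\<^sup>2" using add_strict_mono[OF *(5,2)] by simp
    then have s: "sqrt (\<bar>t - s\<bar> + T / N) \<le> a" using a by (intro real_le_lsqrt) auto
    have "\<bar>(\<integral>x. f x \<partial>curve N t) - (\<integral>x. f x \<partial>curve N s)\<bar> \<le> L * sqrt (\<bar>t - s\<bar> + T / N) * K1"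
      by (rule curve_increment[OF f *(1,3,4)])
    also have "\<dots> \<le> L * a * K1" using s L K1_nonneg by (intro mult_right_mono mult_left_mono)
    also have "\<dots> < a * (L * K1 + 1)" using a by (simp add: algebra_simps)
    also have "\<dots> = e" using p by (simp add: a_def)
    finally show "\<bar>(\<integral>x. f x \<partial>curve N t) - (\<integral>x. f x \<partial>curve N s)\<bar> < e" .
  qed
qed

text \<open>Convergence along one subsequence is arranged at the rational times. The increment bound
  makes the curves equicontinuous up to an error of the size of the mesh, so at any other time the
  integrals form Cauchy sequences by comparison with a nearby rational time.\<close>

lemma ex_limit_curve:
  "\<exists>r::nat\<Rightarrow>nat. strict_mono r \<and> (\<forall>t\<in>{0..T}. \<exists>\<mu>. prob_space \<mu> \<and> sets \<mu> = sets borel \<and> bl_conv (\<lambda>k. curve (Suc (r k)) t) \<mu>)"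
proof -
  define X where "X = \<rat> \<inter> {0..T}"
  have X: "countable X" "X \<noteq> {}" using T by (auto simp: X_def countable_rat intro!: exI[of _ 0])
  define dd where "dd = from_nat_into X"
  have D: "dd n \<in> {0..T}" for n using from_nat_into[OF X(2), of n] by (simp add: dd_def X_def)
  obtain r where r: "strict_mono (r::nat\<Rightarrow>nat)" and lim: "\<And>n. \<exists>\<mu>. prob_space \<mu> \<and> sets \<mu> = sets borel \<and> bl_conv (\<lambda>k. curve (Suc (r k)) (dd n)) \<mu>"
    using subsequence_countable_times[of dd, OF D] by blast
  have "\<exists>\<mu>. prob_space \<mu> \<and> sets \<mu> = sets borel \<and> bl_conv (\<lambda>k. curve (Suc (r k)) t) \<mu>" if t: "t \<in> {0..T}" for t
  proof (rule bl_conv_exists)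
    show "prob_space (curve (Suc (r k)) t)" "sets (curve (Suc (r k)) t) = sets borel" for k using curve_prob t by auto
    show "\<exists>R. \<forall>k. measure (curve (Suc (r k)) t) {x. R < norm x} \<le> e" if "e > 0" for e using that t by (intro curve_tight) auto
    fix f :: "real ^ 'n \<Rightarrow> real" and L assume f: "L-lipschitz_on UNIV f" "bounded (range f)"
    have "Cauchy (\<lambda>k. \<integral>x. f x \<partial>curve (Suc (r k)) t)"
    proof (rule metric_CauchyI)
      fix e :: real assume e: "e > 0"
      obtain \<eta> where \<eta>: "\<eta> > 0" "\<And>N s t. N \<ge> 1 \<Longrightarrow> T / real N < \<eta> \<Longrightarrow> s \<in> {0..T} \<Longrightarrow> t \<in> {0..T} \<Longrightarrow> \<bar>t - s\<bar> < \<eta> \<Longrightarrow>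
          \<bar>(\<integral>x. f x \<partial>curve N t) - (\<integral>x. f x \<partial>curve N s)\<bar> < e / 3"
        using curve_increment_small[OF f, of "e / 3"] e by auto
      \<comment> \<open>The inequality is strict for \<open>t = 0\<close> and \<open>t = T\<close>
        too, so a rational time inside the interval also exists near the endpoints.\<close>
      have "max 0 (t - \<eta>) < min T (t + \<eta>)" using t T \<eta> by auto
      from Rats_dense_in_real[OF this] obtain p where p: "p \<in> \<rat>" "max 0 (t - \<eta>) < p" "p < min T (t + \<eta>)" by blast
      then have pX: "p \<in> X" by (auto simp: X_def)
      obtain n where n: "dd n = p" using from_nat_into_surj[OF X(1) pX] by (auto simp: dd_def)
      obtain \<mu> where "bl_conv (\<lambda>k. curve (Suc (r k)) p) \<mu>" using lim[of n] by (auto simp: n)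
      from bl_convD[OF this f] have "Cauchy (\<lambda>k. \<integral>x. f x \<partial>curve (Suc (r k)) p)" by (intro convergent_Cauchy convergentI)
      then obtain M where M: "\<And>k l. k \<ge> M \<Longrightarrow> l \<ge> M \<Longrightarrow> dist (\<integral>x. f x \<partial>curve (Suc (r k)) p) (\<integral>x. f x \<partial>curve (Suc (r l)) p) < e / 3"
        using metric_CauchyD[of _ "e / 3"] e by (metis divide_pos_pos zero_less_numeral)
      obtain M' where M': "T / \<eta> < real M'" using reals_Archimedean2 by blast
      have small: "T / real (Suc (r k)) < \<eta>" if "k \<ge> M'" for k
      proof -
        have "real M' < real (Suc (r k))" using seq_suble[OF r, of k] that by simp
        then have "T / \<eta> < real (Suc (r k))" using M' by simp
        then show ?thesis using \<eta>(1) by (simp add: field_simps)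
      qed
      show "\<exists>M. \<forall>k\<ge>M. \<forall>l\<ge>M. dist (\<integral>x. f x \<partial>curve (Suc (r k)) t) (\<integral>x. f x \<partial>curve (Suc (r l)) t) < e"
      proof (intro exI allI impI)
        fix k l assume kl: "max M M' \<le> k" "max M M' \<le> l"
        have pT: "p \<in> {0..T}" using pX by (simp add: X_def)
        have pt: "\<bar>t - p\<bar> < \<eta>" using p by auto
        have a: "\<bar>(\<integral>x. f x \<partial>curve (Suc (r k)) t) - (\<integral>x. f x \<partial>curve (Suc (r k)) p)\<bar> < e / 3"
          by (rule \<eta>(2)) (use small[of k] kl pT t pt in auto)
        have b: "\<bar>(\<integral>x. f x \<partial>curve (Suc (r l)) t) - (\<integral>x. f x \<partial>curve (Suc (r l)) p)\<bar> < e / 3"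
          by (rule \<eta>(2)) (use small[of l] kl pT t pt in auto)
        have c: "\<bar>(\<integral>x. f x \<partial>curve (Suc (r k)) p) - (\<integral>x. f x \<partial>curve (Suc (r l)) p)\<bar> < e / 3"
          using M[of k l] kl by (simp add: dist_real_def)
        show "dist (\<integral>x. f x \<partial>curve (Suc (r k)) t) (\<integral>x. f x \<partial>curve (Suc (r l)) t) < e"
          using a b c unfolding dist_real_def by linarith
      qed
    qed
    then show "convergent (\<lambda>k. \<integral>x. f x \<partial>curve (Suc (r k)) t)" by (rule Cauchy_convergent)
  qed
  then show ?thesis using r by blast
qed

section \<open>The limit curve and its continuity\<close>

definition mesh_subseq :: "nat \<Rightarrow> nat" where
  "mesh_subseq = (SOME r. strict_mono r \<and> (\<forall>t\<in>{0..T}. \<exists>\<mu>. prob_space \<mu> \<and> sets \<mu> = sets borel \<and> bl_conv (\<lambda>k. curve (Suc (r k)) t) \<mu>))"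

definition mesh :: "nat \<Rightarrow> nat" where "mesh k = Suc (mesh_subseq k)"

text \<open>Extends curves constantly beyond [0,T], so that kernels and joint laws are defined on
  the whole line and measurability involves no restricted domain.\<close>

definition clamp :: "real \<Rightarrow> real" where "clamp t = max 0 (min T t)"

definition limit_curve :: "real \<Rightarrow> (real ^ 'n) measure" where
  "limit_curve t = (SOME \<mu>. prob_space \<mu> \<and> sets \<mu> = sets borel \<and> bl_conv (\<lambda>k. curve (mesh k) (clamp t)) \<mu>)"

lemma clamp_in: "clamp t \<in> {0..T}" using T by (auto simp: clamp_def)
lemma clamp_id: "t \<in> {0..T} \<Longrightarrow> clamp t = t" by (auto simp: clamp_def)

lemma mesh_subseq: "strict_mono mesh_subseq" "t \<in> {0..T} \<Longrightarrow> \<exists>\<mu>. prob_space \<mu> \<and> sets \<mu> = sets borel \<and> bl_conv (\<lambda>k. curve (mesh k) t) \<mu>"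
  using someI_ex[OF ex_limit_curve] unfolding mesh_subseq_def[symmetric] mesh_def by blast+

lemma mesh_ge: "mesh k \<ge> 1" "k \<le> mesh k"
  using seq_suble[OF mesh_subseq(1), of k] by (simp_all add: mesh_def)

lemma mesh_small: "(\<lambda>k. T / real (mesh k)) \<longlonglongrightarrow> 0"
proof (rule Lim_null_comparison)
  show "\<forall>\<^sub>F k in sequentially. norm (T / real (mesh k)) \<le> T * inverse (real (Suc k))"
  proof (intro always_eventually allI)
    fix k
    have "real (Suc k) \<le> real (mesh k)" using seq_suble[OF mesh_subseq(1), of k] by (simp add: mesh_def)
    then show "norm (T / real (mesh k)) \<le> T * inverse (real (Suc k))"
      using T by (simp add: divide_inverse le_imp_inverse_le del: of_nat_Suc)
  qed
  show "(\<lambda>k. T * inverse (real (Suc k))) \<longlonglongrightarrow> 0"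
    using tendsto_mult[OF tendsto_const LIMSEQ_inverse_real_of_nat, of T] by simp
qed

lemma limit_curve: "prob_space (limit_curve t)" "sets (limit_curve t) = sets borel" "bl_conv (\<lambda>k. curve (mesh k) (clamp t)) (limit_curve t)"
  using someI_ex[OF mesh_subseq(2)[OF clamp_in]] unfolding limit_curve_def by blast+

text \<open>The times may move with \<open>k\<close>, as the random times delivered by the
  representation theorem do. The increment bound, whose mesh term vanishes, reduces this to
  convergence at the fixed time \<open>t\<close>.\<close>

lemma limit_curve_conv:
  assumes \<sigma>: "strict_mono \<sigma>" and s: "\<And>k. s k \<in> {0..T}" and t: "t \<in> {0..T}" and l: "s \<longlonglongrightarrow> t"
  shows "bl_conv (\<lambda>k. curve (mesh (\<sigma> k)) (s k)) (limit_curve t)"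
  unfolding bl_conv_def
proof (intro allI impI)
  fix f :: "real ^ 'n \<Rightarrow> real" and L assume f: "L-lipschitz_on UNIV f" "bounded (range f)"
  have 1: "(\<lambda>k. \<integral>x. f x \<partial>curve (mesh (\<sigma> k)) t) \<longlonglongrightarrow> (\<integral>x. f x \<partial>limit_curve t)"
    using bl_convD[OF bl_conv_subseq[OF limit_curve(3)[of t] \<sigma>] f] clamp_id[OF t] by simp
  have "(\<lambda>k. (\<integral>x. f x \<partial>curve (mesh (\<sigma> k)) (s k)) - (\<integral>x. f x \<partial>curve (mesh (\<sigma> k)) t)) \<longlonglongrightarrow> 0"
  proof (rule LIMSEQ_I)
    fix e :: real assume e: "0 < e"
    obtain \<eta> where \<eta>: "\<eta> > 0" "\<And>N s t. N \<ge> 1 \<Longrightarrow> T / real N < \<eta> \<Longrightarrow> s \<in> {0..T} \<Longrightarrow> t \<in> {0..T} \<Longrightarrow> \<bar>t - s\<bar> < \<eta> \<Longrightarrow>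
        \<bar>(\<integral>x. f x \<partial>curve N t) - (\<integral>x. f x \<partial>curve N s)\<bar> < e"
      using curve_increment_small[OF f e] by auto
    have "\<forall>\<^sub>F k in sequentially. T / real (mesh (\<sigma> k)) < \<eta> \<and> dist (s k) t < \<eta>"
      using order_tendstoD(2)[OF LIMSEQ_subseq_LIMSEQ[OF mesh_small \<sigma>, unfolded o_def] \<eta>(1)] tendstoD[OF l \<eta>(1)] by (rule eventually_conj)
    then obtain M where M: "\<And>k. k \<ge> M \<Longrightarrow> T / real (mesh (\<sigma> k)) < \<eta> \<and> dist (s k) t < \<eta>" unfolding eventually_sequentially by blast
    show "\<exists>no. \<forall>k\<ge>no. norm ((\<integral>x. f x \<partial>curve (mesh (\<sigma> k)) (s k)) - (\<integral>x. f x \<partial>curve (mesh (\<sigma> k)) t) - 0) < e"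
      using \<eta>(2)[OF mesh_ge(1) _ t s] M by (auto simp: dist_real_def)
  qed
  from tendsto_add[OF this 1] show "(\<lambda>k. \<integral>x. f x \<partial>curve (mesh (\<sigma> k)) (s k)) \<longlonglongrightarrow> (\<integral>x. f x \<partial>limit_curve t)" by simp
qed

lemma limit_curve_W2_limit:
  assumes \<sigma>: "strict_mono \<sigma>" and s: "\<And>k. s k \<in> {0..T}" and t: "t \<in> {0..T}" and l: "s \<longlonglongrightarrow> t"
  shows "limit_curve t \<in> P2" "(\<lambda>k. W2 (curve (mesh (\<sigma> k)) (s k)) (limit_curve t)) \<longlonglongrightarrow> 0"
    "\<rho> \<ge> 0 \<Longrightarrow> (\<lambda>k. \<integral>x. max 0 ((norm x)\<^sup>2 - \<rho>) \<partial>curve (mesh (\<sigma> k)) (s k)) \<longlonglongrightarrow> (\<integral>x. max 0 ((norm x)\<^sup>2 - \<rho>) \<partial>limit_curve t)"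
    "(\<lambda>k. \<integral>x. (norm x)\<^sup>2 \<partial>curve (mesh (\<sigma> k)) (s k)) \<longlonglongrightarrow> (\<integral>x. (norm x)\<^sup>2 \<partial>limit_curve t)"
proof -
  have P: "curve (mesh (\<sigma> k)) (s k) \<in> P2" for k using curve_P2 mesh_ge s by blast
  have UI: "\<exists>\<rho>. \<forall>k. (\<integral>x. max 0 ((norm x)\<^sup>2 - \<rho>) \<partial>curve (mesh (\<sigma> k)) (s k)) \<le> e" if "e > 0" for e
    using curve_uniformly_integrable[OF that] mesh_ge s by blast
  note u = uniformly_integrable_limit[OF P limit_curve(1,2) limit_curve_conv[OF \<sigma> s t l] UI]
  show "limit_curve t \<in> P2" "(\<lambda>k. W2 (curve (mesh (\<sigma> k)) (s k)) (limit_curve t)) \<longlonglongrightarrow> 0"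
    "(\<lambda>k. \<integral>x. (norm x)\<^sup>2 \<partial>curve (mesh (\<sigma> k)) (s k)) \<longlonglongrightarrow> (\<integral>x. (norm x)\<^sup>2 \<partial>limit_curve t)" by (rule u, assumption)+
  show "(\<lambda>k. \<integral>x. max 0 ((norm x)\<^sup>2 - \<rho>) \<partial>curve (mesh (\<sigma> k)) (s k)) \<longlonglongrightarrow> (\<integral>x. max 0 ((norm x)\<^sup>2 - \<rho>) \<partial>limit_curve t)" if "\<rho> \<ge> 0"
    using u(3) that by blast
qed

lemma limit_curve_P2: "t \<in> {0..T} \<Longrightarrow> limit_curve t \<in> P2"
  using limit_curve_W2_limit(1)[of "\<lambda>k. k" "\<lambda>_. t" t] by (simp add: strict_mono_def)

lemma limit_curve_moment: "t \<in> {0..T} \<Longrightarrow> (\<integral>x. (norm x)\<^sup>2 \<partial>limit_curve t) \<le> K0"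
  using limit_curve_W2_limit(4)[of "\<lambda>k. k" "\<lambda>_. t" t] curve_moment mesh_ge by (auto simp: strict_mono_def intro!: LIMSEQ_le_const2)

lemma limit_curve_uniformly_integrable:
  assumes e: "e > 0" shows "\<exists>\<rho>>0. \<forall>t\<in>{0..T}. (\<integral>x. max 0 ((norm x)\<^sup>2 - \<rho>) \<partial>limit_curve t) \<le> e"
proof -
  obtain \<rho> where \<rho>: "\<rho> > 0" "\<And>N t. N \<ge> 1 \<Longrightarrow> t \<in> {0..T} \<Longrightarrow> (\<integral>x. max 0 ((norm x)\<^sup>2 - \<rho>) \<partial>curve N t) \<le> e"
    using curve_uniformly_integrable[OF e] by blast
  have "(\<integral>x. max 0 ((norm x)\<^sup>2 - \<rho>) \<partial>limit_curve t) \<le> e" if t: "t \<in> {0..T}" for t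
    by (rule LIMSEQ_le_const2[OF limit_curve_W2_limit(3)[of "\<lambda>k. k" "\<lambda>_. t" t \<rho>]]) (use \<rho> t mesh_ge in \<open>auto simp: strict_mono_def\<close>)
  then show ?thesis using \<rho>(1) by blast
qed

lemma limit_curve_0: "limit_curve 0 = \<nu>"
proof (rule bl_conv_unique[OF limit_curve(3)])
  show "bl_conv (\<lambda>k. curve (mesh k) (clamp 0)) \<nu>" using T by (simp add: clamp_id curve_0 bl_conv_def)
qed (use limit_curve \<nu> in \<open>auto simp: P2_def\<close>)

lemma limit_curve_lipschitz:
  assumes f: "L-lipschitz_on UNIV f" "bounded (range f)" and st: "s \<in> {0..T}" "t \<in> {0..T}"
  shows "\<bar>(\<integral>x. f x \<partial>limit_curve t) - (\<integral>x. f x \<partial>limit_curve s)\<bar> \<le> L * sqrt \<bar>t - s\<bar> * K1"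
proof -
  have 1: "(\<lambda>k. \<bar>(\<integral>x. f x \<partial>curve (mesh k) t) - (\<integral>x. f x \<partial>curve (mesh k) s)\<bar>) \<longlonglongrightarrow> \<bar>(\<integral>x. f x \<partial>limit_curve t) - (\<integral>x. f x \<partial>limit_curve s)\<bar>"
    using bl_convD[OF limit_curve(3)[of t] f] bl_convD[OF limit_curve(3)[of s] f] st by (intro tendsto_intros) (simp_all add: clamp_id)
  have 2: "(\<lambda>k. L * sqrt (\<bar>t - s\<bar> + T / real (mesh k)) * K1) \<longlonglongrightarrow> L * sqrt (\<bar>t - s\<bar> + 0) * K1"
    by (intro tendsto_intros mesh_small)
  show ?thesis using LIMSEQ_le[OF 1 2] curve_increment[OF f mesh_ge(1) st] by simp
qed

lemma limit_curve_continuous: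
  assumes s: "\<And>k. s k \<in> {0..T}" and t: "t \<in> {0..T}" and l: "s \<longlonglongrightarrow> t"
  shows "bl_conv (\<lambda>k. limit_curve (s k)) (limit_curve t)" "(\<lambda>k. W2 (limit_curve (s k)) (limit_curve t)) \<longlonglongrightarrow> 0"
proof -
  show b: "bl_conv (\<lambda>k. limit_curve (s k)) (limit_curve t)"
    unfolding bl_conv_def
  proof (intro allI impI)
    fix f :: "real ^ 'n \<Rightarrow> real" and L assume f: "L-lipschitz_on UNIV f" "bounded (range f)"
    show "(\<lambda>k. \<integral>x. f x \<partial>limit_curve (s k)) \<longlonglongrightarrow> (\<integral>x. f x \<partial>limit_curve t)"
    proof (rule LIM_zero_cancel, rule Lim_null_comparison)
      show "\<forall>\<^sub>F k in sequentially. norm ((\<integral>x. f x \<partial>limit_curve (s k)) - (\<integral>x. f x \<partial>limit_curve t)) \<le> L * sqrt \<bar>s k - t\<bar> * K1"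
        using limit_curve_lipschitz[OF f t s] by simp
      have "(\<lambda>k. L * sqrt \<bar>s k - t\<bar> * K1) \<longlonglongrightarrow> L * sqrt \<bar>t - t\<bar> * K1" by (intro tendsto_intros l)
      then show "(\<lambda>k. L * sqrt \<bar>s k - t\<bar> * K1) \<longlonglongrightarrow> 0" by simp
    qed
  qed
  have UI: "\<exists>\<rho>. \<forall>k. (\<integral>x. max 0 ((norm x)\<^sup>2 - \<rho>) \<partial>limit_curve (s k)) \<le> e" if "e > 0" for e
    using limit_curve_uniformly_integrable[OF that] s by blast
  show "(\<lambda>k. W2 (limit_curve (s k)) (limit_curve t)) \<longlonglongrightarrow> 0"
    by (rule uniformly_integrable_limit(4)[OF limit_curve_P2[OF s] limit_curve(1,2) b UI])
qed

lemma flow_limit_curve: "flow_of_probabilities T limit_curve"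
  unfolding flow_of_probabilities_def
proof (intro conjI ballI allI impI limit_curve_P2)
  fix f :: "real ^ 'n \<Rightarrow> real" assume f: "continuous_on UNIV f" "bounded (range f)"
  show "continuous_on {0..T} (\<lambda>t. \<integral>x. f x \<partial>limit_curve t)"
    unfolding continuous_on_sequentially o_def
  proof (intro allI ballI impI, elim conjE)
    fix s t assume t: "t \<in> {0..T}" and s: "\<forall>n. s n \<in> {0..T}" and l: "s \<longlonglongrightarrow> t"
    have s: "\<And>n. s n \<in> {0..T}" using s by simp
    have tight: "\<exists>R. \<forall>k. measure (limit_curve (s k)) {x. R < norm x} \<le> e" if "e > 0" for e
      using second_moment_tight[of UNIV "\<lambda>k. limit_curve (s k)" K0 e] limit_curve_P2 limit_curve_moment s that by auto
    show "(\<lambda>n. \<integral>x. f x \<partial>limit_curve (s n)) \<longlonglongrightarrow> (\<integral>x. f x \<partial>limit_curve t)"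
      by (rule bl_conv_imp_weak[OF limit_curve(1,2) limit_curve(1,2) tight limit_curve_continuous(1)[OF s t l] f])
  qed
qed

end

section \<open>Flows as measures on space-time\<close>

text \<open>Closed sets are a generator stable under intersections, and their measures are limits of
  the integrals assumed to be measurable.\<close>

lemma measurable_kernel_if_lipschitz:
  fixes \<kappa> :: "real \<Rightarrow> 'a::metric_space measure"
  assumes p: "\<And>t. prob_space (\<kappa> t)" and s: "\<And>t. sets (\<kappa> t) = sets borel"
    and f: "\<And>f L. L-lipschitz_on UNIV f \<Longrightarrow> bounded (range f) \<Longrightarrow> (\<lambda>t. \<integral>x. (f x :: real) \<partial>\<kappa> t) \<in> borel_measurable borel"
  shows "\<kappa> \<in> measurable borel (subprob_algebra borel)"
proof (rule measurable_subprob_algebra_generated[where \<Omega> = UNIV and G = "Collect closed"])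
  show "sets borel = sigma_sets UNIV (Collect closed :: 'a set set)" by (subst borel_eq_closed) simp
  show "Int_stable (Collect closed :: 'a set set)" by (auto simp: Int_stable_def)
  show "subprob_space (\<kappa> a)" "sets (\<kappa> a) = sets borel" for a using p s by (auto intro: prob_space_imp_subprob_space)
  have sp: "space (\<kappa> t) = UNIV" for t using sets_eq_imp_space_eq[OF s[of t]] by simp
  have "(\<lambda>t. emeasure (\<kappa> t) UNIV) = (\<lambda>t. 1)" using prob_space.emeasure_space_1[OF p] sp by simp
  then show "(\<lambda>t. emeasure (\<kappa> t) UNIV) \<in> borel_measurable borel" by simp
  fix C :: "'a set" assume "C \<in> Collect closed"
  then have C: "closed C" by simp
  show "(\<lambda>t. emeasure (\<kappa> t) C) \<in> borel_measurable borel"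
  proof (cases "C = {}")
    case False
    obtain f :: "nat \<Rightarrow> 'a \<Rightarrow> real" where g: "\<And>k. (real k)-lipschitz_on UNIV (f k)" "\<And>k x. 0 \<le> f k x \<and> f k x \<le> 1"
      "\<And>x. (\<lambda>k. f k x) \<longlonglongrightarrow> indicator C x" by (rule closed_indicator_approx[OF C False]) (rule that)
    have b: "bounded (range (f k))" for k using g(2) by (auto simp: bounded_iff intro!: exI[of _ 1])
    have "(\<lambda>t. measure (\<kappa> t) C) \<in> borel_measurable borel"
    proof (rule borel_measurable_LIMSEQ_real)
      show "(\<lambda>t. \<integral>x. f k x \<partial>\<kappa> t) \<in> borel_measurable borel" for k by (rule f[OF g(1) b])
      fix t
      interpret prob_space "\<kappa> t" by (rule p)
      have fm: "f k \<in> borel_measurable borel" for k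
        using lipschitz_on_continuous_on[OF g(1)] by (rule borel_measurable_continuous_onI)
      have "(\<lambda>k. \<integral>x. f k x \<partial>\<kappa> t) \<longlonglongrightarrow> (\<integral>x. indicator C x \<partial>\<kappa> t)"
        by (rule integral_dominated_convergence[where w = "\<lambda>_. 1"])
          (use C fm g s in \<open>auto intro!: borel_measurable_indicator simp: measurable_cong_sets[OF s refl]\<close>)
      then show "(\<lambda>k. \<integral>x. f k x \<partial>\<kappa> t) \<longlonglongrightarrow> measure (\<kappa> t) C" using C s sp by simp
    qed
    then show ?thesis using finite_measure.emeasure_eq_measure[OF prob_space.finite_measure[OF p]] by simp
  qed simp
qed simp

text \<open>Time is uniformly distributed over [0,T]. Total mass 1 makes the representation theorem
  applicable, at the price of a factor 1 / T in front of time integrals.\<close>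

definition flow_measure :: "real \<Rightarrow> (real \<Rightarrow> 'a::euclidean_space measure) \<Rightarrow> (real \<times> 'a) measure" where
  "flow_measure T \<kappa> = uniform_measure lborel {0..T} \<bind> (\<lambda>t. distr (\<kappa> t) borel (Pair t))"

lemma measurable_flow_kernel:
  fixes \<kappa> :: "real \<Rightarrow> 'a::euclidean_space measure"
  assumes [measurable]: "\<kappa> \<in> measurable borel (subprob_algebra borel)"
  shows "(\<lambda>t. distr (\<kappa> t) borel (Pair t)) \<in> measurable (uniform_measure lborel {0..T}) (subprob_algebra (borel :: (real \<times> 'a) measure))"
proof -
  have "(\<lambda>t. distr (\<kappa> t) borel (Pair t)) \<in> measurable borel (subprob_algebra (borel :: (real \<times> 'a) measure))"
    by (rule measurable_distr2[where M = borel]) (auto simp: borel_prod)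
  then show ?thesis by (simp add: measurable_def)
qed

lemma flow_measure:
  fixes \<kappa> :: "real \<Rightarrow> 'a::euclidean_space measure"
  assumes T: "T > 0" and \<kappa>: "\<kappa> \<in> measurable borel (subprob_algebra borel)" and p: "\<And>t. prob_space (\<kappa> t)"
  shows "prob_space (flow_measure T \<kappa>)" "sets (flow_measure T \<kappa>) = sets borel"
    and "\<And>f B. f \<in> borel_measurable borel \<Longrightarrow> (\<And>z. \<bar>f z\<bar> \<le> B) \<Longrightarrow>
      (\<lambda>t. \<integral>x. (f (t, x) :: real) \<partial>\<kappa> t) \<in> borel_measurable borel \<and>
      (\<integral>z. f z \<partial>flow_measure T \<kappa>) = (LINT t:{0..T}|lborel. (\<integral>x. f (t, x) \<partial>\<kappa> t)) / T"
    and "\<And>Q. Measurable.pred borel Q \<Longrightarrow>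
      (AE z in flow_measure T \<kappa>. Q z) \<longleftrightarrow> (AE t in lborel. t \<in> {0..T} \<longrightarrow> (AE x in \<kappa> t. Q (t, x)))"
proof -
  let ?U = "uniform_measure lborel {0..T} :: real measure" and ?K = "\<lambda>t. distr (\<kappa> t) borel (Pair t) :: (real \<times> 'a) measure"
  have em: "emeasure lborel {0..T} = ennreal T" using T by simp
  have U: "prob_space ?U" using em T by (intro prob_space_uniform_measure) auto
  interpret U: prob_space ?U by (rule U)
  have K: "?K \<in> measurable ?U (subprob_algebra borel)" by (rule measurable_flow_kernel[OF \<kappa>])
  have s\<kappa>: "sets (\<kappa> t) = sets borel" for t using sets_kernel[OF \<kappa>] by simp
  note [measurable_cong] = s\<kappa>
  have Pt: "Pair t \<in> measurable (\<kappa> t) borel" for t :: real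
    using s\<kappa> by (auto simp: measurable_cong_sets[OF s\<kappa> refl] intro!: borel_measurable_continuous_onI continuous_intros)
  have pK: "prob_space (?K t)" for t by (rule prob_space.prob_space_distr[OF p Pt])
  show sets: "sets (flow_measure T \<kappa>) = sets borel" unfolding flow_measure_def by (rule sets_bind) auto
  show "prob_space (flow_measure T \<kappa>)" unfolding flow_measure_def
    by (rule U.prob_space_bind[where S = borel]) (use pK K in auto)
  show "(\<lambda>t. \<integral>x. f (t, x) \<partial>\<kappa> t) \<in> borel_measurable borel \<and>
      (\<integral>z. f z \<partial>flow_measure T \<kappa>) = (LINT t:{0..T}|lborel. (\<integral>x. f (t, x) \<partial>\<kappa> t)) / T"
    if f [measurable]: "f \<in> borel_measurable borel" and B: "\<And>z. \<bar>f z\<bar> \<le> B" for f :: "real \<times> 'a \<Rightarrow> real" and B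
  proof
    have eqK: "(\<integral>z. f z \<partial>?K t) = (\<integral>x. f (t, x) \<partial>\<kappa> t)" for t by (rule integral_distr[OF Pt f])
    have "(\<lambda>t. \<integral>z. f z \<partial>?K t) \<in> borel_measurable ?U"
      using measurable_compose[OF K integral_measurable_subprob_algebra[OF f]] by simp
    then show m: "(\<lambda>t. \<integral>x. f (t, x) \<partial>\<kappa> t) \<in> borel_measurable borel" unfolding eqK by (simp add: measurable_def)
    have "(\<integral>z. f z \<partial>flow_measure T \<kappa>) = (\<integral>t. (\<integral>z. f z \<partial>?K t) \<partial>?U)"
      unfolding flow_measure_def
    proof (rule integral_bind[where K = borel and B' = 1 and B = B])
      show "?K \<in> measurable ?U (subprob_algebra borel)" by (rule K)
      show "finite_measure ?U" by (rule U.finite_measure)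
      show "AE t in ?U. emeasure (?K t) (space (?K t)) \<le> ennreal 1"
        using prob_space.emeasure_space_1[OF pK] by (intro AE_I2) simp
    qed (use f B in auto)
    also have "\<dots> = (\<integral>t. (\<integral>x. f (t, x) \<partial>\<kappa> t) \<partial>?U)" unfolding eqK ..
    also have "\<dots> = (\<integral>t. (indicator {0..T} t / T) *\<^sub>R (\<integral>x. f (t, x) \<partial>\<kappa> t) \<partial>lborel)"
    proof -
      have "?U = density lborel (\<lambda>t. ennreal (indicator {0..T} t / T))"
        unfolding uniform_measure_def em using T
        by (intro density_cong) (auto simp: divide_ennreal indicator_def simp flip: ennreal_1)
      then show ?thesis using m T by (simp add: integral_density)
    qed
    also have "\<dots> = (LINT t:{0..T}|lborel. (\<integral>x. f (t, x) \<partial>\<kappa> t)) / T"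
      unfolding set_lebesgue_integral_def by (simp add: divide_inverse mult_ac)
    finally show "(\<integral>z. f z \<partial>flow_measure T \<kappa>) = (LINT t:{0..T}|lborel. (\<integral>x. f (t, x) \<partial>\<kappa> t)) / T" .
  qed
  show "(AE z in flow_measure T \<kappa>. Q z) \<longleftrightarrow> (AE t in lborel. t \<in> {0..T} \<longrightarrow> (AE x in \<kappa> t. Q (t, x)))"
    if Q [measurable]: "Measurable.pred borel Q" for Q
  proof -
    have "(AE z in flow_measure T \<kappa>. Q z) \<longleftrightarrow> (AE t in ?U. AE z in ?K t. Q z)"
      unfolding flow_measure_def by (rule AE_bind[OF K Q])
    also have "\<dots> \<longleftrightarrow> (AE t in ?U. AE x in \<kappa> t. Q (t, x))"
      using AE_distr_iff[OF Pt, of Q] Q by (simp add: pred_def)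
    also have "\<dots> \<longleftrightarrow> (AE t in lborel. t \<in> {0..T} \<longrightarrow> (AE x in \<kappa> t. Q (t, x)))"
      using em T by (intro AE_uniform_measure) auto
    finally show ?thesis .
  qed
qed

section \<open>Conditional means and closed convex sets\<close>

text \<open>Conditional expectation given the first component, taken coordinatewise. Being
  measurable for the sigma-algebra of that component, it is a function of it, obtained by inserting
  0 for the second component.\<close>

lemma conditional_expectation_disintegration:
  fixes P :: "('c::euclidean_space \<times> 'y::euclidean_space) measure"
  assumes P: "prob_space P" and s: "sets P = sets borel" and i: "\<And>i. i \<in> Basis \<Longrightarrow> integrable P (\<lambda>p. snd p \<bullet> i)"
  obtains g :: "'c \<Rightarrow> 'y" where "g \<in> borel_measurable borel"
    "\<And>i. i \<in> Basis \<Longrightarrow> integrable P (\<lambda>p. g (fst p) \<bullet> i)"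
    "\<And>i \<psi>. i \<in> Basis \<Longrightarrow> \<psi> \<in> borel_measurable borel \<Longrightarrow> bounded (range \<psi>) \<Longrightarrow>
       (\<integral>p. \<psi> (fst p) * (snd p \<bullet> i) \<partial>P) = (\<integral>p. \<psi> (fst p) * (g (fst p) \<bullet> i) \<partial>P)"
proof -
  interpret prob_space P by fact
  define V where "V = vimage_algebra (UNIV :: ('c \<times> 'y) set) fst (borel :: 'c measure)"
  have sp: "space P = UNIV" using sets_eq_imp_space_eq[OF s] by simp
  have fst_m: "fst \<in> measurable P borel"
    by (auto simp: measurable_cong_sets[OF s refl] intro!: borel_measurable_continuous_onI continuous_intros)
  have fst_V: "fst \<in> measurable V borel" unfolding V_def by (rule measurable_vimage_algebra1) simp
  have setsV: "sets V = {fst -` A \<inter> UNIV | A. A \<in> sets borel}" unfolding V_def by (rule sets_vimage_algebra2) simp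
  have sub: "subalgebra P V"
    unfolding subalgebra_def
  proof
    show "space V = space P" by (simp add: V_def sp)
    show "sets V \<subseteq> sets P" unfolding setsV using measurable_sets[OF fst_m] by (auto simp: sp)
  qed
  interpret finite_measure_subalgebra P V by unfold_locales (rule sub)
  define c where "c i = real_cond_exp P V (\<lambda>p. snd p \<bullet> i)" for i
  have cV: "c i \<in> borel_measurable V" for i unfolding c_def by (rule borel_measurable_cond_exp)
  \<comment> \<open>Level sets of \<open>c i\<close> belong to the sigma-algebra of the first
    component and are therefore cylinders: with \<open>(z, 0)\<close> they contain every
    \<open>(z, y)\<close>.\<close>
  have c_fst: "c i (z, y) = c i (z, 0)" for i z y
  proof -
    have "c i -` {c i (z, 0)} \<inter> space V \<in> sets V" by (rule measurable_sets[OF cV]) simp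
    then obtain A where A: "c i -` {c i (z, 0)} = fst -` A" unfolding setsV by (auto simp: V_def)
    moreover have "(z, 0) \<in> c i -` {c i (z, 0)}" by simp
    ultimately have "z \<in> A" unfolding A by simp
    then have "(z, y) \<in> c i -` {c i (z, 0)}" unfolding A by simp
    then show ?thesis by simp
  qed
  define g where "g z = (\<Sum>i\<in>Basis. c i (z, 0) *\<^sub>R i)" for z
  have gi: "g (fst p) \<bullet> i = c i p" if "i \<in> Basis" for p i
    using c_fst[of i "fst p" "snd p"] that by (simp add: g_def inner_sum_left_Basis)
  have cP: "c i \<in> borel_measurable borel" for i
    using measurable_from_subalg[OF sub cV[of i]] by (simp add: measurable_cong_sets[OF s refl])
  have "(\<lambda>z. c i (z, 0)) \<in> borel_measurable borel" for i
    by (rule measurable_compose[OF _ cP]) (auto intro!: borel_measurable_continuous_onI continuous_intros)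
  then have gm: "g \<in> borel_measurable borel" unfolding g_def[abs_def] by (intro borel_measurable_sum borel_measurable_scaleR) auto
  show ?thesis
  proof (rule that[OF gm])
    show "integrable P (\<lambda>p. g (fst p) \<bullet> i)" if "i \<in> Basis" for i
      using real_cond_exp_int(1)[OF i[OF that]] that by (simp add: gi c_def)
    fix i :: 'y and \<psi> :: "'c \<Rightarrow> real" assume i': "i \<in> Basis" and \<psi> [measurable]: "\<psi> \<in> borel_measurable borel" and "bounded (range \<psi>)"
    then obtain B where B: "\<And>z. \<bar>\<psi> z\<bar> \<le> B" by (auto simp: bounded_iff)
    have \<psi>P: "(\<lambda>p. \<psi> (fst p)) \<in> borel_measurable P" by (rule measurable_compose[OF fst_m \<psi>])
    have "integrable P (\<lambda>p. \<psi> (fst p) * (snd p \<bullet> i))"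
    proof (rule Bochner_Integration.integrable_bound)
      show "integrable P (\<lambda>p. B * (snd p \<bullet> i))" using i[OF i'] by simp
      show "(\<lambda>p. \<psi> (fst p) * (snd p \<bullet> i)) \<in> borel_measurable P" using \<psi>P i[OF i'] by (intro borel_measurable_times) auto
      show "AE p in P. norm (\<psi> (fst p) * (snd p \<bullet> i)) \<le> norm (B * (snd p \<bullet> i))"
      proof (rule AE_I2)
        fix p
        have "\<bar>\<psi> (fst p)\<bar> * \<bar>snd p \<bullet> i\<bar> \<le> \<bar>B\<bar> * \<bar>snd p \<bullet> i\<bar>" using B[of "fst p"] by (intro mult_right_mono) auto
        then show "norm (\<psi> (fst p) * (snd p \<bullet> i)) \<le> norm (B * (snd p \<bullet> i))" by (simp add: abs_mult)
      qed
    qed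
    from real_cond_exp_intg(2)[OF this measurable_compose[OF fst_V \<psi>]] i[OF i']
    show "(\<integral>p. \<psi> (fst p) * (snd p \<bullet> i) \<partial>P) = (\<integral>p. \<psi> (fst p) * (g (fst p) \<bullet> i) \<partial>P)"
      by (simp add: gi[OF i'] c_def)
  qed
qed

text \<open>Sums the scalar identities over the basis, so that the generator, an inner product with
  a vector depending on time and position, can serve as a test.\<close>

lemma disintegration_inner:
  fixes P :: "('c::euclidean_space \<times> 'y::euclidean_space) measure"
  assumes P: "prob_space P" and s: "sets P = sets borel" and i: "integrable P (\<lambda>p. norm (snd p))"
  obtains g :: "'c \<Rightarrow> 'y" where "g \<in> borel_measurable borel"
    "\<And>v. v \<in> borel_measurable borel \<Longrightarrow> bounded (range v) \<Longrightarrow> integrable P (\<lambda>p. v (fst p) \<bullet> snd p)"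
    "\<And>v. v \<in> borel_measurable borel \<Longrightarrow> bounded (range v) \<Longrightarrow> integrable P (\<lambda>p. v (fst p) \<bullet> g (fst p))"
    "\<And>v. v \<in> borel_measurable borel \<Longrightarrow> bounded (range v) \<Longrightarrow>
       (\<integral>p. v (fst p) \<bullet> snd p \<partial>P) = (\<integral>p. v (fst p) \<bullet> g (fst p) \<partial>P)"
proof -
  have fst_m: "fst \<in> measurable P borel"
    by (auto simp: measurable_cong_sets[OF s refl] intro!: borel_measurable_continuous_onI continuous_intros)
  have snd_m: "snd \<in> measurable P borel"
    by (auto simp: measurable_cong_sets[OF s refl] intro!: borel_measurable_continuous_onI continuous_intros)
  have ii: "integrable P (\<lambda>p. snd p \<bullet> i)" if "i \<in> Basis" for i
  proof (rule Bochner_Integration.integrable_bound[OF i])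
    show "(\<lambda>p. snd p \<bullet> i) \<in> borel_measurable P" using snd_m by (intro borel_measurable_inner) auto
    show "AE p in P. norm (snd p \<bullet> i) \<le> norm (norm (snd p))" using Basis_le_norm[OF that] by (intro AE_I2) simp
  qed
  obtain g where g: "g \<in> borel_measurable borel"
    and gi: "\<And>i. i \<in> Basis \<Longrightarrow> integrable P (\<lambda>p. g (fst p) \<bullet> i)"
    and eq: "\<And>i \<psi>. i \<in> Basis \<Longrightarrow> \<psi> \<in> borel_measurable borel \<Longrightarrow> bounded (range \<psi>) \<Longrightarrow>
       (\<integral>p. \<psi> (fst p) * (snd p \<bullet> i) \<partial>P) = (\<integral>p. \<psi> (fst p) * (g (fst p) \<bullet> i) \<partial>P)"
    by (rule conditional_expectation_disintegration[OF P s ii], assumption) (rule that)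
  have bd: "integrable P (\<lambda>p. \<psi> (fst p) * f p)"
    if \<psi>: "\<psi> \<in> borel_measurable borel" and "bounded (range \<psi>)" and f: "integrable P f" for \<psi> :: "'c \<Rightarrow> real" and f
  proof -
    obtain B where B: "\<And>z. \<bar>\<psi> z\<bar> \<le> B" using \<open>bounded (range \<psi>)\<close> by (auto simp: bounded_iff)
    show ?thesis
  proof (rule Bochner_Integration.integrable_bound)
    show "integrable P (\<lambda>p. B * f p)" using f by simp
    show "(\<lambda>p. \<psi> (fst p) * f p) \<in> borel_measurable P"
      using measurable_compose[OF fst_m \<psi>] f by (intro borel_measurable_times) auto
    show "AE p in P. norm (\<psi> (fst p) * f p) \<le> norm (B * f p)"
    proof (rule AE_I2)
      fix p
      have "\<bar>\<psi> (fst p)\<bar> * \<bar>f p\<bar> \<le> \<bar>B\<bar> * \<bar>f p\<bar>" using B[of "fst p"] by (intro mult_right_mono) auto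
      then show "norm (\<psi> (fst p) * f p) \<le> norm (B * f p)" by (simp add: abs_mult)
    qed
  qed
  qed
  have vi: "(\<lambda>z. v z \<bullet> i) \<in> borel_measurable borel" "bounded (range (\<lambda>z. v z \<bullet> i))"
    if "v \<in> borel_measurable borel" "bounded (range v)" "i \<in> Basis" for v :: "'c \<Rightarrow> 'y" and i
    using that order_trans[OF Basis_le_norm[OF that(3)]] by (auto simp: bounded_iff; blast)+
  have I: "integrable P (\<lambda>p. v (fst p) \<bullet> i * (snd p \<bullet> i))" "integrable P (\<lambda>p. v (fst p) \<bullet> i * (g (fst p) \<bullet> i))"
    if "v \<in> borel_measurable borel" "bounded (range v)" "i \<in> Basis" for v :: "'c \<Rightarrow> 'y" and i
    using bd[OF vi(1)[OF that] vi(2)[OF that]] ii gi that(3) by auto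
  show ?thesis
  proof (rule that[OF g])
    fix v :: "'c \<Rightarrow> 'y" assume v: "v \<in> borel_measurable borel" "bounded (range v)"
    show "integrable P (\<lambda>p. v (fst p) \<bullet> snd p)" "integrable P (\<lambda>p. v (fst p) \<bullet> g (fst p))"
      using I[OF v] by (subst euclidean_inner; simp)+
    show "(\<integral>p. v (fst p) \<bullet> snd p \<partial>P) = (\<integral>p. v (fst p) \<bullet> g (fst p) \<partial>P)"
      using I[OF v] eq[OF _ vi(1)[OF v] vi(2)[OF v]] by (subst (1 2) euclidean_inner) simp
  qed
qed

text \<open>A point outside \<open>S\<close> is strictly separated with a gap \<delta>. Because
  \<open>S\<close> is bounded, the normal can be moved into the dense set \<open>Q\<close>; the
  errors on \<open>S\<close> and at \<open>x\<close> take at most a third of the gap each, and the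
  remaining third contains a rational level.\<close>

lemma mem_closed_convex_if_rational_halfspaces:
  fixes S :: "'a::euclidean_space set"
  assumes S: "closed S" "convex S" "S \<noteq> {}" "bounded S"
    and Q: "\<And>X. open X \<Longrightarrow> X \<noteq> {} \<Longrightarrow> \<exists>d\<in>Q. d \<in> X"
    and h: "\<And>p c. p \<in> Q \<Longrightarrow> c \<in> \<rat> \<Longrightarrow> (\<And>y. y \<in> S \<Longrightarrow> p \<bullet> y < c) \<Longrightarrow> p \<bullet> x \<le> c"
  shows "x \<in> S"
proof (rule ccontr)
  assume "x \<notin> S"
  then obtain a b where ab: "a \<bullet> x < b" "\<And>y. y \<in> S \<Longrightarrow> b < a \<bullet> y"
    using separating_hyperplane_closed_point[OF S(2,1)] by blast
  obtain M where M: "\<And>y. y \<in> S \<Longrightarrow> norm y \<le> M" "M > 0" using S(4) bounded_pos by blast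
  define \<delta> where "\<delta> = b - a \<bullet> x"
  define e where "e = \<delta> / (3 * (M + norm x + 1))"
  have pos: "0 < \<delta>" "0 < M + norm x + 1" using ab(1) M(2) norm_ge_zero[of x] by (auto simp: \<delta>_def simp del: norm_ge_zero)
  have e: "e > 0" unfolding e_def using pos by (intro divide_pos_pos) auto
  have es: "e * (M + norm x + 1) = \<delta> / 3" unfolding e_def using pos by (simp add: field_simps)
  obtain p where p: "p \<in> Q" "p \<in> ball (- a) e" using Q[of "ball (- a) e"] e by auto
  have pa: "\<bar>p \<bullet> y + a \<bullet> y\<bar> \<le> e * norm y" for y
  proof -
    have "\<bar>(p + a) \<bullet> y\<bar> \<le> norm (p + a) * norm y" by (rule Cauchy_Schwarz_ineq2)
    also have "\<dots> \<le> e * norm y" using p(2) by (intro mult_right_mono) (auto simp: dist_norm norm_minus_commute add.commute)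
    finally show ?thesis by (simp add: inner_add_left)
  qed
  obtain c where c: "c \<in> \<rat>" "- b + \<delta> / 3 < c" "c < - b + 2 * \<delta> / 3"
    using Rats_dense_in_real[of "- b + \<delta> / 3" "- b + 2 * \<delta> / 3"] pos by auto
  have e1: "e * M \<le> \<delta> / 3" "e * norm x \<le> \<delta> / 3"
    using e M(2) norm_ge_zero[of x] mult_nonneg_nonneg[of e "norm x"] mult_nonneg_nonneg[of e M] unfolding es[symmetric]
    by (auto simp: algebra_simps)
  have "p \<bullet> y < c" if y: "y \<in> S" for y
  proof -
    have "e * norm y \<le> e * M" using e M(1)[OF y] by simp
    then show ?thesis using pa[of y] ab(2)[OF y] c(2) e1(1) by argo
  qed
  then have "p \<bullet> x \<le> c" using h[OF p(1) c(1)] by blast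
  moreover have "p \<bullet> x \<ge> - (a \<bullet> x) - e * norm x" using pa[of x] by argo
  ultimately show False using c(3) e1(2) unfolding \<delta>_def by argo
qed

context fpk_data
begin

section \<open>Passage to the limit in the coefficients\<close>

definition index :: "nat \<Rightarrow> real \<Rightarrow> nat" where "index N t = nat \<lfloor>clamp t * N / T\<rfloor>"

definition coeff_sel :: "nat \<Rightarrow> real \<times> (real ^ 'n) \<Rightarrow> (real ^ 'n) \<times> (real ^ 'n ^ 'n)" where
  "coeff_sel N z = (drift_sel (index N (fst z) * (T / N)) (grid_point (T / N) (snd z)) (scheme N (index N (fst z))),
     outer_sum (disp_sel (index N (fst z) * (T / N)) (grid_point (T / N) (snd z)) (scheme N (index N (fst z)))))"

lemma curve_clamp: "curve N (clamp t) = scheme N (index N t)" by (simp add: curve_def index_def)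

lemma index_bounds':
  fixes N :: nat
  assumes N: "N \<ge> 1"
  shows "index N t \<le> N" "real (index N t) * (T / N) \<le> clamp t" "clamp t \<le> real (index N t) * (T / N) + T / N"
  unfolding index_def using index_bounds[OF N clamp_in] by auto

lemma measurable_clamp [measurable]: "clamp \<in> borel_measurable borel"
  unfolding clamp_def[abs_def] by measurable

lemma continuous_clamp: "continuous_on UNIV clamp"
  unfolding clamp_def[abs_def] by (intro continuous_intros)

lemma measurable_index [measurable]: "index N \<in> measurable borel (count_space UNIV)"
  unfolding index_def[abs_def] by measurable

lemma measurable_coeff_sel [measurable]: "coeff_sel N \<in> borel_measurable borel"
proof -
  define f :: "nat \<Rightarrow> real \<times> (real ^ 'n) \<Rightarrow> (real ^ 'n) \<times> (real ^ 'n ^ 'n)" where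
    "f i z = (drift_sel (i * (T / N)) (grid_point (T / N) (snd z)) (scheme N i), outer_sum (disp_sel (i * (T / N)) (grid_point (T / N) (snd z)) (scheme N i)))" for i z
  have m: "snd \<in> borel_measurable (borel :: (real \<times> (real ^ 'n)) measure)" "fst \<in> borel_measurable (borel :: (real \<times> (real ^ 'n)) measure)"
    by (intro borel_measurable_continuous_onI continuous_intros)+
  have f: "f i \<in> borel_measurable borel" for i
    unfolding f_def[abs_def]
    by (rule measurable_compose[OF m(1) measurable_grid_point_compose[of "\<lambda>x. (drift_sel (i * (T / N)) x (scheme N i), outer_sum (disp_sel (i * (T / N)) x (scheme N i)))"]])
  have "(\<lambda>z. f (index N (fst z)) z) \<in> borel_measurable borel"
    by (rule measurable_compose_countable[OF f measurable_compose[OF m(2) measurable_index]])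
  then show ?thesis by (simp add: f_def coeff_sel_def[abs_def])
qed

lemma coeff_sel_in:
  assumes "N \<ge> 1"
  shows "coeff_sel N (t, x) \<in> F (index N t * (T / N)) (grid_point (T / N) x) (curve N (clamp t))"
  using sel_in[OF time_in[OF assms index_bounds'(1)[OF assms]] scheme_P2[OF assms index_bounds'(1)[OF assms]], of t "grid_point (T / N) x" t]
  by (simp add: coeff_sel_def curve_clamp)

lemma norm_coeff_sel:
  assumes "N \<ge> 1"
  shows "norm (coeff_sel N z) \<le> (1 + 2 * cs) * (1 + (norm (snd z))\<^sup>2)"
proof -
  note s = step_bounds[OF assms index_bounds'(1)[OF assms], of "fst z" "snd z"]
  have "norm (coeff_sel N z) \<le> norm (fst (coeff_sel N z)) + norm (snd (coeff_sel N z))" using norm_Pair_le[of "fst (coeff_sel N z)" "snd (coeff_sel N z)"] by simp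
  also have "\<dots> \<le> 1 + cs * (1 + (norm (snd z))\<^sup>2) + cs * (1 + (norm (snd z))\<^sup>2)"
    using s(1,3) le_one_plus_square[of "norm (fst (coeff_sel N z))"] by (simp add: coeff_sel_def)
  also have "\<dots> \<le> (1 + 2 * cs) * (1 + (norm (snd z))\<^sup>2)" by (simp add: algebra_simps)
  finally show ?thesis .
qed

lemma measurable_curve_kernel: "(\<lambda>t. curve N (clamp t)) \<in> measurable borel (subprob_algebra borel)" if N: "N \<ge> 1"
proof -
  \<comment> \<open>The laws are known to be probability measures up to index \<open>N\<close>,
    hence the \<open>min\<close>; \<open>index N t\<close> never exceeds \<open>N\<close>.\<close>
  have "(\<lambda>i. scheme N (min i N)) \<in> measurable (count_space UNIV) (subprob_algebra borel)"
    using scheme_P2[OF N] by (auto simp: space_subprob_algebra P2_def intro: prob_space_imp_subprob_space)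
  from measurable_compose[OF measurable_index this, of N]
  show ?thesis using index_bounds'(1)[OF N] by (simp add: curve_clamp min_absorb1)
qed

lemma limit_curve_clamp: "limit_curve (clamp t) = limit_curve t"
proof -
  have "clamp (clamp t) = clamp t" by (rule clamp_id[OF clamp_in])
  then show ?thesis unfolding limit_curve_def by simp
qed

lemma measurable_limit_curve_kernel: "limit_curve \<in> measurable borel (subprob_algebra borel)"
proof (rule measurable_kernel_if_lipschitz[OF limit_curve(1,2)])
  fix f :: "real ^ 'n \<Rightarrow> real" and L assume f: "L-lipschitz_on UNIV f" "bounded (range f)"
  have "continuous_on {0..T} (\<lambda>t. \<integral>x. f x \<partial>limit_curve t)"
    using flow_limit_curve f lipschitz_on_continuous_on[OF f(1)] by (simp add: flow_of_probabilities_def)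
  from continuous_on_compose2[OF this continuous_clamp] have "continuous_on UNIV (\<lambda>t. \<integral>x. f x \<partial>limit_curve (clamp t))"
    using clamp_in by blast
  then show "(\<lambda>t. \<integral>x. f x \<partial>limit_curve t) \<in> borel_measurable borel" by (simp add: limit_curve_clamp borel_measurable_continuous_onI)
qed

section \<open>Space-time laws of the scheme and their tightness\<close>

definition scheme_flow :: "nat \<Rightarrow> (real \<times> (real ^ 'n)) measure" where "scheme_flow N = flow_measure T (\<lambda>t. curve N (clamp t))"

lemma scheme_flow:
  assumes N: "N \<ge> 1"
  shows "prob_space (scheme_flow N)" "sets (scheme_flow N) = sets borel"
    and "\<And>f B. f \<in> borel_measurable borel \<Longrightarrow> (\<And>z. \<bar>f z\<bar> \<le> B) \<Longrightarrow>
      (\<lambda>t. \<integral>x. (f (t, x) :: real) \<partial>curve N (clamp t)) \<in> borel_measurable borel \<and>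
      (\<integral>z. f z \<partial>scheme_flow N) = (LINT t:{0..T}|lborel. (\<integral>x. f (t, x) \<partial>curve N (clamp t))) / T"
    and "\<And>Q. Measurable.pred borel Q \<Longrightarrow>
      (AE z in scheme_flow N. Q z) \<longleftrightarrow> (AE t in lborel. t \<in> {0..T} \<longrightarrow> (AE x in curve N (clamp t). Q (t, x)))"
  unfolding scheme_flow_def using flow_measure[OF T measurable_curve_kernel[OF N] curve_prob(1)[OF N clamp_in]] by blast+

lemmas limit_flow = flow_measure[OF T measurable_limit_curve_kernel limit_curve(1)]

text \<open>For each fixed time the slice of \<open>f\<close> is bounded and Lipschitz, so the inner
  integrals converge; dominated convergence takes care of the time integral.\<close>

lemma scheme_flow_conv: "bl_conv (\<lambda>k. scheme_flow (mesh k)) (flow_measure T limit_curve)"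
  unfolding bl_conv_def
proof (intro allI impI)
  fix f :: "real \<times> (real ^ 'n) \<Rightarrow> real" and L assume f: "L-lipschitz_on UNIV f" and b: "bounded (range f)"
  obtain B where B: "\<And>z. \<bar>f z\<bar> \<le> B" using b by (auto simp: bounded_iff)
  have fm: "f \<in> borel_measurable borel" using lipschitz_on_continuous_on[OF f] by (rule borel_measurable_continuous_onI)
  have L0: "0 \<le> L" using f by (rule lipschitz_on_nonneg)
  have ft: "L-lipschitz_on UNIV (\<lambda>x. f (t, x))" for t
    using lipschitz_onD[OF f] by (intro lipschitz_onI L0) (simp add: dist_Pair_Pair, metis (no_types) UNIV_I dist_Pair_Pair dist_self power_zero_numeral add_0 real_sqrt_abs abs_of_nonneg zero_le_dist)
  have ftb: "bounded (range (\<lambda>x. f (t, x)))" for t using B by (auto simp: bounded_iff)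
  have B': "\<bar>\<integral>x. f (t, x) \<partial>\<kappa>\<bar> \<le> B" if "prob_space \<kappa>" "sets \<kappa> = sets borel" for \<kappa> t
  proof -
    interpret prob_space \<kappa> by fact
    have "(\<lambda>x. f (t, x)) \<in> borel_measurable \<kappa>"
      using lipschitz_on_continuous_on[OF ft, of t] by (auto simp: measurable_cong_sets[OF that(2) refl] intro: borel_measurable_continuous_onI)
    then show ?thesis using B by (intro abs_integral_le_const)
  qed
  have "(\<lambda>k. LINT t:{0..T}|lborel. (\<integral>x. f (t, x) \<partial>curve (mesh k) (clamp t))) \<longlonglongrightarrow> (LINT t:{0..T}|lborel. (\<integral>x. f (t, x) \<partial>limit_curve t))"
    unfolding set_lebesgue_integral_def
  proof (rule integral_dominated_convergence[where w = "\<lambda>t. indicator {0..T} t * B"])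
    show "(\<lambda>t. indicat_real {0..T} t *\<^sub>R (\<integral>x. f (t, x) \<partial>limit_curve t)) \<in> borel_measurable lborel"
      using limit_flow(3)[OF fm B] by (intro borel_measurable_scaleR) simp_all
    show "(\<lambda>t. indicat_real {0..T} t *\<^sub>R (\<integral>x. f (t, x) \<partial>curve (mesh k) (clamp t))) \<in> borel_measurable lborel" for k
      using scheme_flow(3)[OF mesh_ge(1) fm B, of k] by (intro borel_measurable_scaleR) simp_all
    show "integrable lborel (\<lambda>t. indicator {0..T} t * B)" using T by (simp add: integrable_real_mult_indicator)
    show "AE t in lborel. (\<lambda>k. indicat_real {0..T} t *\<^sub>R (\<integral>x. f (t, x) \<partial>curve (mesh k) (clamp t)))
        \<longlonglongrightarrow> indicat_real {0..T} t *\<^sub>R (\<integral>x. f (t, x) \<partial>limit_curve t)"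
      by (intro AE_I2 tendsto_scaleR tendsto_const bl_convD[OF limit_curve(3) ft ftb])
    show "AE t in lborel. norm (indicat_real {0..T} t *\<^sub>R (\<integral>x. f (t, x) \<partial>curve (mesh k) (clamp t))) \<le> indicator {0..T} t * B" for k
      using B'[OF curve_prob(1)[OF mesh_ge(1) clamp_in] curve_prob(2)[OF mesh_ge(1) clamp_in]] by (intro AE_I2) (auto simp: indicator_def)
  qed
  then show "(\<lambda>k. \<integral>z. f z \<partial>scheme_flow (mesh k)) \<longlonglongrightarrow> (\<integral>z. f z \<partial>flow_measure T limit_curve)"
    using limit_flow(3)[OF fm B] scheme_flow(3)[OF mesh_ge(1) fm B] T by (auto intro!: tendsto_divide)
qed

lemma AE_scheme_flow_time:
  assumes N: "N \<ge> 1" shows "AE z in scheme_flow N. fst z \<in> {0..T}"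
proof -
  have "Measurable.pred borel (\<lambda>z :: real \<times> (real ^ 'n). fst z \<in> {0..T})"
    by (rule measurable_compose[of fst _ borel]) (auto intro!: borel_measurable_continuous_onI continuous_intros)
  from scheme_flow(4)[OF N this] show ?thesis by simp
qed

definition scheme_law :: "nat \<Rightarrow> ((real \<times> (real ^ 'n)) \<times> ((real ^ 'n) \<times> (real ^ 'n ^ 'n))) measure" where
  "scheme_law N = distr (scheme_flow N) borel (\<lambda>z. (z, coeff_sel N z))"

lemma measurable_coeff_sel_pair: "N \<ge> 1 \<Longrightarrow> (\<lambda>z. (z, coeff_sel N z)) \<in> borel_measurable (scheme_flow N)"
  unfolding measurable_cong_sets[OF scheme_flow(2) refl] by (intro borel_measurable_Pair measurable_ident_sets measurable_coeff_sel refl)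

lemma scheme_law_prob: "N \<ge> 1 \<Longrightarrow> prob_space (scheme_law N)" "sets (scheme_law N) = sets borel"
  unfolding scheme_law_def using prob_space.prob_space_distr[OF scheme_flow(1) measurable_coeff_sel_pair] by auto

lemma scheme_flow_tight:
  assumes e: "e > 0" shows "\<exists>R. \<forall>N\<ge>1. measure (scheme_flow N) {z. R < norm (snd z)} \<le> e"
proof -
  let ?I = "{p. fst p \<ge> (1::nat) \<and> snd p \<in> {0..T}}"
  have "\<exists>R. \<forall>p\<in>?I. measure (curve (fst p) (snd p)) {x. R < norm x} \<le> e"
    by (rule second_moment_tight[of _ _ K0]) (auto intro: curve_P2 curve_moment e)
  then obtain R where R: "\<And>N t. N \<ge> 1 \<Longrightarrow> t \<in> {0..T} \<Longrightarrow> measure (curve N t) {x. R < norm x} \<le> e" by fastforce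
  have "measure (scheme_flow N) {z. R < norm (snd z)} \<le> e" if N: "N \<ge> 1" for N
  proof -
    define f :: "real \<times> (real ^ 'n) \<Rightarrow> real" where "f = indicator {z. R < norm (snd z)}"
    have o: "open {z :: real \<times> (real ^ 'n). R < norm (snd z)}" by (intro open_Collect_less continuous_intros)
    have f: "f \<in> borel_measurable borel" "\<And>z. \<bar>f z\<bar> \<le> 1" using o by (auto simp: f_def indicator_def)
    have *: "(\<integral>x. f (t, x) \<partial>curve N (clamp t)) = measure (curve N (clamp t)) {x. R < norm x}" for t
    proof -
      have "(\<lambda>x. f (t, x)) = indicator {x. R < norm x}" by (auto simp: f_def indicator_def)
      moreover have "space (curve N (clamp t)) = UNIV" using sets_eq_imp_space_eq[OF curve_prob(2)[OF N clamp_in]] by simp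
      ultimately show ?thesis by simp
    qed
    have sp: "space (scheme_flow N) = UNIV" using sets_eq_imp_space_eq[OF scheme_flow(2)[OF N]] by simp
    have "measure (scheme_flow N) {z. R < norm (snd z)} = (\<integral>z. f z \<partial>scheme_flow N)" by (simp add: f_def sp)
    also have "\<dots> = (LINT t:{0..T}|lborel. (\<integral>x. f (t, x) \<partial>curve N (clamp t))) / T"
      using scheme_flow(3)[OF N f] by blast
    also have "\<dots> \<le> (LINT t:{0..T}|lborel. e) / T"
    proof (intro divide_right_mono set_integral_mono)
      have m: "(\<lambda>t. \<integral>x. f (t, x) \<partial>curve N (clamp t)) \<in> borel_measurable borel" using scheme_flow(3)[OF N f] by blast
      show "set_integrable lborel {0..T} (\<lambda>t. \<integral>x. f (t, x) \<partial>curve N (clamp t))"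
        unfolding set_integrable_def
      proof (rule Bochner_Integration.integrable_bound)
        show "integrable lborel (\<lambda>t. indicator {0..T} t * e)" using T by (simp add: integrable_real_mult_indicator)
        show "(\<lambda>t. indicat_real {0..T} t *\<^sub>R (\<integral>x. f (t, x) \<partial>curve N (clamp t))) \<in> borel_measurable lborel"
          using m by (intro borel_measurable_scaleR) simp_all
        show "AE t in lborel. norm (indicat_real {0..T} t *\<^sub>R (\<integral>x. f (t, x) \<partial>curve N (clamp t))) \<le> norm (indicat_real {0..T} t * e)"
          using R[OF N clamp_in] e unfolding * by (intro AE_I2) (auto simp: indicator_def)
      qed
      show "set_integrable lborel {0..T} (\<lambda>t. e)" using T by (simp add: set_integrable_def integrable_real_mult_indicator)
    qed (use R[OF N clamp_in] T in \<open>auto simp: *\<close>)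
    also have "\<dots> = e" using T by (simp add: set_lebesgue_integral_def)
    finally show ?thesis .
  qed
  then show ?thesis by blast
qed

lemma scheme_law_tight:
  assumes e: "e > 0" shows "\<exists>R. \<forall>N\<ge>1. measure (scheme_law N) {p. R < norm p} \<le> e"
proof -
  obtain R where R: "\<And>N. N \<ge> 1 \<Longrightarrow> measure (scheme_flow N) {z. R < norm (snd z)} \<le> e" using scheme_flow_tight[OF e] by blast
  \<comment> \<open>The summands bound the time, the position and, through
    \<open>norm_coeff_sel\<close>, the coefficient whenever the position has norm at most
    \<open>R\<close>.\<close>
  define R' where "R' = T + \<bar>R\<bar> + (1 + 2 * cs) * (1 + R\<^sup>2)"
  have "measure (scheme_law N) {p. R' < norm p} \<le> e" if N: "N \<ge> 1" for N
  proof -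
    interpret prob_space "scheme_flow N" by (rule scheme_flow(1)[OF N])
    have sp: "space (scheme_flow N) = UNIV" using sets_eq_imp_space_eq[OF scheme_flow(2)[OF N]] by simp
    have o: "open {z :: real \<times> (real ^ 'n). R < norm (snd z)}" by (intro open_Collect_less continuous_intros)
    have o': "open {p :: (real \<times> (real ^ 'n)) \<times> ((real ^ 'n) \<times> (real ^ 'n ^ 'n)). R' < norm p}" by (intro open_Collect_less continuous_intros)
    have le: "norm (z, coeff_sel N z) \<le> R'" if t: "fst z \<in> {0..T}" and x: "norm (snd z) \<le> R" for z
    proof -
      have "norm z \<le> norm (fst z) + norm (snd z)" using norm_Pair_le[of "fst z" "snd z"] by simp
      moreover have "norm (z, coeff_sel N z) \<le> norm z + norm (coeff_sel N z)" by (rule norm_Pair_le)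
      moreover have "(norm (snd z))\<^sup>2 \<le> R\<^sup>2" using x by (intro power_mono) auto
      then have "(1 + 2 * cs) * (1 + (norm (snd z))\<^sup>2) \<le> (1 + 2 * cs) * (1 + R\<^sup>2)" using cs0 by (intro mult_left_mono) auto
      moreover have "norm (fst z) \<le> T" "norm (snd z) \<le> \<bar>R\<bar>" using t x by auto
      ultimately show ?thesis using norm_coeff_sel[OF N, of z] unfolding R'_def by linarith
    qed
    have "measure (scheme_law N) {p. R' < norm p} = measure (scheme_flow N) ((\<lambda>z. (z, coeff_sel N z)) -` {p. R' < norm p} \<inter> space (scheme_flow N))"
      unfolding scheme_law_def by (rule measure_distr[OF measurable_coeff_sel_pair[OF N]]) (use o' in simp)
    also have "\<dots> \<le> measure (scheme_flow N) {z. R < norm (snd z)}"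
    proof (rule finite_measure_mono_AE)
      show "AE z in scheme_flow N. z \<in> (\<lambda>z. (z, coeff_sel N z)) -` {p. R' < norm p} \<inter> space (scheme_flow N) \<longrightarrow> z \<in> {z. R < norm (snd z)}"
        using AE_scheme_flow_time[OF N]
      proof eventually_elim
        case (elim z)
        have "R' < norm (z, coeff_sel N z) \<Longrightarrow> R < norm (snd z)" using le[OF elim] by (meson not_le)
        then show ?case by simp
      qed
      show "{z. R < norm (snd z)} \<in> events" using o scheme_flow(2)[OF N] by simp
    qed
    also have "\<dots> \<le> e" by (rule R[OF N])
    finally show ?thesis .
  qed
  then show ?thesis by blast
qed

section \<open>The graph of the inclusion and the limiting joint law\<close>

definition graph :: "((real \<times> (real ^ 'n)) \<times> ((real ^ 'n) \<times> (real ^ 'n ^ 'n))) set" where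
  "graph = {p. fst (fst p) \<in> {0..T} \<and> snd p \<in> F (fst (fst p)) (snd (fst p)) (limit_curve (fst (fst p)))}"

text \<open>All arguments of \<open>F\<close> move at once. The \<open>W2\<close>-continuity of the
  limit curve handles the measure argument, and then upper semicontinuity is sequential
  closedness.\<close>

lemma closed_graph: "closed graph"
  unfolding closed_sequential_limits
proof (intro allI impI, elim conjE)
  fix p l assume p: "\<forall>k. p k \<in> graph" and l: "p \<longlonglongrightarrow> l"
  have t: "fst (fst (p k)) \<in> {0..T}" and y: "snd (p k) \<in> F (fst (fst (p k))) (snd (fst (p k))) (limit_curve (fst (fst (p k))))" for k
    using p by (auto simp: graph_def)
  have lt: "(\<lambda>k. fst (fst (p k))) \<longlonglongrightarrow> fst (fst l)" and lx: "(\<lambda>k. snd (fst (p k))) \<longlonglongrightarrow> snd (fst l)" and ly: "(\<lambda>k. snd (p k)) \<longlonglongrightarrow> snd l"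
    using l by (auto intro: tendsto_intros)
  have t': "fst (fst l) \<in> {0..T}" using closed_sequentially[OF closed_atLeastAtMost t lt] .
  have "snd l \<in> F (fst (fst l)) (snd (fst l)) (limit_curve (fst (fst l)))"
    by (rule usc[unfolded usc_multimap_def, rule_format, OF t' limit_curve_P2[OF t'] _ lt lx limit_curve_continuous(2)[OF t t' lt] ly])
      (use t y limit_curve_P2 in auto)
  then show "l \<in> graph" using t' by (simp add: graph_def)
qed

lemma graph_bound:
  assumes "p \<in> graph"
  shows "norm (snd p) \<le> (Cb + CA) * (3 + 2 * (norm (snd (fst p)))\<^sup>2 + 2 * K0)"
proof -
  let ?t = "fst (fst p)" and ?x = "snd (fst p)"
  have t: "?t \<in> {0..T}" and y: "(fst (snd p), snd (snd p)) \<in> F ?t ?x (limit_curve ?t)" using assms by (auto simp: graph_def)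
  note g = growth[OF t limit_curve_P2[OF t] y]
  have M: "(M2 (limit_curve ?t))\<^sup>2 \<le> K0" using limit_curve_moment[OF t] by (simp add: M2_square)
  have K: "0 \<le> K0" using K0_1 by simp
  have "Cb * (1 + norm ?x + M2 (limit_curve ?t)) \<le> Cb * (3 + 2 * (norm ?x)\<^sup>2 + 2 * K0)"
  proof (rule mult_left_mono[OF _ Cb])
    show "1 + norm ?x + M2 (limit_curve ?t) \<le> 3 + 2 * (norm ?x)\<^sup>2 + 2 * K0"
      using le_one_plus_square[of "norm ?x"] le_one_plus_square[of "M2 (limit_curve ?t)"] M K zero_le_power2[of "norm ?x"] by argo
  qed
  moreover have "CA * (1 + (norm ?x)\<^sup>2 + (M2 (limit_curve ?t))\<^sup>2) \<le> CA * (3 + 2 * (norm ?x)\<^sup>2 + 2 * K0)"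
  proof (rule mult_left_mono[OF _ CA])
    show "1 + (norm ?x)\<^sup>2 + (M2 (limit_curve ?t))\<^sup>2 \<le> 3 + 2 * (norm ?x)\<^sup>2 + 2 * K0"
      using M K zero_le_power2[of "norm ?x"] by argo
  qed
  moreover have "norm (snd p) \<le> norm (fst (snd p)) + norm (snd (snd p))" using norm_Pair_le[of "fst (snd p)" "snd (snd p)"] by simp
  ultimately show ?thesis using g by (simp add: distrib_right)
qed

text \<open>Iterated integrals against the space-time measure are available for bounded functions,
  so truncated moments are bounded by \<open>K0\<close> first. Passing to the law of the position
  leads to the situation of \<open>integrable_norm_square_if_bounded\<close>.\<close>

lemma limit_flow_norm_square: "integrable (flow_measure T limit_curve) (\<lambda>z. (norm (snd z))\<^sup>2)"
proof -
  define m where "m = distr (flow_measure T limit_curve) borel (snd :: real \<times> (real ^ 'n) \<Rightarrow> _)"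
  have s: "(snd :: real \<times> (real ^ 'n) \<Rightarrow> _) \<in> borel_measurable (flow_measure T limit_curve)"
    unfolding measurable_cong_sets[OF limit_flow(2) refl] by (intro borel_measurable_continuous_onI continuous_intros)
  have "integrable m (\<lambda>x. (norm x)\<^sup>2)"
  proof (rule integrable_norm_square_if_bounded(1))
    show "sets m = sets borel" "prob_space m" by (auto simp: m_def intro: prob_space.prob_space_distr[OF limit_flow(1) s])
    fix n :: nat
    define f :: "real \<times> (real ^ 'n) \<Rightarrow> real" where "f z = min ((norm (snd z))\<^sup>2) (real n)" for z
    have f: "f \<in> borel_measurable borel" unfolding f_def[abs_def] by (intro borel_measurable_continuous_onI continuous_intros)
    have B: "\<bar>f z\<bar> \<le> real n" for z by (auto simp: f_def)
    have b: "0 \<le> (\<integral>x. f (t, x) \<partial>limit_curve t)" "(\<integral>x. f (t, x) \<partial>limit_curve t) \<le> K0" if t: "t \<in> {0..T}" for t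
    proof -
      show "0 \<le> (\<integral>x. f (t, x) \<partial>limit_curve t)" by (intro integral_nonneg_AE AE_I2) (simp add: f_def)
      have "(\<integral>x. f (t, x) \<partial>limit_curve t) \<le> (\<integral>x. (norm x)\<^sup>2 \<partial>limit_curve t)"
        by (rule integral_mono') (use limit_curve_P2[OF t] in \<open>auto simp: P2_def f_def\<close>)
      then show "(\<integral>x. f (t, x) \<partial>limit_curve t) \<le> K0" using limit_curve_moment[OF t] by linarith
    qed
    have "(\<integral>x. min ((norm x)\<^sup>2) (real n) \<partial>m) = (\<integral>z. f z \<partial>flow_measure T limit_curve)"
      unfolding m_def f_def by (rule integral_distr[OF s]) measurable
    also have "\<dots> = (LINT t:{0..T}|lborel. (\<integral>x. f (t, x) \<partial>limit_curve t)) / T" using limit_flow(3)[OF f B] by blast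
    also have "\<dots> \<le> (LINT t:{0..T}|lborel. K0) / T"
    proof (intro divide_right_mono set_integral_mono)
      show "set_integrable lborel {0..T} (\<lambda>t. \<integral>x. f (t, x) \<partial>limit_curve t)"
        unfolding set_integrable_def
      proof (rule Bochner_Integration.integrable_bound)
        show "integrable lborel (\<lambda>t. indicator {0..T} t * K0)" using T by (simp add: integrable_real_mult_indicator)
        show "(\<lambda>t. indicat_real {0..T} t *\<^sub>R (\<integral>x. f (t, x) \<partial>limit_curve t)) \<in> borel_measurable lborel"
          using limit_flow(3)[OF f B] by (intro borel_measurable_scaleR) simp_all
        show "AE t in lborel. norm (indicat_real {0..T} t *\<^sub>R (\<integral>x. f (t, x) \<partial>limit_curve t)) \<le> norm (indicat_real {0..T} t * K0)"
          using b K0_1 by (intro AE_I2) (auto simp: indicator_def)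
      qed
      show "set_integrable lborel {0..T} (\<lambda>t. K0)" using T by (simp add: set_integrable_def integrable_real_mult_indicator)
    qed (use b T in auto)
    also have "\<dots> = K0" using T by (simp add: set_lebesgue_integral_def)
    finally show "(\<integral>x. min ((norm x)\<^sup>2) (real n) \<partial>m) \<le> K0" .
  qed
  then show ?thesis unfolding m_def by (subst (asm) integrable_distr_eq[OF s]) auto
qed

text \<open>Convergence is claimed for functions bounded along the graphs of the selections, since
  \<open>test_op\<close> grows with the coefficient variable. Dominated convergence applies because
  the represented variables almost surely lie on these graphs.\<close>

lemma limit_law:
  "\<exists>\<sigma> \<Theta>. strict_mono (\<sigma> :: nat \<Rightarrow> nat) \<and> prob_space \<Theta> \<and> sets \<Theta> = sets borel \<and> distr \<Theta> borel fst = flow_measure T limit_curve \<and>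
     (AE p in \<Theta>. p \<in> graph) \<and>
     (\<forall>f B. continuous_on UNIV f \<longrightarrow> (\<forall>N\<ge>1. \<forall>z. fst z \<in> {0..T} \<longrightarrow> \<bar>f (z, coeff_sel N z)\<bar> \<le> B) \<longrightarrow>
        (\<lambda>k. \<integral>z. f (z, coeff_sel (mesh (\<sigma> k)) z) \<partial>scheme_flow (mesh (\<sigma> k))) \<longlonglongrightarrow> (\<integral>p. (f p :: real) \<partial>\<Theta>))"
proof -
  have tight: "\<exists>R. \<forall>k. measure (scheme_law (mesh k)) {p. R < norm p} \<le> e" if "e > 0" for e
    using scheme_law_tight[OF that] mesh_ge(1) by meson
  obtain \<Omega> :: "real measure" and \<sigma> Z Z' where \<sigma>: "strict_mono (\<sigma> :: nat \<Rightarrow> nat)" and \<Omega>: "prob_space \<Omega>"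
    and Z [measurable]: "\<And>k. Z k \<in> borel_measurable \<Omega>" and Z' [measurable]: "Z' \<in> borel_measurable \<Omega>"
    and law: "\<And>k. distr \<Omega> borel (Z k) = scheme_law (mesh (\<sigma> k))" and lim: "AE \<omega> in \<Omega>. (\<lambda>k. Z k \<omega>) \<longlonglongrightarrow> Z' \<omega>"
    by (rule skorohod_subsequence[OF scheme_law_prob(1)[OF mesh_ge(1)] scheme_law_prob(2) tight], assumption, rule that)
  interpret prob_space \<Omega> by fact
  define \<Theta> where "\<Theta> = distr \<Omega> borel Z'"
  have \<Theta>: "prob_space \<Theta>" "sets \<Theta> = sets borel" unfolding \<Theta>_def using prob_space_distr[OF Z'] by auto
  have fst_m: "fst \<in> borel_measurable (borel :: ((real \<times> (real ^ 'n)) \<times> ((real ^ 'n) \<times> (real ^ 'n ^ 'n))) measure)"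
    and snd_m: "snd \<in> borel_measurable (borel :: ((real \<times> (real ^ 'n)) \<times> ((real ^ 'n) \<times> (real ^ 'n ^ 'n))) measure)"
    and fst_fst_m: "(\<lambda>p. fst (fst p)) \<in> borel_measurable (borel :: ((real \<times> (real ^ 'n)) \<times> ((real ^ 'n) \<times> (real ^ 'n ^ 'n))) measure)"
    by (intro borel_measurable_continuous_onI continuous_intros)+
  have supp: "AE \<omega> in \<Omega>. fst (fst (Z k \<omega>)) \<in> {0..T} \<and> snd (Z k \<omega>) = coeff_sel (mesh (\<sigma> k)) (fst (Z k \<omega>))" for k
  proof -
    let ?N = "mesh (\<sigma> k)"
    let ?Q = "{p :: (real \<times> (real ^ 'n)) \<times> ((real ^ 'n) \<times> (real ^ 'n ^ 'n)). fst (fst p) \<in> {0..T} \<and> snd p = coeff_sel ?N (fst p)}"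
    have "{p \<in> space borel. snd p = coeff_sel ?N (fst p)} \<in> sets (borel :: ((real \<times> (real ^ 'n)) \<times> ((real ^ 'n) \<times> (real ^ 'n ^ 'n))) measure)"
      by (rule measurable_equality_set[OF snd_m measurable_compose[OF fst_m measurable_coeff_sel]])
    moreover have "(\<lambda>p. fst (fst p)) -` {0..T} \<inter> space borel \<in> sets (borel :: ((real \<times> (real ^ 'n)) \<times> ((real ^ 'n) \<times> (real ^ 'n ^ 'n))) measure)"
      by (rule measurable_sets[OF fst_fst_m]) simp
    ultimately have "((\<lambda>p. fst (fst p)) -` {0..T} \<inter> space borel) \<inter> {p \<in> space borel. snd p = coeff_sel ?N (fst p)} \<in> sets borel"
      by (rule sets.Int[rotated])
    then have Q: "?Q \<in> sets borel" by (simp add: Int_def conj_commute)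
    have "AE z in scheme_flow ?N. (z, coeff_sel ?N z) \<in> ?Q" using AE_scheme_flow_time[OF mesh_ge(1)] by eventually_elim simp
    then have "AE p in scheme_law ?N. p \<in> ?Q"
      unfolding scheme_law_def by (subst AE_distr_iff[OF measurable_coeff_sel_pair[OF mesh_ge(1)]]) (use Q in auto)
    then have "AE \<omega> in \<Omega>. Z k \<omega> \<in> ?Q"
      unfolding law[symmetric] by (subst (asm) AE_distr_iff[OF Z]) (use Q in auto)
    then show ?thesis by simp
  qed
  have small: "(\<lambda>k. T / real (mesh (\<sigma> k))) \<longlonglongrightarrow> 0" using LIMSEQ_subseq_LIMSEQ[OF mesh_small \<sigma>] by (simp add: comp_def)
  have supp_all: "AE \<omega> in \<Omega>. \<forall>k. fst (fst (Z k \<omega>)) \<in> {0..T} \<and> snd (Z k \<omega>) = coeff_sel (mesh (\<sigma> k)) (fst (Z k \<omega>))"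
    using supp by (subst AE_all_countable) blast
  have "AE \<omega> in \<Omega>. Z' \<omega> \<in> graph"
    using lim supp_all
  proof eventually_elim
    case (elim \<omega>)
    define \<tau> \<xi> where "\<tau> k = fst (fst (Z k \<omega>))" and "\<xi> k = snd (fst (Z k \<omega>))" for k
    have \<tau>: "\<tau> k \<in> {0..T}" and \<eta>: "snd (Z k \<omega>) = coeff_sel (mesh (\<sigma> k)) (\<tau> k, \<xi> k)" for k
      using elim(2) by (auto simp: \<tau>_def \<xi>_def)
    have l\<tau>: "\<tau> \<longlonglongrightarrow> fst (fst (Z' \<omega>))" and l\<xi>: "\<xi> \<longlonglongrightarrow> snd (fst (Z' \<omega>))" and l\<eta>: "(\<lambda>k. snd (Z k \<omega>)) \<longlonglongrightarrow> snd (Z' \<omega>)"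
      using elim(1) by (auto simp: \<tau>_def[abs_def] \<xi>_def[abs_def] intro: tendsto_intros)
    have t: "fst (fst (Z' \<omega>)) \<in> {0..T}" using closed_sequentially[OF closed_atLeastAtMost \<tau> l\<tau>] .
    \<comment> \<open>The selection was made at a rounded time, at a grid point and for the law of
      the scheme at that time. The first two errors are at most a multiple of the mesh, and the laws
      converge in \<open>W2\<close> along the convergent times \<open>\<tau>\<close>, so upper
      semicontinuity applies at the limit.\<close>
    let ?s = "\<lambda>k. real (index (mesh (\<sigma> k)) (\<tau> k)) * (T / real (mesh (\<sigma> k)))"
    have ls: "?s \<longlonglongrightarrow> fst (fst (Z' \<omega>))"
    proof -
      have "(\<lambda>k. ?s k - \<tau> k) \<longlonglongrightarrow> 0"
      proof (rule Lim_null_comparison[OF _ small], intro always_eventually allI)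
        fix k show "norm (?s k - \<tau> k) \<le> T / real (mesh (\<sigma> k))"
          using index_bounds'(2,3)[OF mesh_ge(1)[of "\<sigma> k"], of "\<tau> k"] clamp_id[OF \<tau>, of k] by (simp only: real_norm_def abs_le_iff) argo
      qed
      from tendsto_add[OF this l\<tau>] show ?thesis by simp
    qed
    have lx: "(\<lambda>k. grid_point (T / real (mesh (\<sigma> k))) (\<xi> k)) \<longlonglongrightarrow> snd (fst (Z' \<omega>))"
    proof -
      have "(\<lambda>k. grid_point (T / real (mesh (\<sigma> k))) (\<xi> k) - \<xi> k) \<longlonglongrightarrow> 0"
      proof (rule Lim_null_comparison)
        show "(\<lambda>k. real CARD('n) * (T / real (mesh (\<sigma> k)))) \<longlonglongrightarrow> 0" using tendsto_mult_right_zero[OF small] .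
        show "\<forall>\<^sub>F k in sequentially. norm (grid_point (T / real (mesh (\<sigma> k))) (\<xi> k) - \<xi> k) \<le> real CARD('n) * (T / real (mesh (\<sigma> k)))"
          using h_bounds[OF mesh_ge(1)] by (intro always_eventually allI grid_point_dist) blast
      qed
      from tendsto_add[OF this l\<xi>] show ?thesis by simp
    qed
    have "snd (Z' \<omega>) \<in> F (fst (fst (Z' \<omega>))) (snd (fst (Z' \<omega>))) (limit_curve (fst (fst (Z' \<omega>))))"
    proof (rule usc[unfolded usc_multimap_def, rule_format, OF t limit_curve_P2[OF t] _ ls lx limit_curve_W2_limit(2)[OF \<sigma> \<tau> t l\<tau>] l\<eta>])
      fix k
      show "?s k \<in> {0..T} \<and> curve (mesh (\<sigma> k)) (\<tau> k) \<in> P2 \<and>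
          snd (Z k \<omega>) \<in> F (?s k) (grid_point (T / real (mesh (\<sigma> k))) (\<xi> k)) (curve (mesh (\<sigma> k)) (\<tau> k))"
        using time_in[OF mesh_ge(1) index_bounds'(1)[OF mesh_ge(1)]] curve_P2[OF mesh_ge(1) \<tau>] coeff_sel_in[OF mesh_ge(1), of "\<sigma> k" "\<tau> k" "\<xi> k"]
        unfolding \<eta> clamp_id[OF \<tau>] by blast
    qed
    then show ?case using t by (simp add: graph_def)
  qed
  then have gr: "AE p in \<Theta>. p \<in> graph"
    unfolding \<Theta>_def by (subst AE_distr_iff[OF Z']) (use closed_graph in auto)
  have fst_law: "scheme_flow (mesh (\<sigma> k)) = distr \<Omega> borel (\<lambda>\<omega>. fst (Z k \<omega>))" for k
  proof -
    have "distr \<Omega> borel (\<lambda>\<omega>. fst (Z k \<omega>)) = distr (distr \<Omega> borel (Z k)) borel fst"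
      by (subst distr_distr[OF fst_m Z]) (simp add: comp_def)
    also have "\<dots> = distr (scheme_flow (mesh (\<sigma> k))) borel (\<lambda>z. z)"
      unfolding law scheme_law_def by (subst distr_distr[OF fst_m measurable_coeff_sel_pair[OF mesh_ge(1)]]) (simp add: comp_def)
    also have "\<dots> = scheme_flow (mesh (\<sigma> k))" by (rule distr_id2[OF scheme_flow(2)[OF mesh_ge(1), symmetric]])
    finally show ?thesis ..
  qed
  have fZ: "(\<lambda>\<omega>. fst (Z k \<omega>)) \<in> borel_measurable \<Omega>" "(\<lambda>\<omega>. fst (Z' \<omega>)) \<in> borel_measurable \<Omega>" for k
    using measurable_compose[OF Z fst_m] measurable_compose[OF Z' fst_m] by auto
  have fst_\<Theta>: "distr \<Theta> borel fst = distr \<Omega> borel (\<lambda>\<omega>. fst (Z' \<omega>))"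
    unfolding \<Theta>_def by (subst distr_distr[OF fst_m Z']) (simp add: comp_def)
  \<comment> \<open>The first marginal is recognised as the space-time measure of the limit curve
    because both are bounded Lipschitz limits of the same sequence.\<close>
  have "bl_conv (\<lambda>k. scheme_flow (mesh (\<sigma> k))) (distr \<Theta> borel fst)"
    unfolding bl_conv_def fst_law fst_\<Theta>
  proof (intro allI impI)
    fix f :: "real \<times> (real ^ 'n) \<Rightarrow> real" and L assume f: "L-lipschitz_on UNIV f" "bounded (range f)"
    have "AE \<omega> in \<Omega>. (\<lambda>k. fst (Z k \<omega>)) \<longlonglongrightarrow> fst (Z' \<omega>)" using lim by eventually_elim (rule tendsto_fst)
    then show "(\<lambda>k. integral\<^sup>L (distr \<Omega> borel (\<lambda>\<omega>. fst (Z k \<omega>))) f) \<longlonglongrightarrow> integral\<^sup>L (distr \<Omega> borel (\<lambda>\<omega>. fst (Z' \<omega>))) f"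
      by (rule ae_tendsto_integral[OF \<Omega> fZ _ lipschitz_on_continuous_on[OF f(1)] f(2)])
  qed
  then have marg: "distr \<Theta> borel fst = flow_measure T limit_curve"
    by (rule bl_conv_unique[OF _ bl_conv_subseq[OF scheme_flow_conv \<sigma>]])
      (use limit_flow(1,2) prob_space_distr[OF fZ(2)] in \<open>auto simp: fst_\<Theta>\<close>)
  have "(\<lambda>k. \<integral>z. f (z, coeff_sel (mesh (\<sigma> k)) z) \<partial>scheme_flow (mesh (\<sigma> k))) \<longlonglongrightarrow> (\<integral>p. f p \<partial>\<Theta>)"
    if f: "continuous_on UNIV f" and B: "\<forall>N\<ge>1. \<forall>z. fst z \<in> {0..T} \<longrightarrow> \<bar>f (z, coeff_sel N z)\<bar> \<le> B"
    for f :: "(real \<times> (real ^ 'n)) \<times> ((real ^ 'n) \<times> (real ^ 'n ^ 'n)) \<Rightarrow> real" and B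
  proof -
    have fm: "f \<in> borel_measurable borel" using f by (rule borel_measurable_continuous_onI)
    have e: "(\<integral>z. f (z, coeff_sel (mesh (\<sigma> k)) z) \<partial>scheme_flow (mesh (\<sigma> k))) = (\<integral>\<omega>. f (Z k \<omega>) \<partial>\<Omega>)" for k
    proof -
      have "(\<integral>z. f (z, coeff_sel (mesh (\<sigma> k)) z) \<partial>scheme_flow (mesh (\<sigma> k))) = (\<integral>p. f p \<partial>scheme_law (mesh (\<sigma> k)))"
        unfolding scheme_law_def by (rule integral_distr[OF measurable_coeff_sel_pair[OF mesh_ge(1)] fm, symmetric])
      also have "\<dots> = (\<integral>\<omega>. f (Z k \<omega>) \<partial>\<Omega>)" unfolding law[symmetric] by (rule integral_distr[OF Z fm])
      finally show ?thesis .
    qed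
    have "(\<lambda>k. \<integral>\<omega>. f (Z k \<omega>) \<partial>\<Omega>) \<longlonglongrightarrow> (\<integral>\<omega>. f (Z' \<omega>) \<partial>\<Omega>)"
    proof (rule integral_dominated_convergence[where w = "\<lambda>_. B"])
      show "AE \<omega> in \<Omega>. (\<lambda>k. f (Z k \<omega>)) \<longlonglongrightarrow> f (Z' \<omega>)"
        using lim by eventually_elim (rule continuous_on_tendsto_compose[OF f], auto)
      show "AE \<omega> in \<Omega>. norm (f (Z k \<omega>)) \<le> B" for k
        using supp[of k]
      proof eventually_elim
        case (elim \<omega>)
        then show ?case using B[rule_format, OF mesh_ge(1), of "fst (Z k \<omega>)" "\<sigma> k"] by (metis prod.collapse real_norm_def)
      qed
    qed (use measurable_compose[OF Z fm] measurable_compose[OF Z' fm] in auto)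
    moreover have "(\<integral>p. f p \<partial>\<Theta>) = (\<integral>\<omega>. f (Z' \<omega>) \<partial>\<Omega>)" unfolding \<Theta>_def by (rule integral_distr[OF Z' fm])
    ultimately show ?thesis unfolding e by simp
  qed
  then show ?thesis using \<sigma> \<Theta> marg gr by blast
qed

text \<open>Where \<open>F\<close> avoids the closed half-space \<open>{y. c \<le> p \<bullet> y}\<close>, averaging preserves the inequality
  \<open>p \<bullet> y < c\<close>; countably many half-spaces then recover the closed convex values of \<open>F\<close>.\<close>

definition halfspace_hit :: "(real ^ 'n) \<times> (real ^ 'n ^ 'n) \<Rightarrow> real \<Rightarrow> (real \<times> (real ^ 'n)) set" where
  "halfspace_hit p c = {z. \<exists>y. (z, y) \<in> graph \<and> c \<le> p \<bullet> y}"

text \<open>A limit of points of the set needs a witness in its own fibre.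
  \<open>graph_bound\<close> keeps the witnesses bounded along a convergent sequence, so some
  subsequence of them converges, and the closed graph contains the limit.\<close>

lemma closed_halfspace_hit: "closed (halfspace_hit p c)"
  unfolding closed_sequential_limits
proof (intro allI impI, elim conjE)
  fix z l assume z: "\<forall>k. z k \<in> halfspace_hit p c" and l: "z \<longlonglongrightarrow> l"
  from z obtain y where y: "\<And>k. (z k, y k) \<in> graph" "\<And>k. c \<le> p \<bullet> y k" unfolding halfspace_hit_def mem_Collect_eq by metis
  have "bounded (range z)" using l convergent_imp_bounded by blast
  then obtain B where B: "\<And>k. norm (z k) \<le> B" by (auto simp: bounded_iff)
  have "norm (y k) \<le> (Cb + CA) * (3 + 2 * B\<^sup>2 + 2 * K0)" for k
  proof -
    have "norm (snd (z k)) \<le> B" using norm_snd_le[of "snd (z k)" "fst (z k)"] B[of k] by simp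
    then have "(norm (snd (z k)))\<^sup>2 \<le> B\<^sup>2" by (intro power_mono) auto
    then have "(Cb + CA) * (3 + 2 * (norm (snd (z k)))\<^sup>2 + 2 * K0) \<le> (Cb + CA) * (3 + 2 * B\<^sup>2 + 2 * K0)"
      using Cb CA by (intro mult_left_mono) auto
    then show ?thesis using graph_bound[OF y(1)[of k]] by simp
  qed
  then have "bounded (range y)" by (auto simp: bounded_iff)
  then obtain l' r where r: "strict_mono (r :: nat \<Rightarrow> nat)" and l': "(y \<circ> r) \<longlonglongrightarrow> l'"
    using bounded_imp_convergent_subsequence by blast
  have "(\<lambda>k. (z (r k), y (r k))) \<longlonglongrightarrow> (l, l')"
    using LIMSEQ_subseq_LIMSEQ[OF l r] l' by (intro tendsto_Pair) (auto simp: comp_def)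
  then have "(l, l') \<in> graph" by (rule closed_sequentially[OF closed_graph, rotated]) (rule y(1))
  moreover have "c \<le> p \<bullet> l'"
    by (rule Lim_bounded2[where f = "\<lambda>k. p \<bullet> y (r k)" and N = 0])
      (use l' y(2) in \<open>auto intro!: tendsto_intros simp: comp_def\<close>)
  ultimately show "l \<in> halfspace_hit p c" unfolding halfspace_hit_def by blast
qed

lemma conditional_mean_in_F:
  assumes \<Theta>: "prob_space \<Theta>" "sets \<Theta> = sets borel" and gr: "AE p in \<Theta>. p \<in> graph"
    and g [measurable]: "g \<in> borel_measurable borel"
    and i: "\<And>v. v \<in> borel_measurable borel \<Longrightarrow> bounded (range v) \<Longrightarrow> integrable \<Theta> (\<lambda>p. v (fst p) \<bullet> snd p)"
      "\<And>v. v \<in> borel_measurable borel \<Longrightarrow> bounded (range v) \<Longrightarrow> integrable \<Theta> (\<lambda>p. v (fst p) \<bullet> g (fst p))"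
    and eq: "\<And>v. v \<in> borel_measurable borel \<Longrightarrow> bounded (range v) \<Longrightarrow>
       (\<integral>p. v (fst p) \<bullet> snd p \<partial>\<Theta>) = (\<integral>p. v (fst p) \<bullet> g (fst p) \<partial>\<Theta>)"
  shows "AE p in \<Theta>. (fst p, g (fst p)) \<in> graph"
proof -
  interpret prob_space \<Theta> by fact
  have fst_m: "fst \<in> measurable \<Theta> borel"
    by (auto simp: measurable_cong_sets[OF \<Theta>(2) refl] intro!: borel_measurable_continuous_onI continuous_intros)
  have half: "AE p in \<Theta>. fst p \<notin> halfspace_hit a c \<longrightarrow> a \<bullet> g (fst p) \<le> c" for a c
  proof -
    \<comment> \<open>The set where \<open>g\<close> exceeds the level although no value of
      \<open>F\<close> reaches the half-space. Integrated over it, the coefficient stays at or below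
      the level while its conditional mean \<open>g\<close> lies strictly above, so the set is
      null.\<close>
    define B where "B = - halfspace_hit a c \<inter> {z. c < a \<bullet> g z}"
    have "{z \<in> space borel. c < a \<bullet> g z} \<in> sets borel" by measurable
    then have B: "B \<in> sets borel"
      unfolding B_def using closed_halfspace_hit[of a c] by (intro sets.Int) auto
    define \<psi> :: "real \<times> (real ^ 'n) \<Rightarrow> real" where "\<psi> = indicator B"
    have \<psi>: "\<psi> \<in> borel_measurable borel" using B by (simp add: \<psi>_def)
    have v: "(\<lambda>z. \<psi> z *\<^sub>R a) \<in> borel_measurable borel" "bounded (range (\<lambda>z. \<psi> z *\<^sub>R a))"
      using \<psi> by simp (auto simp: \<psi>_def indicator_def bounded_iff)
    have \<psi>i: "integrable \<Theta> (\<lambda>p. \<psi> (fst p) * c)"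
      using measurable_compose[OF fst_m \<psi>] by (intro integrable_mult_left integrable_const_bound[of _ 1]) (auto simp: \<psi>_def)
    have ig: "integrable \<Theta> (\<lambda>p. \<psi> (fst p) * (a \<bullet> g (fst p)))" and int_snd: "integrable \<Theta> (\<lambda>p. \<psi> (fst p) * (a \<bullet> snd p))"
      and e: "(\<integral>p. \<psi> (fst p) * (a \<bullet> snd p) \<partial>\<Theta>) = (\<integral>p. \<psi> (fst p) * (a \<bullet> g (fst p)) \<partial>\<Theta>)"
      using i(2)[OF v] i(1)[OF v] eq[OF v] by simp_all
    have "(\<integral>p. \<psi> (fst p) * (a \<bullet> snd p) \<partial>\<Theta>) \<le> (\<integral>p. \<psi> (fst p) * c \<partial>\<Theta>)"
    proof (rule integral_mono_AE[OF int_snd \<psi>i])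
      show "AE p in \<Theta>. \<psi> (fst p) * (a \<bullet> snd p) \<le> \<psi> (fst p) * c"
        using gr
      proof eventually_elim
        case (elim p)
        have "(fst p, snd p) \<in> graph" using elim by simp
        then have "fst p \<in> B \<Longrightarrow> a \<bullet> snd p \<le> c" unfolding B_def halfspace_hit_def using linear by blast
        then show ?case by (auto simp: \<psi>_def indicator_def)
      qed
    qed
    then have "(\<integral>p. \<psi> (fst p) * (a \<bullet> g (fst p)) - \<psi> (fst p) * c \<partial>\<Theta>) \<le> 0" using ig \<psi>i e by simp
    moreover have nn: "0 \<le> \<psi> (fst p) * (a \<bullet> g (fst p)) - \<psi> (fst p) * c" for p :: "(real \<times> (real ^ 'n)) \<times> ((real ^ 'n) \<times> (real ^ 'n ^ 'n))"
      by (auto simp: \<psi>_def indicator_def B_def)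
    ultimately have "(\<integral>p. \<psi> (fst p) * (a \<bullet> g (fst p)) - \<psi> (fst p) * c \<partial>\<Theta>) = 0"
      by (intro antisym integral_nonneg_AE) auto
    then have "AE p in \<Theta>. \<psi> (fst p) * (a \<bullet> g (fst p)) - \<psi> (fst p) * c = 0"
      using integral_nonneg_eq_0_iff_AE[OF Bochner_Integration.integrable_diff[OF ig \<psi>i]] nn by auto
    then show ?thesis
    proof eventually_elim
      case (elim p)
      then show ?case by (auto simp: \<psi>_def indicator_def B_def not_le split: if_splits)
    qed
  qed
  obtain Q :: "((real ^ 'n) \<times> (real ^ 'n ^ 'n)) set" where Q: "countable Q" "\<And>X. open X \<Longrightarrow> X \<noteq> {} \<Longrightarrow> \<exists>d\<in>Q. d \<in> X"
    using countable_dense_exists by blast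
  have "AE p in \<Theta>. \<forall>a\<in>Q. \<forall>c\<in>\<rat>. fst p \<notin> halfspace_hit a c \<longrightarrow> a \<bullet> g (fst p) \<le> c"
    using half Q(1) countable_rat by (intro AE_ball_countable' ) auto
  with gr show ?thesis
  proof eventually_elim
    case (elim p)
    let ?t = "fst (fst p)" and ?x = "snd (fst p)"
    have t: "?t \<in> {0..T}" and ne: "F ?t ?x (limit_curve ?t) \<noteq> {}" using elim(1) by (auto simp: graph_def)
    have gF: "(fst p, y) \<in> graph \<longleftrightarrow> y \<in> F ?t ?x (limit_curve ?t)" for y using t by (auto simp: graph_def)
    have "g (fst p) \<in> F ?t ?x (limit_curve ?t)"
    proof (rule mem_closed_convex_if_rational_halfspaces[OF _ _ ne _ Q(2)])
      have "F ?t ?x (limit_curve ?t) = Pair (fst p) -` graph" using gF by auto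
      also have "closed (Pair (fst p) -` graph)"
        by (rule closed_vimage[OF closed_graph]) (intro continuous_intros)
      finally show "closed (F ?t ?x (limit_curve ?t))" .
      show "convex (F ?t ?x (limit_curve ?t))" using nonempty_convex[OF t limit_curve_P2[OF t]] by blast
      show "bounded (F ?t ?x (limit_curve ?t))"
        unfolding bounded_iff using graph_bound[of "(fst p, _)"] gF by (intro exI ballI) force
      show "a \<bullet> g (fst p) \<le> c" if "a \<in> Q" "c \<in> \<rat>" and less: "\<And>y. y \<in> F ?t ?x (limit_curve ?t) \<Longrightarrow> a \<bullet> y < c" for a c
      proof -
        have "fst p \<notin> halfspace_hit a c" using less gF by (force simp: halfspace_hit_def)
        then show ?thesis using elim(2) that(1,2) by blast
      qed
    qed
    then show ?case using gF by blast
  qed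
qed

end

section \<open>The weak equation\<close>

text \<open>On each step interval \<open>J\<close> is within \<epsilon> of the difference quotient
  of \<open>a\<close>, and the sum over the intervals telescopes.\<close>

lemma telescoping_integral:
  fixes J :: "real \<Rightarrow> real"
  assumes J [measurable]: "J \<in> borel_measurable borel" and B: "\<And>t. \<bar>J t\<bar> \<le> B" and h: "h > 0"
    and step: "\<And>k t. k < N \<Longrightarrow> real k * h \<le> t \<Longrightarrow> t < real (Suc k) * h \<Longrightarrow> \<bar>h * J t - (a (Suc k) - a k)\<bar> \<le> h * \<epsilon>"
  shows "\<bar>(LINT t:{0..<real N * h}|lborel. J t) - (a N - a 0)\<bar> \<le> real N * h * \<epsilon>"
  using step
proof (induction N)
  case 0
  then show ?case by (simp add: set_lebesgue_integral_def)
next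
  case (Suc N)
  have i: "set_integrable lborel {u..<v} J" "set_integrable lborel {u..<v} (\<lambda>_. c)" for u v c :: real
  proof -
    show c: "set_integrable lborel {u..<v} (\<lambda>_. c)" for c :: real
      by (cases "u \<le> v") (auto simp: set_integrable_def integrable_real_mult_indicator)
    show "set_integrable lborel {u..<v} J"
      by (rule set_integrable_bound[OF c[of B]]) (use order_trans[OF B abs_ge_self] in \<open>auto simp: set_borel_measurable_def\<close>)
  qed
  define u v where "u = real N * h" and "v = real (Suc N) * h"
  define d where "d = a (Suc N) - a N"
  have uv: "0 \<le> u" "u \<le> v" "v - u = h" using h by (auto simp: u_def v_def algebra_simps)
  have const: "(LINT t:{u..<v}|lborel. c) = c * h" for c using uv by (simp add: set_lebesgue_integral_def)
  have bd: "d / h - \<epsilon> \<le> J t \<and> J t \<le> d / h + \<epsilon>" if "t \<in> {u..<v}" for t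
  proof -
    have "\<bar>h * J t - d\<bar> \<le> h * \<epsilon>" using Suc.prems[of N t] that by (auto simp: u_def v_def d_def)
    then show ?thesis using h by (auto simp: field_simps abs_le_iff)
  qed
  have le: "(LINT t:{u..<v}|lborel. J t) \<le> (LINT t:{u..<v}|lborel. d / h + \<epsilon>)" "(LINT t:{u..<v}|lborel. d / h - \<epsilon>) \<le> (LINT t:{u..<v}|lborel. J t)"
    using bd i by (intro set_integral_mono; simp)+
  have piece: "\<bar>(LINT t:{u..<v}|lborel. J t) - d\<bar> \<le> h * \<epsilon>"
  proof -
    have "(d / h + \<epsilon>) * h = d + h * \<epsilon>" "(d / h - \<epsilon>) * h = d - h * \<epsilon>" using h by (auto simp: field_simps)
    with le show ?thesis unfolding const by argo
  qed
  have "(LINT t:{0..<v}|lborel. J t) = (LINT t:{0..<u} \<union> {u..<v}|lborel. J t)"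
    using uv by (simp add: ivl_disj_un)
  also have "\<dots> = (LINT t:{0..<u}|lborel. J t) + (LINT t:{u..<v}|lborel. J t)"
    by (rule set_integral_Un) (use i in auto)
  finally have split: "(LINT t:{0..<v}|lborel. J t) = (LINT t:{0..<u}|lborel. J t) + (LINT t:{u..<v}|lborel. J t)" .
  have IH: "\<bar>(LINT t:{0..<u}|lborel. J t) - (a N - a 0)\<bar> \<le> u * \<epsilon>"
    using Suc.IH Suc.prems unfolding u_def by auto
  have "v * \<epsilon> = u * \<epsilon> + h * \<epsilon>" by (simp add: u_def v_def algebra_simps)
  then show ?case using piece IH split unfolding v_def[symmetric] d_def by (simp only:)
qed

text \<open>The inner product form exposes linearity in the coefficient pair, which is what
  conditional means are compatible with. The transpose appears because the trace of H \<Sigma> is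
  the Frobenius product of the transpose of H with \<Sigma>.\<close>

lemma generator_eq_inner:
  fixes \<Sigma> :: "real ^ 'n ^ 'n"
  shows "generator \<beta> \<Sigma> f x = (grad f x, (1 / 2) *\<^sub>R transpose (hessian f x)) \<bullet> (\<beta>, \<Sigma>)"
proof -
  have "trace (H ** \<Sigma>) = transpose H \<bullet> \<Sigma>" for H :: "real ^ 'n ^ 'n"
  proof -
    have "trace (H ** \<Sigma>) = (\<Sum>i\<in>UNIV. \<Sum>j\<in>UNIV. H $ i $ j * \<Sigma> $ j $ i)" by (simp add: trace_def matrix_matrix_mult_def)
    also have "\<dots> = (\<Sum>j\<in>UNIV. \<Sum>i\<in>UNIV. H $ i $ j * \<Sigma> $ j $ i)" by (rule sum.swap)
    also have "\<dots> = transpose H \<bullet> \<Sigma>" by (simp add: transpose_def inner_vec_def)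
    finally show ?thesis .
  qed
  then show ?thesis by (simp add: generator_def)
qed

definition test_op :: "(real \<Rightarrow> real ^ 'n \<Rightarrow> real) \<Rightarrow> (real \<times> (real ^ 'n)) \<times> ((real ^ 'n) \<times> (real ^ 'n ^ 'n)) \<Rightarrow> real" where
  "test_op \<phi> p = deriv (\<lambda>s. \<phi> s (snd (fst p))) (fst (fst p))
     + generator (fst (snd p)) (snd (snd p)) (\<phi> (fst (fst p))) (snd (fst p))"

definition test_vec :: "(real \<Rightarrow> real ^ 'n \<Rightarrow> real) \<Rightarrow> real \<times> (real ^ 'n) \<Rightarrow> (real ^ 'n) \<times> (real ^ 'n ^ 'n)" where
  "test_vec \<phi> z = (grad (\<phi> (fst z)) (snd z), (1 / 2) *\<^sub>R transpose (hessian (\<phi> (fst z)) (snd z)))"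

lemma test_op_eq: "test_op \<phi> p = deriv (\<lambda>s. \<phi> s (snd (fst p))) (fst (fst p)) + test_vec \<phi> (fst p) \<bullet> snd p"
  unfolding test_op_def test_vec_def generator_eq_inner by simp

lemma continuous_on_transpose [continuous_intros]:
  fixes f :: "'a::topological_space \<Rightarrow> real ^ 'n ^ 'm"
  shows "continuous_on S f \<Longrightarrow> continuous_on S (\<lambda>x. transpose (f x))"
  unfolding transpose_def by (intro continuous_intros)

lemma test_op_continuous:
  assumes "\<phi> \<in> C12c T"
  shows "continuous_on UNIV (test_op \<phi>)" "continuous_on UNIV (test_vec \<phi>)"
    "continuous_on UNIV (\<lambda>z. deriv (\<lambda>s. \<phi> s (snd z)) (fst z))"
proof -
  note c = C12c_continuous[OF assms]
  show v: "continuous_on UNIV (test_vec \<phi>)" unfolding test_vec_def[abs_def] by (intro continuous_intros c)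
  show "continuous_on UNIV (test_op \<phi>)" unfolding test_op_eq[abs_def]
    by (intro continuous_intros continuous_on_compose2[OF v] continuous_on_compose2[OF c(2)]) auto
  show "continuous_on UNIV (\<lambda>z. deriv (\<lambda>s. \<phi> s (snd z)) (fst z))" by (rule c)
qed

text \<open>The coefficient may grow quadratically in the position, but \<open>test_vec\<close> has
  compact support, on which this growth is bounded.\<close>

lemma test_op_bounded:
  fixes \<phi> :: "real \<Rightarrow> real ^ 'n \<Rightarrow> real"
  assumes \<phi>: "\<phi> \<in> C12c T"
  shows "bounded (range (test_vec \<phi>))" "bounded (range (\<lambda>z. deriv (\<lambda>s. \<phi> s (snd z)) (fst z)))"
    "C \<ge> 0 \<Longrightarrow> \<exists>B. \<forall>p. norm (snd p) \<le> C * (1 + (norm (snd (fst p)))\<^sup>2) \<longrightarrow> \<bar>test_op \<phi> p\<bar> \<le> B"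
proof -
  obtain R where R: "R > 0" and z: "\<And>t x. norm (t, x) > R \<Longrightarrow> \<phi> t x = 0 \<and> deriv (\<lambda>s. \<phi> s x) t = 0 \<and> grad (\<phi> t) x = 0 \<and> hessian (\<phi> t) x = 0"
    by (rule C12c_support[OF \<phi>]) (rule that)
  have z': "test_vec \<phi> p = 0" "deriv (\<lambda>s. \<phi> s (snd p)) (fst p) = 0" if "norm p > R" for p
    using z[of "fst p" "snd p"] that by (auto simp: test_vec_def transpose_def vec_eq_iff zero_prod_def)
  obtain C1 where C1: "\<And>z. norm (test_vec \<phi> z) \<le> C1"
    using uniformly_continuous_compact_support(2)[OF test_op_continuous(2)[OF \<phi>] z'(1)] by blast
  obtain C2 where C2: "\<And>z. norm (deriv (\<lambda>s. \<phi> s (snd z)) (fst z)) \<le> C2"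
    using uniformly_continuous_compact_support(2)[OF test_op_continuous(3)[OF \<phi>] z'(2)] by blast
  show "bounded (range (test_vec \<phi>))" "bounded (range (\<lambda>z. deriv (\<lambda>s. \<phi> s (snd z)) (fst z)))"
    by (rule boundedI[of _ C1], use C1 in blast) (rule boundedI[of _ C2], use C2 in blast)
  show "\<exists>B. \<forall>p. norm (snd p) \<le> C * (1 + (norm (snd (fst p)))\<^sup>2) \<longrightarrow> \<bar>test_op \<phi> p\<bar> \<le> B" if C: "C \<ge> 0"
  proof (intro exI allI impI)
    fix p :: "(real \<times> (real ^ 'n)) \<times> ((real ^ 'n) \<times> (real ^ 'n ^ 'n))"
    assume p: "norm (snd p) \<le> C * (1 + (norm (snd (fst p)))\<^sup>2)"
    have C10: "0 \<le> C1" using C1 norm_ge_zero order_trans by blast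
    have "\<bar>test_vec \<phi> (fst p) \<bullet> snd p\<bar> \<le> C1 * (C * (1 + R\<^sup>2))"
    proof (cases "norm (fst p) > R")
      case True
      then show ?thesis using z'(1)[OF True] C C10 by simp
    next
      case False
      have "norm (snd (fst p)) \<le> R" using False norm_snd_le[of "snd (fst p)" "fst (fst p)"] by simp
      then have "(norm (snd (fst p)))\<^sup>2 \<le> R\<^sup>2" by (intro power_mono) auto
      then have "C * (1 + (norm (snd (fst p)))\<^sup>2) \<le> C * (1 + R\<^sup>2)" using C by (intro mult_left_mono) auto
      then have "norm (snd p) \<le> C * (1 + R\<^sup>2)" using p by linarith
      then have "norm (test_vec \<phi> (fst p)) * norm (snd p) \<le> C1 * (C * (1 + R\<^sup>2))" using C1 C10 by (intro mult_mono) auto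
      then show ?thesis using Cauchy_Schwarz_ineq2 order_trans by blast
    qed
    then show "\<bar>test_op \<phi> p\<bar> \<le> C2 + C1 * (C * (1 + R\<^sup>2))"
      using C2[of "fst p"] unfolding test_op_eq real_norm_def by linarith
  qed
qed

context fpk_data
begin

section \<open>The approximate weak equation satisfied by the scheme\<close>

lemma test_op_coeff_sel_bounded:
  assumes \<phi>: "\<phi> \<in> C12c T"
  shows "\<exists>B. \<forall>N\<ge>1. \<forall>z. \<bar>test_op \<phi> (z, coeff_sel N z)\<bar> \<le> B"
proof -
  have "0 \<le> 1 + 2 * cs" using cs0 by simp
  then obtain B where "\<And>p. norm (snd p) \<le> (1 + 2 * cs) * (1 + (norm (snd (fst p)))\<^sup>2) \<Longrightarrow> \<bar>test_op \<phi> p\<bar> \<le> B"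
    using test_op_bounded(3)[OF \<phi>] by blast
  then have "\<bar>test_op \<phi> (z, coeff_sel N z)\<bar> \<le> B" if "N \<ge> 1" for N z using norm_coeff_sel[OF that, of z] by simp
  then show ?thesis by blast
qed

text \<open>For every \<open>t\<close> inside a step, the mean of \<open>test_op\<close> at time
  \<open>t\<close>, under the law held fixed since the last grid time, is compared with the
  increment over the whole step. \<open>consistency\<close> permits this because it evaluates the
  derivatives of the test function at an arbitrary time of the step.\<close>

lemma scheme_step:
  assumes \<phi>: "\<phi> \<in> C12c T" and \<epsilon>: "\<epsilon> > 0"
  shows "\<exists>h0>0. \<forall>N k t. N \<ge> 1 \<longrightarrow> T / real N < h0 \<longrightarrow> k < N \<longrightarrow> real k * (T / real N) \<le> t \<longrightarrow> t < real (Suc k) * (T / real N) \<longrightarrow>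
     \<bar>T / real N * (\<integral>x. test_op \<phi> ((t, x), coeff_sel N (t, x)) \<partial>curve N (clamp t))
       - ((\<integral>x. \<phi> (real (Suc k) * (T / real N)) x \<partial>scheme N (Suc k)) - (\<integral>x. \<phi> (real k * (T / real N)) x \<partial>scheme N k))\<bar> \<le> T / real N * \<epsilon>"
proof -
  obtain h0 where h0: "h0 > 0" and cons: "\<And>h s t x b w. 0 < h \<Longrightarrow> h < h0 \<Longrightarrow> s \<le> t \<Longrightarrow> t \<le> s + h \<Longrightarrow>
     (norm b)\<^sup>2 \<le> cs * (1 + (norm x)\<^sup>2) \<Longrightarrow> (\<And>j. (norm (w j))\<^sup>2 \<le> cs * (1 + (norm x)\<^sup>2)) \<Longrightarrow>
     \<bar>avg (\<lambda>js. \<phi> (s + h) (x + euler_step h b w js)) - \<phi> s x - h * (deriv (\<lambda>r. \<phi> r x) t + generator b (outer_sum w) (\<phi> t) x)\<bar> \<le> h * \<epsilon>"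
    using consistency[OF \<phi> cs0 \<epsilon>] by blast
  obtain B where B: "\<And>N z. N \<ge> 1 \<Longrightarrow> \<bar>test_op \<phi> (z, coeff_sel N z)\<bar> \<le> B"
    using test_op_coeff_sel_bounded[OF \<phi>] by blast
  obtain R where R: "R > 0" and z: "\<And>t x. norm (t, x) > R \<Longrightarrow> \<phi> t x = 0 \<and> deriv (\<lambda>s. \<phi> s x) t = 0 \<and> grad (\<phi> t) x = 0 \<and> hessian (\<phi> t) x = 0"
    by (rule C12c_support[OF \<phi>]) (rule that)
  have z': "\<phi> (fst p) (snd p) = 0" if "norm p > R" for p using z[of "fst p" "snd p"] that by simp
  obtain B1 where "\<And>p. norm (\<phi> (fst p) (snd p)) \<le> B1"
    using uniformly_continuous_compact_support(2)[OF C12c_continuous(1)[OF \<phi>] z'] by blast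
  then have B1: "\<bar>\<phi> s x\<bar> \<le> B1" for s x by (metis fst_conv snd_conv real_norm_def)
  have \<phi>m [measurable]: "\<phi> s \<in> borel_measurable borel" for s
  proof -
    have "continuous_on UNIV (\<lambda>x. \<phi> (fst (s, x)) (snd (s, x)))"
      by (rule continuous_on_compose2[OF C12c_continuous(1)[OF \<phi>]]) (auto intro!: continuous_intros)
    then show ?thesis by (intro borel_measurable_continuous_onI) simp
  qed
  have "\<bar>T / real N * (\<integral>x. test_op \<phi> ((t, x), coeff_sel N (t, x)) \<partial>curve N (clamp t))
       - ((\<integral>x. \<phi> (real (Suc k) * (T / real N)) x \<partial>scheme N (Suc k)) - (\<integral>x. \<phi> (real k * (T / real N)) x \<partial>scheme N k))\<bar> \<le> T / real N * \<epsilon>"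
    if N: "N \<ge> 1" and small: "T / real N < h0" and k: "k < N" and t1: "real k * (T / real N) \<le> t" and t2: "t < real (Suc k) * (T / real N)"
    for N k :: nat and t
  proof -
    define h where "h = T / real N"
    have h: "0 < h" "h < h0" using h_bounds[OF N] small by (auto simp: h_def)
    have hN: "real N * h = T" using N by (simp add: h_def)
    have tT: "t \<in> {0..T}"
    proof -
      have "real (Suc k) * h \<le> real N * h" using k h by (intro mult_right_mono) auto
      then show ?thesis using t1 t2 h unfolding h_def[symmetric] hN by (auto intro: order_trans[rotated])
    qed
    \<comment> \<open>The step interval is half-open, so rounding down returns exactly
      \<open>k\<close>.\<close>
    have ik: "index N t = k"
    proof -
      have e: "t * real N / T = t / h" using T N by (simp add: h_def)
      have "real k \<le> t / h" "t / h < real k + 1" using t1 t2 h unfolding h_def[symmetric] by (auto simp: field_simps)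
      then have "\<lfloor>t / h\<rfloor> = int k" by (simp add: floor_eq_iff)
      then show ?thesis unfolding index_def clamp_id[OF tT] e by simp
    qed
    let ?m = "scheme N k" and ?s = "real k * h"
    have m: "prob_space ?m" "sets ?m = sets borel" using scheme_P2[OF N, of k] k by (auto simp: P2_def)
    interpret prob_space ?m by (rule m)
    define b w where "b x = drift_sel ?s (grid_point h x) ?m" and "w x = disp_sel ?s (grid_point h x) ?m" for x
    have y: "coeff_sel N (t, x) = (b x, outer_sum (w x))" for x by (simp add: coeff_sel_def ik b_def w_def h_def)
    have S: "step_map N k ?m js x = x + euler_step h (b x) (w x) js" for js x by (simp add: step_map_def b_def w_def h_def)
    have Suc: "real (Suc k) * h = ?s + h" by (simp add: algebra_simps)
    define f where "f x = test_op \<phi> ((t, x), coeff_sel N (t, x))" for x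
    define g where "g x = avg (\<lambda>js. \<phi> (?s + h) (step_map N k ?m js x))" for x
    have "(\<integral>x. \<phi> (?s + h) x \<partial>random_step (step_map N k ?m) ?m) = (\<integral>x. g x \<partial>?m)"
      unfolding g_def
    proof (rule random_step(4)[OF m measurable_step_map \<phi>m])
      fix js show "integrable ?m (\<lambda>x. \<phi> (?s + h) (step_map N k ?m js x))"
        using B1 measurable_compose[OF measurable_step_map \<phi>m] by (intro integrable_const_bound[of _ B1]) (auto simp: measurable_cong_sets[OF m(2) refl])
    qed
    then have e1: "(\<integral>x. \<phi> (real (Suc k) * h) x \<partial>scheme N (Suc k)) = (\<integral>x. g x \<partial>?m)" unfolding Suc by simp
    have fm: "f \<in> borel_measurable borel"
    proof -
      have "(\<lambda>x. ((t, x), coeff_sel N (t, x))) \<in> borel_measurable borel"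
        by (intro borel_measurable_Pair measurable_compose[OF _ measurable_coeff_sel] borel_measurable_const measurable_ident_sets refl)
      then show ?thesis unfolding f_def[abs_def]
        by (rule measurable_compose) (rule borel_measurable_continuous_onI[OF test_op_continuous(1)[OF \<phi>]])
    qed
    have fB: "\<bar>f x\<bar> \<le> B" for x unfolding f_def by (rule B[OF N])
    have fi: "integrable ?m f" using fm fB by (intro integrable_const_bound[of _ B]) (auto simp: measurable_cong_sets[OF m(2) refl])
    have gB: "\<bar>g x\<bar> \<le> B1" for x
    proof -
      have "\<bar>g x\<bar> \<le> avg (\<lambda>js. \<bar>\<phi> (?s + h) (step_map N k ?m js x)\<bar>)" unfolding g_def by (rule avg_abs)
      also have "\<dots> \<le> avg (\<lambda>js :: 'n \<times> bool. B1)" by (rule avg_mono) (rule B1)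
      finally show ?thesis by simp
    qed
    have gm: "g \<in> borel_measurable borel" unfolding g_def[abs_def] avg_def by measurable
    have gi: "integrable ?m g" using gm gB by (intro integrable_const_bound[of _ B1]) (auto simp: measurable_cong_sets[OF m(2) refl])
    have \<phi>i: "integrable ?m (\<phi> ?s)" using B1 \<phi>m by (intro integrable_const_bound[of _ B1]) (auto simp: measurable_cong_sets[OF m(2) refl])
    have pt: "\<bar>h * f x - (g x - \<phi> ?s x)\<bar> \<le> h * \<epsilon>" for x
    proof -
      have "\<bar>avg (\<lambda>js. \<phi> (?s + h) (x + euler_step h (b x) (w x) js)) - \<phi> ?s x - h * (deriv (\<lambda>r. \<phi> r x) t + generator (b x) (outer_sum (w x)) (\<phi> t) x)\<bar> \<le> h * \<epsilon>"
      proof (rule cons[OF h])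
        show "?s \<le> t" "t \<le> ?s + h" using t1 t2 Suc unfolding h_def[symmetric] by auto
        show "(norm (b x))\<^sup>2 \<le> cs * (1 + (norm x)\<^sup>2)" "(norm (w x j))\<^sup>2 \<le> cs * (1 + (norm x)\<^sup>2)" for j
          using step_bounds(1,2)[OF N, of k x] k by (auto simp: b_def w_def h_def)
      qed
      then have "\<bar>g x - \<phi> ?s x - h * f x\<bar> \<le> h * \<epsilon>" by (simp add: g_def S f_def y test_op_def)
      then show ?thesis by (simp add: abs_minus_commute)
    qed
    have "\<bar>\<integral>x. h * f x - (g x - \<phi> ?s x) \<partial>?m\<bar> \<le> h * \<epsilon>"
      using fi gi \<phi>i pt by (intro abs_integral_le_const(2)) auto
    then have "\<bar>h * (\<integral>x. f x \<partial>?m) - ((\<integral>x. g x \<partial>?m) - (\<integral>x. \<phi> ?s x \<partial>?m))\<bar> \<le> h * \<epsilon>"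
      using fi gi \<phi>i by simp
    then show ?thesis unfolding h_def[symmetric] e1 curve_clamp ik f_def .
  qed
  then show ?thesis using h0 by blast
qed

text \<open>The one-step increments telescope to the integrals of the test function at times T and
  0. Both vanish because its support lies in the open interval, so only the accumulated consistency
  error remains.\<close>

lemma scheme_weak_error:
  assumes \<phi>: "\<phi> \<in> C12c T" and \<epsilon>: "\<epsilon> > 0"
  shows "\<exists>h0>0. \<forall>N\<ge>1. T / real N < h0 \<longrightarrow> \<bar>\<integral>z. test_op \<phi> (z, coeff_sel N z) \<partial>scheme_flow N\<bar> \<le> \<epsilon>"
proof -
  obtain h0 where h0: "h0 > 0" and step: "\<And>N k t. N \<ge> 1 \<Longrightarrow> T / real N < h0 \<Longrightarrow> k < N \<Longrightarrow> real k * (T / real N) \<le> t \<Longrightarrow> t < real (Suc k) * (T / real N) \<Longrightarrow>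
     \<bar>T / real N * (\<integral>x. test_op \<phi> ((t, x), coeff_sel N (t, x)) \<partial>curve N (clamp t))
       - ((\<integral>x. \<phi> (real (Suc k) * (T / real N)) x \<partial>scheme N (Suc k)) - (\<integral>x. \<phi> (real k * (T / real N)) x \<partial>scheme N k))\<bar> \<le> T / real N * \<epsilon>"
    using scheme_step[OF \<phi> \<epsilon>] by blast
  obtain B where B: "\<And>N z. N \<ge> 1 \<Longrightarrow> \<bar>test_op \<phi> (z, coeff_sel N z)\<bar> \<le> B"
    using test_op_coeff_sel_bounded[OF \<phi>] by blast
  obtain R where zero: "\<And>t x. t \<notin> {0<..<T} \<Longrightarrow> \<phi> t x = 0" by (rule C12c_support[OF \<phi>]) (rule that)
  have "\<bar>\<integral>z. test_op \<phi> (z, coeff_sel N z) \<partial>scheme_flow N\<bar> \<le> \<epsilon>" if N: "N \<ge> 1" and small: "T / real N < h0" for N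
  proof -
    define f where "f z = test_op \<phi> (z, coeff_sel N z)" for z
    define J where "J t = (\<integral>x. f (t, x) \<partial>curve N (clamp t))" for t
    have fm: "f \<in> borel_measurable borel"
    proof -
      have "(\<lambda>z. (z, coeff_sel N z)) \<in> borel_measurable borel"
        by (intro borel_measurable_Pair measurable_coeff_sel measurable_ident_sets refl)
      then show ?thesis unfolding f_def[abs_def]
        by (rule measurable_compose) (rule borel_measurable_continuous_onI[OF test_op_continuous(1)[OF \<phi>]])
    qed
    have fB: "\<bar>f z\<bar> \<le> B" for z unfolding f_def by (rule B[OF N])
    have Jm: "J \<in> borel_measurable borel" and int: "(\<integral>z. f z \<partial>scheme_flow N) = (LINT t:{0..T}|lborel. J t) / T"
      unfolding J_def[abs_def] using scheme_flow(3)[OF N fm fB] by auto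
    have JB: "\<bar>J t\<bar> \<le> B" for t
    proof -
      have "(\<lambda>x. f (t, x)) \<in> borel_measurable borel"
        by (rule measurable_compose[OF _ fm]) (intro borel_measurable_continuous_onI continuous_intros)
      then show ?thesis unfolding J_def using fB
        by (intro prob_space.abs_integral_le_const(2)[OF curve_prob(1)[OF N clamp_in]]) (auto simp: measurable_cong_sets[OF curve_prob(2)[OF N clamp_in] refl])
    qed
    define a where "a k = (\<integral>x. \<phi> (real k * (T / real N)) x \<partial>scheme N k)" for k
    have "\<bar>(LINT t:{0..<real N * (T / real N)}|lborel. J t) - (a N - a 0)\<bar> \<le> real N * (T / real N) * \<epsilon>"
      by (rule telescoping_integral[OF Jm JB]) (use h_bounds[OF N] step[OF N small] in \<open>auto simp: J_def f_def a_def\<close>)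
    moreover have "real N * (T / real N) = T" using N by simp
    have "\<phi> T = (\<lambda>x. 0)" "\<phi> 0 = (\<lambda>x. 0)" using zero[of T] zero[of 0] by auto
    then have a0: "a N = 0" "a 0 = 0" unfolding a_def using N by auto
    \<comment> \<open>The half-open step intervals miss the endpoint T, a null set.\<close>
    moreover have "(LINT t:{0..<T}|lborel. J t) = (LINT t:{0..T}|lborel. J t)"
      by (rule set_integral_discrete_difference[of "{T}"]) auto
    ultimately have "\<bar>LINT t:{0..T}|lborel. J t\<bar> \<le> T * \<epsilon>" using a0 N by simp
    then have "\<bar>LINT t:{0..T}|lborel. J t\<bar> / T \<le> \<epsilon>" using T by (simp add: divide_le_eq mult.commute)
    then show ?thesis using int T by (simp add: f_def abs_divide)
  qed
  then show ?thesis using h0 by blast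
qed

end

section \<open>The limit curve as a solution of the inclusion\<close>

lemma closed_psd_matrices: "closed (psd_matrices :: (real ^ 'n ^ 'n) set)"
proof -
  have "psd_matrices = {A :: real ^ 'n ^ 'n. transpose A = A} \<inter> (\<Inter>v. {A. 0 \<le> v \<bullet> (A *v v)})"
    by (auto simp: psd_matrices_def)
  moreover have "closed {A :: real ^ 'n ^ 'n. transpose A = A}"
    by (intro closed_Collect_eq continuous_intros)
  moreover have "closed {A :: real ^ 'n ^ 'n. 0 \<le> v \<bullet> (A *v v)}" for v
    unfolding matrix_vector_mult_def by (intro closed_Collect_le continuous_intros)
  ultimately show ?thesis by (metis (no_types, lifting) closed_INT closed_Int)
qed

lemma zero_psd: "0 \<in> psd_matrices"
  by (simp add: psd_matrices_def transpose_def vec_eq_iff)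

context fpk_data
begin

lemma limit_weak_form:
  assumes \<sigma>: "strict_mono (\<sigma> :: nat \<Rightarrow> nat)" and \<phi>: "\<phi> \<in> C12c T"
    and lim: "\<forall>f B. continuous_on UNIV f \<longrightarrow> (\<forall>N\<ge>1. \<forall>z. fst z \<in> {0..T} \<longrightarrow> \<bar>f (z, coeff_sel N z)\<bar> \<le> B) \<longrightarrow>
        (\<lambda>k. \<integral>z. f (z, coeff_sel (mesh (\<sigma> k)) z) \<partial>scheme_flow (mesh (\<sigma> k))) \<longlonglongrightarrow> (\<integral>p. (f p :: real) \<partial>\<Theta>)"
  shows "(\<integral>p. test_op \<phi> p \<partial>\<Theta>) = 0"
proof -
  obtain B where B: "\<And>N z. N \<ge> 1 \<Longrightarrow> \<bar>test_op \<phi> (z, coeff_sel N z)\<bar> \<le> B"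
    using test_op_coeff_sel_bounded[OF \<phi>] by blast
  let ?I = "\<lambda>k. \<integral>z. test_op \<phi> (z, coeff_sel (mesh (\<sigma> k)) z) \<partial>scheme_flow (mesh (\<sigma> k))"
  have 1: "?I \<longlonglongrightarrow> (\<integral>p. test_op \<phi> p \<partial>\<Theta>)" using lim test_op_continuous(1)[OF \<phi>] B by blast
  have small: "(\<lambda>k. T / real (mesh (\<sigma> k))) \<longlonglongrightarrow> 0" using LIMSEQ_subseq_LIMSEQ[OF mesh_small \<sigma>] by (simp add: comp_def)
  have "?I \<longlonglongrightarrow> 0"
  proof (rule tendstoI)
    fix e :: real assume e: "e > 0"
    obtain h0 where h0: "h0 > 0" and h: "\<And>N. N \<ge> 1 \<Longrightarrow> T / real N < h0 \<Longrightarrow> \<bar>\<integral>z. test_op \<phi> (z, coeff_sel N z) \<partial>scheme_flow N\<bar> \<le> e / 2"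
      using scheme_weak_error[OF \<phi>, of "e / 2"] e by auto
    show "\<forall>\<^sub>F k in sequentially. dist (?I k) 0 < e"
      using order_tendstoD(2)[OF small h0]
    proof eventually_elim
      case (elim k)
      show ?case using h[OF mesh_ge(1) elim] e by simp
    qed
  qed
  then show ?thesis using 1 LIMSEQ_unique by blast
qed

text \<open>Drift and diffusion are the two components of \<open>y\<close>, the conditional mean of
  the limiting coefficient given time and position, altered on a null set. Inclusion and weak
  equation are read off from the joint law and transferred to iterated integrals through
  \<open>flow_measure\<close>.\<close>

theorem limit_curve_solution: "FPK_solution T F limit_curve"
proof -
  obtain \<sigma> \<Theta> where \<sigma>: "strict_mono (\<sigma> :: nat \<Rightarrow> nat)" and \<Theta>: "prob_space \<Theta>" "sets \<Theta> = sets borel"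
    and marg: "distr \<Theta> borel fst = flow_measure T limit_curve" and gr: "AE p in \<Theta>. p \<in> graph"
    and lim: "\<forall>f B. continuous_on UNIV f \<longrightarrow> (\<forall>N\<ge>1. \<forall>z. fst z \<in> {0..T} \<longrightarrow> \<bar>f (z, coeff_sel N z)\<bar> \<le> B) \<longrightarrow>
        (\<lambda>k. \<integral>z. f (z, coeff_sel (mesh (\<sigma> k)) z) \<partial>scheme_flow (mesh (\<sigma> k))) \<longlonglongrightarrow> (\<integral>p. (f p :: real) \<partial>\<Theta>)"
    using limit_law by blast
  interpret \<Theta>: prob_space \<Theta> by fact
  have fst_m: "fst \<in> measurable \<Theta> borel" and snd_m: "snd \<in> measurable \<Theta> borel"
    by (auto simp: measurable_cong_sets[OF \<Theta>(2) refl] intro!: borel_measurable_continuous_onI continuous_intros)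
  have K: "0 \<le> K0" using K0_1 by simp
  have "integrable \<Theta> (\<lambda>p. (norm (snd (fst p)))\<^sup>2)"
    using limit_flow_norm_square unfolding marg[symmetric] by (subst (asm) integrable_distr_eq[OF fst_m])
      (auto intro!: borel_measurable_continuous_onI continuous_intros)
  then have "integrable \<Theta> (\<lambda>p. (Cb + CA) * (3 + 2 * (norm (snd (fst p)))\<^sup>2 + 2 * K0))"
    by (intro integrable_mult_right Bochner_Integration.integrable_add) auto
  then have isnd: "integrable \<Theta> (\<lambda>p. norm (snd p))"
  proof (rule Bochner_Integration.integrable_bound)
    show "AE p in \<Theta>. norm (norm (snd p)) \<le> norm ((Cb + CA) * (3 + 2 * (norm (snd (fst p)))\<^sup>2 + 2 * K0))"
      using gr by eventually_elim (use graph_bound Cb CA K in \<open>force intro: order_trans[OF _ abs_ge_self]\<close>)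
  qed (use snd_m in simp)
  obtain g where g [measurable]: "g \<in> borel_measurable borel"
    and ig1: "\<And>v. v \<in> borel_measurable borel \<Longrightarrow> bounded (range v) \<Longrightarrow> integrable \<Theta> (\<lambda>p. v (fst p) \<bullet> snd p)"
    and ig2: "\<And>v. v \<in> borel_measurable borel \<Longrightarrow> bounded (range v) \<Longrightarrow> integrable \<Theta> (\<lambda>p. v (fst p) \<bullet> g (fst p))"
    and eq: "\<And>v. v \<in> borel_measurable borel \<Longrightarrow> bounded (range v) \<Longrightarrow>
       (\<integral>p. v (fst p) \<bullet> snd p \<partial>\<Theta>) = (\<integral>p. v (fst p) \<bullet> g (fst p) \<partial>\<Theta>)"
    by (rule disintegration_inner[OF \<Theta> isnd]) (rule that)
  have ggr: "AE p in \<Theta>. (fst p, g (fst p)) \<in> graph"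
    by (rule conditional_mean_in_F[OF \<Theta> gr g ig1 ig2 eq])
  define Cg where "Cg = (Cb + CA) * (3 + 2 * K0)"
  \<comment> \<open>Besides positivity the set enforces the growth bound at every point, so that the
    integrand built from \<open>y\<close> is bounded and \<open>limit_flow(3)\<close>
    applies.\<close>
  define G where "G = {z. fst z \<in> {0..T}} \<inter> {z. snd (g z) \<in> psd_matrices} \<inter> {z. norm (g z) \<le> Cg * (1 + (norm (snd z))\<^sup>2)}"
  \<comment> \<open>a solution needs a positive semidefinite \<open>A\<close> at every point, not only almost everywhere\<close>
  define y where "y z = (if z \<in> G then g z else 0)" for z
  have Cg: "0 \<le> Cg" using Cb CA K by (simp add: Cg_def)
  have fst_snd: "fst \<in> borel_measurable (borel :: (real \<times> (real ^ 'n)) measure)" "snd \<in> borel_measurable (borel :: (real \<times> (real ^ 'n)) measure)"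
    "fst \<in> borel_measurable (borel :: ((real ^ 'n) \<times> (real ^ 'n ^ 'n)) measure)" "snd \<in> borel_measurable (borel :: ((real ^ 'n) \<times> (real ^ 'n ^ 'n)) measure)"
    by (intro borel_measurable_continuous_onI continuous_intros)+
  have "G \<in> sets borel"
  proof -
    have "fst -` {0..T} \<inter> space borel \<in> sets (borel :: (real \<times> (real ^ 'n)) measure)" by (rule measurable_sets[OF fst_snd(1)]) simp
    moreover have "(\<lambda>z. snd (g z)) -` psd_matrices \<inter> space borel \<in> sets borel"
      by (rule measurable_sets[OF measurable_compose[OF g fst_snd(4)]]) (rule borel_closed[OF closed_psd_matrices])
    moreover have "{z \<in> space borel. norm (g z) \<le> Cg * (1 + (norm (snd z))\<^sup>2)} \<in> sets borel"
      by (rule borel_measurable_le) (use fst_snd(2) in \<open>measurable\<close>)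
    ultimately show ?thesis unfolding G_def by (intro sets.Int) (simp_all add: vimage_def)
  qed
  then have y [measurable]: "y \<in> borel_measurable borel" unfolding y_def[abs_def] by measurable
  have y_bound: "norm (y z) \<le> Cg * (1 + (norm (snd z))\<^sup>2)" for z using Cg by (auto simp: y_def G_def)
  have y_psd: "snd (y z) \<in> psd_matrices" for z using zero_psd by (auto simp: y_def G_def)
  have graph_y: "y z = g z" if z: "(z, g z) \<in> graph" for z
  proof -
    have t: "fst z \<in> {0..T}" and F: "g z \<in> F (fst z) (snd z) (limit_curve (fst z))" using z by (auto simp: graph_def)
    have "snd (g z) \<in> psd_matrices" using psd[OF t limit_curve_P2[OF t], of "snd z"] F by auto
    moreover have "norm (g z) \<le> Cg * (1 + (norm (snd z))\<^sup>2)"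
    proof -
      have "3 + 2 * (norm (snd z))\<^sup>2 + 2 * K0 \<le> (3 + 2 * K0) * (1 + (norm (snd z))\<^sup>2)"
        using mult_nonneg_nonneg[OF K zero_le_power2[of "norm (snd z)"]] zero_le_power2[of "norm (snd z)"] by (simp add: algebra_simps)
      then have "(Cb + CA) * (3 + 2 * (norm (snd z))\<^sup>2 + 2 * K0) \<le> (Cb + CA) * ((3 + 2 * K0) * (1 + (norm (snd z))\<^sup>2))"
        using Cb CA by (intro mult_left_mono) auto
      then show ?thesis using graph_bound[OF z] by (simp add: Cg_def mult.assoc)
    qed
    ultimately show ?thesis using t by (simp add: y_def G_def)
  qed
  have pairm: "(\<lambda>z. (z, y z)) \<in> borel_measurable borel"
    by (intro borel_measurable_Pair y measurable_ident_sets refl)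
  have Q: "Measurable.pred borel (\<lambda>z. (z, y z) \<in> graph)"
    using measurable_sets[OF pairm, of graph] closed_graph by (simp add: pred_def vimage_def)
  have "AE p in \<Theta>. (fst p, y (fst p)) \<in> graph"
    using ggr by eventually_elim (simp add: graph_y)
  then have "AE z in flow_measure T limit_curve. (z, y z) \<in> graph"
    unfolding marg[symmetric] using Q by (subst AE_distr_iff[OF fst_m]) (auto simp: pred_def)
  then have incl: "AE t in lborel. t \<in> {0..T} \<longrightarrow> (AE x in limit_curve t. (fst (y (t, x)), snd (y (t, x))) \<in> F t x (limit_curve t))"
    unfolding limit_flow(4)[OF Q] by eventually_elim (simp add: graph_def)
  have weak: "let G = (\<lambda>t x. deriv (\<lambda>s. \<phi> s x) t + generator (fst (y (t, x))) (snd (y (t, x))) (\<phi> t) x)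
     in (AE t in lborel. t \<in> {0..T} \<longrightarrow> integrable (limit_curve t) (G t)) \<and>
        set_integrable lborel {0..T} (\<lambda>t. \<integral>x. G t x \<partial>limit_curve t) \<and>
        (LINT t:{0..T}|lborel. (\<integral>x. G t x \<partial>limit_curve t)) = 0"
    if \<phi>: "\<phi> \<in> C12c T" for \<phi>
  proof -
    define f where "f z = test_op \<phi> (z, y z)" for z
    obtain B where B: "\<And>p. norm (snd p) \<le> Cg * (1 + (norm (snd (fst p)))\<^sup>2) \<Longrightarrow> \<bar>test_op \<phi> p\<bar> \<le> B"
      using test_op_bounded(3)[OF \<phi> Cg] by blast
    have fB: "\<bar>f z\<bar> \<le> B" for z unfolding f_def by (rule B) (use y_bound[of z] in simp)
    have fm: "f \<in> borel_measurable borel"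
      unfolding f_def[abs_def] by (rule measurable_compose[OF pairm borel_measurable_continuous_onI[OF test_op_continuous(1)[OF \<phi>]]])
    note fl = limit_flow(3)[OF fm fB]
    have "(\<lambda>x. f (t, x)) \<in> borel_measurable borel" for t
      by (rule measurable_compose[OF _ fm]) (intro borel_measurable_continuous_onI continuous_intros)
    then have "(\<lambda>x. f (t, x)) \<in> borel_measurable (limit_curve t)" for t by (simp add: measurable_cong_sets[OF limit_curve(2) refl])
    note im = prob_space.abs_integral_le_const[OF limit_curve(1) this fB]
    have Jb: "\<bar>\<integral>x. f (t, x) \<partial>limit_curve t\<bar> \<le> \<bar>B\<bar>" for t using im(2)[of t] by simp
    have c: "set_integrable lborel {0..T} (\<lambda>_. B)" using T by (simp add: set_integrable_def integrable_real_mult_indicator)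
    have si: "set_integrable lborel {0..T} (\<lambda>t. \<integral>x. f (t, x) \<partial>limit_curve t)"
      by (rule set_integrable_bound[OF c]) (use fl Jb in \<open>auto simp: set_borel_measurable_def\<close>)
    define d where "d z = deriv (\<lambda>s. \<phi> s (snd z)) (fst z)" for z
    have v: "test_vec \<phi> \<in> borel_measurable borel" "bounded (range (test_vec \<phi>))"
      using borel_measurable_continuous_onI[OF test_op_continuous(2)[OF \<phi>]] test_op_bounded(1)[OF \<phi>] by auto
    have dm: "d \<in> borel_measurable borel"
      unfolding d_def[abs_def] by (rule borel_measurable_continuous_onI[OF test_op_continuous(3)[OF \<phi>]])
    obtain B2 where "\<And>z. norm (d z) \<le> B2" using test_op_bounded(2)[OF \<phi>] unfolding d_def[abs_def] by (auto simp: bounded_iff)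
    then have id: "integrable \<Theta> (\<lambda>p. d (fst p))"
      using measurable_compose[OF fst_m dm] by (intro \<Theta>.integrable_const_bound[of _ B2]) auto
    have "(\<integral>z. f z \<partial>flow_measure T limit_curve) = (\<integral>p. f (fst p) \<partial>\<Theta>)"
      unfolding marg[symmetric] by (rule integral_distr[OF fst_m fm])
    also have "\<dots> = (\<integral>p. d (fst p) + test_vec \<phi> (fst p) \<bullet> g (fst p) \<partial>\<Theta>)"
    proof (rule integral_cong_AE)
      show "(\<lambda>p. f (fst p)) \<in> borel_measurable \<Theta>" by (rule measurable_compose[OF fst_m fm])
      show "(\<lambda>p. d (fst p) + test_vec \<phi> (fst p) \<bullet> g (fst p)) \<in> borel_measurable \<Theta>"
        using id ig2[OF v] by (intro borel_measurable_add) auto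
      show "AE p in \<Theta>. f (fst p) = d (fst p) + test_vec \<phi> (fst p) \<bullet> g (fst p)"
        using ggr by eventually_elim (simp add: f_def test_op_eq d_def graph_y)
    qed
    \<comment> \<open>The conditional mean is replaced by the random coefficient itself, the test
      vector being a bounded weight that depends on time and position only.\<close>
    also have "\<dots> = (\<integral>p. d (fst p) + test_vec \<phi> (fst p) \<bullet> snd p \<partial>\<Theta>)"
      using id ig1[OF v] ig2[OF v] eq[OF v] by simp
    also have "\<dots> = (\<integral>p. test_op \<phi> p \<partial>\<Theta>)" by (simp add: test_op_eq d_def)
    also have "\<dots> = 0" by (rule limit_weak_form[OF \<sigma> \<phi> lim])
    finally have "(LINT t:{0..T}|lborel. (\<integral>x. f (t, x) \<partial>limit_curve t)) = 0" using fl T by simp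
    moreover have "deriv (\<lambda>s. \<phi> s x) t + generator (fst (y (t, x))) (snd (y (t, x))) (\<phi> t) x = f (t, x)" for t x
      by (simp add: f_def test_op_def)
    ultimately show ?thesis using im(1) si by (simp add: Let_def)
  qed
  show ?thesis
    unfolding FPK_solution_def
  proof (intro conjI exI ballI)
    show "flow_of_probabilities T limit_curve" by (rule flow_limit_curve)
    show "(\<lambda>z. fst (y z)) \<in> borel_measurable (restrict_space borel ({0..T} \<times> UNIV))"
      "(\<lambda>z. snd (y z)) \<in> borel_measurable (restrict_space borel ({0..T} \<times> UNIV))"
      using measurable_compose[OF y fst_snd(3)] measurable_compose[OF y fst_snd(4)] by (auto intro: measurable_restrict_space1)
    show "(\<lambda>z. snd (y z)) ` ({0..T} \<times> UNIV) \<subseteq> psd_matrices" using y_psd by blast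
    show "AE t in lborel. t \<in> {0..T} \<longrightarrow> (AE x in limit_curve t. (fst (y (t, x)), snd (y (t, x))) \<in> F t x (limit_curve t))" by (rule incl)
  qed (rule weak)
qed

end

theorem theorem3p3:
  fixes T Cb CA :: real
    and F :: "real \<Rightarrow> real ^ 'n \<Rightarrow> (real ^ 'n) measure \<Rightarrow> ((real ^ 'n) \<times> (real ^ 'n ^ 'n)) set"
    and \<nu> :: "(real ^ 'n) measure"
  assumes "T > 0"
    and "\<And>t x m. t \<in> {0..T} \<Longrightarrow> m \<in> P2 \<Longrightarrow> F t x m \<subseteq> UNIV \<times> psd_matrices"
    and "usc_multimap T F"
    and "\<And>t x m. t \<in> {0..T} \<Longrightarrow> m \<in> P2 \<Longrightarrow> F t x m \<noteq> {} \<and> convex (F t x m)"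
    and "Cb \<ge> 0" and "CA \<ge> 0"
    and "\<And>t x m \<beta> \<Sigma>. t \<in> {0..T} \<Longrightarrow> m \<in> P2 \<Longrightarrow> (\<beta>, \<Sigma>) \<in> F t x m \<Longrightarrow>
           norm \<beta> \<le> Cb * (1 + norm x + M2 m) \<and> norm \<Sigma> \<le> CA * (1 + (norm x)\<^sup>2 + (M2 m)\<^sup>2)"
    and "\<nu> \<in> P2"
  shows "FPK_solutions T F \<nu> \<noteq> {} \<and> FPK_solutions T F \<nu> \<subseteq> C_P2 T"
proof
  interpret fpk_data T Cb CA F \<nu> using assms by (unfold_locales) blast+
  show "FPK_solutions T F \<nu> \<noteq> {}" using limit_curve_solution limit_curve_0 unfolding FPK_solutions_def by blast
  show "FPK_solutions T F \<nu> \<subseteq> C_P2 T"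
  proof
    fix m assume "m \<in> FPK_solutions T F \<nu>"
    then have "FPK_solution T F m" by (simp add: FPK_solutions_def)
    then show "m \<in> C_P2 T" by (rule FPK_solution_continuous[OF _ Cb CA]) (rule growth)
  qed
qed

end
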